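(* Let $X$ be a branched affine surface, with set of conical singularities $\Lambda$, that has no self-intersecting trajectory. Let $C\subset\mathbb{C}$ be an open cone (infinite sector) of angle $\theta$ and let $f:C\to X\setminus\Lambda$ be an affine immersion. Then the image $f(C)$ contains a hyperbolic closed geodesic that belongs to a hyperbolic cylinder of angle at least $\theta$. Moreover, the image under $f$ of every ray of the cone $C$ accumulates on some closed geodesic of this cylinder.
   Context: A branched affine surface is a compact orientable topological surface $X$ with a nonempty finite set $\Lambda$ of marked points, together with an atlas of charts of $X\setminus\Lambda$ to $\mathbb{C}$ whose transition maps are affine maps $x\mapsto ax+b$ with $a\in\mathbb{C}^*$, $b\in\mathbb{C}$, such that every marked point is a conical singularity. A conical singularity of angle $\theta_0>0$ and dilation ratio $\lambda>0$ is a point with a neighborhood isomorphic to a neighborhood of the apex in the following model: take an infinite Euclidean cone of total angle $\theta_0$, cut it along a ray from the apex, and reglue the right side of the ray to the left side by the homothety of ratio $\lambda$ fixing the apex. Straight lines, directions (locally) and angles make sense in $X\setminus\Lambda$. A trajectory is a path in $X$ with locally constant direction (a straight line). It is self-intersecting if it crosses itself at a regular point (closing up into a closed geodesic does not count as a self-intersection). An affine immersion $f:C\to X\setminus\Lambda$ is a map which in the affine charts of $X$ is locally of the form $z\mapsto az+b$ with $a\in\mathbb{C}^*$. A closed geodesic is a locally straight simple loop in $X\setminus\Lambda$. It is called hyperbolic if the modulus of its linear holonomy (the linear part $a$ of the affine transition map obtained by continuing a chart along the loop) is different from $1$, and flat otherwise. A closed geodesic belongs to a cylinder, the maximal family of closed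 geodesics obtained by continuation. A hyperbolic cylinder of angle $\beta>0$ is a cylinder formed by hyperbolic closed geodesics, isomorphic to the quotient of $\{(r,\varphi): r>0,\ 0<\varphi<\beta\}$, with affine structure given by $z=re^{i\varphi}$, by $(r,\varphi)\sim(\lambda r,\varphi)$ for some $\lambda>1$ (the closed geodesics are the curves $\varphi=$ const); it is bounded by saddle connections, i.e. geodesic segments without self-intersection outside their ends and whose ends are conical singularities. *)

theory Defs
  imports "HOL-Analysis.Analysis"
begin

section \<open>Affine structures on surfaces\<close>

text \<open>
  An atlas is a set of pairs \<open>(U, \<phi>)\<close>; the map \<open>\<phi>\<close> is only relevant on \<open>U\<close>.
\<close>

type_synonym 'a atlas = "('a set \<times> ('a \<Rightarrow> complex)) set"

text \<open>
  Transition maps are required to be affine locally on the overlaps, because an overlap of two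
  chart domains need not be connected.
\<close>

definition affine_atlas :: "'a topology \<Rightarrow> 'a atlas \<Rightarrow> bool" where
  "affine_atlas Y \<A> \<longleftrightarrow>
     (\<Union>(U, \<phi>)\<in>\<A>. U) = topspace Y \<and>
     (\<forall>(U, \<phi>)\<in>\<A>. openin Y U \<and> open (\<phi> ` U) \<and>
        homeomorphic_map (subtopology Y U) (top_of_set (\<phi> ` U)) \<phi>) \<and>
     (\<forall>(U, \<phi>)\<in>\<A>. \<forall>(V, \<psi>)\<in>\<A>. \<forall>x\<in>U \<inter> V. \<exists>a b W. a \<noteq> 0 \<and>
        openin Y W \<and> x \<in> W \<and> W \<subseteq> U \<inter> V \<and> (\<forall>y\<in>W. \<psi> y = a * \<phi> y + b))"

text \<open>
  \<open>affine_chart_at Y \<A> x \<phi>\<close>: the germ of \<open>\<phi>\<close> at \<open>x\<close> is an affine chart, i.e. belongs to the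
  maximal affine atlas generated by \<open>\<A>\<close>.
\<close>

definition affine_chart_at :: "'a topology \<Rightarrow> 'a atlas \<Rightarrow> 'a \<Rightarrow> ('a \<Rightarrow> complex) \<Rightarrow> bool" where
  "affine_chart_at Y \<A> x \<phi> \<longleftrightarrow>
     (\<exists>(U, \<psi>)\<in>\<A>. \<exists>a b W. a \<noteq> 0 \<and> openin Y W \<and> x \<in> W \<and> W \<subseteq> U \<and>
        (\<forall>y\<in>W. \<phi> y = a * \<psi> y + b))"

text \<open>
  A map that reads \<open>z \<mapsto> a z + b\<close> with \<open>a \<noteq> 0\<close> in affine charts is one that pulls affine charts
  back to affine charts.
\<close>

definition affine_immersion ::
  "'a topology \<Rightarrow> 'a atlas \<Rightarrow> 'b topology \<Rightarrow> 'b atlas \<Rightarrow> ('a \<Rightarrow> 'b) \<Rightarrow> bool" where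
  "affine_immersion Y \<A> Z \<B> f \<longleftrightarrow> continuous_map Y Z f \<and>
     (\<forall>x\<in>topspace Y. \<exists>\<psi>. affine_chart_at Z \<B> (f x) \<psi> \<and> affine_chart_at Y \<A> x (\<psi> \<circ> f))"

definition affine_isomorphism ::
  "'a topology \<Rightarrow> 'a atlas \<Rightarrow> 'b topology \<Rightarrow> 'b atlas \<Rightarrow> ('a \<Rightarrow> 'b) \<Rightarrow> bool" where
  "affine_isomorphism Y \<A> Z \<B> f \<longleftrightarrow> homeomorphic_map Y Z f \<and> affine_immersion Y \<A> Z \<B> f"

definition plane_atlas :: "complex set \<Rightarrow> complex atlas" where
  "plane_atlas C = {(C, \<lambda>z. z)}"


section \<open>Quotients of sets of polar coordinates\<close>

definition quotient_topology :: "'a topology \<Rightarrow> ('a \<times> 'a) set \<Rightarrow> 'a set topology" where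
  "quotient_topology Y r =
     topology (\<lambda>V. V \<subseteq> topspace Y // r \<and> openin Y {x \<in> topspace Y. r `` {x} \<in> V})"

lemma openin_quotient_topology:
  "openin (quotient_topology Y r) V \<longleftrightarrow>
     V \<subseteq> topspace Y // r \<and> openin Y {x \<in> topspace Y. r `` {x} \<in> V}"
proof -
  have "istopology (\<lambda>V. V \<subseteq> topspace Y // r \<and> openin Y {x \<in> topspace Y. r `` {x} \<in> V})"
    unfolding istopology_def
  proof (rule conjI; intro allI impI)
    fix V W
    assume "V \<subseteq> topspace Y // r \<and> openin Y {x \<in> topspace Y. r `` {x} \<in> V}"
      and "W \<subseteq> topspace Y // r \<and> openin Y {x \<in> topspace Y. r `` {x} \<in> W}"
    moreover have "{x \<in> topspace Y. r `` {x} \<in> V \<inter> W} =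
      {x \<in> topspace Y. r `` {x} \<in> V} \<inter> {x \<in> topspace Y. r `` {x} \<in> W}"
      by auto
    ultimately show "V \<inter> W \<subseteq> topspace Y // r \<and> openin Y {x \<in> topspace Y. r `` {x} \<in> V \<inter> W}"
      by (metis (no_types, lifting) le_infI1 openin_Int)
  next
    fix \<V>
    assume *: "\<forall>V\<in>\<V>. V \<subseteq> topspace Y // r \<and> openin Y {x \<in> topspace Y. r `` {x} \<in> V}"
    have "{x \<in> topspace Y. r `` {x} \<in> \<Union>\<V>} = (\<Union>V\<in>\<V>. {x \<in> topspace Y. r `` {x} \<in> V})"
      by auto
    with * show "\<Union>\<V> \<subseteq> topspace Y // r \<and> openin Y {x \<in> topspace Y. r `` {x} \<in> \<Union>\<V>}"
      by auto
  qed
  then show ?thesis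
    by (simp add: quotient_topology_def)
qed

text \<open>
  Let \<open>S\<close> be a set of polar coordinates \<open>(r, \<phi>)\<close>. The function \<open>z = r e\<^sup>i\<^sup>\<phi>\<close> induces an affine
  structure on the quotient of \<open>S\<close> by \<open>\<sim>\<close>: the charts are the homeomorphisms onto open subsets of
  the plane whose lifts to \<open>S\<close> are locally of the form \<open>a z + b\<close>. Classes containing a point with
  \<open>r = 0\<close> are excluded from the chart domains. When an edge of \<open>S\<close> is glued to another one, a
  chart around a glued point is affine in \<open>z\<close> on each of the two sides, and the two affine
  expressions determine each other, since they agree on the common edge.
\<close>

definition polar_quotient_atlas ::
  "(real \<times> real) set \<Rightarrow> ((real \<times> real) \<times> (real \<times> real)) set \<Rightarrow> (real \<times> real) set atlas" where
  "polar_quotient_atlas S r = {(V, \<psi>).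
     openin (quotient_topology (top_of_set S) r) V \<and> open (\<psi> ` V) \<and>
     homeomorphic_map (subtopology (quotient_topology (top_of_set S) r) V)
       (top_of_set (\<psi> ` V)) \<psi> \<and>
     (\<forall>p\<in>S. r `` {p} \<in> V \<longrightarrow> fst p > 0 \<and>
        (\<exists>a b W. a \<noteq> 0 \<and> openin (top_of_set S) W \<and> p \<in> W \<and>
           (\<forall>q\<in>W. \<psi> (r `` {q}) = a * rcis (fst q) (snd q) + b)))}"


section \<open>Conical singularities and branched affine surfaces\<close>

text \<open>
  The model of a conical singularity of angle \<open>\<theta>\<close> and dilation ratio \<open>\<rho>\<close>. The Euclidean cone cut
  along a ray is the closed sector \<open>0 \<le> \<phi> \<le> \<theta>\<close> (not embedded in the plane when \<open>\<theta> \<ge> 2\<pi>\<close>), and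
  the edge \<open>\<phi> = \<theta>\<close> is glued to the edge \<open>\<phi> = 0\<close> by the homothety of ratio \<open>\<rho>\<close>. As \<open>\<rho>\<close> ranges
  over all positive numbers, the choice of which edge is scaled is immaterial.
\<close>

definition cone_sector :: "real \<Rightarrow> (real \<times> real) set" where
  "cone_sector \<theta> = {0..} \<times> {0..\<theta>}"

definition cone_rel :: "real \<Rightarrow> real \<Rightarrow> ((real \<times> real) \<times> (real \<times> real)) set" where
  "cone_rel \<theta> \<rho> = {(p, q). p \<in> cone_sector \<theta> \<and> q \<in> cone_sector \<theta> \<and>
     (p = q \<or> (fst p = 0 \<and> fst q = 0) \<or>
      (\<exists>r. p = (r, \<theta>) \<and> q = (\<rho> * r, 0)) \<or> (\<exists>r. q = (r, \<theta>) \<and> p = (\<rho> * r, 0)))}"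

lemma equiv_cone_rel:
  assumes "\<theta> > 0" "\<rho> > 0"
  shows "equiv (cone_sector \<theta>) (cone_rel \<theta> \<rho>)"
proof (rule equivI)
  show "trans (cone_rel \<theta> \<rho>)"
    using assms by (auto simp: trans_def cone_rel_def)
qed (auto simp: refl_on_def sym_def cone_rel_def)

definition cone_space :: "real \<Rightarrow> real \<Rightarrow> (real \<times> real) set topology" where
  "cone_space \<theta> \<rho> = quotient_topology (top_of_set (cone_sector \<theta>)) (cone_rel \<theta> \<rho>)"

definition cone_atlas :: "real \<Rightarrow> real \<Rightarrow> (real \<times> real) set atlas" where
  "cone_atlas \<theta> \<rho> = polar_quotient_atlas (cone_sector \<theta>) (cone_rel \<theta> \<rho>)"

definition cone_apex :: "real \<Rightarrow> real \<Rightarrow> (real \<times> real) set" where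
  "cone_apex \<theta> \<rho> = cone_rel \<theta> \<rho> `` {(0, 0)}"

definition conical_singularity :: "'a topology \<Rightarrow> 'a set \<Rightarrow> 'a atlas \<Rightarrow> 'a \<Rightarrow> bool" where
  "conical_singularity X \<Lambda> \<A> p \<longleftrightarrow>
     (\<exists>\<theta> \<rho> U V h. \<theta> > 0 \<and> \<rho> > 0 \<and>
        openin X U \<and> U \<inter> \<Lambda> = {p} \<and> openin (cone_space \<theta> \<rho>) V \<and>
        homeomorphic_map (subtopology X U) (subtopology (cone_space \<theta> \<rho>) V) h \<and>
        h p = cone_apex \<theta> \<rho> \<and>
        affine_isomorphism
          (subtopology X (U - {p})) \<A>
          (subtopology (cone_space \<theta> \<rho>) (V - {cone_apex \<theta> \<rho>})) (cone_atlas \<theta> \<rho>) h)"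

text \<open>Surfaces are connected and without boundary.\<close>

definition compact_surface :: "'a topology \<Rightarrow> bool" where
  "compact_surface X \<longleftrightarrow> compact_space X \<and> Hausdorff_space X \<and> connected_space X \<and>
     (\<forall>x\<in>topspace X. \<exists>U (V::complex set). openin X U \<and> x \<in> U \<and> open V \<and>
        subtopology X U homeomorphic_space top_of_set V)"

abbreviation regular_part :: "'a topology \<Rightarrow> 'a set \<Rightarrow> 'a topology" where
  "regular_part X \<Lambda> \<equiv> subtopology X (topspace X - \<Lambda>)"

text \<open>
  Orientability needs no separate clause: the maps \<open>z \<mapsto> a z + b\<close> preserve the orientation of the
  plane, so the atlas orients the complement of the finite set \<open>\<Lambda>\<close>, and hence \<open>X\<close>.
\<close>

definition branched_affine_surface :: "'a topology \<Rightarrow> 'a set \<Rightarrow> 'a atlas \<Rightarrow> bool" where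
  "branched_affine_surface X \<Lambda> \<A> \<longleftrightarrow>
     compact_surface X \<and> finite \<Lambda> \<and> \<Lambda> \<noteq> {} \<and> \<Lambda> \<subseteq> topspace X \<and>
     affine_atlas (regular_part X \<Lambda>) \<A> \<and> (\<forall>p\<in>\<Lambda>. conical_singularity X \<Lambda> \<A> p)"


section \<open>Trajectories, closed geodesics and saddle connections\<close>

text \<open>
  Near the time \<open>t\<close> the curve \<open>\<gamma>\<close> runs straight in the direction \<open>u\<close>, as seen in the affine
  chart \<open>\<phi>\<close> at \<open>\<gamma> t\<close>. The parametrization (given by \<open>h\<close>) is arbitrary.
\<close>

definition straight_at ::
  "'a topology \<Rightarrow> 'a atlas \<Rightarrow> (real \<Rightarrow> 'a) \<Rightarrow> real \<Rightarrow> ('a \<Rightarrow> complex) \<Rightarrow> complex \<Rightarrow> bool" where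
  "straight_at Y \<A> \<gamma> t \<phi> u \<longleftrightarrow> affine_chart_at Y \<A> (\<gamma> t) \<phi> \<and> u \<noteq> 0 \<and>
     (\<exists>\<epsilon>>0. \<exists>h. strict_mono_on {t - \<epsilon><..<t + \<epsilon>} h \<and>
        (\<forall>s\<in>{t - \<epsilon><..<t + \<epsilon>}. \<phi> (\<gamma> s) = \<phi> (\<gamma> t) + of_real (h s) * u))"

text \<open>
  A trajectory is a path on an interval \<open>I\<close>, possibly unbounded. It may start or end at a
  singularity, but its interior lies in the regular part (this is implied by \<open>straight_at\<close>).
\<close>

definition trajectory ::
  "'a topology \<Rightarrow> 'a set \<Rightarrow> 'a atlas \<Rightarrow> real set \<Rightarrow> (real \<Rightarrow> 'a) \<Rightarrow> bool" where
  "trajectory X \<Lambda> \<A> I \<gamma> \<longleftrightarrow> is_interval I \<and> interior I \<noteq> {} \<and>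
     continuous_map (top_of_set I) X \<gamma> \<and>
     (\<forall>t\<in>interior I. \<exists>\<phi> u. straight_at (regular_part X \<Lambda>) \<A> \<gamma> t \<phi> u)"

text \<open>
  The two branches must cross, i.e. have different tangent lines; a trajectory that comes back to
  one of its points with the same direction closes up into a closed geodesic.
\<close>

definition self_intersecting ::
  "'a topology \<Rightarrow> 'a set \<Rightarrow> 'a atlas \<Rightarrow> real set \<Rightarrow> (real \<Rightarrow> 'a) \<Rightarrow> bool" where
  "self_intersecting X \<Lambda> \<A> I \<gamma> \<longleftrightarrow>
     (\<exists>s\<in>interior I. \<exists>t\<in>interior I. \<exists>\<phi> u v. s \<noteq> t \<and> \<gamma> s = \<gamma> t \<and>
        straight_at (regular_part X \<Lambda>) \<A> \<gamma> s \<phi> u \<and>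
        straight_at (regular_part X \<Lambda>) \<A> \<gamma> t \<phi> v \<and>
        (\<forall>c::real. v \<noteq> of_real c * u))"

text \<open>
  Closed geodesics are given by their 1-periodic parametrizations, so that straightness at the
  base point is included.
\<close>

definition closed_geodesic ::
  "'a topology \<Rightarrow> 'a set \<Rightarrow> 'a atlas \<Rightarrow> (real \<Rightarrow> 'a) \<Rightarrow> bool" where
  "closed_geodesic X \<Lambda> \<A> \<gamma> \<longleftrightarrow>
     trajectory X \<Lambda> \<A> UNIV \<gamma> \<and> (\<forall>t. \<gamma> (t + 1) = \<gamma> t) \<and> inj_on \<gamma> {0..<1}"

text \<open>
  Continuation of a chart along the loop \<open>\<gamma>\<close> restricted to \<open>[0, 1]\<close>: \<open>\<Phi> t\<close> is an affine chart at
  \<open>\<gamma> t\<close> whose germ is locally constant in \<open>t\<close>. At the end the chart \<open>\<Phi> 0\<close> has become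
  \<open>\<Phi> 1 = a \<Phi> 0 + b\<close>, and \<open>a\<close> is the linear holonomy.
\<close>

definition linear_holonomy ::
  "'a topology \<Rightarrow> 'a atlas \<Rightarrow> (real \<Rightarrow> 'a) \<Rightarrow> complex \<Rightarrow> bool" where
  "linear_holonomy Y \<A> \<gamma> a \<longleftrightarrow> \<gamma> 0 = \<gamma> 1 \<and>
     (\<exists>\<Phi>. (\<forall>t\<in>{0..1}. affine_chart_at Y \<A> (\<gamma> t) (\<Phi> t) \<and>
               (\<exists>\<delta>>0. \<exists>W. openin Y W \<and> \<gamma> t \<in> W \<and>
                  (\<forall>s\<in>{0..1}. \<bar>s - t\<bar> < \<delta> \<longrightarrow> \<gamma> s \<in> W \<and> (\<forall>y\<in>W. \<Phi> s y = \<Phi> t y)))) \<and>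
           (\<exists>b W. openin Y W \<and> \<gamma> 0 \<in> W \<and> (\<forall>y\<in>W. \<Phi> 1 y = a * \<Phi> 0 y + b)))"

definition hyperbolic_closed_geodesic ::
  "'a topology \<Rightarrow> 'a set \<Rightarrow> 'a atlas \<Rightarrow> (real \<Rightarrow> 'a) \<Rightarrow> bool" where
  "hyperbolic_closed_geodesic X \<Lambda> \<A> \<gamma> \<longleftrightarrow> closed_geodesic X \<Lambda> \<A> \<gamma> \<and>
     (\<exists>a. linear_holonomy (regular_part X \<Lambda>) \<A> \<gamma> a \<and> cmod a \<noteq> 1)"

definition saddle_connection ::
  "'a topology \<Rightarrow> 'a set \<Rightarrow> 'a atlas \<Rightarrow> (real \<Rightarrow> 'a) \<Rightarrow> bool" where
  "saddle_connection X \<Lambda> \<A> \<sigma> \<longleftrightarrow> trajectory X \<Lambda> \<A> {0..1} \<sigma> \<and>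
     \<sigma> 0 \<in> \<Lambda> \<and> \<sigma> 1 \<in> \<Lambda> \<and> inj_on \<sigma> {0<..<1}"


section \<open>Hyperbolic cylinders\<close>

definition cylinder_strip :: "real \<Rightarrow> (real \<times> real) set" where
  "cylinder_strip \<beta> = {0<..} \<times> {0<..<\<beta>}"

definition cylinder_rel :: "real \<Rightarrow> real \<Rightarrow> ((real \<times> real) \<times> (real \<times> real)) set" where
  "cylinder_rel \<beta> \<rho> = {(p, q). p \<in> cylinder_strip \<beta> \<and> q \<in> cylinder_strip \<beta> \<and>
     (\<exists>k::int. fst q = \<rho> powi k * fst p \<and> snd q = snd p)}"

lemma equiv_cylinder_rel:
  assumes "\<rho> > 1"
  shows "equiv (cylinder_strip \<beta>) (cylinder_rel \<beta> \<rho>)"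
proof (rule equivI)
  show "refl_on (cylinder_strip \<beta>) (cylinder_rel \<beta> \<rho>)"
    by (auto simp: refl_on_def cylinder_rel_def intro!: exI[of _ 0])
  show "sym (cylinder_rel \<beta> \<rho>)"
  proof (rule symI)
    fix p q
    assume "(p, q) \<in> cylinder_rel \<beta> \<rho>"
    then obtain k :: int where "p \<in> cylinder_strip \<beta>" "q \<in> cylinder_strip \<beta>"
      "fst q = \<rho> powi k * fst p" "snd q = snd p"
      by (auto simp: cylinder_rel_def)
    moreover from this have "fst p = \<rho> powi (- k) * fst q"
      using assms by (simp add: power_int_minus)
    ultimately show "(q, p) \<in> cylinder_rel \<beta> \<rho>"
      by (auto simp: cylinder_rel_def)
  qed
  show "trans (cylinder_rel \<beta> \<rho>)"
  proof (rule transI)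
    fix p q s
    assume pq: "(p, q) \<in> cylinder_rel \<beta> \<rho>" and qs: "(q, s) \<in> cylinder_rel \<beta> \<rho>"
    obtain k :: int where k: "p \<in> cylinder_strip \<beta>" "fst q = \<rho> powi k * fst p" "snd q = snd p"
      using pq unfolding cylinder_rel_def by blast
    obtain l :: int where l:
      "s \<in> cylinder_strip \<beta>" "fst s = \<rho> powi l * fst q" "snd s = snd q"
      using qs unfolding cylinder_rel_def by blast
    have "fst s = \<rho> powi (l + k) * fst p"
      using k l assms by (simp add: power_int_add)
    with k l show "(p, s) \<in> cylinder_rel \<beta> \<rho>"
      unfolding cylinder_rel_def mem_Collect_eq case_prod_conv by metis
  qed
qed (auto simp: cylinder_rel_def)

definition cylinder_space :: "real \<Rightarrow> real \<Rightarrow> (real \<times> real) set topology" where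
  "cylinder_space \<beta> \<rho> = quotient_topology (top_of_set (cylinder_strip \<beta>)) (cylinder_rel \<beta> \<rho>)"

definition cylinder_atlas :: "real \<Rightarrow> real \<Rightarrow> (real \<times> real) set atlas" where
  "cylinder_atlas \<beta> \<rho> = polar_quotient_atlas (cylinder_strip \<beta>) (cylinder_rel \<beta> \<rho>)"

definition hyperbolic_annulus ::
  "'a topology \<Rightarrow> 'a set \<Rightarrow> 'a atlas \<Rightarrow> 'a set \<Rightarrow> real \<Rightarrow> bool" where
  "hyperbolic_annulus X \<Lambda> \<A> K \<beta> \<longleftrightarrow> openin X K \<and> K \<inter> \<Lambda> = {} \<and> \<beta> > 0 \<and>
     (\<exists>\<rho>>1. \<exists>h. affine_isomorphism (cylinder_space \<beta> \<rho>) (cylinder_atlas \<beta> \<rho>)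
                  (subtopology X K) \<A> h)"

text \<open>
  A cylinder is a maximal family of closed geodesics, so it is not contained in a larger annulus
  foliated by closed geodesics. The closed geodesics that continue a hyperbolic one have the same
  holonomy, so it suffices to compare with hyperbolic annuli. The closed geodesics belonging to
  the cylinder \<open>K\<close> (the curves \<open>\<phi> = const\<close>) are exactly the closed geodesics contained in \<open>K\<close>,
  since along any other straight line in \<open>K\<close> the angle \<open>\<phi>\<close> is strictly monotone.
\<close>

definition hyperbolic_cylinder ::
  "'a topology \<Rightarrow> 'a set \<Rightarrow> 'a atlas \<Rightarrow> 'a set \<Rightarrow> real \<Rightarrow> bool" where
  "hyperbolic_cylinder X \<Lambda> \<A> K \<beta> \<longleftrightarrow> hyperbolic_annulus X \<Lambda> \<A> K \<beta> \<and>
     (\<forall>K' \<beta>'. hyperbolic_annulus X \<Lambda> \<A> K' \<beta>' \<and> K \<subseteq> K' \<longrightarrow> K' = K) \<and>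
     (\<exists>\<S>. (\<forall>\<sigma>\<in>\<S>. saddle_connection X \<Lambda> \<A> \<sigma>) \<and> X frontier_of K = (\<Union>\<sigma>\<in>\<S>. \<sigma> ` {0..1}))"


section \<open>Cones in the plane and accumulation of rays\<close>

definition open_cone :: "complex \<Rightarrow> real \<Rightarrow> real \<Rightarrow> complex set" where
  "open_cone c \<alpha> \<theta> = {c + rcis r \<phi> | r \<phi>. r > 0 \<and> \<alpha> < \<phi> \<and> \<phi> < \<alpha> + \<theta>}"

text \<open>Accumulation points of a curve as time goes to infinity.\<close>

definition omega_limit :: "'a topology \<Rightarrow> (real \<Rightarrow> 'a) \<Rightarrow> 'a set" where
  "omega_limit X g = (\<Inter>T\<in>{0<..}. X closure_of (g ` {T..}))"

text \<open>The curve accumulates, as time goes to infinity, on the closed curve \<open>\<gamma>\<close> and nowhere else.\<close>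

definition accumulates_on :: "'a topology \<Rightarrow> (real \<Rightarrow> 'a) \<Rightarrow> (real \<Rightarrow> 'a) \<Rightarrow> bool" where
  "accumulates_on X g \<gamma> \<longleftrightarrow> omega_limit X g = range \<gamma>"

end

theory Submission
  imports Defs "HOL-Real_Asymp.Real_Asymp"
begin

text \<open>
  On a surface without self-intersecting trajectories two points of the cone with the same image differ
  by a real homothety, since the straight segment joining them must return to its starting point in its
  own direction. A generic ray of the cone leaves the neighbourhoods of the singularities infinitely
  often, so compactness produces such collisions; the resulting symmetries form a cyclic group of
  homotheties \<open>z \<mapsto> q + \<lambda>\<^sup>k (z - q)\<close>. In the logarithmic coordinate \<open>w\<close>, with \<open>z = q + exp w\<close>, this gives an
  immersion \<open>F\<close> of the strip \<open>\<alpha> < Im w < \<alpha> + \<theta>\<close> with period \<open>L = ln \<lambda>\<close>. A maximal extension of \<open>F\<close> to a strip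
  is injective modulo \<open>L\<close>, has finite width by compactness, and its boundary lines consist of saddle
  connections, for otherwise it could be extended; its image is the required cylinder. Along a ray of
  the cone, \<open>w\<close> is asymptotic to \<open>ln t + i \<phi>\<close>, so the ray winds onto the closed geodesic \<open>Im w = \<phi>\<close>.
\<close>

section \<open>Affine maps into the surface\<close>

text \<open>Convexity is available only in pieces of angle at most pi: the cone may make a full turn
  and the strip may be wider still. Hence facts such as the homothety group, the period and
  injectivity modulo \<open>L\<close> are first proved on convex sectors in the plane and then
  carried further by the identity principle. What this does not reach, a collision between leaves
  whose angles differ by pi or more, needs its own argument on how far a straight line can turn
  around the origin.

  The compactness arguments all compare two lengths. A fixed embedded disc of the surface, seen in
  the plane through an affine transition with linear part \<open>A\<close>, has size about
  \<open>1 / |A|\<close>; the other length is the distance to the boundary or to the centre. A disc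
  that is small in comparison fits into the domain and so produces a second point with a prescribed
  image; a large one reaches over the boundary or over a point that it cannot contain.

  The existence of a singularity enters through connectedness: an open immersed image in the regular
  part cannot be compact. The same principle shows that a regular annulus cannot absorb a whole
  boundary line of the strip.\<close>

definition developing :: "(complex \<Rightarrow> complex) \<Rightarrow> bool" where
  "developing d \<longleftrightarrow> d = (\<lambda>z. z) \<or> d = exp"

lemma developing_simps [simp]: "developing (\<lambda>z. z)" "developing exp"
  by (auto simp: developing_def)

lemma developing_isCont: "developing d \<Longrightarrow> isCont d w"
  by (auto simp: developing_def)

lemma developing_local_inverse:
  assumes "developing d"
  obtains g where "isCont g (d w)" "g (d w) = w" "\<forall>\<^sub>F z in nhds (d w). d (g z) = z"
proof (cases "d = (\<lambda>z. z)")
  case True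
  thus ?thesis using that[of "\<lambda>z. z"] by simp
next
  case False
  hence d: "d = exp" using assms by (simp add: developing_def)
  \<comment> \<open>The branch is centred at \<open>exp w\<close>, so that the argument of
    \<open>Ln\<close> is near 1 and away from the cut.\<close>
  let ?g = "\<lambda>z. w + Ln (z / exp w)"
  have "isCont ?g (exp w)"
    by (intro continuous_intros) (auto simp: complex_nonpos_Reals_iff)
  moreover have "\<forall>\<^sub>F z in nhds (exp w). z \<noteq> 0"
    by (simp add: t1_space_nhds)
  hence "\<forall>\<^sub>F z in nhds (exp w). exp (?g z) = z"
    by eventually_elim (simp add: exp_add)
  ultimately show ?thesis using that[of ?g] d by simp
qed

lemma nhds_transport:
  assumes "eventually P (nhds (g w))" "isCont g w"
  shows "\<forall>\<^sub>F v in nhds w. P (g v)"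
  using eventually_compose_filterlim[OF assms(1)] assms(2)
  by (simp add: isCont_def tendsto_at_iff_tendsto_nhds)

text \<open>A local inverse of \<open>d\<close> turns the hypothesis into an identity of affine maps
  on a disc, and two points of the disc determine the coefficients.\<close>

lemma developing_affine_unique:
  assumes d: "developing d" and ev: "\<forall>\<^sub>F v in nhds w. A * d v + B = d v"
  shows "A = 1 \<and> B = 0"
proof -
  obtain g where g: "isCont g (d w)" "g (d w) = w" "\<forall>\<^sub>F z in nhds (d w). d (g z) = z"
    using developing_local_inverse[OF d] by blast
  have "\<forall>\<^sub>F z in nhds (d w). A * d (g z) + B = d (g z)"
    by (rule nhds_transport) (use ev g in auto)
  with g(3) have "\<forall>\<^sub>F z in nhds (d w). A * z + B = z"
    by eventually_elim auto
  then obtain e where e: "e > 0" "\<And>z. dist z (d w) < e \<Longrightarrow> A * z + B = z"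
    unfolding eventually_nhds_metric by blast
  have "A * d w + B = d w" using e by simp
  moreover define h where "h = complex_of_real (e/2)"
  moreover have "A * (d w + h) + B = d w + h" "h \<noteq> 0"
    using e(1) by (auto intro!: e(2) simp: dist_norm h_def)
  moreover have "A * h = (A * (d w + h) + B) - (A * d w + B)"
    by (simp add: algebra_simps)
  ultimately have "A * h = h" "h \<noteq> 0" by simp_all
  hence "A = 1" by simp
  thus ?thesis using \<open>A * d w + B = d w\<close> by simp
qed

lemma open_eventually_nhds: "open {w. eventually P (nhds w)}"
proof (subst open_subopen, clarify)
  fix x assume "eventually P (nhds x)"
  hence "\<forall>\<^sub>F y in nhds x. eventually P (nhds y)" by (simp add: eventually_eventually)
  then obtain S where "open S" "x \<in> S" "\<forall>y\<in>S. eventually P (nhds y)"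
    unfolding eventually_nhds by blast
  thus "\<exists>T. open T \<and> x \<in> T \<and> T \<subseteq> {w. eventually P (nhds w)}" by blast
qed

text \<open>In an abstract topological space infinite index sets replace subsequences. If every
  point had a neighbourhood visited finitely often, finitely many of these would cover
  \<open>K\<close> and exhaust \<open>N\<close>.\<close>

lemma compact_space_cluster:
  assumes "compactin X K" "infinite N" "\<And>n. n \<in> N \<Longrightarrow> g n \<in> K"
  obtains y where "y \<in> K" "\<And>U. openin X U \<Longrightarrow> y \<in> U \<Longrightarrow> infinite {n \<in> N. g n \<in> U}"
proof (rule ccontr)
  assume "\<not> thesis"
  hence "\<forall>y\<in>K. \<exists>U. openin X U \<and> y \<in> U \<and> finite {n \<in> N. g n \<in> U}"
    using that by blast
  then obtain U where U: "\<And>y. y \<in> K \<Longrightarrow> openin X (U y) \<and> y \<in> U y \<and> finite {n \<in> N. g n \<in> U y}"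
    by metis
  have "\<forall>V\<in>U ` K. openin X V" "K \<subseteq> \<Union>(U ` K)" using U by blast+
  then obtain F where F: "finite F" "F \<subseteq> U ` K" "K \<subseteq> \<Union>F"
    using assms(1) unfolding compactin_def by meson
  have "N \<subseteq> (\<Union>V\<in>F. {n \<in> N. g n \<in> V})"
    using F(3) assms(3) by blast
  moreover have "finite (\<Union>V\<in>F. {n \<in> N. g n \<in> V})"
    using F(1,2) U by blast
  ultimately show False using assms(2) finite_subset by blast
qed

section \<open>Local theory of affine maps: continuity, openness, transitions, unique
  continuation\<close>

locale affine_surface =
  fixes X :: "'a topology" and \<Lambda> :: "'a set" and \<A> :: "'a atlas"
  assumes surface: "branched_affine_surface X \<Lambda> \<A>"
begin

abbreviation "M \<equiv> topspace X - \<Lambda>"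

lemma compact_X: "compact_space X" and Hausdorff_X: "Hausdorff_space X"
  and connected_X: "connected_space X" and finite_sing: "finite \<Lambda>" and sing_ne: "\<Lambda> \<noteq> {}"
  and sing_subset: "\<Lambda> \<subseteq> topspace X"
  using surface by (auto simp: branched_affine_surface_def compact_surface_def)

lemma atlas: "affine_atlas (regular_part X \<Lambda>) \<A>"
  using surface by (simp add: branched_affine_surface_def)

lemma openin_M: "openin X M"
  using Hausdorff_X finite_sing sing_subset
  by (intro openin_diff) (auto intro: closedin_Hausdorff_finite)

lemma openin_regular: "openin (regular_part X \<Lambda>) V \<longleftrightarrow> openin X V \<and> V \<subseteq> M"
  by (rule openin_open_subtopology[OF openin_M])

lemma chart_open: "(U, \<psi>) \<in> \<A> \<Longrightarrow> openin X U \<and> U \<subseteq> M"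
  using atlas openin_regular unfolding affine_atlas_def by blast

lemma chart_cover: "x \<in> M \<Longrightarrow> \<exists>U \<psi>. (U, \<psi>) \<in> \<A> \<and> x \<in> U"
proof -
  assume x: "x \<in> M"
  have "(\<Union>(U, \<phi>)\<in>\<A>. U) = topspace (regular_part X \<Lambda>)"
    using atlas unfolding affine_atlas_def by blast
  hence "x \<in> (\<Union>(U, \<phi>)\<in>\<A>. U)" using x by simp
  thus ?thesis by auto
qed

lemma chart_homeomorphic:
  assumes "(U, \<psi>) \<in> \<A>"
  shows "homeomorphic_map (subtopology X U) (top_of_set (\<psi> ` U)) \<psi>" "open (\<psi> ` U)"
proof -
  have "homeomorphic_map (subtopology (regular_part X \<Lambda>) U) (top_of_set (\<psi> ` U)) \<psi>" "open (\<psi> ` U)"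
    using atlas assms unfolding affine_atlas_def by auto
  moreover have "M \<inter> U = U" using chart_open[OF assms] by blast
  ultimately show "homeomorphic_map (subtopology X U) (top_of_set (\<psi> ` U)) \<psi>" "open (\<psi> ` U)"
    by (auto simp: subtopology_subtopology)
qed

lemma chart_inj: "(U, \<psi>) \<in> \<A> \<Longrightarrow> inj_on \<psi> U"
  using chart_homeomorphic(1)[of U \<psi>] chart_open[of U \<psi>]
  by (metis homeomorphic_imp_injective_map openin_subset topspace_subtopology_subset)

lemma chart_continuous:
  assumes "(U, \<psi>) \<in> \<A>" "open V"
  shows "openin X {x \<in> U. \<psi> x \<in> V}"
proof -
  have "continuous_map (subtopology X U) (top_of_set (\<psi> ` U)) \<psi>"
    using chart_homeomorphic(1)[OF assms(1)] homeomorphic_imp_continuous_map by blast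
  hence "openin (subtopology X U) {x \<in> topspace (subtopology X U). \<psi> x \<in> \<psi> ` U \<inter> V}"
    using assms(2) by (intro openin_continuous_map_preimage) auto
  moreover have "{x \<in> topspace (subtopology X U). \<psi> x \<in> \<psi> ` U \<inter> V} = {x \<in> U. \<psi> x \<in> V}"
    using chart_open[OF assms(1)] by auto
  ultimately show ?thesis
    using openin_open_subtopology chart_open[OF assms(1)] by metis
qed

lemma chart_image:
  assumes "(U, \<psi>) \<in> \<A>" "openin X W" "W \<subseteq> U"
  shows "open (\<psi> ` W)"
proof -
  have "open_map (subtopology X U) (top_of_set (\<psi> ` U)) \<psi>"
    using chart_homeomorphic(1)[OF assms(1)] homeomorphic_imp_open_map by blast
  hence "openin (top_of_set (\<psi> ` U)) (\<psi> ` W)"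
    using assms by (auto simp: open_map_def openin_subtopology_Int2 openin_open_subtopology chart_open)
  thus ?thesis
    using chart_homeomorphic(2)[OF assms(1)] openin_open_eq by blast
qed

lemma chart_transition:
  assumes "(U, \<psi>) \<in> \<A>" "(U', \<psi>') \<in> \<A>" "x \<in> U" "x \<in> U'"
  obtains a b W where "a \<noteq> 0" "openin X W" "x \<in> W" "W \<subseteq> U \<inter> U'" "\<And>y. y \<in> W \<Longrightarrow> \<psi>' y = a * \<psi> y + b"
proof -
  have *: "\<forall>(U, \<phi>)\<in>\<A>. \<forall>(V, \<psi>)\<in>\<A>. \<forall>x\<in>U \<inter> V. \<exists>a b W. a \<noteq> 0 \<and>
        openin (regular_part X \<Lambda>) W \<and> x \<in> W \<and> W \<subseteq> U \<inter> V \<and> (\<forall>y\<in>W. \<psi> y = a * \<phi> y + b)"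
    using atlas unfolding affine_atlas_def by (elim conjE)
  have "x \<in> U \<inter> U'" using assms by simp
  hence "\<exists>a b W. a \<noteq> 0 \<and> openin (regular_part X \<Lambda>) W \<and> x \<in> W \<and> W \<subseteq> U \<inter> U' \<and>
          (\<forall>y\<in>W. \<psi>' y = a * \<psi> y + b)"
    using bspec[OF bspec[OF * assms(1), unfolded case_prod_conv] assms(2), unfolded case_prod_conv]
    by (rule bspec[rotated])
  thus ?thesis by (elim exE conjE) (rule that, auto simp: openin_regular)
qed

text \<open>
  With \<open>d\<close> the identity or the exponential, \<open>afm_at d F w\<close> says that near \<open>w\<close> the map \<open>F\<close>
  is affine in the developing coordinate \<open>d\<close>.
\<close>

definition afm_at :: "(complex \<Rightarrow> complex) \<Rightarrow> (complex \<Rightarrow> 'a) \<Rightarrow> complex \<Rightarrow> bool" where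
  "afm_at d F w \<longleftrightarrow> (\<exists>U \<psi> a b. (U, \<psi>) \<in> \<A> \<and> a \<noteq> 0 \<and>
     (\<forall>\<^sub>F v in nhds w. F v \<in> U \<and> \<psi> (F v) = a * d v + b))"

lemma afm_atI:
  "(U, \<psi>) \<in> \<A> \<Longrightarrow> a \<noteq> 0 \<Longrightarrow> \<forall>\<^sub>F v in nhds w. F v \<in> U \<and> \<psi> (F v) = a * d v + b \<Longrightarrow> afm_at d F w"
  unfolding afm_at_def by blast

lemma afm_atE:
  assumes "afm_at d F w"
  obtains U \<psi> a b where "(U, \<psi>) \<in> \<A>" "a \<noteq> 0" "\<forall>\<^sub>F v in nhds w. F v \<in> U \<and> \<psi> (F v) = a * d v + b"
  using assms unfolding afm_at_def by (elim exE conjE) (rule that)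

lemma afm_at_in_M: "afm_at d F w \<Longrightarrow> F w \<in> M"
  unfolding afm_at_def using chart_open by (blast dest: eventually_nhds_x_imp_x)

lemma afm_at_eventually: "afm_at d F w \<Longrightarrow> \<forall>\<^sub>F v in nhds w. afm_at d F v"
proof (erule afm_atE)
  fix U \<psi> a b
  assume *: "(U, \<psi>) \<in> \<A>" "a \<noteq> 0" "\<forall>\<^sub>F v in nhds w. F v \<in> U \<and> \<psi> (F v) = a * d v + b"
  from *(3) have "\<forall>\<^sub>F v in nhds w. \<forall>\<^sub>F v in nhds v. F v \<in> U \<and> \<psi> (F v) = a * d v + b"
    by (simp add: eventually_eventually)
  thus ?thesis
    by eventually_elim (use *(1,2) in \<open>auto simp: afm_at_def\<close>)
qed

lemma afm_at_cong:
  assumes "\<forall>\<^sub>F v in nhds w. F v = G v"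
  shows "afm_at d F w \<longleftrightarrow> afm_at d G w"
proof -
  have "afm_at d G w" if h: "afm_at d F w" "\<forall>\<^sub>F v in nhds w. F v = G v" for F G
  proof -
    obtain U \<psi> a b where "(U, \<psi>) \<in> \<A>" "a \<noteq> 0" "\<forall>\<^sub>F v in nhds w. F v \<in> U \<and> \<psi> (F v) = a * d v + b"
      by (rule afm_atE[OF h(1)])
    moreover from this(3) h(2) have "\<forall>\<^sub>F v in nhds w. G v \<in> U \<and> \<psi> (G v) = a * d v + b"
      by eventually_elim auto
    ultimately show ?thesis unfolding afm_at_def by blast
  qed
  moreover have "\<forall>\<^sub>F v in nhds w. G v = F v"
    using assms by eventually_elim auto
  ultimately show ?thesis using assms by blast
qed

text \<open>The chain rule also changes the developing coordinate, from \<open>d\<close> to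
  \<open>e\<close>; it is the passage between plane and logarithmic coordinates.\<close>

lemma afm_at_comp:
  assumes "afm_at d F (g w)" "isCont g w" "A \<noteq> 0" "\<forall>\<^sub>F v in nhds w. d (g v) = A * e v + B"
  shows "afm_at e (\<lambda>v. F (g v)) w"
proof -
  obtain U \<psi> a b where *: "(U, \<psi>) \<in> \<A>" "a \<noteq> 0" "\<forall>\<^sub>F v in nhds (g w). F v \<in> U \<and> \<psi> (F v) = a * d v + b"
    by (rule afm_atE[OF assms(1)])
  have "\<forall>\<^sub>F v in nhds w. F (g v) \<in> U \<and> \<psi> (F (g v)) = a * d (g v) + b"
    using nhds_transport[OF *(3) assms(2)] .
  with assms(4) have "\<forall>\<^sub>F v in nhds w. F (g v) \<in> U \<and> \<psi> (F (g v)) = (a * A) * e v + (a * B + b)"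
    by eventually_elim (simp add: algebra_simps)
  thus ?thesis by (rule afm_atI[OF *(1), rotated]) (use *(2) assms(3) in simp)
qed

text \<open>\<open>afm_at\<close> does not mention continuity. It follows because \<open>F\<close>
  read in a chart is continuous, and the chart is injective with open images of open sets.\<close>

lemma afm_at_open_preimage:
  assumes d: "developing d" and F: "afm_at d F w" and W: "openin X W" "F w \<in> W"
  shows "\<forall>\<^sub>F v in nhds w. F v \<in> W"
proof -
  obtain U \<psi> a b where *: "(U, \<psi>) \<in> \<A>" "a \<noteq> 0" "\<forall>\<^sub>F v in nhds w. F v \<in> U \<and> \<psi> (F v) = a * d v + b"
    by (rule afm_atE[OF F])
  have w: "F w \<in> U" "\<psi> (F w) = a * d w + b" using eventually_nhds_x_imp_x[OF *(3)] by auto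
  have "open (\<psi> ` (U \<inter> W))"
    using chart_image[OF *(1), of "U \<inter> W"] W chart_open[OF *(1)] by auto
  hence "\<forall>\<^sub>F z in nhds (a * d w + b). z \<in> \<psi> ` (U \<inter> W)"
    using w W(2) by (intro eventually_nhds_in_open) (auto simp: image_iff intro!: bexI[of _ "F w"])
  hence "\<forall>\<^sub>F v in nhds w. a * d v + b \<in> \<psi> ` (U \<inter> W)"
    by (rule nhds_transport) (intro continuous_intros developing_isCont d)
  with *(3) show ?thesis
  proof eventually_elim
    case (elim v)
    then obtain x where "x \<in> U" "x \<in> W" "\<psi> (F v) = \<psi> x" by auto
    thus ?case using inj_onD[OF chart_inj[OF *(1)], of "F v" x] elim by auto
  qed
qed

lemma afm_at_chart:
  assumes d: "developing d" and F: "afm_at d F w" and ch: "(U', \<psi>') \<in> \<A>" "F w \<in> U'"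
  obtains a b where "a \<noteq> 0" "\<forall>\<^sub>F v in nhds w. F v \<in> U' \<and> \<psi>' (F v) = a * d v + b"
proof -
  obtain U \<psi> a b where *: "(U, \<psi>) \<in> \<A>" "a \<noteq> 0" "\<forall>\<^sub>F v in nhds w. F v \<in> U \<and> \<psi> (F v) = a * d v + b"
    by (rule afm_atE[OF F])
  have w: "F w \<in> U" using eventually_nhds_x_imp_x[OF *(3)] by auto
  obtain a' b' W where W: "a' \<noteq> 0" "openin X W" "F w \<in> W" "W \<subseteq> U \<inter> U'" "\<And>y. y \<in> W \<Longrightarrow> \<psi>' y = a' * \<psi> y + b'"
    using chart_transition[OF *(1) ch(1) w ch(2)] by metis
  have "\<forall>\<^sub>F v in nhds w. F v \<in> W" using afm_at_open_preimage[OF d F] W by blast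
  with *(3) have "\<forall>\<^sub>F v in nhds w. F v \<in> U' \<and> \<psi>' (F v) = (a' * a) * d v + (a' * b + b')"
    by eventually_elim (use W in \<open>auto simp: algebra_simps\<close>)
  thus ?thesis by (rule that[rotated]) (use *(2) W(1) in simp)
qed

lemma afm_at_continuous_map:
  assumes "developing d" "\<And>w. w \<in> D \<Longrightarrow> afm_at d F w"
  shows "continuous_map (top_of_set D) X F"
  unfolding continuous_map_openin_preimage_eq
proof (intro conjI ballI allI impI)
  show "F \<in> topspace (top_of_set D) \<rightarrow> topspace X"
    using assms(2) afm_at_in_M by auto
  fix W assume W: "openin X W"
  have "open {w. \<forall>\<^sub>F v in nhds w. F v \<in> W}"
    by (rule open_eventually_nhds)
  moreover have "topspace (top_of_set D) \<inter> F -` W = D \<inter> {w. \<forall>\<^sub>F v in nhds w. F v \<in> W}"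
    using afm_at_open_preimage[OF assms(1) assms(2) W] by (auto dest: eventually_nhds_x_imp_x)
  ultimately show "openin (top_of_set D) (topspace (top_of_set D) \<inter> F -` W)"
    by (simp add: openin_open_Int)
qed

text \<open>The chart and the local inverse of \<open>d\<close> together give an explicit local
  section of \<open>F\<close> on a neighbourhood of \<open>F w\<close>.\<close>

lemma afm_at_open_image_local:
  assumes d: "developing d" and F: "afm_at d F w" and N: "\<forall>\<^sub>F v in nhds w. v \<in> N"
  obtains W where "openin X W" "F w \<in> W" "W \<subseteq> F ` N"
proof -
  obtain U \<psi> a b where *: "(U, \<psi>) \<in> \<A>" "a \<noteq> 0" "\<forall>\<^sub>F v in nhds w. F v \<in> U \<and> \<psi> (F v) = a * d v + b"
    by (rule afm_atE[OF F])
  obtain g where g: "isCont g (d w)" "g (d w) = w" "\<forall>\<^sub>F z in nhds (d w). d (g z) = z"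
    using developing_local_inverse[OF d] by blast
  have w: "F w \<in> U" "\<psi> (F w) = a * d w + b" using eventually_nhds_x_imp_x[OF *(3)] by auto
  have "\<forall>\<^sub>F z in nhds (d w). g z \<in> N \<and> F (g z) \<in> U \<and> \<psi> (F (g z)) = a * d (g z) + b"
    using *(3) N g by (intro nhds_transport[of _ g]) (auto intro: eventually_conj)
  with g(3) have "\<forall>\<^sub>F z in nhds (d w). g z \<in> N \<and> F (g z) \<in> U \<and> \<psi> (F (g z)) = a * z + b"
    by eventually_elim auto
  then obtain S where S: "open S" "d w \<in> S" "\<And>z. z \<in> S \<Longrightarrow> g z \<in> N \<and> F (g z) \<in> U \<and> \<psi> (F (g z)) = a * z + b"
    unfolding eventually_nhds by blast
  define V where "V = {x \<in> U. \<psi> x \<in> (\<lambda>z. (z - b) / a) -` S}"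
  have "open ((\<lambda>z. (z - b) / a) -` S)"
    using S(1) *(2) by (intro open_vimage continuous_intros) auto
  hence "openin X V" unfolding V_def
    using chart_continuous[OF *(1)] by blast
  moreover have "F w \<in> V"
    using w S(2) *(2) by (simp add: V_def)
  moreover have "V \<subseteq> F ` N"
  proof
    fix x assume "x \<in> V"
    hence x: "x \<in> U" "(\<psi> x - b) / a \<in> S" by (auto simp: V_def)
    have "\<psi> (F (g ((\<psi> x - b) / a))) = \<psi> x" "F (g ((\<psi> x - b) / a)) \<in> U" "g ((\<psi> x - b) / a) \<in> N"
      using S(3)[OF x(2)] *(2) by auto
    thus "x \<in> F ` N" using inj_onD[OF chart_inj[OF *(1)]] x(1) by (metis imageI)
  qed
  ultimately show ?thesis using that by blast
qed

lemma afm_open_image: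
  assumes "developing d" "\<And>w. w \<in> D \<Longrightarrow> afm_at d F w" "open D"
  shows "openin X (F ` D)"
proof (subst openin_subopen, intro ballI)
  fix x assume "x \<in> F ` D"
  then obtain w where w: "w \<in> D" "x = F w" by auto
  obtain W where "openin X W" "F w \<in> W" "W \<subseteq> F ` D"
    using afm_at_open_image_local[OF assms(1) assms(2)[OF w(1)], of D] assms(3) w(1)
    by (metis eventually_nhds_in_open)
  thus "\<exists>T. openin X T \<and> x \<in> T \<and> T \<subseteq> F ` D" using w by blast
qed

text \<open>Both maps are read in one chart around the common value. The result is an equivalence on
  a product of neighbourhoods: along the graph of a lift it yields equality of two maps, and in the
  other direction it yields local injectivity.\<close>

lemma transition:
  assumes d: "developing d" "developing e" and F: "afm_at d F w" and G: "afm_at e G v" and eq: "F w = G v"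
  obtains A B where "A \<noteq> 0" "e v = A * d w + B"
    "\<forall>\<^sub>F p in nhds w \<times>\<^sub>F nhds v. F (fst p) = G (snd p) \<longleftrightarrow> A * d (fst p) + B = e (snd p)"
proof -
  obtain U \<psi> where ch: "(U, \<psi>) \<in> \<A>" "F w \<in> U" using chart_cover afm_at_in_M[OF F] by blast
  obtain a b where a: "a \<noteq> 0" "\<forall>\<^sub>F x in nhds w. F x \<in> U \<and> \<psi> (F x) = a * d x + b"
    using afm_at_chart[OF d(1) F ch] by blast
  obtain a' b' where a': "a' \<noteq> 0" "\<forall>\<^sub>F x in nhds v. G x \<in> U \<and> \<psi> (G x) = a' * e x + b'"
    using afm_at_chart[OF d(2) G ch(1)] eq ch(2) by auto
  have "\<forall>\<^sub>F p in nhds w \<times>\<^sub>F nhds v. F (fst p) \<in> U \<and> \<psi> (F (fst p)) = a * d (fst p) + b"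
    by (rule eventually_compose_filterlim[OF a(2) filterlim_fst])
  moreover have "\<forall>\<^sub>F p in nhds w \<times>\<^sub>F nhds v. G (snd p) \<in> U \<and> \<psi> (G (snd p)) = a' * e (snd p) + b'"
    by (rule eventually_compose_filterlim[OF a'(2) filterlim_snd])
  ultimately have "\<forall>\<^sub>F p in nhds w \<times>\<^sub>F nhds v. F (fst p) = G (snd p) \<longleftrightarrow> (a / a') * d (fst p) + (b - b') / a' = e (snd p)"
  proof eventually_elim
    case (elim p)
    hence "F (fst p) = G (snd p) \<longleftrightarrow> \<psi> (F (fst p)) = \<psi> (G (snd p))"
      using inj_onD[OF chart_inj[OF ch(1)]] by metis
    also have "\<dots> \<longleftrightarrow> a * d (fst p) + b = a' * e (snd p) + b'" using elim by auto
    also have "\<dots> \<longleftrightarrow> (a / a') * d (fst p) + (b - b') / a' = e (snd p)"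
    proof -
      have "(a / a') * d (fst p) + (b - b') / a' = (a * d (fst p) + b - b') / a'"
        by (simp add: add_divide_distrib diff_divide_distrib)
      thus ?thesis using a'(1) by (simp add: divide_eq_eq diff_eq_eq mult.commute)
    qed
    finally show ?case .
  qed
  moreover have "e v = (a / a') * d w + (b - b') / a'"
  proof -
    have "a * d w + b = a' * e v + b'"
      using eventually_nhds_x_imp_x[OF a(2)] eventually_nhds_x_imp_x[OF a'(2)] eq by simp
    moreover have "(a / a') * d w + (b - b') / a' = (a * d w + b - b') / a'"
      by (simp add: add_divide_distrib diff_divide_distrib)
    ultimately show ?thesis using a'(1) by simp
  qed
  ultimately show ?thesis using that[of "a/a'" "(b-b')/a'"] a(1) a'(1) by auto
qed

lemma eventually_nhds_prod_along:
  assumes "\<forall>\<^sub>F p in nhds w \<times>\<^sub>F nhds (g w). P (fst p) (snd p)" "isCont g w"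
  shows "\<forall>\<^sub>F x in nhds w. P x (g x)"
proof -
  have "filterlim g (nhds (g w)) (nhds w)"
    using assms(2) isCont_def tendsto_at_iff_tendsto_nhds by blast
  hence "filterlim (\<lambda>x. (x, g x)) (nhds w \<times>\<^sub>F nhds (g w)) (nhds w)"
    by (intro filterlim_Pair filterlim_ident)
  from eventually_compose_filterlim[OF assms(1) this] show ?thesis by simp
qed

text \<open>Take the transition of \<open>F\<close> with itself. The diagonal consists of
  collisions, so the affine transition fixes all nearby values of \<open>d\<close> and is the
  identity.\<close>

lemma locally_injective:
  assumes d: "developing d" and F: "afm_at d F w"
  shows "\<forall>\<^sub>F p in nhds w \<times>\<^sub>F nhds w. F (fst p) = F (snd p) \<longleftrightarrow> d (fst p) = d (snd p)"
proof -
  obtain A B where AB: "A \<noteq> 0" "d w = A * d w + B"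
    "\<forall>\<^sub>F p in nhds w \<times>\<^sub>F nhds w. F (fst p) = F (snd p) \<longleftrightarrow> A * d (fst p) + B = d (snd p)"
    by (rule transition[OF d d F F refl])
  have "\<forall>\<^sub>F x in nhds w. F x = F x \<longleftrightarrow> A * d x + B = d x"
    using eventually_nhds_prod_along[where w=w and g="\<lambda>x. x" and P="\<lambda>x y. F x = F y \<longleftrightarrow> A * d x + B = d y"] AB(3) by simp
  hence "A = 1 \<and> B = 0" by (intro developing_affine_unique[OF d]) simp
  thus ?thesis using AB(3) by simp
qed

text \<open>The set where the germs agree is open by definition. At a limit point in
  \<open>D\<close> the Hausdorff property gives equal values, so a transition exists there; it is
  the identity because it is so near some point of agreement. \<open>D\<close> may be a segment,
  which allows continuation along curves.\<close>

lemma identity_principle: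
  assumes d: "developing d" and D: "connected D"
    and F: "\<And>w. w \<in> D \<Longrightarrow> afm_at d F w" and G: "\<And>w. w \<in> D \<Longrightarrow> afm_at d G w"
    and w0: "w0 \<in> D" "\<forall>\<^sub>F v in nhds w0. F v = G v" and w: "w \<in> D"
  shows "\<forall>\<^sub>F v in nhds w. F v = G v"
proof -
  let ?E = "{w. \<forall>\<^sub>F v in nhds w. F v = G v}"
  have opE: "open ?E"
    by (rule open_eventually_nhds)
  have cl: "u \<in> ?E" if u: "u \<in> D" "u \<in> closure ?E" for u
  proof -
    have "F u = G u"
    proof (rule ccontr)
      assume ne: "F u \<noteq> G u"
      have "F u \<in> topspace X" "G u \<in> topspace X"
        using afm_at_in_M F G u(1) by blast+
      then obtain V W where VW: "openin X V" "openin X W" "F u \<in> V" "G u \<in> W" "disjnt V W"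
        using Hausdorff_X ne unfolding Hausdorff_space_def by metis
      have "\<forall>\<^sub>F v in nhds u. F v \<in> V \<and> G v \<in> W"
        using afm_at_open_preimage[OF d F[OF u(1)]] afm_at_open_preimage[OF d G[OF u(1)]] VW
        by (intro eventually_conj) blast+
      then obtain S where S: "open S" "u \<in> S" "\<And>v. v \<in> S \<Longrightarrow> F v \<in> V \<and> G v \<in> W"
        unfolding eventually_nhds by blast
      then obtain v where "v \<in> S" "v \<in> ?E" using open_Int_closure_eq_empty[OF S(1), of ?E] u(2) S(2) by blast
      moreover from \<open>v \<in> ?E\<close> have "F v = G v" by (auto dest: eventually_nhds_x_imp_x)
      moreover have "F v \<in> V" "G v \<in> W" using S(3)[OF \<open>v \<in> S\<close>] by blast+
      ultimately show False using VW(5) by (metis disjnt_iff)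
    qed
    obtain A B where AB: "A \<noteq> 0" "d u = A * d u + B"
      "\<forall>\<^sub>F p in nhds u \<times>\<^sub>F nhds u. F (fst p) = G (snd p) \<longleftrightarrow> A * d (fst p) + B = d (snd p)"
      by (rule transition[OF d d F[OF u(1)] G[OF u(1)] \<open>F u = G u\<close>])
    have ev: "\<forall>\<^sub>F x in nhds u. F x = G x \<longleftrightarrow> A * d x + B = d x"
      using eventually_nhds_prod_along[where w=u and g="\<lambda>x. x" and P="\<lambda>x y. F x = G y \<longleftrightarrow> A * d x + B = d y"] AB(3) by simp
    then obtain S where S: "open S" "u \<in> S" "\<And>v. v \<in> S \<Longrightarrow> F v = G v \<longleftrightarrow> A * d v + B = d v"
      by (auto simp only: eventually_nhds)
    then obtain v where v: "v \<in> S" "v \<in> ?E" using open_Int_closure_eq_empty[OF S(1), of ?E] u(2) S(2) by blast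
    have "\<forall>\<^sub>F x in nhds v. x \<in> S" using S(1) v(1) by (rule eventually_nhds_in_open)
    moreover have "\<forall>\<^sub>F x in nhds v. F x = G x" using v(2) by simp
    ultimately have "\<forall>\<^sub>F x in nhds v. A * d x + B = d x"
      by eventually_elim (use S(3) in auto)
    hence "A = 1 \<and> B = 0" by (rule developing_affine_unique[OF d])
    with ev show "u \<in> ?E" by simp
  qed
  have "D \<subseteq> ?E"
  proof -
    have "?E \<inter> (- closure ?E) \<inter> D = {}" using closure_subset[of ?E] by blast
    moreover have "D \<subseteq> ?E \<union> - closure ?E" using cl by blast
    ultimately have "?E \<inter> D = {} \<or> (- closure ?E) \<inter> D = {}"
      using connectedD[OF D opE open_Compl[OF closed_closure[of ?E]]] by blast
    moreover have "w0 \<in> ?E \<inter> D" using w0 by simp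
    ultimately show ?thesis using cl by blast
  qed
  thus ?thesis using w by blast
qed

lemma identity_principle_eq:
  assumes "developing d" "connected D"
    "\<And>w. w \<in> D \<Longrightarrow> afm_at d F w" "\<And>w. w \<in> D \<Longrightarrow> afm_at d G w"
    "w0 \<in> D" "\<forall>\<^sub>F v in nhds w0. F v = G v" "w \<in> D"
  shows "F w = G w"
  using identity_principle[OF assms] eventually_nhds_x_imp_x by blast

text \<open>Rescaling to the unit disc gives all later compactness arguments the same numerical
  margins.\<close>

lemma chart_disc:
  assumes "y \<in> M"
  obtains E where "\<And>e. e \<in> ball 0 1 \<Longrightarrow> afm_at (\<lambda>z. z) E e" "inj_on E (ball 0 1)" "E 0 = y"
proof -
  obtain U \<psi> where ch: "(U, \<psi>) \<in> \<A>" "y \<in> U" using chart_cover assms by blast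
  obtain r where r: "r > 0" "ball (\<psi> y) r \<subseteq> \<psi> ` U"
    using chart_homeomorphic(2)[OF ch(1)] ch(2) by (meson imageI open_contains_ball)
  define E where "E = (\<lambda>e::complex. inv_into U \<psi> (\<psi> y + r * e))"
  have *: "E e \<in> U" "\<psi> (E e) = r * e + \<psi> y" if "e \<in> ball 0 1" for e :: complex
  proof -
    have "norm (complex_of_real r * e) < r" using that r(1) by (simp add: norm_mult)
    hence "\<psi> y + r * e \<in> \<psi> ` U" using r by (intro subsetD[OF r(2)]) (simp add: dist_norm)
    thus "E e \<in> U" "\<psi> (E e) = r * e + \<psi> y" unfolding E_def
      by (auto simp: inv_into_into f_inv_into_f)
  qed
  show ?thesis
  proof (rule that)
    show "afm_at (\<lambda>z. z) E e" if "e \<in> ball 0 1" for e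
    proof -
      have "\<forall>\<^sub>F v in nhds e. v \<in> ball 0 1" using that by (intro eventually_nhds_in_open) auto
      hence "\<forall>\<^sub>F v in nhds e. E v \<in> U \<and> \<psi> (E v) = r * v + \<psi> y"
        by eventually_elim (use * in auto)
      thus ?thesis by (rule afm_atI[OF ch(1), rotated]) (use r(1) in simp)
    qed
    show "inj_on E (ball 0 1)" 
      by (rule inj_onI) (metis "*"(2) add_right_cancel less_irrefl mult_cancel_left of_real_eq_0_iff r(1))
    show "E 0 = y" using ch(2) chart_inj[OF ch(1)] by (simp add: E_def)
  qed
qed

end

section \<open>Logarithmic coordinates at a conical singularity\<close>

lemma isCont_Re_Im: "isCont Re w" "isCont Im w"
  by (auto intro: linear_continuous_at bounded_linear_Re bounded_linear_Im)

lemma tendsto_Im_nhds: "(Im \<longlongrightarrow> Im w) (nhds w)"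
  using isCont_Re_Im(2)[of w] by (simp add: isCont_def tendsto_at_iff_tendsto_nhds)

locale cone_model =
  fixes \<theta> \<rho> :: real
  assumes \<theta>_pos: "\<theta> > 0" and \<rho>_pos: "\<rho> > 0"
begin

text \<open>The gluing identifies radius \<open>r\<close> at angle \<open>\<theta>\<close> with
  radius \<open>\<rho> * r\<close> at angle 0. In the coordinate \<open>ln r + i \<phi>\<close> this
  is a translation, which generates the deck group of the punctured cone.\<close>

definition deck :: complex where "deck = Complex (- ln \<rho>) \<theta>"

text \<open>A substitute for the logarithm of the radius, corrected by a multiple of the angle so
  that it is invariant under \<open>deck\<close>.\<close>

definition lev :: "complex \<Rightarrow> real" where "lev w = Re w + ln \<rho> / \<theta> * Im w"

definition cls :: "real \<times> real \<Rightarrow> (real \<times> real) set" where "cls p = cone_rel \<theta> \<rho> `` {p}"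

text \<open>The universal covering of the punctured cone: translate by a multiple of
  \<open>deck\<close> into the sector \<open>0 \<le> Im < \<theta>\<close>, then take the class of
  the polar coordinates.\<close>

definition cpar :: "complex \<Rightarrow> (real \<times> real) set" where
  "cpar w = (let v = w - of_int \<lfloor>Im w / \<theta>\<rfloor> * deck in cls (exp (Re v), Im v))"

lemma deck_sel [simp]: "Re deck = - ln \<rho>" "Im deck = \<theta>"
  by (simp_all add: deck_def)

lemma lev_add_deck [simp]: "lev (w + of_int k * deck) = lev w"
  using \<theta>_pos by (simp add: lev_def field_simps)

lemma isCont_lev: "isCont lev w"
  unfolding lev_def by (intro continuous_intros isCont_Re_Im)

lemma cls_eqI: "(p, q) \<in> cone_rel \<theta> \<rho> \<Longrightarrow> cls p = cls q"
  unfolding cls_def by (rule equiv_class_eq[OF equiv_cone_rel[OF \<theta>_pos \<rho>_pos]])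

lemma cls_eqD: "cls p = cls q \<Longrightarrow> q \<in> cone_sector \<theta> \<Longrightarrow> (p, q) \<in> cone_rel \<theta> \<rho>"
  unfolding cls_def using eq_equiv_class[OF _ equiv_cone_rel[OF \<theta>_pos \<rho>_pos]] by blast

lemma cls_in: "p \<in> cone_sector \<theta> \<Longrightarrow> cls p \<in> cone_sector \<theta> // cone_rel \<theta> \<rho>"
  unfolding cls_def by (rule quotientI)

lemma apex_eq: "cone_apex \<theta> \<rho> = cls (0, 0)"
  by (simp add: cone_apex_def cls_def)

lemma cls_zero: "0 \<le> \<phi> \<Longrightarrow> \<phi> \<le> \<theta> \<Longrightarrow> cls (0, \<phi>) = cone_apex \<theta> \<rho>"
  unfolding apex_eq using \<theta>_pos by (intro cls_eqI) (auto simp: cone_rel_def cone_sector_def)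

lemma frac_strip:
  assumes "v = w - of_int \<lfloor>Im w / \<theta>\<rfloor> * deck"
  shows "0 \<le> Im v" "Im v < \<theta>"
proof -
  have "of_int \<lfloor>Im w / \<theta>\<rfloor> \<le> Im w / \<theta>" "Im w / \<theta> < of_int \<lfloor>Im w / \<theta>\<rfloor> + 1" by linarith+
  hence "of_int \<lfloor>Im w / \<theta>\<rfloor> * \<theta> \<le> Im w" "Im w < (of_int \<lfloor>Im w / \<theta>\<rfloor> + 1) * \<theta>"
    by (simp_all only: pos_le_divide_eq[OF \<theta>_pos] pos_divide_less_eq[OF \<theta>_pos])
  thus "0 \<le> Im v" "Im v < \<theta>" unfolding assms by (simp_all add: algebra_simps)
qed

lemma cpar_strip:
  assumes "0 \<le> Im w" "Im w \<le> \<theta>"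
  shows "cpar w = cls (exp (Re w), Im w)"
proof (cases "Im w = \<theta>")
  case True
  hence *: "cpar w = cls (\<rho> * exp (Re w), 0)"
    using \<theta>_pos \<rho>_pos by (simp add: cpar_def exp_add Let_def mult.commute)
  show ?thesis unfolding *
    by (intro cls_eqI) (use True \<theta>_pos \<rho>_pos in \<open>auto simp: cone_rel_def cone_sector_def\<close>)
next
  case False
  hence "\<lfloor>Im w / \<theta>\<rfloor> = 0" using assms \<theta>_pos by (intro floor_unique) auto
  thus ?thesis by (simp add: cpar_def)
qed

lemma cpar_deck [simp]: "cpar (w + of_int k * deck) = cpar w"
proof -
  have "Im (w + of_int k * deck) / \<theta> = Im w / \<theta> + of_int k"
    using \<theta>_pos by (simp add: field_simps)
  hence "\<lfloor>Im (w + of_int k * deck) / \<theta>\<rfloor> = \<lfloor>Im w / \<theta>\<rfloor> + k" by simp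
  thus ?thesis unfolding cpar_def Let_def by (simp add: algebra_simps)
qed

lemma cpar_eqD:
  assumes "cpar w = cpar w'"
  shows "\<exists>k::int. w' = w + of_int k * deck"
proof -
  define v v' where "v = w - of_int \<lfloor>Im w / \<theta>\<rfloor> * deck" and "v' = w' - of_int \<lfloor>Im w' / \<theta>\<rfloor> * deck"
  have "0 \<le> Im v" "Im v < \<theta>" "0 \<le> Im v'" "Im v' < \<theta>" using frac_strip v_def v'_def by auto
  moreover have "cls (exp (Re v), Im v) = cls (exp (Re v'), Im v')"
    using assms by (simp add: cpar_def v_def v'_def Let_def)
  hence "((exp (Re v), Im v), (exp (Re v'), Im v')) \<in> cone_rel \<theta> \<rho>"
    using \<open>0 \<le> Im v'\<close> \<open>Im v' < \<theta>\<close> by (intro cls_eqD) (auto simp: cone_sector_def)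
  ultimately have "v = v'" by (auto simp: cone_rel_def complex_eq_iff)
  hence "w' = w + of_int (\<lfloor>Im w' / \<theta>\<rfloor> - \<lfloor>Im w / \<theta>\<rfloor>) * deck"
    by (simp add: v_def v'_def algebra_simps)
  thus ?thesis by blast
qed

lemma openin_cone:
  "openin (cone_space \<theta> \<rho>) V \<longleftrightarrow> V \<subseteq> cone_sector \<theta> // cone_rel \<theta> \<rho> \<and>
     openin (top_of_set (cone_sector \<theta>)) {p \<in> cone_sector \<theta>. cls p \<in> V}"
  by (simp add: cone_space_def openin_quotient_topology cls_def)

text \<open>Only the edge \<open>Im w = 0\<close> needs care: points just below it are seen near the
  edge \<open>Im = \<theta>\<close> after adding \<open>deck\<close>. All other points are
  translated into the sector first.\<close>

lemma cpar_open_vimage: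
  assumes "openin (cone_space \<theta> \<rho>) V"
  shows "open (cpar -` V)"
proof -
  obtain T where T: "open T" "{p \<in> cone_sector \<theta>. cls p \<in> V} = cone_sector \<theta> \<inter> T"
    using assms unfolding openin_cone openin_open by blast
  define g where "g = (\<lambda>w::complex. (exp (Re w), Im w))"
  have opn: "open (g -` T)"
    unfolding g_def by (intro open_vimage T continuous_intros)
  have mem: "cpar w \<in> V \<longleftrightarrow> w \<in> g -` T" if "0 \<le> Im w" "Im w \<le> \<theta>" for w
  proof -
    have "g w \<in> cone_sector \<theta>" using that by (simp add: g_def cone_sector_def)
    moreover have "cpar w = cls (g w)" using cpar_strip[OF that] by (simp add: g_def)
    ultimately show ?thesis using T(2) by auto
  qed
  have "\<forall>\<^sub>F v in nhds w. cpar v \<in> V" if w: "cpar w \<in> V" "0 \<le> Im w" "Im w < \<theta>" for w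
  proof -
    have 1: "\<forall>\<^sub>F v in nhds w. v \<in> g -` T"
      using mem[of w] w opn by (intro eventually_nhds_in_open) auto
    note tIm = tendsto_Im_nhds[of w]
    have 2: "\<forall>\<^sub>F v in nhds w. Im v < \<theta>" using w(3) tIm by (rule order_tendstoD(2)[rotated])
    show ?thesis
    proof (cases "Im w = 0")
      case False
      hence "\<forall>\<^sub>F v in nhds w. 0 < Im v" using w(2) tIm by (intro order_tendstoD(1)) auto
      with 1 2 show ?thesis by eventually_elim (use mem in auto)
    next
      case True
      have "cpar (w + deck) \<in> V" using w(1) cpar_deck[of w 1] by simp
      hence "w + deck \<in> g -` T" using mem[of "w + deck"] True \<theta>_pos by auto
      hence "\<forall>\<^sub>F v in nhds (w + deck). v \<in> g -` T" using opn by (intro eventually_nhds_in_open) auto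
      hence 3: "\<forall>\<^sub>F v in nhds w. v + deck \<in> g -` T"
        by (rule nhds_transport) (intro continuous_intros)
      have 4: "\<forall>\<^sub>F v in nhds w. - \<theta> < Im v" using tIm True \<theta>_pos by (intro order_tendstoD(1)) auto
      from 1 2 3 4 show ?thesis
      proof eventually_elim
        case (elim v)
        show ?case
        proof (cases "Im v \<ge> 0")
          case True
          thus ?thesis using mem elim by auto
        next
          case False
          hence "cpar (v + deck) \<in> V" using mem[of "v + deck"] elim by auto
          thus ?thesis using cpar_deck[of v 1] by simp
        qed
      qed
    qed
  qed note * = this
  have "\<forall>\<^sub>F v in nhds w. cpar v \<in> V" if w: "cpar w \<in> V" for w
  proof -
    define k where "k = - \<lfloor>Im w / \<theta>\<rfloor>"
    have "cpar (w + of_int k * deck) \<in> V" unfolding cpar_deck by (rule w)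
    moreover have "0 \<le> Im (w + of_int k * deck)" "Im (w + of_int k * deck) < \<theta>"
      using frac_strip[of "w + of_int k * deck" w] by (simp_all add: k_def)
    ultimately have u: "cpar (w + of_int k * deck) \<in> V" "0 \<le> Im (w + of_int k * deck)" "Im (w + of_int k * deck) < \<theta>"
      by auto
    from *[OF u] have "\<forall>\<^sub>F v in nhds w. cpar (v + of_int k * deck) \<in> V"
      by (rule nhds_transport) (intro continuous_intros)
    thus ?thesis by simp
  qed
  hence "cpar -` V = {w. \<forall>\<^sub>F v in nhds w. cpar v \<in> V}"
    by (auto dest: eventually_nhds_x_imp_x)
  thus ?thesis using open_eventually_nhds by metis
qed

lemma cpar_ne_apex: "cpar w \<noteq> cone_apex \<theta> \<rho>"
proof
  assume "cpar w = cone_apex \<theta> \<rho>"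
  hence "((exp (Re (w - of_int \<lfloor>Im w / \<theta>\<rfloor> * deck)), Im (w - of_int \<lfloor>Im w / \<theta>\<rfloor> * deck)), (0, 0)) \<in> cone_rel \<theta> \<rho>"
    unfolding apex_eq cpar_def Let_def using \<theta>_pos by (intro cls_eqD) (auto simp: cone_sector_def)
  thus False using \<rho>_pos by (auto simp: cone_rel_def)
qed

text \<open>In polar coordinates \<open>exp \<circ> lev\<close> is the radius times
  \<open>exp (ln \<rho> / \<theta> * \<phi>)\<close>. This is continuous down to radius 0 and
  respects the gluing, so its sublevel sets are open in the quotient.\<close>

lemma openin_levels: "openin (cone_space \<theta> \<rho>) (insert (cone_apex \<theta> \<rho>) (cpar ` {w. lev w < L}))"
  unfolding openin_cone
proof
  show "insert (cone_apex \<theta> \<rho>) (cpar ` {w. lev w < L}) \<subseteq> cone_sector \<theta> // cone_rel \<theta> \<rho>"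
  proof -
    have "cpar w \<in> cone_sector \<theta> // cone_rel \<theta> \<rho>" for w
      unfolding cpar_def Let_def using frac_strip[OF refl, of w]
      by (intro cls_in) (auto simp: cone_sector_def)
    moreover have "cone_apex \<theta> \<rho> \<in> cone_sector \<theta> // cone_rel \<theta> \<rho>"
      unfolding apex_eq using \<theta>_pos by (intro cls_in) (auto simp: cone_sector_def)
    ultimately show ?thesis by blast
  qed
  have "{p \<in> cone_sector \<theta>. cls p \<in> insert (cone_apex \<theta> \<rho>) (cpar ` {w. lev w < L})} =
    cone_sector \<theta> \<inter> {p. fst p * exp (ln \<rho> / \<theta> * snd p) < exp L}" (is "?A = ?B")
  proof (intro set_eqI)
    fix p
    show "p \<in> ?A \<longleftrightarrow> p \<in> ?B"
    proof (cases "p \<in> cone_sector \<theta>")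
      case True
      then obtain x \<phi> where p: "p = (x, \<phi>)" "0 \<le> x" "0 \<le> \<phi>" "\<phi> \<le> \<theta>" by (auto simp: cone_sector_def)
      show ?thesis
      proof (cases "x = 0")
        case True
        thus ?thesis using p \<open>p \<in> cone_sector \<theta>\<close> cls_zero by auto
      next
        case False
        define w where "w = Complex (ln x) \<phi>"
        have x: "x > 0" using False p by simp
        have w: "cpar w = cls p" using cpar_strip[of w] p x by (simp add: w_def)
        have "cls p \<in> insert (cone_apex \<theta> \<rho>) (cpar ` {w. lev w < L}) \<longleftrightarrow> lev w < L"
        proof
          assume "cls p \<in> insert (cone_apex \<theta> \<rho>) (cpar ` {w. lev w < L})"
          then obtain w' where w': "cpar w' = cpar w" "lev w' < L" using w cpar_ne_apex by fastforce
          then obtain k where "w = w' + of_int k * deck" using cpar_eqD by blast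
          thus "lev w < L" using w' by simp
        next
          assume "lev w < L"
          thus "cls p \<in> insert (cone_apex \<theta> \<rho>) (cpar ` {w. lev w < L})"
            by (intro insertI2 image_eqI[of _ _ w]) (auto simp: w)
        qed
        also have "\<dots> \<longleftrightarrow> exp (lev w) < exp L" by simp
        also have "exp (lev w) = x * exp (ln \<rho> / \<theta> * \<phi>)" using x by (simp add: lev_def w_def exp_add)
        finally show ?thesis using True p by auto
      qed
    qed auto
  qed
  moreover have "open {p::real\<times>real. fst p * exp (ln \<rho> / \<theta> * snd p) < exp L}"
    by (intro open_Collect_less continuous_intros)
  ultimately show "openin (top_of_set (cone_sector \<theta>))
      {p \<in> cone_sector \<theta>. cls p \<in> insert (cone_apex \<theta> \<rho>) (cpar ` {w. lev w < L})}"
    by (simp add: openin_open_Int)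
qed

text \<open>The apex is a whole compact segment of polar coordinates with radius 0. An open set
  around that segment contains a uniform neighbourhood of it.\<close>

lemma levels_basis:
  assumes V: "openin (cone_space \<theta> \<rho>) V" "cone_apex \<theta> \<rho> \<in> V"
  obtains L where "cpar ` {w. lev w < L} \<subseteq> V"
proof -
  obtain T where T: "open T" "{p \<in> cone_sector \<theta>. cls p \<in> V} = cone_sector \<theta> \<inter> T"
    using V(1) unfolding openin_cone openin_open by blast
  have "{0} \<times> {0..\<theta>} \<subseteq> T"
  proof
    fix p :: "real \<times> real" assume "p \<in> {0} \<times> {0..\<theta>}"
    hence "p \<in> {p \<in> cone_sector \<theta>. cls p \<in> V}" using cls_zero V(2) by (auto simp: cone_sector_def)
    thus "p \<in> T" using T(2) by auto
  qed
  moreover have "compact ({0::real} \<times> {0..\<theta>})" by (intro compact_Times) auto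
  ultimately obtain e where e: "e > 0" "(\<Union>p\<in>{0} \<times> {0..\<theta>}. ball p e) \<subseteq> T"
    using compact_subset_open_imp_ball_epsilon_subset[of "{0::real} \<times> {0..\<theta>}" T] T(1) by blast
  have small: "cls (x, \<phi>) \<in> V" if "0 \<le> x" "x < e" "0 \<le> \<phi>" "\<phi> \<le> \<theta>" for x \<phi>
  proof -
    have "dist (0, \<phi>) (x, \<phi>) < e" using that by (simp add: dist_Pair_Pair)
    hence "(x, \<phi>) \<in> T" using e(2) that by force
    hence "(x, \<phi>) \<in> {p \<in> cone_sector \<theta>. cls p \<in> V}"
      unfolding T(2) using that by (simp add: cone_sector_def)
    thus ?thesis by simp
  qed
  \<comment> \<open>On the sector \<open>0 \<le> Im v < \<theta>\<close> the numbers
    \<open>lev v\<close> and \<open>Re v\<close> differ by at most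
    \<open>\<bar>ln \<rho>\<bar>\<close>.\<close>
  define L where "L = ln e - \<bar>ln \<rho>\<bar>"
  have "cpar w \<in> V" if "lev w < L" for w
  proof -
    define v where "v = w - of_int \<lfloor>Im w / \<theta>\<rfloor> * deck"
    have v: "0 \<le> Im v" "Im v < \<theta>" using frac_strip[OF v_def] by auto
    have "lev v = lev w" using lev_add_deck[of w "- \<lfloor>Im w / \<theta>\<rfloor>"] by (simp add: v_def)
    moreover have "\<bar>ln \<rho> / \<theta> * Im v\<bar> \<le> \<bar>ln \<rho>\<bar>"
    proof -
      have "\<bar>ln \<rho> / \<theta> * Im v\<bar> = \<bar>ln \<rho>\<bar> * (Im v / \<theta>)" using v \<theta>_pos by (simp add: abs_mult)
      also have "\<dots> \<le> \<bar>ln \<rho>\<bar> * 1" using v \<theta>_pos by (intro mult_left_mono) auto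
      finally show ?thesis by simp
    qed
    ultimately have "Re v < ln e" using that unfolding lev_def L_def by linarith
    hence "exp (Re v) < e" using e(1) by (metis exp_less_cancel_iff exp_ln)
    thus ?thesis unfolding cpar_def Let_def v_def[symmetric] using v by (intro small) auto
  qed
  thus ?thesis using that[of L] by blast
qed

text \<open>On a glued edge the atlas provides one affine expression for each side. After pulling
  back by \<open>deck\<close> both are affine in \<open>exp\<close>, and their agreement along the
  edge forces equal coefficients.\<close>

lemma cone_atlas_cpar:
  assumes ch: "(V, \<psi>) \<in> cone_atlas \<theta> \<rho>" "cpar w \<in> V"
  obtains a b where "a \<noteq> 0" "\<forall>\<^sub>F v in nhds w. \<psi> (cpar v) = a * exp v + b"
proof -
  have loc: "\<exists>a b W. a \<noteq> 0 \<and> open W \<and> u \<in> W \<and> (\<forall>v\<in>W. 0 \<le> Im v \<and> Im v \<le> \<theta> \<longrightarrow> \<psi> (cpar v) = a * exp v + b)"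
    if u: "cpar u \<in> V" "0 \<le> Im u" "Im u \<le> \<theta>" for u
  proof -
    let ?p = "(exp (Re u), Im u)"
    have "?p \<in> cone_sector \<theta>" "cone_rel \<theta> \<rho> `` {?p} \<in> V"
      using u cpar_strip[of u] by (auto simp: cone_sector_def cls_def)
    moreover have "\<forall>p\<in>cone_sector \<theta>. cone_rel \<theta> \<rho> `` {p} \<in> V \<longrightarrow> fst p > 0 \<and>
        (\<exists>a b W. a \<noteq> 0 \<and> openin (top_of_set (cone_sector \<theta>)) W \<and> p \<in> W \<and>
           (\<forall>q\<in>W. \<psi> (cone_rel \<theta> \<rho> `` {q}) = a * rcis (fst q) (snd q) + b))"
      using ch(1) by (simp add: cone_atlas_def polar_quotient_atlas_def)
    ultimately obtain a b W where W: "a \<noteq> 0" "openin (top_of_set (cone_sector \<theta>)) W" "?p \<in> W"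
      "\<And>q. q \<in> W \<Longrightarrow> \<psi> (cls q) = a * rcis (fst q) (snd q) + b"
      unfolding cls_def by meson
    obtain T where T: "open T" "W = cone_sector \<theta> \<inter> T" using W(2) unfolding openin_open by blast
    let ?W = "(\<lambda>v::complex. (exp (Re v), Im v)) -` T"
    have "open ?W" by (intro open_vimage T continuous_intros)
    moreover have "u \<in> ?W" using W(3) T(2) by auto
    moreover have "\<psi> (cpar v) = a * exp v + b" if "v \<in> ?W" "0 \<le> Im v" "Im v \<le> \<theta>" for v
    proof -
      have "(exp (Re v), Im v) \<in> W" using that T(2) by (auto simp: cone_sector_def)
      thus ?thesis using W(4) cpar_strip[OF that(2,3)]
        by (simp add: rcis_def exp_eq_polar)
    qed
    ultimately show ?thesis using W(1) by blast
  qed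
  define k where "k = - \<lfloor>Im w / \<theta>\<rfloor>"
  define u where "u = w + of_int k * deck"
  have "cpar u \<in> V" unfolding u_def cpar_deck by (rule ch(2))
  moreover have "0 \<le> Im u" "Im u < \<theta>" using frac_strip[of u w] by (simp_all add: u_def k_def)
  ultimately have u: "cpar u \<in> V" "0 \<le> Im u" "Im u < \<theta>" by auto
  note tIm = tendsto_Im_nhds[of u]
  have "\<exists>a b. a \<noteq> 0 \<and> (\<forall>\<^sub>F v in nhds u. \<psi> (cpar v) = a * exp v + b)"
  proof -
    obtain a b W where W: "a \<noteq> 0" "open W" "u \<in> W" "\<And>v. v \<in> W \<Longrightarrow> 0 \<le> Im v \<Longrightarrow> Im v \<le> \<theta> \<Longrightarrow> \<psi> (cpar v) = a * exp v + b"
      using loc[of u] u by auto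
    have 1: "\<forall>\<^sub>F v in nhds u. v \<in> W" using W by (intro eventually_nhds_in_open)
    have 2: "\<forall>\<^sub>F v in nhds u. Im v < \<theta>" using u(3) tIm by (rule order_tendstoD(2)[rotated])
    show ?thesis
    proof (cases "Im u = 0")
      case False
      hence "\<forall>\<^sub>F v in nhds u. 0 < Im v" using u(2) tIm by (intro order_tendstoD(1)) auto
      with 1 2 have "\<forall>\<^sub>F v in nhds u. \<psi> (cpar v) = a * exp v + b"
        by eventually_elim (use W in auto)
      thus ?thesis using W(1) by blast
    next
      case True
      have "cpar (u + deck) \<in> V" using u(1) cpar_deck[of u 1] by simp
      then obtain a' b' W' where W': "a' \<noteq> 0" "open W'" "u + deck \<in> W'"
        "\<And>v. v \<in> W' \<Longrightarrow> 0 \<le> Im v \<Longrightarrow> Im v \<le> \<theta> \<Longrightarrow> \<psi> (cpar v) = a' * exp v + b'"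
        using loc[of "u + deck"] True \<theta>_pos by auto
      have "\<forall>\<^sub>F v in nhds (u + deck). v \<in> W'" using W' by (intro eventually_nhds_in_open)
      hence 3: "\<forall>\<^sub>F v in nhds u. v + deck \<in> W'"
        by (rule nhds_transport) (intro continuous_intros)
      have 4: "\<forall>\<^sub>F v in nhds u. - \<theta> < Im v" using tIm True \<theta>_pos by (intro order_tendstoD(1)) auto
      have lower: "\<forall>\<^sub>F v in nhds u. Im v \<le> 0 \<longrightarrow> \<psi> (cpar v) = a' * exp deck * exp v + b'"
        using 3 4
      proof eventually_elim
        case (elim v)
        thus ?case using W'(4)[of "v + deck"] cpar_deck[of v 1]
          by (auto simp: exp_add mult_ac)
      qed
      have upper: "\<forall>\<^sub>F v in nhds u. 0 \<le> Im v \<longrightarrow> \<psi> (cpar v) = a * exp v + b"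
        using 1 2 by eventually_elim (use W in auto)
      from eventually_conj[OF lower upper]
      obtain d where d: "d > 0" "\<And>v. dist v u < d \<Longrightarrow> (Im v \<le> 0 \<longrightarrow> \<psi> (cpar v) = a' * exp deck * exp v + b')
        \<and> (0 \<le> Im v \<longrightarrow> \<psi> (cpar v) = a * exp v + b)"
        unfolding eventually_nhds_metric by blast
      \<comment> \<open>On the real line through \<open>u\<close> both one-sided formulas apply; two
        points with different exponentials suffice to compare them.\<close>
      have agree: "a' * exp deck * exp (u + of_real t) + b' = a * exp (u + of_real t) + b" if "\<bar>t\<bar> < d" for t
      proof -
        have "dist (u + of_real t) u < d" "Im (u + of_real t) = 0" using that True by (simp_all add: dist_norm)
        thus ?thesis using d(2)[of "u + of_real t"] by (metis order_refl)
      qed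
      have "a' * exp deck * exp u + b' = a * exp u + b" using agree[of 0] d(1) by simp
      moreover have "a' * exp deck * exp (u + of_real (d/2)) + b' = a * exp (u + of_real (d/2)) + b"
        using agree[of "d/2"] d(1) by simp
      moreover have "(a' * exp deck - a) * (exp (u + of_real (d/2)) - exp u) =
        (a' * exp deck * exp (u + of_real (d/2)) + b' - (a * exp (u + of_real (d/2)) + b)) -
        (a' * exp deck * exp u + b' - (a * exp u + b))"
        by (simp add: algebra_simps)
      ultimately have "(a' * exp deck - a) * (exp (u + of_real (d/2)) - exp u) = 0" by simp
      moreover have "exp (u + of_real (d/2)) \<noteq> exp u"
      proof
        assume "exp (u + of_real (d/2)) = exp u"
        hence "exp (complex_of_real (d/2)) = 1" by (simp add: exp_add)
        hence "exp (d/2) = 1" by (metis Re_complex_of_real exp_of_real of_real_1)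
        thus False using d(1) by simp
      qed
      ultimately have a: "a' * exp deck = a" by simp
      hence b: "b' = b" using agree[of 0] d(1) by simp
      have "\<forall>\<^sub>F v in nhds u. \<psi> (cpar v) = a * exp v + b"
        using lower upper by eventually_elim (metis a b linear)
      thus ?thesis using W(1) by blast
    qed
  qed
  then obtain a b where ab: "a \<noteq> 0" "\<forall>\<^sub>F v in nhds (w + of_int k * deck). \<psi> (cpar v) = a * exp v + b"
    unfolding u_def by blast
  have "\<forall>\<^sub>F v in nhds w. \<psi> (cpar (v + of_int k * deck)) = a * exp (v + of_int k * deck) + b"
    using nhds_transport[where g="\<lambda>v. v + of_int k * deck" and w=w, OF ab(2)]
    by (simp add: continuous_intros)
  hence "\<forall>\<^sub>F v in nhds w. \<psi> (cpar v) = (a * exp (of_int k * deck)) * exp v + b"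
    by (simp add: exp_add mult_ac)
  thus ?thesis using that ab(1) by (metis exp_not_eq_zero no_zero_divisors)
qed

end

context affine_surface
begin

text \<open>This is the interface to singularities: angle and dilation ratio survive only as the
  slope \<open>\<kappa>\<close> of the level function and the deck translation
  \<open>\<tau>\<close>. The sublevels of \<open>Re w + \<kappa> * Im w\<close>, completed by
  \<open>y\<close>, form a neighbourhood basis of \<open>y\<close>.\<close>

lemma conical_parametrization:
  assumes y: "y \<in> \<Lambda>"
  obtains P :: "complex \<Rightarrow> 'a" and \<kappa> L :: real and \<tau> :: complex where
    "\<And>w. Re w + \<kappa> * Im w < L \<Longrightarrow> afm_at exp P w"
    "Re \<tau> + \<kappa> * Im \<tau> = 0"
    "\<And>w w'. Re w + \<kappa> * Im w < L \<Longrightarrow> Re w' + \<kappa> * Im w' < L \<Longrightarrow> P w = P w' \<Longrightarrow> \<exists>k::int. w' = w + of_int k * \<tau>"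
    "\<And>w k. P (w + of_int k * \<tau>) = P w"
    "\<And>L'. L' \<le> L \<Longrightarrow> openin X (insert y (P ` {w. Re w + \<kappa> * Im w < L'}))"
    "\<And>W. openin X W \<Longrightarrow> y \<in> W \<Longrightarrow> \<exists>L'\<le>L. P ` {w. Re w + \<kappa> * Im w < L'} \<subseteq> W"
proof -
  have "conical_singularity X \<Lambda> \<A> y" using surface y by (auto simp: branched_affine_surface_def)
  then obtain \<theta> \<rho> U V h where \<theta>\<rho>: "\<theta> > 0" "\<rho> > 0" and U: "openin X U" "U \<inter> \<Lambda> = {y}"
    and V: "openin (cone_space \<theta> \<rho>) V"
    and h: "homeomorphic_map (subtopology X U) (subtopology (cone_space \<theta> \<rho>) V) h"
    and hy: "h y = cone_apex \<theta> \<rho>"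
    and iso: "affine_isomorphism (subtopology X (U - {y})) \<A>
          (subtopology (cone_space \<theta> \<rho>) (V - {cone_apex \<theta> \<rho>})) (cone_atlas \<theta> \<rho>) h"
    unfolding conical_singularity_def by blast
  interpret cone_model \<theta> \<rho> using \<theta>\<rho> by unfold_locales
  let ?Z = "cone_space \<theta> \<rho>" and ?ap = "cone_apex \<theta> \<rho>"
  have tU: "topspace (subtopology X U) = U" using openin_subset[OF U(1)] by auto
  have tV: "topspace (subtopology ?Z V) = V" using openin_subset[OF V] by auto
  have hinj: "inj_on h U" using homeomorphic_imp_injective_map[OF h] tU by simp
  have hUV: "h ` U = V" using homeomorphic_imp_surjective_map[OF h] tU tV by simp
  have yU: "y \<in> U" using U by blast
  have apV: "?ap \<in> V" using hUV hy yU by blast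
  have h_open: "openin ?Z (h ` W)" if "openin X W" "W \<subseteq> U" for W
    using homeomorphic_imp_open_map[OF h] that openin_open_subtopology[OF U(1)] openin_open_subtopology[OF V]
    unfolding open_map_def by blast
  have h_cont: "openin X {x \<in> U. h x \<in> W}" if "openin ?Z W" for W
  proof -
    have "openin (subtopology ?Z V) (V \<inter> W)" using V that by (simp add: openin_open_subtopology openin_Int)
    from openin_continuous_map_preimage[OF homeomorphic_imp_continuous_map[OF h] this]
    have "openin (subtopology X U) {x \<in> topspace (subtopology X U). h x \<in> V \<inter> W}" .
    moreover have "{x \<in> topspace (subtopology X U). h x \<in> V \<inter> W} = {x \<in> U. h x \<in> W}"
      using hUV unfolding tU by blast
    ultimately show ?thesis using openin_open_subtopology[OF U(1)] by simp
  qed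
  define P where "P = (\<lambda>w. inv_into U h (cpar w))"
  obtain L where L: "cpar ` {w. lev w < L} \<subseteq> V" using levels_basis[OF V apV] by blast
  have P: "P w \<in> U" "h (P w) = cpar w" "P w \<noteq> y" if "lev w < L" for w
  proof -
    have "cpar w \<in> h ` U" using L that hUV by blast
    thus "P w \<in> U" "h (P w) = cpar w" by (simp_all add: P_def inv_into_into f_inv_into_f)
    thus "P w \<noteq> y" using hy cpar_ne_apex by metis
  qed
  have P_ev: "\<forall>\<^sub>F v in nhds w. P v \<in> W" if "lev w < L" "openin X W" "P w \<in> W" for w W
  proof -
    have "open (cpar -` (h ` (U \<inter> W)))" by (intro cpar_open_vimage h_open) (use U that in auto)
    moreover have "w \<in> cpar -` (h ` (U \<inter> W))" using P[OF that(1)] that(3) by (auto simp: image_iff intro!: bexI[of _ "P w"])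
    ultimately have "\<forall>\<^sub>F v in nhds w. v \<in> cpar -` (h ` (U \<inter> W))" by (rule eventually_nhds_in_open)
    moreover have "\<forall>\<^sub>F v in nhds w. lev v < L"
      using isCont_lev[of w] that(1) by (intro order_tendstoD(2)) (auto simp: isCont_def tendsto_at_iff_tendsto_nhds)
    ultimately show ?thesis
    proof eventually_elim
      case (elim v)
      then obtain x where x: "x \<in> U" "x \<in> W" "cpar v = h x" by auto
      hence "P v = x" using P[of v] elim(2) hinj by (metis inj_onD)
      thus ?case using x by simp
    qed
  qed
  show ?thesis
  proof (rule that[of "ln \<rho> / \<theta>" L P deck])
    show "afm_at exp P w" if "Re w + ln \<rho> / \<theta> * Im w < L" for w
    proof -
      have w: "lev w < L" using that by (simp add: lev_def)
      note Pw = P[OF w]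
      have imm: "affine_immersion (subtopology X (U - {y})) \<A>
          (subtopology ?Z (V - {?ap})) (cone_atlas \<theta> \<rho>) h"
        using iso by (simp add: affine_isomorphism_def)
      have "P w \<in> topspace (subtopology X (U - {y}))" using Pw openin_subset[OF U(1)] by auto
      then obtain \<psi> where \<psi>: "affine_chart_at (subtopology ?Z (V - {?ap})) (cone_atlas \<theta> \<rho>) (h (P w)) \<psi>"
        "affine_chart_at (subtopology X (U - {y})) \<A> (P w) (\<psi> \<circ> h)"
        using imm unfolding affine_immersion_def by blast
      from \<psi>(1) obtain V1 \<psi>1 a1 b1 W1 where 1: "(V1, \<psi>1) \<in> cone_atlas \<theta> \<rho>" "a1 \<noteq> 0"
         "openin (subtopology ?Z (V - {?ap})) W1" "h (P w) \<in> W1" "W1 \<subseteq> V1" "\<And>y. y \<in> W1 \<Longrightarrow> \<psi> y = a1 * \<psi>1 y + b1"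
        unfolding affine_chart_at_def by blast
      from \<psi>(2) obtain U0 \<psi>0 a0 b0 W0 where 0: "(U0, \<psi>0) \<in> \<A>" "a0 \<noteq> 0"
         "openin (subtopology X (U - {y})) W0" "P w \<in> W0" "W0 \<subseteq> U0" "\<And>x. x \<in> W0 \<Longrightarrow> \<psi> (h x) = a0 * \<psi>0 x + b0"
        unfolding affine_chart_at_def by auto
      obtain T0 where T0: "openin X T0" "W0 = T0 \<inter> (U - {y})" using 0(3) by (auto simp: openin_subtopology)
      obtain T1 where T1: "openin ?Z T1" "W1 = T1 \<inter> (V - {?ap})" using 1(3) by (auto simp: openin_subtopology)
      have "openin X {x \<in> U. h x \<in> T1}" by (rule h_cont[OF T1(1)])
      hence e1: "\<forall>\<^sub>F v in nhds w. P v \<in> T0 \<inter> {x \<in> U. h x \<in> T1}"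
        using P_ev[OF w, of "T0 \<inter> {x \<in> U. h x \<in> T1}"] T0 T1 0(4) 1(4) Pw by auto
      have e2: "\<forall>\<^sub>F v in nhds w. lev v < L"
        using isCont_lev[of w] w by (intro order_tendstoD(2)) (auto simp: isCont_def tendsto_at_iff_tendsto_nhds)
      have "cpar w \<in> V1" using 1(4,5) Pw by auto
      then obtain a b where ab: "a \<noteq> 0" "\<forall>\<^sub>F v in nhds w. \<psi>1 (cpar v) = a * exp v + b"
        using cone_atlas_cpar[OF 1(1)] by blast
      have "\<forall>\<^sub>F v in nhds w. P v \<in> U0 \<and> \<psi>0 (P v) = (a1 * a / a0) * exp v + (a1 * b + b1 - b0) / a0"
        using e1 e2 ab(2)
      proof eventually_elim
        case (elim v)
        note Pv = P[OF elim(2)]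
        have "P v \<in> W0" "cpar v \<in> W1" using elim Pv T0 T1 hUV cpar_ne_apex by auto
        hence "\<psi> (cpar v) = a0 * \<psi>0 (P v) + b0" "\<psi> (cpar v) = a1 * (a * exp v + b) + b1" "P v \<in> U0"
          using 0(5) 0(6)[of "P v"] 1(6)[of "cpar v"] Pv elim(3) by auto
        hence "a0 * \<psi>0 (P v) + b0 = a1 * (a * exp v + b) + b1" "P v \<in> U0" by simp_all
        thus ?case using 0(2) by (auto simp: field_simps)
      qed
      thus ?thesis by (rule afm_atI[OF 0(1), rotated]) (use ab(1) 0(2) 1(2) in simp)
    qed
    show "Re deck + ln \<rho> / \<theta> * Im deck = 0" using \<theta>_pos by simp
    show "\<exists>k::int. w' = w + of_int k * deck"
      if "Re w + ln \<rho> / \<theta> * Im w < L" "Re w' + ln \<rho> / \<theta> * Im w' < L" "P w = P w'" for w w'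
      using that P[of w] P[of w'] cpar_eqD unfolding lev_def by metis
    show "P (w + of_int k * deck) = P w" for w k by (simp add: P_def)
    have img: "insert y (P ` {w. lev w < L'}) = {x \<in> U. h x \<in> insert ?ap (cpar ` {w. lev w < L'})}" if "L' \<le> L" for L'
    proof (intro set_eqI iffI)
      fix x assume "x \<in> insert y (P ` {w. lev w < L'})"
      thus "x \<in> {x \<in> U. h x \<in> insert ?ap (cpar ` {w. lev w < L'})}"
        using yU hy P that by fastforce
    next
      fix x assume x: "x \<in> {x \<in> U. h x \<in> insert ?ap (cpar ` {w. lev w < L'})}"
      then consider "h x = h y" | w where "lev w < L'" "h x = cpar w" using hy by auto
      thus "x \<in> insert y (P ` {w. lev w < L'})"
      proof cases
        case 1
        thus ?thesis using x yU hinj by (auto dest: inj_onD)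
      next
        case (2 w)
        hence "P w = x" using P[of w] x that inj_onD[OF hinj] by auto
        thus ?thesis using 2(1) by auto
      qed
    qed
    show "openin X (insert y (P ` {w. Re w + ln \<rho> / \<theta> * Im w < L'}))" if "L' \<le> L" for L'
      using h_cont[OF openin_levels[of L']] img[OF that] by (simp add: lev_def)
    show "\<exists>L'\<le>L. P ` {w. Re w + ln \<rho> / \<theta> * Im w < L'} \<subseteq> W" if W: "openin X W" "y \<in> W" for W
    proof -
      have "openin ?Z (h ` (U \<inter> W))" "?ap \<in> h ` (U \<inter> W)"
        using W U yU hy by (auto intro!: h_open)
      then obtain L1 where L1: "cpar ` {w. lev w < L1} \<subseteq> h ` (U \<inter> W)" using levels_basis by blast
      have "P w \<in> W" if "lev w < min L L1" for w
      proof -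
        have "cpar w \<in> h ` (U \<inter> W)" using L1 that by auto
        then obtain x where "x \<in> U" "x \<in> W" "h x = cpar w" by auto
        hence "P w = x" using P[of w] that inj_onD[OF hinj] by auto
        thus ?thesis using \<open>x \<in> W\<close> by simp
      qed
      hence "P ` {w. Re w + ln \<rho> / \<theta> * Im w < min L L1} \<subseteq> W" by (auto simp: lev_def)
      thus ?thesis by (intro exI[of _ "min L L1"]) auto
    qed
  qed
qed

end

section \<open>Cone charts, escaping rays and boundary points\<close>

lemma isCont_nhds: "isCont g w \<Longrightarrow> (g \<longlongrightarrow> g w) (nhds w)"
  by (simp add: isCont_def tendsto_at_iff_tendsto_nhds)

context affine_surface
begin

lemma afm_at_param:
  assumes d: "developing d" and F: "afm_at d F w" and E: "afm_at (\<lambda>z. z) E e" and eq: "F w = E e"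
  obtains A where "A \<noteq> 0" "\<forall>\<^sub>F v in nhds w. F v = E (A * (d v - d w) + e)"
proof -
  obtain A B where AB: "A \<noteq> 0" "e = A * d w + B"
    "\<forall>\<^sub>F p in nhds w \<times>\<^sub>F nhds e. F (fst p) = E (snd p) \<longleftrightarrow> A * d (fst p) + B = snd p"
    by (rule transition[OF d developing_simps(1) F E eq])
  define g where "g = (\<lambda>v. A * (d v - d w) + e)"
  have g: "g w = e" "isCont g w" unfolding g_def using developing_isCont[OF d] by (auto intro!: continuous_intros)
  have "\<forall>\<^sub>F v in nhds w. F v = E (g v) \<longleftrightarrow> A * d v + B = g v"
    by (rule eventually_nhds_prod_along[where P="\<lambda>v x. F v = E x \<longleftrightarrow> A * d v + B = x"]) (use AB(3) g in auto)
  hence "\<forall>\<^sub>F v in nhds w. F v = E (g v)"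
    by eventually_elim (use AB(2) in \<open>simp add: g_def algebra_simps\<close>)
  thus ?thesis using that AB(1) by (simp add: g_def)
qed

definition cone_chart :: "'a \<Rightarrow> (complex \<Rightarrow> 'a) \<Rightarrow> real \<Rightarrow> complex \<Rightarrow> real \<Rightarrow> bool" where
  "cone_chart y P \<kappa> \<tau> L \<longleftrightarrow>
    (\<forall>w. Re w + \<kappa> * Im w < L \<longrightarrow> afm_at exp P w) \<and> Re \<tau> + \<kappa> * Im \<tau> = 0 \<and>
    (\<forall>w w'. Re w + \<kappa> * Im w < L \<longrightarrow> Re w' + \<kappa> * Im w' < L \<longrightarrow> P w = P w' \<longrightarrow> (\<exists>k::int. w' = w + of_int k * \<tau>)) \<and>
    (\<forall>w k. P (w + of_int k * \<tau>) = P w) \<and>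
    (\<forall>L'\<le>L. openin X (insert y (P ` {w. Re w + \<kappa> * Im w < L'}))) \<and>
    (\<forall>W. openin X W \<longrightarrow> y \<in> W \<longrightarrow> (\<exists>L'\<le>L. P ` {w. Re w + \<kappa> * Im w < L'} \<subseteq> W))"

lemma cone_chartD:
  assumes "cone_chart y P \<kappa> \<tau> L"
  shows "\<forall>w. Re w + \<kappa> * Im w < L \<longrightarrow> afm_at exp P w" "Re \<tau> + \<kappa> * Im \<tau> = 0"
    "\<forall>w w'. Re w + \<kappa> * Im w < L \<longrightarrow> Re w' + \<kappa> * Im w' < L \<longrightarrow> P w = P w' \<longrightarrow> (\<exists>k::int. w' = w + of_int k * \<tau>)"
    "\<forall>w k. P (w + of_int k * \<tau>) = P w"
    "\<forall>L'\<le>L. openin X (insert y (P ` {w. Re w + \<kappa> * Im w < L'}))"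
    "\<forall>W. openin X W \<longrightarrow> y \<in> W \<longrightarrow> (\<exists>L'\<le>L. P ` {w. Re w + \<kappa> * Im w < L'} \<subseteq> W)"
  using assms unfolding cone_chart_def by - ((elim conjE, assumption)+)

lemma cone_chart_exists:
  assumes "y \<in> \<Lambda>"
  shows "\<exists>P \<kappa> \<tau> L. cone_chart y P \<kappa> \<tau> L"
proof (rule conical_parametrization[OF assms])
  fix P :: "complex \<Rightarrow> 'a" and \<kappa> L :: real and \<tau> :: complex
  assume *: "\<And>w. Re w + \<kappa> * Im w < L \<Longrightarrow> afm_at exp P w" "Re \<tau> + \<kappa> * Im \<tau> = 0"
    "\<And>w w'. Re w + \<kappa> * Im w < L \<Longrightarrow> Re w' + \<kappa> * Im w' < L \<Longrightarrow> P w = P w' \<Longrightarrow> \<exists>k::int. w' = w + of_int k * \<tau>"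
    "\<And>w k. P (w + of_int k * \<tau>) = P w"
    "\<And>L'. L' \<le> L \<Longrightarrow> openin X (insert y (P ` {w. Re w + \<kappa> * Im w < L'}))"
    "\<And>W. openin X W \<Longrightarrow> y \<in> W \<Longrightarrow> \<exists>L'\<le>L. P ` {w. Re w + \<kappa> * Im w < L'} \<subseteq> W"
  have "cone_chart y P \<kappa> \<tau> L" unfolding cone_chart_def
    by (intro conjI allI impI) (rule *; assumption)+
  thus ?thesis by blast
qed

lemma cone_chart_mono:
  assumes c: "cone_chart y P \<kappa> \<tau> L" and L: "L' \<le> L"
  shows "cone_chart y P \<kappa> \<tau> L'"
proof -
  have "\<exists>l\<le>L'. P ` {w. Re w + \<kappa> * Im w < l} \<subseteq> W" if W: "openin X W" "y \<in> W" for W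
  proof -
    obtain l where l: "P ` {w. Re w + \<kappa> * Im w < l} \<subseteq> W"
      using cone_chartD(6)[OF c] W by meson
    hence "P ` {w. Re w + \<kappa> * Im w < min l L'} \<subseteq> W" by auto
    thus ?thesis by (intro exI[of _ "min l L'"]) auto
  qed
  thus ?thesis unfolding cone_chart_def
    using cone_chartD[OF c] L by (intro conjI allI impI) simp_all
qed

text \<open>Disjointness is what ties a connected set near the singularities to a single one of
  them. Shrinking the level is harmless by \<open>cone_chart_mono\<close>.\<close>

lemma cone_charts_disjoint:
  obtains P \<kappa> \<tau> L where "\<And>y. y \<in> \<Lambda> \<Longrightarrow> cone_chart y (P y) (\<kappa> y) (\<tau> y) (L y)"
    "\<And>y y'. y \<in> \<Lambda> \<Longrightarrow> y' \<in> \<Lambda> \<Longrightarrow> y \<noteq> y' \<Longrightarrow>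
       insert y (P y ` {w. Re w + \<kappa> y * Im w < L y}) \<inter> insert y' (P y' ` {w. Re w + \<kappa> y' * Im w < L y'}) = {}"
proof -
  have "\<forall>y\<in>\<Lambda>. \<exists>P \<kappa> \<tau> L. cone_chart y P \<kappa> \<tau> L" using cone_chart_exists by blast
  then obtain P \<kappa> \<tau> L where c: "\<And>y. y \<in> \<Lambda> \<Longrightarrow> cone_chart y (P y) (\<kappa> y) (\<tau> y) (L y)" by metis
  have "\<forall>y\<in>\<Lambda>. \<forall>y'\<in>\<Lambda>. y \<noteq> y' \<longrightarrow> (\<exists>A B. openin X A \<and> openin X B \<and> y \<in> A \<and> y' \<in> B \<and> A \<inter> B = {})"
    using Hausdorff_X sing_subset unfolding Hausdorff_space_def disjnt_def by blast
  then obtain A B where AB: "\<And>y y'. y \<in> \<Lambda> \<Longrightarrow> y' \<in> \<Lambda> \<Longrightarrow> y \<noteq> y' \<Longrightarrow>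
      openin X (A y y') \<and> openin X (B y y') \<and> y \<in> A y y' \<and> y' \<in> B y y' \<and> A y y' \<inter> B y y' = {}"
    by metis
  define W where "W y = topspace X \<inter> (\<Inter>y'\<in>\<Lambda> - {y}. A y y' \<inter> B y' y)" for y
  have W: "openin X (W y) \<and> y \<in> W y" if "y \<in> \<Lambda>" for y
  proof -
    have "openin X (W y)"
    proof (cases "\<Lambda> - {y} = {}")
      case False
      have "openin X (\<Inter>y'\<in>\<Lambda> - {y}. A y y' \<inter> B y' y)"
        using finite_sing False AB that by (intro openin_INT2) auto
      thus ?thesis unfolding W_def by blast
    qed (unfold W_def, simp only: INT_empty, simp)
    thus ?thesis using AB that sing_subset unfolding W_def by auto
  qed
  have "\<forall>y\<in>\<Lambda>. \<exists>l. l \<le> L y \<and> P y ` {w. Re w + \<kappa> y * Im w < l} \<subseteq> W y"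
  proof
    fix y assume y: "y \<in> \<Lambda>"
    show "\<exists>l\<le>L y. P y ` {w. Re w + \<kappa> y * Im w < l} \<subseteq> W y"
      using cone_chartD(6)[OF c[OF y]] W[OF y] by meson
  qed
  then obtain l where l: "\<And>y. y \<in> \<Lambda> \<Longrightarrow> l y \<le> L y \<and> P y ` {w. Re w + \<kappa> y * Im w < l y} \<subseteq> W y" by metis
  show ?thesis
  proof (rule that[of P \<kappa> \<tau> l])
    show "cone_chart y (P y) (\<kappa> y) (\<tau> y) (l y)" if "y \<in> \<Lambda>" for y
      using cone_chart_mono c l that by blast
    show "insert y (P y ` {w. Re w + \<kappa> y * Im w < l y}) \<inter> insert y' (P y' ` {w. Re w + \<kappa> y' * Im w < l y'}) = {}"
      if "y \<in> \<Lambda>" "y' \<in> \<Lambda>" "y \<noteq> y'" for y y'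
    proof -
      have "insert y (P y ` {w. Re w + \<kappa> y * Im w < l y}) \<subseteq> W y" "insert y' (P y' ` {w. Re w + \<kappa> y' * Im w < l y'}) \<subseteq> W y'"
        using l[OF that(1)] l[OF that(2)] W[OF that(1)] W[OF that(2)] by auto
      moreover have "A y y' \<inter> B y y' = {}" using AB[OF that] by simp
      moreover have "W y \<subseteq> A y y'" "W y' \<subseteq> B y y'" using that unfolding W_def by auto
      ultimately show ?thesis by blast
    qed
  qed
qed

end

section \<open>The thick part, lifts near a singularity, and escaping rays\<close>

locale charted_surface = affine_surface X \<Lambda> \<A>
  for X :: "'a topology" and \<Lambda> :: "'a set" and \<A> :: "'a atlas" +
  fixes cP :: "'a \<Rightarrow> complex \<Rightarrow> 'a" and c\<kappa> :: "'a \<Rightarrow> real" and c\<tau> :: "'a \<Rightarrow> complex" and cL :: "'a \<Rightarrow> real"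
  assumes cone_chart: "y \<in> \<Lambda> \<Longrightarrow> cone_chart y (cP y) (c\<kappa> y) (c\<tau> y) (cL y)"
    and cone_chart_disjoint: "y \<in> \<Lambda> \<Longrightarrow> y' \<in> \<Lambda> \<Longrightarrow> y \<noteq> y' \<Longrightarrow>
       insert y (cP y ` {w. Re w + c\<kappa> y * Im w < cL y}) \<inter> insert y' (cP y' ` {w. Re w + c\<kappa> y' * Im w < cL y'}) = {}"
begin

abbreviation "lv y w \<equiv> Re w + c\<kappa> y * Im w"

definition "nb y l = insert y (cP y ` {w. lv y w < l})"

text \<open>The neighbourhoods are removed only up to level \<open>cL y - 1\<close>. The margin
  keeps limits of points outside \<open>thick\<close> strictly inside the domain of the cone
  chart.\<close>

definition "thick = topspace X - (\<Union>y\<in>\<Lambda>. nb y (cL y - 1))"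

lemma cP_afm: "y \<in> \<Lambda> \<Longrightarrow> lv y w < cL y \<Longrightarrow> afm_at exp (cP y) w"
  using cone_chartD(1)[OF cone_chart] by blast

lemma cP_eqD: "y \<in> \<Lambda> \<Longrightarrow> lv y w < cL y \<Longrightarrow> lv y w' < cL y \<Longrightarrow> cP y w = cP y w' \<Longrightarrow> \<exists>k::int. w' = w + of_int k * c\<tau> y"
  using cone_chartD(3)[OF cone_chart] by blast

lemma cP_period: "y \<in> \<Lambda> \<Longrightarrow> cP y (w + of_int k * c\<tau> y) = cP y w"
  using cone_chartD(4)[OF cone_chart] by blast

lemma lv_period: "y \<in> \<Lambda> \<Longrightarrow> lv y (w + of_int k * c\<tau> y) = lv y w"
proof -
  assume "y \<in> \<Lambda>"
  hence "Re (c\<tau> y) + c\<kappa> y * Im (c\<tau> y) = 0" using cone_chartD(2)[OF cone_chart] by blast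
  hence "of_int k * (Re (c\<tau> y) + c\<kappa> y * Im (c\<tau> y)) = 0" by simp
  thus ?thesis by (simp add: algebra_simps)
qed

lemma nb_open: "y \<in> \<Lambda> \<Longrightarrow> l \<le> cL y \<Longrightarrow> openin X (nb y l)"
  using cone_chartD(5)[OF cone_chart] unfolding nb_def by blast

lemma nb_basis: "y \<in> \<Lambda> \<Longrightarrow> openin X W \<Longrightarrow> y \<in> W \<Longrightarrow> \<exists>l\<le>cL y. cP y ` {w. lv y w < l} \<subseteq> W"
  using cone_chartD(6)[OF cone_chart] by blast

lemma thick_compact: "compactin X thick" and thick_subset: "thick \<subseteq> M"
proof -
  have "openin X (\<Union>y\<in>\<Lambda>. nb y (cL y - 1))" using nb_open by (intro openin_Union) auto
  hence "closedin X thick" unfolding thick_def by (simp add: closedin_diff)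
  thus "compactin X thick" using compact_X closedin_compact_space by blast
  show "thick \<subseteq> M" unfolding thick_def nb_def by blast
qed

text \<open>Points of the compact set \<open>thick\<close> cluster at a regular point, around which
  a unit disc is embedded; every smaller concentric disc is visited infinitely often.\<close>

lemma regular_cluster:
  assumes "infinite N" "\<And>n. n \<in> N \<Longrightarrow> g n \<in> thick"
  obtains E where "\<And>e. e \<in> ball 0 1 \<Longrightarrow> afm_at (\<lambda>z. z) E e" "inj_on E (ball 0 1)"
    "\<And>r. 0 < r \<Longrightarrow> r \<le> 1 \<Longrightarrow> infinite {n \<in> N. g n \<in> E ` ball 0 r}"
proof -
  obtain y where y: "y \<in> thick" "\<And>U. openin X U \<Longrightarrow> y \<in> U \<Longrightarrow> infinite {n \<in> N. g n \<in> U}"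
    using compact_space_cluster[of X thick N g, OF thick_compact assms] by metis
  hence "y \<in> M" using thick_subset by blast
  then obtain E where E: "\<And>e. e \<in> ball 0 1 \<Longrightarrow> afm_at (\<lambda>z. z) E e" "inj_on E (ball 0 1)" "E 0 = y"
    by (erule chart_disc)
  have "infinite {n \<in> N. g n \<in> E ` ball 0 r}" if "0 < r" "r \<le> 1" for r
  proof (rule y(2))
    show "openin X (E ` ball 0 r)"
      using that by (intro afm_open_image[OF developing_simps(1)] E(1)) auto
    show "y \<in> E ` ball 0 r" using E(3) that by (intro image_eqI[of _ _ 0]) auto
  qed
  thus ?thesis using that E by blast
qed

lemma cP_Ln_afm:
  assumes "y \<in> \<Lambda>" "u \<noteq> 0" "(z - q) / u \<notin> \<real>\<^sub>\<le>\<^sub>0" "lv y (c + Ln ((z - q) / u)) < cL y"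
  shows "afm_at (\<lambda>z. z) (\<lambda>z. cP y (c + Ln ((z - q) / u))) z"
proof (rule afm_at_comp[where d=exp])
  show "afm_at exp (cP y) (c + Ln ((z - q) / u))" using cP_afm assms by blast
  show "isCont (\<lambda>z. c + Ln ((z - q) / u)) z" using assms by (intro continuous_intros) auto
  have "z \<noteq> q" using assms(3) by auto
  hence "\<forall>\<^sub>F v in nhds z. v \<noteq> q" by (simp add: t1_space_nhds)
  thus "\<forall>\<^sub>F v in nhds z. exp (c + Ln ((v - q) / u)) = (exp c / u) * v + - (exp c / u * q)"
    by eventually_elim (use assms(2) in \<open>simp add: exp_add field_simps\<close>)
qed (use assms in auto)

text \<open>The image of \<open>D\<close> is connected and covered by disjoint open neighbourhoods
  of the singularities, hence lies in one of them; it misses the singularity itself because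
  immersions take regular values.\<close>

lemma connected_in_cone:
  assumes D: "connected D" "D \<noteq> {}" and d: "developing d"
    and F: "\<And>z. z \<in> D \<Longrightarrow> afm_at d F z" and nt: "\<And>z. z \<in> D \<Longrightarrow> F z \<notin> thick"
  obtains y where "y \<in> \<Lambda>" "\<And>z. z \<in> D \<Longrightarrow> F z \<in> cP y ` {w. lv y w < cL y - 1}"
proof -
  have "continuous_map (top_of_set D) X F" by (rule afm_at_continuous_map[OF d F])
  hence conn: "connectedin X (F ` D)"
    by (rule connectedin_continuous_map_image) (simp add: connectedin_subtopology D(1))
  have cov: "\<exists>y\<in>\<Lambda>. F z \<in> nb y (cL y - 1)" if "z \<in> D" for z
    using nt[OF that] afm_at_in_M[OF F[OF that]] unfolding thick_def by blast
  obtain z0 where z0: "z0 \<in> D" using D(2) by blast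
  obtain y where y: "y \<in> \<Lambda>" "F z0 \<in> nb y (cL y - 1)" using cov z0 by blast
  define V where "V = (\<Union>y'\<in>\<Lambda> - {y}. nb y' (cL y' - 1))"
  have V1: "openin X V" unfolding V_def using nb_open by (intro openin_Union) auto
  have V2: "openin X (nb y (cL y - 1))" using nb_open y by auto
  have V3: "F ` D \<subseteq> nb y (cL y - 1) \<union> V" using cov unfolding V_def by blast
  have V4: "nb y (cL y - 1) \<inter> V \<inter> F ` D = {}"
  proof -
    have "nb y (cL y - 1) \<inter> nb y' (cL y' - 1) = {}" if "y' \<in> \<Lambda> - {y}" for y'
    proof -
      have "nb v (cL v - 1) \<subseteq> insert v (cP v ` {w. lv v w < cL v})" for v by (auto simp: nb_def)
      from Int_mono[OF this[of y] this[of y']]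
      have "nb y (cL y - 1) \<inter> nb y' (cL y' - 1) \<subseteq>
        insert y (cP y ` {w. lv y w < cL y}) \<inter> insert y' (cP y' ` {w. lv y' w < cL y'})" .
      also have "\<dots> = {}" by (rule cone_chart_disjoint[OF y(1)]) (use that in auto)
      finally show ?thesis by (rule subset_empty[THEN iffD1])
    qed
    thus ?thesis unfolding V_def by blast
  qed
  have "nb y (cL y - 1) \<inter> F ` D = {} \<or> V \<inter> F ` D = {}"
  proof (rule ccontr)
    assume "\<not> ?thesis"
    hence "nb y (cL y - 1) \<inter> F ` D \<noteq> {}" "V \<inter> F ` D \<noteq> {}" by simp_all
    hence "\<exists>E1 E2. openin X E1 \<and> openin X E2 \<and> F ` D \<subseteq> E1 \<union> E2 \<and> E1 \<inter> E2 \<inter> F ` D = {} \<and>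
      E1 \<inter> F ` D \<noteq> {} \<and> E2 \<inter> F ` D \<noteq> {}"
      by (intro exI[of _ "nb y (cL y - 1)"] exI[of _ V] conjI V1 V2 V3 V4)
    thus False using conn unfolding connectedin by (elim conjE notE)
  qed
  hence "V \<inter> F ` D = {}" using y z0 by blast
  hence "F z \<in> nb y (cL y - 1)" if "z \<in> D" for z using cov[OF that] that unfolding V_def by blast
  moreover have "F z \<noteq> y" if "z \<in> D" for z using afm_at_in_M[OF F[OF that]] y by blast
  ultimately show ?thesis using that[OF y(1)] unfolding nb_def by blast
qed

text \<open>
  The apex of the cone, read in the affine coordinate \<open>z\<close> of \<open>F\<close>, is a point \<open>q\<close> that is locally
  constant along \<open>F\<close>; hence a lift to the logarithmic coordinate is a branch of \<open>log (z - q)\<close>.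
\<close>

lemma cone_lift:
  assumes y: "y \<in> \<Lambda>" and l: "l \<le> cL y" and D: "convex D" "D \<noteq> {}"
    and F: "\<And>z. z \<in> D \<Longrightarrow> afm_at (\<lambda>z. z) F z" and FP: "\<And>z. z \<in> D \<Longrightarrow> F z \<in> cP y ` {w. lv y w < l}"
  obtains q u c where "u \<noteq> 0" "\<And>z. z \<in> D \<Longrightarrow> z \<noteq> q \<and> 0 \<le> Re ((z - q) / u) \<and>
     lv y (c + Ln ((z - q) / u)) < l \<and> (\<forall>\<^sub>F v in nhds z. F v = cP y (c + Ln ((v - q) / u)))"
proof -
  note conn = convex_connected[OF D(1)]
  define T where "T q u c z \<longleftrightarrow> (z - q) / u \<notin> \<real>\<^sub>\<le>\<^sub>0 \<and> lv y (c + Ln ((z - q) / u)) < l \<and>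
     (\<forall>\<^sub>F v in nhds z. F v = cP y (c + Ln ((v - q) / u)))" for q u c z
  have T_open: "\<forall>\<^sub>F v in nhds z. T q u c v" if "T q u c z" "u \<noteq> 0" for q u c z
  proof -
    have ne: "(z - q) / u \<notin> \<real>\<^sub>\<le>\<^sub>0" using that by (simp add: T_def)
    have c1: "isCont (\<lambda>v. (v - q) / u) z" using that(2) by (intro continuous_intros)
    have "open (- (\<real>\<^sub>\<le>\<^sub>0::complex set))" by (intro open_Compl closed_nonpos_Reals_complex)
    hence "\<forall>\<^sub>F x in nhds ((z - q) / u). x \<in> - \<real>\<^sub>\<le>\<^sub>0" using ne by (intro eventually_nhds_in_open) auto
    hence 1: "\<forall>\<^sub>F v in nhds z. (v - q) / u \<in> - \<real>\<^sub>\<le>\<^sub>0"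
      using nhds_transport[where g="\<lambda>v. (v - q) / u" and w=z] c1 by blast
    have "isCont (\<lambda>v. lv y (c + Ln ((v - q) / u))) z"
      using ne that(2) by (intro continuous_intros) auto
    hence "((\<lambda>v. lv y (c + Ln ((v - q) / u))) \<longlongrightarrow> lv y (c + Ln ((z - q) / u))) (nhds z)"
      by (rule isCont_nhds)
    hence 2: "\<forall>\<^sub>F v in nhds z. lv y (c + Ln ((v - q) / u)) < l"
      by (rule order_tendstoD(2)) (use that in \<open>simp only: T_def\<close>)
    have 3: "\<forall>\<^sub>F v in nhds z. \<forall>\<^sub>F v in nhds v. F v = cP y (c + Ln ((v - q) / u))"
      using that by (simp add: T_def eventually_eventually)
    show ?thesis using 1 2 3 by eventually_elim (auto simp: T_def)
  qed
  have T_val: "F z = cP y (c + Ln ((z - q) / u))" if "T q u c z" for q u c z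
    using that unfolding T_def by (blast dest: eventually_nhds_x_imp_x)
  text \<open>Two lifts through the same point have proportional exponentials.\<close>
  have T_affine: "\<exists>A B. A \<noteq> 0 \<and> (\<forall>q u c. u \<noteq> 0 \<longrightarrow> (z - q) / u \<notin> \<real>\<^sub>\<le>\<^sub>0 \<longrightarrow> w = c + Ln ((z - q) / u) \<longrightarrow>
      (T q u c z \<longleftrightarrow> exp c / u = A \<and> - exp c / u * q = B))"
    if z: "z \<in> D" "lv y w < l" "F z = cP y w" for z w
  proof -
    have "afm_at exp (cP y) w" using cP_afm y z(2) l by auto
    obtain A B where AB: "A \<noteq> 0" "exp w = A * z + B"
      "\<forall>\<^sub>F p in nhds z \<times>\<^sub>F nhds w. F (fst p) = cP y (snd p) \<longleftrightarrow> A * (fst p) + B = exp (snd p)"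
      by (rule transition[where d="\<lambda>z. z" and e=exp and F=F and w=z and G="cP y" and v=w,
          OF developing_simps F[OF z(1)] \<open>afm_at exp (cP y) w\<close> z(3)])
    have "T q u c z \<longleftrightarrow> exp c / u = A \<and> - exp c / u * q = B"
      if q: "u \<noteq> 0" "(z - q) / u \<notin> \<real>\<^sub>\<le>\<^sub>0" "w = c + Ln ((z - q) / u)" for q u c
    proof -
      define g where "g = (\<lambda>v. c + Ln ((v - q) / u))"
      have "isCont g z" unfolding g_def using q by (intro continuous_intros) auto
      hence ev: "\<forall>\<^sub>F v in nhds z. F v = cP y (g v) \<longleftrightarrow> A * v + B = exp (g v)"
        by (intro eventually_nhds_prod_along[where P="\<lambda>v x. F v = cP y x \<longleftrightarrow> A * v + B = exp x"])
          (use AB(3) q in \<open>auto simp: g_def\<close>)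
      have "z \<noteq> q" using q by auto
      hence "\<forall>\<^sub>F v in nhds z. v \<noteq> q" by (simp add: t1_space_nhds)
      hence eg: "\<forall>\<^sub>F v in nhds z. exp (g v) = (exp c / u) * v + - exp c / u * q"
        by eventually_elim (use q(1) in \<open>simp add: g_def exp_add field_simps\<close>)
      have Tg: "T q u c z \<longleftrightarrow> (\<forall>\<^sub>F v in nhds z. F v = cP y (g v))"
        using q z(2) by (simp add: T_def g_def)
      show ?thesis
      proof
        assume "T q u c z"
        hence "\<forall>\<^sub>F v in nhds z. F v = cP y (g v)" using Tg by simp
        with ev eg have "\<forall>\<^sub>F v in nhds z. A * v + B = (exp c / u) * v + - exp c / u * q"
          by eventually_elim auto
        hence "\<forall>\<^sub>F v in nhds z. (A / (exp c / u)) * v + (B + exp c / u * q) / (exp c / u) = v"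
        proof eventually_elim
          case (elim v)
          define \<alpha> where "\<alpha> = exp c / u"
          have "(A / \<alpha>) * v + (B + \<alpha> * q) / \<alpha> = (A * v + B + \<alpha> * q) / \<alpha>"
            by (simp add: add_divide_distrib)
          also have "\<dots> = v" using elim q(1) by (simp add: \<alpha>_def)
          finally show ?case by (simp add: \<alpha>_def)
        qed
        from developing_affine_unique[OF developing_simps(1) this]
        have "A = exp c / u" "B + exp c / u * q = 0" using q(1) by (simp_all add: divide_eq_1_iff eq_divide_eq)
        thus "exp c / u = A \<and> - exp c / u * q = B"
          by (simp add: add_eq_0_iff2)
      next
        assume AB': "exp c / u = A \<and> - exp c / u * q = B"
        from ev eg have "\<forall>\<^sub>F v in nhds z. F v = cP y (g v)" by eventually_elim (simp only: AB'[THEN conjunct1] AB'[THEN conjunct2])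
        thus "T q u c z" using Tg by simp
      qed
    qed
    thus ?thesis using AB(1) by (intro exI[of _ A] exI[of _ B] conjI allI impI)
  qed
  have T_exists: "\<exists>q u c. u \<noteq> 0 \<and> T q u c z" if z: "z \<in> D" for z
  proof -
    obtain w where w: "lv y w < l" "F z = cP y w" using FP[OF z] by auto
    have "afm_at exp (cP y) w" using cP_afm y w(1) l by auto
    obtain A B where AB: "A \<noteq> 0" "exp w = A * z + B"
      "\<forall>\<^sub>F p in nhds z \<times>\<^sub>F nhds w. F (fst p) = cP y (snd p) \<longleftrightarrow> A * (fst p) + B = exp (snd p)"
      by (rule transition[where d="\<lambda>z. z" and e=exp and F=F and w=z and G="cP y" and v=w,
          OF developing_simps F[OF z(1)] \<open>afm_at exp (cP y) w\<close> w(2)])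
    define q where "q = - B / A"
    have ew: "exp w = A * (z - q)" using AB by (simp add: q_def field_simps)
    hence zq: "z - q \<noteq> 0" using exp_not_eq_zero by force
    define g where "g = (\<lambda>v. w + Ln ((v - q) / (z - q)))"
    have gz: "g z = w" using zq by (simp add: g_def)
    have "isCont g z" unfolding g_def using zq by (intro continuous_intros) (auto simp: complex_nonpos_Reals_iff)
    hence ev: "\<forall>\<^sub>F v in nhds z. F v = cP y (g v) \<longleftrightarrow> A * v + B = exp (g v)"
      by (intro eventually_nhds_prod_along[where P="\<lambda>v x. F v = cP y x \<longleftrightarrow> A * v + B = exp x"])
        (use AB(3) gz in auto)
    have "\<forall>\<^sub>F v in nhds z. v \<noteq> q" using zq by (simp add: t1_space_nhds)
    with ev have "\<forall>\<^sub>F v in nhds z. F v = cP y (g v)"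
    proof eventually_elim
      case (elim v)
      have "exp (g v) = A * (v - q)" using elim(2) zq by (simp add: g_def exp_add ew)
      also have "\<dots> = A * v + B" using AB(1) by (simp add: q_def field_simps)
      finally show ?case using elim by simp
    qed
    hence "T q (z - q) w z" using w(1) zq by (simp add: T_def g_def complex_nonpos_Reals_iff)
    thus ?thesis using zq by blast
  qed
  have T_shift: "T q u (c + of_int k * c\<tau> y) z \<longleftrightarrow> T q u c z" for q u c k z
  proof -
    have e: "c + of_int k * c\<tau> y + Ln x = (c + Ln x) + of_int k * c\<tau> y" for x by simp
    show ?thesis unfolding T_def e lv_period[OF y] cP_period[OF y] by (rule refl)
  qed
  have T_same: "\<exists>k::int. c' + Ln ((z - q') / u') = c + Ln ((z - q) / u) + of_int k * c\<tau> y"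
    if "T q u c z" "T q' u' c' z" for q u c q' u' c' z
    using cP_eqD[OF y, of "c + Ln ((z - q) / u)" "c' + Ln ((z - q') / u')"] T_val[OF that(1)] T_val[OF that(2)]
      that l unfolding T_def by auto
  have T_q: "q' = q" if z: "z \<in> D" and T: "T q u c z" "T q' u' c' z" "u \<noteq> 0" "u' \<noteq> 0" for q u c q' u' c' z
  proof -
    obtain k :: int where k: "c' + Ln ((z - q') / u') = c + Ln ((z - q) / u) + of_int k * c\<tau> y"
      using T_same[OF T(1,2)] by blast
    define c1 where "c1 = c' + of_int (- k) * c\<tau> y"
    have T1: "T q' u' c1 z" using T(2) T_shift unfolding c1_def by blast
    have eq: "c + Ln ((z - q) / u) = c1 + Ln ((z - q') / u')" using k by (simp add: c1_def algebra_simps)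
    have lvw: "lv y (c + Ln ((z - q) / u)) < l" using T(1) by (simp add: T_def)
    obtain A B where AB: "A \<noteq> 0" "\<And>q' u' c'. u' \<noteq> 0 \<Longrightarrow> (z - q') / u' \<notin> \<real>\<^sub>\<le>\<^sub>0 \<Longrightarrow> c + Ln ((z - q) / u) = c' + Ln ((z - q') / u') \<Longrightarrow>
      (T q' u' c' z \<longleftrightarrow> exp c' / u' = A \<and> - exp c' / u' * q' = B)"
      using T_affine[OF z lvw T_val[OF T(1)]] by blast
    have 1: "exp c / u = A" "- exp c / u * q = B"
      using AB(2)[of u q c] T by (auto simp: T_def)
    have 2: "exp c1 / u' = A" "- exp c1 / u' * q' = B"
      using AB(2)[of u' q' c1] T1 T(4) eq by (auto simp: T_def)
    have "- exp c / u * q = - (exp c / u) * q" "- exp c1 / u' * q' = - (exp c1 / u') * q'" by simp_all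
    hence "- A * q = B" "- A * q' = B" using 1 2 by metis+
    hence "A * q = A * q'" by (metis neg_equal_iff_equal mult_minus_left)
    thus ?thesis using AB(1) by (metis mult_cancel_left)
  qed
  obtain z0 where z0: "z0 \<in> D" using D(2) by blast
  obtain q u0 c0 where q: "u0 \<noteq> 0" "T q u0 c0 z0" using T_exists[OF z0] by blast
  have const_q: "\<exists>u c. u \<noteq> 0 \<and> T q u c z" if z: "z \<in> D" for z
  proof -
    \<comment> \<open>Separate the points where \<open>q\<close> serves as apex from those where
      another centre does. Both sets are open, and \<open>T_q\<close> makes them disjoint on the
      connected set \<open>D\<close>.\<close>
    let ?A = "{z. \<exists>u c. u \<noteq> 0 \<and> T q u c z}" and ?B = "{z. \<exists>q' u c. q' \<noteq> q \<and> u \<noteq> 0 \<and> T q' u c z}"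
    have "open ?A"
    proof (subst open_subopen, clarify)
      fix x u c assume "u \<noteq> 0" "T q u c x"
      then obtain S where "open S" "x \<in> S" "\<forall>v\<in>S. T q u c v" using T_open[of q u c x] unfolding eventually_nhds by blast
      thus "\<exists>S. open S \<and> x \<in> S \<and> S \<subseteq> ?A" using \<open>u \<noteq> 0\<close> by blast
    qed
    moreover have "open ?B"
    proof (subst open_subopen, clarify)
      fix x q' u c assume *: "q' \<noteq> q" "u \<noteq> 0" "T q' u c x"
      then obtain S where "open S" "x \<in> S" "\<forall>v\<in>S. T q' u c v" using T_open[of q' u c x] unfolding eventually_nhds by blast
      thus "\<exists>S. open S \<and> x \<in> S \<and> S \<subseteq> ?B" using * by blast
    qed
    moreover have "?A \<inter> ?B \<inter> D = {}" using T_q by blast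
    moreover have "D \<subseteq> ?A \<union> ?B"
    proof
      fix z assume "z \<in> D"
      then obtain q' u c where "u \<noteq> 0" "T q' u c z" using T_exists by blast
      thus "z \<in> ?A \<union> ?B" by (cases "q' = q") blast+
    qed
    ultimately have "?A \<inter> D = {} \<or> ?B \<inter> D = {}" using connectedD[OF conn, of ?A ?B] by blast
    hence "?B \<inter> D = {}" using q z0 by blast
    thus ?thesis using \<open>D \<subseteq> ?A \<union> ?B\<close> z by blast
  qed
  have qD: "z \<noteq> q" if "z \<in> D" for z using const_q[OF that] by (auto simp: T_def)
  \<comment> \<open>A convex set missing \<open>q\<close> lies in a closed half plane bounded by a
    line through \<open>q\<close>. Taking \<open>u\<close> as its inner normal keeps the quotient
    off the cut, so one branch of \<open>Ln\<close> serves on all of \<open>D\<close>.\<close>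
  have "convex ((\<lambda>z. - q + z) ` D)" "0 \<notin> (\<lambda>z. - q + z) ` D"
    using D(1) qD by (auto intro: convex_translation simp: add_eq_0_iff2)
  then obtain u where u: "u \<noteq> 0" "\<And>x. x \<in> (\<lambda>z. - q + z) ` D \<Longrightarrow> 0 \<le> inner u x"
    using separating_hyperplane_set_0[of "(\<lambda>z. - q + z) ` D"] by blast
  have Re_u: "0 \<le> Re ((z - q) / u)" if "z \<in> D" for z
  proof -
    have "0 \<le> inner u (- q + z)" using u(2) that by blast
    also have "inner u (- q + z) = Re ((z - q) / u) * (cmod u)\<^sup>2"
    proof -
      have "(z - q) / u = ((z - q) * cnj u) / of_real ((cmod u)\<^sup>2)"
        using complex_div_cnj[of "z - q" u] by simp
      hence "Re ((z - q) / u) = Re ((z - q) * cnj u) / (cmod u)\<^sup>2"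
        by (simp only: Re_divide_of_real)
      hence "Re ((z - q) / u) * (cmod u)\<^sup>2 = Re ((z - q) * cnj u)" using u(1) by simp
      thus ?thesis by (simp add: inner_complex_def algebra_simps)
    qed
    finally show ?thesis using u(1) by (simp add: zero_le_mult_iff)
  qed
  have nonpos: "(z - q) / u \<notin> \<real>\<^sub>\<le>\<^sub>0" if "z \<in> D" for z
  proof
    assume "(z - q) / u \<in> \<real>\<^sub>\<le>\<^sub>0"
    hence "(z - q) / u = 0" using Re_u[OF that] by (auto simp: complex_nonpos_Reals_iff complex_eq_iff)
    thus False using qD[OF that] u(1) by simp
  qed
  have ex_c: "\<exists>c. T q u c z" if z: "z \<in> D" for z
  proof -
    obtain u' c' where u': "u' \<noteq> 0" "T q u' c' z" using const_q[OF z] by blast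
    \<comment> \<open>The constant is adjusted so that replacing \<open>u'\<close> by
      \<open>u\<close> does not change the value of the lift at \<open>z\<close>.\<close>
    define c where "c = c' + Ln ((z - q) / u') - Ln ((z - q) / u)"
    have lvw: "lv y (c' + Ln ((z - q) / u')) < l" using u' by (simp add: T_def)
    obtain A B where AB: "A \<noteq> 0" "\<And>q2 u2 c2. u2 \<noteq> 0 \<Longrightarrow> (z - q2) / u2 \<notin> \<real>\<^sub>\<le>\<^sub>0 \<Longrightarrow> c' + Ln ((z - q) / u') = c2 + Ln ((z - q2) / u2) \<Longrightarrow>
      (T q2 u2 c2 z \<longleftrightarrow> exp c2 / u2 = A \<and> - exp c2 / u2 * q2 = B)"
      using T_affine[OF z lvw T_val[OF u'(2)]] by blast
    have 1: "exp c' / u' = A" "- exp c' / u' * q = B" using AB(2)[of u' q c'] u' by (auto simp: T_def)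
    have "exp c / u = exp c' / u'" using qD[OF z] u(1) u'(1) by (simp add: c_def exp_add exp_diff)
    hence "exp c / u = A" "- exp c / u * q = B" using 1 by simp_all
    hence "T q u c z" using AB(2)[of u q c] u(1) nonpos[OF z] by (simp add: c_def)
    thus ?thesis by blast
  qed
  obtain c where c: "T q u c z0" using ex_c[OF z0] by blast
  have "T q u c z" if z: "z \<in> D" for z
  proof -
    \<comment> \<open>The remaining ambiguity of the lift is a multiple of \<open>c\<tau> y\<close>.
      A second open partition of \<open>D\<close> shows that one constant \<open>c\<close> works
      everywhere.\<close>
    let ?A = "{z. T q u c z}" and ?B = "{z. \<exists>c'. T q u c' z \<and> (\<nexists>k::int. c' = c + of_int k * c\<tau> y)}"
    have "open ?A"
    proof (subst open_subopen, clarify)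
      fix x assume "T q u c x"
      then obtain S where "open S" "x \<in> S" "\<forall>v\<in>S. T q u c v" using T_open[of q u c x] u(1) unfolding eventually_nhds by blast
      thus "\<exists>S. open S \<and> x \<in> S \<and> S \<subseteq> ?A" by blast
    qed
    moreover have "open ?B"
    proof (subst open_subopen, clarify)
      fix x c' assume *: "T q u c' x" "\<nexists>k::int. c' = c + of_int k * c\<tau> y"
      then obtain S where "open S" "x \<in> S" "\<forall>v\<in>S. T q u c' v" using T_open[of q u c' x] u(1) unfolding eventually_nhds by blast
      thus "\<exists>S. open S \<and> x \<in> S \<and> S \<subseteq> ?B" using * by blast
    qed
    moreover have "?A \<inter> ?B \<inter> D = {}"
    proof -
      have False if "T q u c x" "T q u c' x" "\<nexists>k::int. c' = c + of_int k * c\<tau> y" for x c'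
        using T_same[OF that(1,2)] that(3) by auto
      thus ?thesis by blast
    qed
    moreover have "D \<subseteq> ?A \<union> ?B"
    proof
      fix z assume "z \<in> D"
      then obtain c' where c': "T q u c' z" using ex_c by blast
      show "z \<in> ?A \<union> ?B"
      proof (cases "\<exists>k::int. c' = c + of_int k * c\<tau> y")
        case True
        then obtain k :: int where "c' = c + of_int k * c\<tau> y" by blast
        hence "T q u c z" using c' T_shift[of q u c k z] by simp
        thus ?thesis by blast
      qed (use c' in blast)
    qed
    ultimately have "?A \<inter> D = {} \<or> ?B \<inter> D = {}" using connectedD[OF conn, of ?A ?B] by blast
    hence "?B \<inter> D = {}" using c z0 by blast
    thus ?thesis using \<open>D \<subseteq> ?A \<union> ?B\<close> z by blast
  qed
  thus ?thesis
    by (intro that[of u q c] u(1)) (simp_all add: Re_u qD T_def)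
qed

lemma lv_Ln: "lv y (c + Ln z) \<ge> lv y c + ln (cmod z) - \<bar>c\<kappa> y\<bar> * pi" 
  "lv y (c + Ln z) \<le> lv y c + ln (cmod z) + \<bar>c\<kappa> y\<bar> * pi" if "z \<noteq> 0"
proof -
  have "\<bar>c\<kappa> y * Im (Ln z)\<bar> \<le> \<bar>c\<kappa> y\<bar> * pi"
    using mpi_less_Im_Ln[OF that] Im_Ln_le_pi[OF that] by (auto simp: abs_mult intro!: mult_left_mono)
  thus "lv y (c + Ln z) \<ge> lv y c + ln (cmod z) - \<bar>c\<kappa> y\<bar> * pi" 
    "lv y (c + Ln z) \<le> lv y c + ln (cmod z) + \<bar>c\<kappa> y\<bar> * pi"
    using that by (simp_all add: algebra_simps) 
qed

text \<open>A ray avoiding \<open>thick\<close> would stay near one singularity, with a lift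
  \<open>c + Ln ((z - q) / u)\<close> of bounded level. The level of this lift tends to infinity
  with \<open>|z|\<close>, since the argument of \<open>Ln\<close> contributes a bounded
  amount.\<close>

lemma ray_visits_thick:
  assumes v: "v \<noteq> 0" and F: "\<And>t. t \<ge> T \<Longrightarrow> afm_at (\<lambda>z. z) F (z0 + of_real t * v)"
  shows "\<exists>t\<ge>T. F (z0 + of_real t * v) \<in> thick"
proof (rule ccontr)
  assume nt: "\<not> ?thesis"
  define D where "D = (\<lambda>t. z0 + of_real t * v) ` {T..}"
  have "D = (\<lambda>x. z0 + x) ` ((\<lambda>t. t *\<^sub>R v) ` {T..})"
    by (auto simp: D_def image_image scaleR_conv_of_real)
  moreover have "convex ((\<lambda>t. t *\<^sub>R v) ` {T..})"
    by (intro convex_linear_image) (auto intro: linear_scaleR_left)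
  ultimately have cD: "convex D" using convex_translation by metis
  have ne: "D \<noteq> {}" by (auto simp: D_def)
  have F': "afm_at (\<lambda>z. z) F z" if "z \<in> D" for z using that F by (auto simp: D_def)
  obtain y where y: "y \<in> \<Lambda>" "\<And>z. z \<in> D \<Longrightarrow> F z \<in> cP y ` {w. lv y w < cL y - 1}"
    by (rule connected_in_cone[OF convex_connected[OF cD] ne developing_simps(1) F'])
      (use nt in \<open>auto simp: D_def\<close>)
  obtain q u c where *: "u \<noteq> 0" "\<And>z. z \<in> D \<Longrightarrow> z \<noteq> q \<and> 0 \<le> Re ((z - q) / u) \<and>
     lv y (c + Ln ((z - q) / u)) < cL y - 1 \<and> (\<forall>\<^sub>F v in nhds z. F v = cP y (c + Ln ((v - q) / u)))"
    by (rule cone_lift[OF y(1) _ cD ne F' y(2)]) auto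
  \<comment> \<open>The bound of \<open>lv_Ln\<close> makes the level at least \<open>cL y\<close>
    as soon as \<open>|(z - q) / u|\<close> reaches \<open>B\<close>; the time \<open>t\<close>
    below is chosen for that.\<close>
  define B where "B = exp (cL y - lv y c + \<bar>c\<kappa> y\<bar> * pi)"
  define t where "t = max T ((B * cmod u + cmod (z0 - q)) / cmod v)"
  define z where "z = z0 + of_real t * v"
  have zD: "z \<in> D" by (auto simp: D_def z_def t_def)
  have "B * cmod u + cmod (z0 - q) \<le> t * cmod v"
    using v by (simp add: t_def pos_divide_le_eq[symmetric])
  also have "\<dots> \<le> cmod (of_real t * v)" by (simp add: norm_mult mult_right_mono)
  also have "\<dots> \<le> cmod (z - q) + cmod (z0 - q)"
    using norm_triangle_ineq4[of "z - q" "z0 - q"] by (simp add: z_def)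
  finally have "B \<le> cmod ((z - q) / u)" using *(1) by (simp add: norm_divide pos_le_divide_eq)
  moreover have "B > 0" by (simp add: B_def)
  ultimately have "ln B \<le> ln (cmod ((z - q) / u))" by (subst ln_le_cancel_iff) linarith+
  moreover have "(z - q) / u \<noteq> 0" using *(2)[OF zD] *(1) by simp
  ultimately have "lv y (c + Ln ((z - q) / u)) \<ge> cL y"
    using lv_Ln(1)[where z="(z - q) / u" and y=y and c=c] by (simp add: B_def)
  thus False using *(2)[OF zD] by simp
qed

end

section \<open>Comparison of an immersion with an embedded disc, and boundary points of half
  discs\<close>

context charted_surface
begin

text \<open>The image would be open and closed, hence the whole connected surface, but it misses the
  nonempty set \<open>\<Lambda>\<close>.\<close>

lemma no_compact_image:
  assumes d: "developing d" and D: "open D" "D \<noteq> {}" and F: "\<And>z. z \<in> D \<Longrightarrow> afm_at d F z"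
    and K: "compactin X (F ` D)"
  shows False
proof -
  have "openin X (F ` D)" by (rule afm_open_image[OF d F D(1)])
  moreover have "closedin X (F ` D)" by (rule compactin_imp_closedin[OF Hausdorff_X K])
  moreover have "F ` D \<noteq> {}" using D(2) by simp
  ultimately have "F ` D = topspace X" using connected_X unfolding connected_space_clopen_in by blast
  moreover have "F ` D \<subseteq> M" using afm_at_in_M[OF F] by blast
  ultimately show False using sing_ne sing_subset by blast
qed

text \<open>The affine transition to the unit disc, known near \<open>z\<close>, remains valid on
  the convex set \<open>D\<close> as long as it stays in the disc, by the identity principle. Thus
  \<open>1 / |A|\<close> is the scale at which the disc is seen from \<open>z\<close>.\<close>

lemma disc_param:
  assumes D: "convex D" "z \<in> D" and F: "\<And>z. z \<in> D \<Longrightarrow> afm_at (\<lambda>z. z) F z"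
    and E: "\<And>e. e \<in> ball 0 1 \<Longrightarrow> afm_at (\<lambda>z. z) E e" and e: "cmod e < 1" "F z = E e"
  obtains A where "A \<noteq> 0" "\<And>v. v \<in> D \<Longrightarrow> cmod (A * (v - z)) < 1 - cmod e \<Longrightarrow> F v = E (A * (v - z) + e)"
    "\<And>v. cmod (A * (v - z)) < 1 - cmod e \<Longrightarrow> afm_at (\<lambda>z. z) (\<lambda>v. E (A * (v - z) + e)) v"
proof -
  have "afm_at (\<lambda>z. z) E e" using E e(1) by simp
  from afm_at_param[OF developing_simps(1) F[OF D(2)] this e(2)]
  obtain A where A: "A \<noteq> 0" "\<forall>\<^sub>F v in nhds z. F v = E (A * (v - z) + e)" by blast
  have aff: "afm_at (\<lambda>z. z) (\<lambda>v. E (A * (v - z) + e)) v" if "cmod (A * (v - z)) < 1 - cmod e" for v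
  proof (rule afm_at_comp[where d="\<lambda>z. z" and g="\<lambda>v. A * (v - z) + e" and A=A and B="e - A * z"])
    have "cmod (A * (v - z) + e) < 1" using norm_triangle_ineq[of "A * (v - z)" e] that by linarith
    thus "afm_at (\<lambda>z. z) E (A * (v - z) + e)" using E by simp
    show "\<forall>\<^sub>F v in nhds v. A * (v - z) + e = A * v + (e - A * z)" by (simp add: algebra_simps)
  qed (use A in \<open>auto intro!: continuous_intros\<close>)
  let ?D = "D \<inter> ball z ((1 - cmod e) / cmod A)"
  have mem: "v \<in> ?D \<longleftrightarrow> v \<in> D \<and> cmod (A * (v - z)) < 1 - cmod e" for v
    using A(1) by (auto simp: dist_norm norm_mult norm_minus_commute pos_less_divide_eq mult.commute)
  have "F v = E (A * (v - z) + e)" if "v \<in> D" "cmod (A * (v - z)) < 1 - cmod e" for v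
  proof (rule identity_principle_eq[OF developing_simps(1), of ?D F "\<lambda>v. E (A * (v - z) + e)" z])
    show "connected ?D" by (intro convex_connected convex_Int D convex_ball)
    show "z \<in> ?D" using mem[of z] D(2) e(1) by simp
  qed (use that mem A F aff in auto)
  thus ?thesis using that A(1) aff by blast
qed

lemma Re_div_unit: "cmod n = 1 \<Longrightarrow> Re (z / n) = inner n z"
  using cmod_power2[of n] by (simp add: Re_divide inner_complex_def algebra_simps)

lemma convex_half_disc:
  assumes "cmod n = 1"
  shows "convex {z. cmod (z - p) < R \<and> 0 < Re ((z - p) / n)}"
proof -
  have "{z. cmod (z - p) < R \<and> 0 < Re ((z - p) / n)} = ball p R \<inter> {z. inner n z > inner n p}"
    using assms by (auto simp: Re_div_unit dist_norm norm_minus_commute inner_diff_right)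
  thus ?thesis by (simp add: convex_Int convex_halfspace_gt)
qed

lemma isCont_log_lift: "u \<noteq> 0 \<Longrightarrow> (z - q) / u \<notin> \<real>\<^sub>\<le>\<^sub>0 \<Longrightarrow> isCont (\<lambda>v. c + Ln ((v - q) / u)) z"
  by (intro continuous_intros) auto

text \<open>
  A boundary point of an embedded half disc is either regular or a conical singularity; in the
  second case the immersion is the logarithmic chart of the singularity, centred at that point.
\<close>

lemma half_disc_boundary:
  assumes n: "cmod n = 1" and R: "R > 0"
    and G: "\<And>z. cmod (z - p) < R \<Longrightarrow> 0 < Re ((z - p) / n) \<Longrightarrow> afm_at (\<lambda>z. z) G z"
    and inj: "inj_on G {z. cmod (z - p) < R \<and> 0 < Re ((z - p) / n)}"
  shows "(\<exists>r G'. 0 < r \<and> r \<le> R \<and> (\<forall>z. cmod (z - p) < r \<longrightarrow> afm_at (\<lambda>z. z) G' z) \<and>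
            (\<forall>z. cmod (z - p) < r \<longrightarrow> 0 < Re ((z - p) / n) \<longrightarrow> G' z = G z)) \<or>
         (\<exists>y\<in>\<Lambda>. \<exists>r c. 0 < r \<and> r \<le> R \<and>
            (\<forall>z. cmod (z - p) < r \<longrightarrow> z \<noteq> p \<longrightarrow> 0 \<le> Re ((z - p) / n) \<longrightarrow> lv y (c + Ln ((z - p) / n)) < cL y) \<and>
            (\<forall>z. cmod (z - p) < r \<longrightarrow> 0 < Re ((z - p) / n) \<longrightarrow> G z = cP y (c + Ln ((z - p) / n))))"
    (is "?reg \<or> ?sing")
proof -
  define H where "H = {z. cmod (z - p) < R \<and> 0 < Re ((z - p) / n)}"
  have n0: "n \<noteq> 0" using n by auto
  have convH: "convex H" unfolding H_def by (rule convex_half_disc[OF n])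
  have GH: "afm_at (\<lambda>z. z) G z" if "z \<in> H" for z using G that by (simp add: H_def)
  have seg: "p + of_real t * n \<in> H" if "0 < t" "t < R" for t
    using that n n0 by (simp add: H_def norm_mult)
  show ?thesis
  \<comment> \<open>Either the inner normal at \<open>p\<close> meets \<open>thick\<close> at points
    tending to \<open>p\<close>, or its end lies near a single singularity.\<close>
  proof (cases "\<forall>d>0. \<exists>t. 0 < t \<and> t < d \<and> G (p + of_real t * n) \<in> thick")
    case True
    have "\<exists>t. 0 < t \<and> t < min (R / 2) (1 / (real k + 1)) \<and> G (p + of_real t * n) \<in> thick" for k :: nat
    proof -
      have "0 < min (R / 2) (1 / (real k + 1))" using R by (auto intro: divide_pos_pos)
      with True show ?thesis by blast
    qed
    then obtain \<eta> where \<eta>: "\<And>k::nat. 0 < \<eta> k \<and> \<eta> k < min (R / 2) (1 / (real k + 1)) \<and> G (p + of_real (\<eta> k) * n) \<in> thick"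
      by metis
    define z where "z k = p + of_real (\<eta> k) * n" for k
    obtain E where E: "\<And>e. e \<in> ball 0 1 \<Longrightarrow> afm_at (\<lambda>z. z) E e" "inj_on E (ball 0 1)"
      "\<And>r. 0 < r \<Longrightarrow> r \<le> 1 \<Longrightarrow> infinite {k \<in> UNIV. G (z k) \<in> E ` ball 0 r}"
      using regular_cluster[of "UNIV :: nat set" "\<lambda>k. G (z k)"] \<eta> unfolding z_def by blast
    define N where "N = {k. G (z k) \<in> E ` ball 0 (1/8)}"
    have infN: "infinite N" using E(3)[of "1/8"] by (simp add: N_def)
    have "\<forall>k\<in>N. \<exists>e. cmod e < 1/8 \<and> G (z k) = E e" by (auto simp: N_def)
    then obtain e where e: "\<And>k. k \<in> N \<Longrightarrow> cmod (e k) < 1/8 \<and> G (z k) = E (e k)" by metis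
    have zH: "z k \<in> H" for k unfolding z_def using \<eta>[of k] R by (intro seg) auto
    define Q where "Q k A \<longleftrightarrow> A \<noteq> 0 \<and> (\<forall>v\<in>H. cmod (A * (v - z k)) < 7/8 \<longrightarrow> G v = E (A * (v - z k) + e k)) \<and>
      (\<forall>v. cmod (A * (v - z k)) < 7/8 \<longrightarrow> afm_at (\<lambda>z. z) (\<lambda>v. E (A * (v - z k) + e k)) v)" for k A
    have "\<forall>k\<in>N. \<exists>A. Q k A"
    proof
      fix k assume k: "k \<in> N"
      have e1: "cmod (e k) < 1" "7/8 \<le> 1 - cmod (e k)" using e[OF k] by auto
      obtain A where A: "A \<noteq> 0" "\<And>v. v \<in> H \<Longrightarrow> cmod (A * (v - z k)) < 1 - cmod (e k) \<Longrightarrow> G v = E (A * (v - z k) + e k)"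
        "\<And>v. cmod (A * (v - z k)) < 1 - cmod (e k) \<Longrightarrow> afm_at (\<lambda>z. z) (\<lambda>v. E (A * (v - z k) + e k)) v"
        using disc_param[OF convH zH GH E(1) e1(1)] e[OF k] by blast
      thus "\<exists>A. Q k A" using e1(2) unfolding Q_def by (intro exI[of _ A]) auto
    qed
    then obtain A where QA: "\<forall>k\<in>N. Q k (A k)" by (auto dest: bchoice)
    have A: "\<And>k. k \<in> N \<Longrightarrow> A k \<noteq> 0"
      "\<And>k v. k \<in> N \<Longrightarrow> v \<in> H \<Longrightarrow> cmod (A k * (v - z k)) < 7/8 \<Longrightarrow> G v = E (A k * (v - z k) + e k)"
      "\<And>k v. k \<in> N \<Longrightarrow> cmod (A k * (v - z k)) < 7/8 \<Longrightarrow> afm_at (\<lambda>z. z) (\<lambda>v. E (A k * (v - z k) + e k)) v"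
      using QA unfolding Q_def by blast+
    show ?thesis
    \<comment> \<open>\<open>\<eta> k\<close> is the distance from \<open>z k\<close> to the
      boundary line. In the first case the disc of radius \<open>7 / 8 / |A k|\<close> about
      \<open>z k\<close> contains a neighbourhood of \<open>p\<close>, and the disc formula extends
      \<open>G\<close>.\<close>
    proof (cases "\<exists>k\<in>N. cmod (A k) * \<eta> k < 1/2")
      case True
      then obtain k where k: "k \<in> N" "cmod (A k) * \<eta> k < 1/2" by blast
      define r where "r = min R (7 / 8 / cmod (A k) - \<eta> k)"
      have rpos: "0 < r" using k A(1)[OF k(1)] R by (auto simp: r_def field_simps)
      have small: "cmod (A k * (v - z k)) < 7/8" if "cmod (v - p) < r" for v
      proof -
        have "cmod (v - z k) \<le> cmod (v - p) + \<eta> k"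
          using norm_triangle_ineq4[of "v - p" "of_real (\<eta> k) * n"] \<eta>[of k] n
          by (simp add: z_def norm_mult algebra_simps)
        also have "\<dots> < 7 / 8 / cmod (A k)" using that by (simp add: r_def)
        finally have "cmod (A k) * cmod (v - z k) < cmod (A k) * (7 / 8 / cmod (A k))"
          by (rule mult_strict_left_mono) (use A(1)[OF k(1)] in simp)
        thus ?thesis using A(1)[OF k(1)] by (simp add: norm_mult)
      qed
      have "?reg"
      proof (intro exI conjI allI impI)
        show "0 < r" "r \<le> R" using rpos by (simp_all add: r_def)
        show "afm_at (\<lambda>z. z) (\<lambda>v. E (A k * (v - z k) + e k)) v" if "cmod (v - p) < r" for v
          using A(3)[OF k(1) small[OF that]] .
        show "E (A k * (v - z k) + e k) = G v" if "cmod (v - p) < r" "0 < Re ((v - p) / n)" for v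
          using A(2)[OF k(1) _ small[OF that(1)]] that by (simp add: H_def r_def)
      qed
      thus ?thesis ..
    next
      case False
      \<comment> \<open>Now the image disc is small compared with the distance to the boundary. A
        point within \<open>\<eta> k / 2\<close> of \<open>z k\<close> then has the same image as
        some \<open>z m\<close> much nearer to \<open>p\<close>, against injectivity.\<close>
      obtain k where k: "k \<in> N" using infN by (metis finite.emptyI ex_in_conv)
      obtain m where m: "m \<in> N" "m > nat \<lceil>2 / \<eta> k\<rceil>" using infN infinite_nat_iff_unbounded by blast
      have "2 / \<eta> k \<le> real (nat \<lceil>2 / \<eta> k\<rceil>)" by linarith
      also have "\<dots> < real m + 1" using m(2) by linarith
      finally have "1 / (real m + 1) < \<eta> k / 2" using \<eta>[of k] by (simp add: field_simps)
      hence \<eta>m: "\<eta> m < \<eta> k / 2" using \<eta>[of m] by auto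
      define v where "v = z k + (e m - e k) / A k"
      have Ak: "1/2 \<le> cmod (A k) * \<eta> k" using False k by auto
      have dv: "cmod (v - z k) < \<eta> k / 2"
      proof -
        have "cmod (e m - e k) < 1/4" using norm_triangle_ineq4[of "e m" "e k"] e[OF k] e[OF m(1)] by linarith
        also have "1/4 \<le> \<eta> k / 2 * cmod (A k)" using Ak by (simp add: mult.commute[of "cmod (A k)"])
        finally show ?thesis using A(1)[OF k] by (simp add: v_def norm_divide field_simps)
      qed
      have vH: "v \<in> H"
      proof -
        have "cmod (v - p) \<le> cmod (v - z k) + cmod (of_real (\<eta> k) * n)"
          using norm_triangle_ineq[of "v - z k" "of_real (\<eta> k) * n"] by (simp add: z_def)
        also have "\<dots> < R" using dv \<eta>[of k] n by (simp add: norm_mult)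
        finally have 1: "cmod (v - p) < R" .
        have "(v - p) / n = (v - z k) / n + of_real (\<eta> k)" using n0 by (simp add: z_def field_simps)
        moreover have "\<bar>Re ((v - z k) / n)\<bar> < \<eta> k / 2"
          using abs_Re_le_cmod[of "(v - z k) / n"] dv n by (simp add: norm_divide)
        ultimately have "0 < Re ((v - p) / n)" using \<eta>[of k] by simp
        thus ?thesis using 1 by (simp add: H_def)
      qed
      have Av: "A k * (v - z k) = e m - e k" using A(1)[OF k] by (simp add: v_def)
      have "cmod (e m - e k) < 7/8" using norm_triangle_ineq4[of "e m" "e k"] e[OF k] e[OF m(1)] by linarith
      hence "G v = E (e m)" using A(2)[OF k vH] Av by simp
      also have "\<dots> = G (z m)" using e[OF m(1)] by simp
      finally have "v = z m" using inj vH zH[of m] unfolding H_def by (auto dest: inj_onD)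
      hence "v - z k = of_real (\<eta> m - \<eta> k) * n" by (simp add: z_def algebra_simps)
      hence "cmod (v - z k) = \<bar>\<eta> m - \<eta> k\<bar>" using n by (simp add: norm_mult del: of_real_diff)
      thus ?thesis using dv \<eta>m by linarith
    qed
  next
    case False
    then obtain d where d: "d > 0" "\<And>t. 0 < t \<Longrightarrow> t < d \<Longrightarrow> G (p + of_real t * n) \<notin> thick" by blast
    define d' where "d' = min d R"
    define D where "D = (\<lambda>t. p + of_real t * n) ` {0<..<d'}"
    have d': "0 < d'" "d' \<le> R" using d R by (auto simp: d'_def)
    have "D = (\<lambda>x. p + x) ` ((\<lambda>t. t *\<^sub>R n) ` {0<..<d'})"
      by (auto simp: D_def image_image scaleR_conv_of_real)
    moreover have "convex ((\<lambda>t. t *\<^sub>R n) ` {0<..<d'})"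
      by (intro convex_linear_image) (auto intro: linear_scaleR_left)
    ultimately have cD: "convex D" using convex_translation by metis
    have ne: "D \<noteq> {}" using d' by (auto simp: D_def)
    have DH: "D \<subseteq> H" using seg d' by (auto simp: D_def)
    have FD: "afm_at (\<lambda>z. z) G z" if "z \<in> D" for z using GH DH that by blast
    obtain y where y: "y \<in> \<Lambda>" "\<And>z. z \<in> D \<Longrightarrow> G z \<in> cP y ` {w. lv y w < cL y - 1}"
      by (rule connected_in_cone[OF convex_connected[OF cD] ne developing_simps(1) FD])
        (use d in \<open>auto simp: D_def d'_def\<close>)
    obtain q u c where *: "u \<noteq> 0" "\<And>z. z \<in> D \<Longrightarrow> z \<noteq> q \<and> 0 \<le> Re ((z - q) / u) \<and>
       lv y (c + Ln ((z - q) / u)) < cL y - 1 \<and> (\<forall>\<^sub>F v in nhds z. G v = cP y (c + Ln ((v - q) / u)))"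
      by (rule cone_lift[OF y(1) _ cD ne FD y(2)]) auto
    define s where "s k = p + of_real (d' / (real k + 2)) * n" for k :: nat
    have sD: "s k \<in> D" for k
    proof -
      have "0 < d' * (real k + 1)" using d'(1) by simp
      hence "d' / (real k + 2) < d'" "0 < d' / (real k + 2)" using d'(1) by (simp_all add: field_simps)
      thus ?thesis unfolding D_def s_def by (intro imageI) auto
    qed
    have "(\<lambda>k. d' / (real k + 2)) \<longlonglongrightarrow> 0"
      using LIMSEQ_ignore_initial_segment[OF lim_const_over_n[of d'], of 2] by (simp add: add.commute)
    hence "(\<lambda>k. p + of_real (d' / (real k + 2)) * n) \<longlonglongrightarrow> p + of_real 0 * n"
      by (intro tendsto_intros)
    hence s_lim: "s \<longlonglongrightarrow> p" unfolding s_def by simp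
    show ?thesis
    \<comment> \<open>If the apex \<open>q\<close> of the lift is not \<open>p\<close>, the
      logarithm continues across \<open>p\<close> and gives a regular extension. If it is
      \<open>p\<close>, the boundary point is the singularity.\<close>
    proof (cases "q = p")
      case False
      have lim1: "(\<lambda>k. (s k - q) / u) \<longlonglongrightarrow> (p - q) / u" by (intro tendsto_intros s_lim *(1))
      have "0 \<le> Re ((p - q) / u)"
        by (rule LIMSEQ_le_const[OF tendsto_Re[OF lim1]]) (use * sD in auto)
      moreover have "(p - q) / u \<noteq> 0" using False *(1) by simp
      ultimately have np: "(p - q) / u \<notin> \<real>\<^sub>\<le>\<^sub>0"
        by (auto simp only: complex_nonpos_Reals_iff complex_eq_iff zero_complex.sel)
      define l where "l v = c + Ln ((v - q) / u)" for v
      have cl: "isCont l p" unfolding l_def by (rule isCont_log_lift[OF *(1) np])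
      have "isCont (\<lambda>v. lv y (l v)) p" by (intro continuous_intros isCont_o2[OF cl] isCont_Re_Im)
      hence llim: "((\<lambda>v. lv y (l v)) \<longlongrightarrow> lv y (l p)) (nhds p)" by (rule isCont_nhds)
      have "(\<lambda>k. lv y (l (s k))) \<longlonglongrightarrow> lv y (l p)"
        using filterlim_compose[OF llim s_lim] .
      hence "lv y (l p) \<le> cL y - 1"
        by (rule LIMSEQ_le_const2) (use *(2)[OF sD] in \<open>auto simp: l_def intro: less_imp_le\<close>)
      hence "\<forall>\<^sub>F v in nhds p. lv y (l v) < cL y" by (intro order_tendstoD(2)[OF llim]) auto
      moreover have "\<forall>\<^sub>F v in nhds p. (v - q) / u \<in> - \<real>\<^sub>\<le>\<^sub>0"
      proof (rule nhds_transport[where g="\<lambda>v. (v - q) / u"])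
        show "\<forall>\<^sub>F x in nhds ((p - q) / u). x \<in> - \<real>\<^sub>\<le>\<^sub>0"
          using np by (intro eventually_nhds_in_open open_Compl closed_nonpos_Reals_complex) auto
      qed (intro continuous_intros *(1))
      ultimately have "\<forall>\<^sub>F v in nhds p. lv y (l v) < cL y \<and> (v - q) / u \<notin> \<real>\<^sub>\<le>\<^sub>0" by eventually_elim auto
      then obtain r1 where r1: "r1 > 0" "\<And>v. dist v p < r1 \<Longrightarrow> lv y (l v) < cL y \<and> (v - q) / u \<notin> \<real>\<^sub>\<le>\<^sub>0"
        unfolding eventually_nhds_metric by blast
      define r where "r = min r1 R"
      have af: "afm_at (\<lambda>z. z) (\<lambda>v. cP y (l v)) v" if "cmod (v - p) < r" for v
        unfolding l_def using r1(2)[of v] that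
        by (intro cP_Ln_afm y *(1)) (auto simp: dist_norm l_def r_def)
      obtain k where k: "cmod (s k - p) < r"
      proof -
        have "\<forall>\<^sub>F k in sequentially. dist (s k) p < r" using s_lim r1(1) R by (intro tendstoD) (auto simp: r_def)
        thus ?thesis using that by (auto simp: eventually_sequentially dist_norm)
      qed
      let ?D = "{z. cmod (z - p) < r \<and> 0 < Re ((z - p) / n)}"
      have "cP y (l v) = G v" if "cmod (v - p) < r" "0 < Re ((v - p) / n)" for v
      proof (rule identity_principle_eq[OF developing_simps(1), of ?D "\<lambda>v. cP y (l v)" G "s k"])
        show "connected ?D" by (intro convex_connected convex_half_disc n)
        show "afm_at (\<lambda>z. z) G w" if "w \<in> ?D" for w using that by (intro G) (auto simp: r_def)
        show "s k \<in> ?D" using k sD DH by (auto simp: H_def)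
        show "\<forall>\<^sub>F v in nhds (s k). cP y (l v) = G v"
          using *(2)[OF sD, of k] unfolding l_def by (auto elim: eventually_mono)
      qed (use that af in auto)
      hence ?reg using af r1(1) R by (intro exI[of _ r] exI[of _ "\<lambda>v. cP y (l v)"]) (auto simp: r_def)
      thus ?thesis ..
    next
      case True
      have Re_nu: "0 \<le> Re (n / u)"
      proof -
        have "p + of_real (d'/2) * n \<in> D" unfolding D_def using d' by (intro imageI) auto
        hence "0 \<le> Re ((p + of_real (d'/2) * n - q) / u)" using *(2) by blast
        also have "(p + of_real (d'/2) * n - q) / u = of_real (d'/2) * (n / u)" using True by simp
        also have "Re (of_real (d'/2) * (n / u)) = d'/2 * Re (n / u)" by (simp only: Re_complex_of_real times_complex.sel Im_complex_of_real mult_zero_left diff_zero)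
        finally show ?thesis using d' by (simp add: zero_le_mult_iff)
      qed
      \<comment> \<open>This changes the reference direction from \<open>u\<close> to the normal
        \<open>n\<close>. The two arguments are at most \<open>pi / 2\<close> in absolute value and
        one is strictly smaller, so the principal logarithms add.\<close>
      define c' where "c' = c + Ln (n / u)"
      have Ln_eq: "c + Ln ((v - q) / u) = c' + Ln ((v - p) / n)" if "0 < Re ((v - p) / n)" for v
      proof -
        have 1: "\<bar>Im (Ln ((v - p) / n))\<bar> < pi / 2" using that by (subst Re_Ln_pos_lt) auto
        have 2: "\<bar>Im (Ln (n / u))\<bar> \<le> pi / 2" using Re_nu n0 *(1) by (subst Re_Ln_pos_le) auto
        have "Ln ((v - p) / n * (n / u)) = Ln ((v - p) / n) + Ln (n / u)"
          using 1 2 that n0 *(1) by (intro Ln_times_simple) auto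
        moreover have "(v - p) / n * (n / u) = (v - q) / u" using n0 True by simp
        ultimately have "Ln ((v - q) / u) = Ln ((v - p) / n) + Ln (n / u)" by metis
        thus ?thesis by (simp only: c'_def add_ac)
      qed
      define r where "r = min R (exp (cL y - 1 - lv y c' - \<bar>c\<kappa> y\<bar> * pi))"
      have r: "0 < r" "r \<le> R" using R by (auto simp: r_def)
      have low: "lv y (c' + Ln ((v - p) / n)) < cL y" if "cmod (v - p) < r" "v \<noteq> p" for v
      proof -
        have v0: "(v - p) / n \<noteq> 0" using that n0 by simp
        have "cmod ((v - p) / n) < exp (cL y - 1 - lv y c' - \<bar>c\<kappa> y\<bar> * pi)"
          using that n by (simp add: norm_divide r_def)
        hence "ln (cmod ((v - p) / n)) < cL y - 1 - lv y c' - \<bar>c\<kappa> y\<bar> * pi"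
          using v0 by (metis exp_less_cancel_iff exp_ln zero_less_norm_iff)
        thus ?thesis using lv_Ln(2)[where z="(v - p) / n" and y=y and c=c', OF v0] by linarith
      qed
      have nonneg_np: "(v - p) / n \<notin> \<real>\<^sub>\<le>\<^sub>0" if "0 < Re ((v - p) / n)" for v
        using that by (auto simp: complex_nonpos_Reals_iff)
      have af: "afm_at (\<lambda>z. z) (\<lambda>v. cP y (c' + Ln ((v - p) / n))) v"
        if "cmod (v - p) < r" "0 < Re ((v - p) / n)" for v
      proof -
        have "v \<noteq> p" using that by auto
        thus ?thesis by (intro cP_Ln_afm y(1) n0 nonneg_np low that)
      qed
      obtain k where k: "cmod (s k - p) < r"
      proof -
        have "\<forall>\<^sub>F k in sequentially. dist (s k) p < r" using s_lim r(1) by (intro tendstoD) auto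
        thus ?thesis using that by (auto simp: eventually_sequentially dist_norm)
      qed
      let ?D = "{z. cmod (z - p) < r \<and> 0 < Re ((z - p) / n)}"
      have "G v = cP y (c' + Ln ((v - p) / n))" if "cmod (v - p) < r" "0 < Re ((v - p) / n)" for v
      proof (rule identity_principle_eq[OF developing_simps(1), of ?D G "\<lambda>v. cP y (c' + Ln ((v - p) / n))" "s k"])
        show "connected ?D" by (intro convex_connected convex_half_disc n)
        show "afm_at (\<lambda>z. z) G w" if "w \<in> ?D" for w using that r by (intro G) auto
        show sk: "s k \<in> ?D" using k sD DH by (auto simp: H_def)
        have "open {w. 0 < Re ((w - p) / n)}" using n0 by (intro open_Collect_less continuous_intros) auto
        hence "\<forall>\<^sub>F v in nhds (s k). v \<in> {w. 0 < Re ((w - p) / n)}"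
          using sk by (intro eventually_nhds_in_open) auto
        moreover have "\<forall>\<^sub>F v in nhds (s k). G v = cP y (c + Ln ((v - q) / u))" using *(2)[OF sD, of k] by blast
        ultimately show "\<forall>\<^sub>F v in nhds (s k). G v = cP y (c' + Ln ((v - p) / n))"
          by eventually_elim (use Ln_eq in auto)
      qed (use that af in auto)
      hence ?sing using y(1) r low by (intro bexI[of _ y] exI[of _ r] exI[of _ c']) auto
      thus ?thesis ..
    qed
  qed
qed

text \<open>The monotone reparametrization \<open>h\<close> is the identity for segments in the
  plane and an exponential along horizontal lines of a strip.\<close>

lemma straight_atI:
  assumes ch: "(U, \<phi>) \<in> \<A>" "a \<noteq> 0" "u \<noteq> 0" and h: "strict_mono h"
    and ev: "\<forall>\<^sub>F s in nhds t. \<gamma> s \<in> U \<and> \<phi> (\<gamma> s) = a * (z + of_real (h s) * u) + b"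
  shows "straight_at (regular_part X \<Lambda>) \<A> \<gamma> t \<phi> (a * u)"
proof -
  obtain \<epsilon> where \<epsilon>: "\<epsilon> > 0" "\<And>s. dist s t < \<epsilon> \<Longrightarrow> \<gamma> s \<in> U \<and> \<phi> (\<gamma> s) = a * (z + of_real (h s) * u) + b"
    using ev unfolding eventually_nhds_metric by blast
  have at: "\<gamma> t \<in> U" "\<phi> (\<gamma> t) = a * (z + of_real (h t) * u) + b" using \<epsilon>(2)[of t] \<epsilon>(1) by simp_all
  have "affine_chart_at (regular_part X \<Lambda>) \<A> (\<gamma> t) \<phi>"
    unfolding affine_chart_at_def
    by (rule bexI[OF _ ch(1)], unfold case_prod_conv, rule exI[of _ "1::complex"], rule exI[of _ "0::complex"], rule exI[of _ U])
      (use at(1) chart_open[OF ch(1)] openin_regular in simp)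
  moreover have "\<exists>\<epsilon>>0. \<exists>h. strict_mono_on {t - \<epsilon><..<t + \<epsilon>} h \<and>
        (\<forall>s\<in>{t - \<epsilon><..<t + \<epsilon>}. \<phi> (\<gamma> s) = \<phi> (\<gamma> t) + of_real (h s) * (a * u))"
  proof (intro exI conjI ballI)
    show "strict_mono_on {t - \<epsilon><..<t + \<epsilon>} (\<lambda>s. h s - h t)" using h by (auto simp: strict_mono_on_def strict_mono_def)
    fix s assume "s \<in> {t - \<epsilon><..<t + \<epsilon>}"
    hence "dist s t < \<epsilon>" by (auto simp: dist_real_def)
    thus "\<phi> (\<gamma> s) = \<phi> (\<gamma> t) + of_real (h s - h t) * (a * u)" using \<epsilon>(2) at(2) by (simp add: algebra_simps)
  qed (rule \<epsilon>(1))
  ultimately show ?thesis using ch(2,3) unfolding straight_at_def by auto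
qed

lemma straight_at_line:
  assumes F: "(U, \<phi>) \<in> \<A>" "\<forall>\<^sub>F v in nhds (z + of_real t * dv). F v \<in> U \<and> \<phi> (F v) = a * v + b" "a \<noteq> 0" "dv \<noteq> 0"
  shows "straight_at (regular_part X \<Lambda>) \<A> (\<lambda>t. F (z + of_real t * dv)) t \<phi> (a * dv)"
proof (rule straight_atI[OF F(1,3,4), where h="\<lambda>s. s" and z=z and b=b])
  show "\<forall>\<^sub>F s in nhds t. F (z + of_real s * dv) \<in> U \<and> \<phi> (F (z + of_real s * dv)) = a * (z + of_real s * dv) + b"
    using eventually_compose_filterlim[OF F(2) isCont_nhds[where g="\<lambda>s. z + of_real s * dv" and w=t]]
    by (simp add: continuous_intros)
qed (simp add: strict_mono_def)

end

section \<open>Immersed cones\<close>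

locale straight_surface = charted_surface +
  assumes no_self_intersection: "trajectory X \<Lambda> \<A> I \<gamma> \<Longrightarrow> \<not> self_intersecting X \<Lambda> \<A> I \<gamma>"

text \<open>Convexity together with an open set of recession directions is what the argument uses of
  a cone. Both are available for a sector of angle at most pi and for the overlaps of such
  sectors.\<close>

locale conic_immersion = straight_surface X \<Lambda> \<A> cP c\<kappa> c\<tau> cL
  for X :: "'a topology" and \<Lambda> \<A> cP c\<kappa> c\<tau> cL +
  fixes C :: "complex set" and f :: "complex \<Rightarrow> 'a" and z0 u0 :: complex and \<delta> :: real
  assumes open_C: "open C" and convex_C: "convex C" and z0: "z0 \<in> C" and \<delta>: "\<delta> > 0" and u0: "u0 \<noteq> 0"
    and recession: "z \<in> C \<Longrightarrow> 0 \<le> t \<Longrightarrow> cmod (u - u0) < \<delta> \<Longrightarrow> z + of_real t * u \<in> C"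
    and f_afm: "z \<in> C \<Longrightarrow> afm_at (\<lambda>z. z) f z"
begin

text \<open>Written from \<open>z0\<close>, the transformed point moves in a direction that differs
  from \<open>u0\<close> by a term of order \<open>1 / t\<close>, eventually smaller than
  \<open>\<delta>\<close>. So finitely many homotheties of positive ratio have a common point of
  definition far out in \<open>C\<close>.\<close>

lemma deep: "s > 0 \<Longrightarrow> \<forall>\<^sub>F t in at_top. of_real s * (z0 + of_real t * u0) + b \<in> C"
proof -
  assume s: "s > 0"
  define B where "B = cmod (of_real s * z0 + b - z0)"
  have "of_real s * (z0 + of_real t * u0) + b \<in> C" if t: "t \<ge> B / (s * \<delta>) + 1" for t
  proof -
    have "0 \<le> B / (s * \<delta>)" using s \<delta> by (simp add: B_def)
    hence t0: "t > 0" using t by linarith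
    have "B < s * \<delta> * t" using t s \<delta> by (simp add: field_simps) (smt (verit) mult_pos_pos)
    hence "cmod ((of_real s * z0 + b - z0) / of_real (s * t)) < \<delta>"
    proof -
      have "cmod ((of_real s * z0 + b - z0) / of_real (s * t)) = B / (s * t)"
        using s t0 by (simp add: norm_divide B_def norm_mult)
      also have "\<dots> < \<delta>" using \<open>B < s * \<delta> * t\<close> s t0 by (simp add: pos_divide_less_eq mult_ac)
      finally show ?thesis .
    qed
    hence "z0 + of_real (s * t) * (u0 + (of_real s * z0 + b - z0) / of_real (s * t)) \<in> C"
      using s t0 by (intro recession z0) auto
    moreover have "z0 + of_real (s * t) * (u0 + (of_real s * z0 + b - z0) / of_real (s * t)) =
      of_real s * (z0 + of_real t * u0) + b"
      using s t0 by (simp add: field_simps)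
    ultimately show ?thesis by simp
  qed
  thus ?thesis by (rule eventually_at_top_linorderI)
qed

text \<open>The ray meets \<open>thick\<close> at arbitrarily late times and clusters in an embedded
  disc. Pulling that disc back at one suitable time gives a bounded set that represents the images
  at infinitely many later times.\<close>

lemma ray_returns:
  assumes u: "cmod (u - u0) < \<delta>" "u \<noteq> 0"
  obtains B where "\<And>T. \<exists>t\<ge>T. \<exists>z\<in>C. cmod (z - z0) \<le> B \<and> f z = f (z0 + of_real t * u)"
proof -
  define \<delta>' where "\<delta>' = \<delta> - cmod (u - u0)"
  have \<delta>': "\<delta>' > 0" using u by (simp add: \<delta>'_def)
  have near: "z0 + of_real t * u + v \<in> C" if "t > 0" "cmod v < \<delta>' * t" for t v
  proof -
    have "cmod (v / of_real t) < \<delta>'" using that by (simp add: norm_divide field_simps)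
    hence "cmod (u + v / of_real t - u0) < \<delta>"
      using norm_triangle_ineq[of "u - u0" "v / of_real t"] by (simp add: \<delta>'_def algebra_simps)
    hence "z0 + of_real t * (u + v / of_real t) \<in> C" using that by (intro recession z0) auto
    thus ?thesis using that by (simp add: algebra_simps)
  qed
  have ray: "z0 + of_real t * u \<in> C" if "t \<ge> 0" for t using recession[OF z0 that u(1)] .
  have "\<exists>t\<ge>real k + 1. f (z0 + of_real t * u) \<in> thick" for k :: nat
    by (rule ray_visits_thick[OF u(2)]) (auto intro!: f_afm ray)
  then obtain t where t: "\<And>k::nat. real k + 1 \<le> t k \<and> f (z0 + of_real (t k) * u) \<in> thick" by metis
  define z where "z k = z0 + of_real (t k) * u" for k
  have tpos: "t k \<ge> 1" for k using t[of k] by linarith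
  have zC: "z k \<in> C" for k unfolding z_def using tpos[of k] by (intro ray) auto
  obtain E where E: "\<And>e. e \<in> ball 0 1 \<Longrightarrow> afm_at (\<lambda>z. z) E e" "inj_on E (ball 0 1)"
    "\<And>r. 0 < r \<Longrightarrow> r \<le> 1 \<Longrightarrow> infinite {k \<in> UNIV. f (z k) \<in> E ` ball 0 r}"
    using regular_cluster[of "UNIV :: nat set" "\<lambda>k. f (z k)"] t unfolding z_def by blast
  \<comment> \<open>With \<open>|A k| * t k < c0\<close> the disc seen from \<open>z k\<close> would
    reach all points within \<open>|u|\<close> of \<open>z0\<close>. The bound on
    \<open>\<epsilon>\<close> lets the pulled-back small disc fit into \<open>C\<close> in the other
    case.\<close>
  define c0 where "c0 = 1 / (4 * cmod u)"
  have c0: "c0 > 0" using u by (simp add: c0_def)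
  define \<epsilon> where "\<epsilon> = min (1/8) (\<delta>' * c0 / 8)"
  have \<epsilon>: "0 < \<epsilon>" "\<epsilon> \<le> 1/8" "\<epsilon> \<le> \<delta>' * c0 / 8" using \<delta>' c0 by (simp_all add: \<epsilon>_def)
  define N where "N = {k. f (z k) \<in> E ` ball 0 \<epsilon>}"
  have infN: "infinite N" using E(3)[of \<epsilon>] \<epsilon> by (simp add: N_def)
  have "\<forall>k\<in>N. \<exists>e. cmod e < \<epsilon> \<and> f (z k) = E e" by (auto simp: N_def)
  then obtain e where e: "\<And>k. k \<in> N \<Longrightarrow> cmod (e k) < \<epsilon> \<and> f (z k) = E (e k)" by metis
  define Q where "Q k A \<longleftrightarrow> A \<noteq> 0 \<and> (\<forall>v\<in>C. cmod (A * (v - z k)) < 7/8 \<longrightarrow> f v = E (A * (v - z k) + e k))" for k A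
  have "\<forall>k\<in>N. \<exists>A. Q k A"
  proof
    fix k assume k: "k \<in> N"
    have e1: "cmod (e k) < 1" "7/8 \<le> 1 - cmod (e k)" using e[OF k] \<epsilon> by auto
    obtain A where "A \<noteq> 0" "\<And>v. v \<in> C \<Longrightarrow> cmod (A * (v - z k)) < 1 - cmod (e k) \<Longrightarrow> f v = E (A * (v - z k) + e k)"
      by (rule disc_param[OF convex_C zC f_afm E(1) e1(1) conjunct2[OF e[OF k]]]; blast)
    thus "\<exists>A. Q k A" using e1(2) unfolding Q_def by (intro exI[of _ A]) auto
  qed
  then obtain A where QA: "\<forall>k\<in>N. Q k (A k)" by (auto dest: bchoice)
  have A: "\<And>k. k \<in> N \<Longrightarrow> A k \<noteq> 0"
    "\<And>k v. k \<in> N \<Longrightarrow> v \<in> C \<Longrightarrow> cmod (A k * (v - z k)) < 7/8 \<Longrightarrow> f v = E (A k * (v - z k) + e k)"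
    using QA unfolding Q_def by blast+
  have large: "\<exists>m\<in>N. T \<le> t m" for T
  proof -
    obtain m where "m \<in> N" "m > nat \<lceil>T\<rceil>" using infN infinite_nat_iff_unbounded by blast
    thus ?thesis using t[of m] by (intro bexI[of _ m]) linarith+
  qed
  show ?thesis
  \<comment> \<open>A single such \<open>k\<close> is enough: the points
    \<open>z k + (e m - e k) / A k\<close> lie in a fixed bounded part of \<open>C\<close> and have
    the images of the \<open>z m\<close>, for all later \<open>m\<close>.\<close>
  proof (cases "\<exists>k\<in>N. c0 \<le> cmod (A k) * t k")
    case True
    then obtain k where k: "k \<in> N" "c0 \<le> cmod (A k) * t k" by blast
    have "\<exists>t'\<ge>T. \<exists>v\<in>C. cmod (v - z0) \<le> t k * cmod u + \<delta>' * t k \<and> f v = f (z0 + of_real t' * u)" for T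
    proof -
      obtain m where m: "m \<in> N" "T \<le> t m" using large by blast
      define v where "v = z k + (e m - e k) / A k"
      have de: "cmod (e m - e k) < 2 * \<epsilon>" using norm_triangle_ineq4[of "e m" "e k"] e[OF k(1)] e[OF m(1)] by linarith
      have "0 < \<delta>' * c0" using c0 \<delta>' by simp
      hence "2 * \<epsilon> < \<delta>' * c0" using \<epsilon> by linarith
      also have "\<dots> \<le> \<delta>' * (cmod (A k) * t k)" using k(2) \<delta>' by (intro mult_left_mono) auto
      finally have "cmod (e m - e k) < \<delta>' * (cmod (A k) * t k)" using de by linarith
      hence dv: "cmod ((e m - e k) / A k) < \<delta>' * t k" using A(1)[OF k(1)] by (simp add: norm_divide pos_divide_less_eq mult_ac)
      have vC: "v \<in> C" using near[OF _ dv] tpos[of k] by (simp add: v_def z_def)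
      have "A k * (v - z k) = e m - e k" using A(1)[OF k(1)] by (simp add: v_def)
      moreover have "cmod (e m - e k) < 7/8" using de \<epsilon> by linarith
      ultimately have "f v = E (e m)" using A(2)[OF k(1) vC] by simp
      also have "\<dots> = f (z0 + of_real (t m) * u)" using e[OF m(1)] by (simp add: z_def)
      finally have "f v = f (z0 + of_real (t m) * u)" .
      moreover have "cmod (v - z0) \<le> t k * cmod u + \<delta>' * t k"
        using norm_triangle_ineq[of "of_real (t k) * u" "(e m - e k) / A k"] dv tpos[of k]
        by (simp add: v_def z_def norm_mult)
      ultimately show ?thesis using m(2) vC by blast
    qed
    thus ?thesis using that by blast
  next
    case False
    hence small: "cmod (A k) * t k < c0" if "k \<in> N" for k using that by auto
    have loc: "cmod (A k * (v - z k)) < 7/8" if "k \<in> N" "cmod (v - z0) < cmod u" for k v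
    proof -
      have "cmod (v - z k) \<le> cmod (v - z0) + t k * cmod u"
        using norm_triangle_ineq4[of "v - z0" "of_real (t k) * u"] tpos[of k] by (simp add: z_def norm_mult algebra_simps)
      also have "\<dots> \<le> t k * (2 * cmod u)"
      proof -
        have "1 * cmod u \<le> t k * cmod u" using tpos[of k] by (intro mult_right_mono) auto
        thus ?thesis using that(2) by (simp add: algebra_simps)
      qed
      finally have "cmod (A k) * cmod (v - z k) \<le> cmod (A k) * (t k * (2 * cmod u))" by (intro mult_left_mono) auto
      also have "\<dots> = (cmod (A k) * t k) * (2 * cmod u)" by simp
      also have "\<dots> < c0 * (2 * cmod u)" using small[OF that(1)] u by (intro mult_strict_right_mono) auto
      also have "\<dots> = 1/2" using u by (simp add: c0_def)
      finally show ?thesis by (simp add: norm_mult)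
    qed
    obtain r where r: "r > 0" "ball z0 r \<subseteq> C" using open_C z0 by (meson open_contains_ball)
    define h where "h = complex_of_real (min r (cmod u) / 2)"
    have mpos: "0 < min r (cmod u)" using r u by simp
    have hn: "cmod h = min r (cmod u) / 2" using mpos by (simp add: h_def)
    have h: "h \<noteq> 0" "cmod h < r" "cmod h < cmod u" using mpos hn by (auto simp del: min_less_iff_conj)
    have hC: "z0 + h \<in> C" using r(2) h by (auto simp: dist_norm)
    \<comment> \<open>All discs now cover the same neighbourhood of \<open>z0\<close>, and
      injectivity of \<open>E\<close> makes the corresponding affine maps equal. A constant
      \<open>|A k|\<close> contradicts \<open>|A k| * t k < c0\<close>, since \<open>t k\<close> is
      unbounded.\<close>
    have same: "A k = A m" if "k \<in> N" "m \<in> N" for k m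
    proof -
      have *: "A k * (v - z k) + e k = A m * (v - z m) + e m" if v: "v \<in> C" "cmod (v - z0) < cmod u" for v
      proof -
        have "cmod (A i * (v - z i) + e i) < 1" if "i \<in> N" for i
          using loc[OF that v(2)] e[OF that] \<epsilon> norm_triangle_ineq[of "A i * (v - z i)" "e i"] by linarith
        moreover have "E (A k * (v - z k) + e k) = E (A m * (v - z m) + e m)"
          using A(2)[OF _ v(1) loc[OF _ v(2)]] \<open>k \<in> N\<close> \<open>m \<in> N\<close> by metis
        ultimately show ?thesis using \<open>k \<in> N\<close> \<open>m \<in> N\<close> by (intro inj_onD[OF E(2)]) auto
      qed
      have "(A k - A m) * h = (A k * (z0 + h - z k) + e k - (A m * (z0 + h - z m) + e m)) -
        (A k * (z0 - z k) + e k - (A m * (z0 - z m) + e m))"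
        by (simp add: algebra_simps)
      also have "\<dots> = 0" using *[OF hC] *[OF z0] h u by simp
      finally show ?thesis using h by simp
    qed
    obtain k where k: "k \<in> N" using infN by (metis finite.emptyI ex_in_conv)
    obtain m where m: "m \<in> N" "c0 / cmod (A k) \<le> t m" using large by blast
    hence "c0 \<le> cmod (A m) * t m" using A(1)[OF k] same[OF k m(1)] by (simp add: field_simps)
    thus ?thesis using small[OF m(1)] by simp
  qed
qed

text \<open>\<open>C\<close> is not invariant under a homothety, so the symmetry is required only
  where both points lie in \<open>C\<close>. These partial symmetries behave like a group thanks to
  \<open>deep\<close>.\<close>

definition sym :: "real \<Rightarrow> complex \<Rightarrow> bool" where
  "sym s b \<longleftrightarrow> s > 0 \<and> (\<forall>v\<in>C. of_real s * v + b \<in> C \<longrightarrow> f (of_real s * v + b) = f v)"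

lemma symD: "sym s b \<Longrightarrow> v \<in> C \<Longrightarrow> of_real s * v + b \<in> C \<Longrightarrow> f (of_real s * v + b) = f v"
  by (simp add: sym_def)

text \<open>The intersection of \<open>C\<close> with its preimage under an affine map is convex, so
  a symmetry known as a germ at one point holds on all of it.\<close>

lemma affine_extend:
  assumes A: "A \<noteq> 0" and z: "z \<in> C" "A * z + b \<in> C" "\<forall>\<^sub>F v in nhds z. f (A * v + b) = f v"
    and v: "v \<in> C" "A * v + b \<in> C"
  shows "\<forall>\<^sub>F v in nhds v. f (A * v + b) = f v"
proof (rule identity_principle[OF developing_simps(1), of "C \<inter> (\<lambda>v. A * v + b) -` C"])
  have "convex ((\<lambda>v. A * v + b) -` C)"
  proof -
    have "(\<lambda>v. A * v + b) -` C = (\<lambda>v. A * v) -` ((\<lambda>x. - b + x) ` C)"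
      by (auto simp: image_iff algebra_simps)
    thus ?thesis
      using convex_C by (auto intro!: convex_linear_vimage convex_translation bounded_linear.linear bounded_linear_mult_right)
  qed
  thus "connected (C \<inter> (\<lambda>v. A * v + b) -` C)" by (intro convex_connected convex_Int convex_C)
  show "afm_at (\<lambda>z. z) (\<lambda>v. f (A * v + b)) w" if "w \<in> C \<inter> (\<lambda>v. A * v + b) -` C" for w
    by (rule afm_at_comp[where d="\<lambda>z. z" and A=A and B=b]) (use that f_afm A in \<open>auto intro!: continuous_intros\<close>)
qed (use assms f_afm in auto)

lemma symI_local:
  assumes s: "s > 0" and z: "z \<in> C" "of_real s * z + b \<in> C" "\<forall>\<^sub>F v in nhds z. f (of_real s * v + b) = f v"
  shows "sym s b"
  unfolding sym_def using s affine_extend[OF _ z] eventually_nhds_x_imp_x by fastforce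

text \<open>Near a fixed point \<open>q\<close> a symmetry pairs nearby points with equal images, so
  local injectivity makes it the identity there and hence everywhere.\<close>

lemma affine_fixpoint:
  assumes A: "A \<noteq> 0" and z: "z \<in> C" "A * z + b \<in> C" "\<forall>\<^sub>F v in nhds z. f (A * v + b) = f v"
    and q: "q \<in> C" "A * q + b = q"
  shows "A = 1 \<and> b = 0"
proof -
  have "\<forall>\<^sub>F v in nhds q. f (A * v + b) = f v" using affine_extend[OF A z] q by simp
  moreover have "\<forall>\<^sub>F v in nhds q. f v = f (A * v + b) \<longleftrightarrow> v = A * v + b"
    using eventually_nhds_prod_along[where w=q and g="\<lambda>v. A * v + b" and P="\<lambda>x y. f x = f y \<longleftrightarrow> x = y"]
      locally_injective[OF developing_simps(1) f_afm[OF q(1)]] q(2)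
    by (auto intro!: continuous_intros)
  ultimately have "\<forall>\<^sub>F v in nhds q. A * v + b = v" by eventually_elim metis
  thus ?thesis by (rule developing_affine_unique[OF developing_simps(1)])
qed

lemma sym_local: "sym s b \<Longrightarrow> v \<in> C \<Longrightarrow> of_real s * v + b \<in> C \<Longrightarrow> \<forall>\<^sub>F v in nhds v. f (of_real s * v + b) = f v"
proof -
  assume *: "sym s b" "v \<in> C" "of_real s * v + b \<in> C"
  have "open (C \<inter> (\<lambda>v. of_real s * v + b) -` C)" by (intro open_Int open_C open_vimage continuous_intros)
  hence "\<forall>\<^sub>F w in nhds v. w \<in> C \<inter> (\<lambda>v. of_real s * v + b) -` C" using * by (intro eventually_nhds_in_open) auto
  thus ?thesis by eventually_elim (use symD[OF *(1)] in auto)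
qed

lemma sym_fix: "sym s b \<Longrightarrow> v \<in> C \<Longrightarrow> of_real s * v + b = v \<Longrightarrow> s = 1 \<and> b = 0"
  using affine_fixpoint[of "of_real s" v b v] sym_local[of s b v] by (auto simp: sym_def)

lemma sym_id: "sym 1 0"
  by (simp add: sym_def)

text \<open>\<open>deep\<close> provides a point where the two maps and their composite are all
  defined; the local identity there is enough by \<open>symI_local\<close>.\<close>

lemma sym_comp:
  assumes "sym s b" "sym s' b'"
  shows "sym (s * s') (of_real s * b' + b)"
proof -
  have s: "s > 0" "s' > 0" using assms by (auto simp: sym_def)
  have "\<forall>\<^sub>F t in at_top. of_real 1 * (z0 + of_real t * u0) + 0 \<in> C \<and> of_real s' * (z0 + of_real t * u0) + b' \<in> C \<and>
      of_real (s * s') * (z0 + of_real t * u0) + (of_real s * b' + b) \<in> C"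
    using s by (intro eventually_conj deep) auto
  then obtain t where "z0 + of_real t * u0 \<in> C" "of_real s' * (z0 + of_real t * u0) + b' \<in> C"
      "of_real (s * s') * (z0 + of_real t * u0) + (of_real s * b' + b) \<in> C"
    by (auto simp: eventually_at_top_linorder)
  then obtain z where z: "z \<in> C" "of_real s' * z + b' \<in> C" "of_real (s * s') * z + (of_real s * b' + b) \<in> C" by blast
  have eq: "of_real s * (of_real s' * v + b') + b = of_real (s * s') * v + (of_real s * b' + b)" for v
    by (simp add: algebra_simps)
  have 1: "\<forall>\<^sub>F v in nhds z. f (of_real s' * v + b') = f v" by (rule sym_local[OF assms(2) z(1,2)])
  have "\<forall>\<^sub>F v in nhds (of_real s' * z + b'). f (of_real s * v + b) = f v"
    using sym_local[OF assms(1) z(2)] z(3) eq[of z] by simp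
  hence 2: "\<forall>\<^sub>F v in nhds z. f (of_real s * (of_real s' * v + b') + b) = f (of_real s' * v + b')"
    by (rule nhds_transport) (intro continuous_intros)
  from 1 2 have "\<forall>\<^sub>F v in nhds z. f (of_real (s * s') * v + (of_real s * b' + b)) = f v"
    by eventually_elim (use eq in metis)
  thus ?thesis using s z by (intro symI_local[of _ z]) auto
qed

lemma sym_inv:
  assumes "sym s b"
  shows "sym (1 / s) (- b / of_real s)"
proof -
  have s: "s > 0" using assms by (simp add: sym_def)
  have "f (of_real (1 / s) * v + - b / of_real s) = f v"
    if "v \<in> C" "of_real (1 / s) * v + - b / of_real s \<in> C" for v
    using symD[OF assms that(2)] that s by (simp add: field_simps)
  thus ?thesis using s by (simp add: sym_def)
qed

lemma sym_discrete:
  assumes z: "z \<in> C"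
  obtains r where "r > 0" "\<And>s b. sym s b \<Longrightarrow> cmod (of_real s * z + b - z) < r \<Longrightarrow> s = 1 \<and> b = 0"
proof -
  have "\<forall>\<^sub>F p in nhds z \<times>\<^sub>F nhds z. f (fst p) = f (snd p) \<longleftrightarrow> fst p = snd p"
    by (rule locally_injective[OF developing_simps(1) f_afm[OF z]])
  then obtain P Q where PQ: "eventually P (nhds z)" "eventually Q (nhds z)" "\<And>x y. P x \<Longrightarrow> Q y \<Longrightarrow> f x = f y \<longleftrightarrow> x = y"
    unfolding eventually_prod_filter by auto
  have "\<forall>\<^sub>F v in nhds z. v \<in> C" using open_C z by (rule eventually_nhds_in_open)
  from eventually_conj[OF PQ(2) this]
  obtain r where r: "r > 0" "\<And>v. dist v z < r \<Longrightarrow> Q v \<and> v \<in> C" unfolding eventually_nhds_metric by blast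
  have "s = 1 \<and> b = 0" if "sym s b" "cmod (of_real s * z + b - z) < r" for s b
  proof -
    have v: "Q (of_real s * z + b)" "of_real s * z + b \<in> C" using r(2) that(2) by (auto simp: dist_norm)
    hence "f z = f (of_real s * z + b)" using symD[OF that(1) z] by simp
    hence "of_real s * z + b = z" using PQ(3) eventually_nhds_x_imp_x[OF PQ(1)] v(1) by metis
    thus ?thesis using sym_fix[OF that(1) z] by simp
  qed
  thus ?thesis using that r(1) by blast
qed

text \<open>The time interval is the whole chord of \<open>C\<close> through the two points, so that
  the times 0 and 1 are interior, as \<open>self_intersecting\<close> demands.\<close>

lemma segment_trajectory:
  assumes z: "z \<in> C" "w \<in> C" "z \<noteq> w"
  shows "trajectory X \<Lambda> \<A> {t. z + of_real t * (w - z) \<in> C} (\<lambda>t. f (z + of_real t * (w - z)))"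
proof -
  let ?I = "{t. z + of_real t * (w - z) \<in> C}" and ?g = "\<lambda>t. z + complex_of_real t * (w - z)"
  have I: "?I = ?g -` C" by auto
  have opI: "open ?I" unfolding I by (intro open_vimage open_C continuous_intros)
  have "convex ?I"
  proof (rule convexI)
    fix s t a b :: real assume *: "s \<in> ?I" "t \<in> ?I" "0 \<le> a" "0 \<le> b" "a + b = 1"
    have "a *\<^sub>R ?g s + b *\<^sub>R ?g t \<in> C" using * by (intro convexD[OF convex_C]) auto
    moreover have "a *\<^sub>R ?g s + b *\<^sub>R ?g t = of_real (a + b) * z + of_real (a * s + b * t) * (w - z)"
      by (simp add: scaleR_conv_of_real algebra_simps)
    ultimately show "a *\<^sub>R s + b *\<^sub>R t \<in> ?I" using *(5) by simp
  qed
  hence "is_interval ?I" by (simp add: is_interval_convex_1)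
  moreover have "interior ?I \<noteq> {}" using opI z(1) by (auto simp: interior_open intro: exI[of _ 0])
  moreover have "continuous_map (top_of_set ?I) X (\<lambda>t. f (?g t))"
  proof -
    have "continuous_map (top_of_set C) X f" by (rule afm_at_continuous_map[OF developing_simps(1) f_afm])
    moreover have "continuous_map (top_of_set ?I) (top_of_set C) ?g"
      by (auto intro!: continuous_intros)
    ultimately show ?thesis using continuous_map_compose[of "top_of_set ?I" "top_of_set C" ?g X f] by (simp add: o_def)
  qed
  moreover have "\<exists>\<phi> u. straight_at (regular_part X \<Lambda>) \<A> (\<lambda>t. f (?g t)) t \<phi> u" if "t \<in> interior ?I" for t
  proof -
    have t: "?g t \<in> C" using that interior_subset by blast
    obtain U \<phi> where ch: "(U, \<phi>) \<in> \<A>" "f (?g t) \<in> U" using chart_cover afm_at_in_M[OF f_afm[OF t]] by blast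
    obtain a b where "a \<noteq> 0" "\<forall>\<^sub>F v in nhds (?g t). f v \<in> U \<and> \<phi> (f v) = a * v + b"
      by (rule afm_at_chart[OF developing_simps(1) f_afm[OF t] ch])
    thus ?thesis using straight_at_line[where F=f and z=z and t=t and dv="w - z" and a=a and b=b, OF ch(1)] z(3) by auto
  qed
  ultimately show ?thesis unfolding trajectory_def by blast
qed

text \<open>
  The segment from \<open>z\<close> to \<open>w\<close> is a trajectory through \<open>f z = f w\<close>, so the transition has a real
  linear part; a fixed point of the transition in \<open>C\<close> would contradict local injectivity.
\<close>

lemma collision_sym:
  assumes z: "z \<in> C" "w \<in> C" "z \<noteq> w" "f z = f w"
  obtains s b where "sym s b" "of_real s * z + b = w"
proof -
  obtain A B where AB: "A \<noteq> 0" "w = A * z + B"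
    "\<forall>\<^sub>F p in nhds z \<times>\<^sub>F nhds w. f (fst p) = f (snd p) \<longleftrightarrow> A * (fst p) + B = (snd p)"
    by (rule transition[OF developing_simps(1,1) f_afm[OF z(1)] f_afm[OF z(2)] z(4)])
  have ev: "\<forall>\<^sub>F v in nhds z. f v = f (A * v + B) \<longleftrightarrow> A * v + B = A * v + B"
    by (rule eventually_nhds_prod_along[where P="\<lambda>v x. f v = f x \<longleftrightarrow> A * v + B = x" and g="\<lambda>v. A * v + B"])
      (use AB(2,3) in \<open>auto intro!: continuous_intros\<close>)
  hence ev: "\<forall>\<^sub>F v in nhds z. f (A * v + B) = f v" by eventually_elim simp
  let ?\<gamma> = "\<lambda>t. f (z + of_real t * (w - z))" and ?I = "{t. z + of_real t * (w - z) \<in> C}"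
  obtain U \<phi> where ch: "(U, \<phi>) \<in> \<A>" "f z \<in> U" using chart_cover afm_at_in_M[OF f_afm[OF z(1)]] by blast
  obtain a b where ab: "a \<noteq> 0" "\<forall>\<^sub>F v in nhds z. f v \<in> U \<and> \<phi> (f v) = a * v + b"
    by (rule afm_at_chart[OF developing_simps(1) f_afm[OF z(1)] ch])
  have ch': "f w \<in> U" using ch z by simp
  obtain a' b' where ab': "a' \<noteq> 0" "\<forall>\<^sub>F v in nhds w. f v \<in> U \<and> \<phi> (f v) = a' * v + b'"
    by (rule afm_at_chart[OF developing_simps(1) f_afm[OF z(2)] ch(1) ch'])
  have "\<forall>\<^sub>F v in nhds (A * z + B). f v \<in> U \<and> \<phi> (f v) = a' * v + b'" using ab'(2) AB(2) by simp
  hence "\<forall>\<^sub>F v in nhds z. f (A * v + B) \<in> U \<and> \<phi> (f (A * v + B)) = a' * (A * v + B) + b'"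
    by (rule nhds_transport) (intro continuous_intros)
  with ev ab(2) have "\<forall>\<^sub>F v in nhds z. a * v + b = a' * (A * v + B) + b'"
    by eventually_elim auto
  hence "\<forall>\<^sub>F v in nhds z. (a' * A / a) * v + (a' * B + b' - b) / a = v"
  proof eventually_elim
    case (elim v)
    have "(a' * A / a) * v + (a' * B + b' - b) / a = (a' * (A * v + B) + b' - b) / a"
      by (simp add: add_divide_distrib diff_divide_distrib algebra_simps)
    also have "\<dots> = v" using elim[symmetric] ab(1) by simp
    finally show ?case .
  qed
  from developing_affine_unique[OF developing_simps(1) this] have aA: "a = a' * A" using ab(1) by simp
  have "openin X (f ` C)" by (rule afm_open_image[OF developing_simps(1) f_afm open_C])
  have ns: "\<not> self_intersecting X \<Lambda> \<A> ?I ?\<gamma>" by (rule no_self_intersection[OF segment_trajectory[OF z(1-3)]])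
  have "open ?I"
  proof -
    have "?I = (\<lambda>t. z + complex_of_real t * (w - z)) -` C" by auto
    moreover have "open ((\<lambda>t. z + complex_of_real t * (w - z)) -` C)" by (intro open_vimage open_C continuous_intros)
    ultimately show ?thesis by simp
  qed
  hence int: "0 \<in> interior ?I" "1 \<in> interior ?I" using z by (auto simp: interior_open)
  have str: "straight_at (regular_part X \<Lambda>) \<A> ?\<gamma> 0 \<phi> (a * (w - z))"
    "straight_at (regular_part X \<Lambda>) \<A> ?\<gamma> 1 \<phi> (a' * (w - z))"
    using straight_at_line[where F=f and z=z and t=0 and dv="w - z" and a=a and b=b, OF ch(1)]
      straight_at_line[where F=f and z=z and t=1 and dv="w - z" and a=a' and b=b', OF ch(1)] ab ab' z(3) by simp_all
  have "\<exists>c::real. a' * (w - z) = of_real c * (a * (w - z))"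
  proof (rule ccontr)
    assume "\<not> ?thesis"
    hence "\<forall>c::real. a' * (w - z) \<noteq> of_real c * (a * (w - z))" by blast
    moreover have "?\<gamma> 0 = ?\<gamma> 1" using z(4) by simp
    ultimately have body: "(0::real) \<noteq> 1 \<and> ?\<gamma> 0 = ?\<gamma> 1 \<and>
      straight_at (regular_part X \<Lambda>) \<A> ?\<gamma> 0 \<phi> (a * (w - z)) \<and>
      straight_at (regular_part X \<Lambda>) \<A> ?\<gamma> 1 \<phi> (a' * (w - z)) \<and>
      (\<forall>c::real. a' * (w - z) \<noteq> of_real c * (a * (w - z)))" using str by simp
    have "self_intersecting X \<Lambda> \<A> ?I ?\<gamma>"
      unfolding self_intersecting_def
      by (rule bexI[OF _ int(1)], rule bexI[OF _ int(2)], rule exI, rule exI, rule exI, rule body)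
    thus False using ns by blast
  qed
  then obtain c :: real where "a' = of_real c * a" using z(3) by auto
  hence "a' * (of_real c * A) = a' * 1" using aA by simp
  hence cA: "of_real c * A = 1" using ab'(1) by (metis mult_cancel_left)
  hence "c \<noteq> 0" by auto
  define s where "s = 1 / c"
  have s: "A = of_real s" "s \<noteq> 0" using \<open>c \<noteq> 0\<close> cA by (simp_all add: s_def field_simps)
  have "s > 0"
  proof (rule ccontr)
    assume "\<not> s > 0"
    hence neg: "s < 0" using s(2) by simp
    \<comment> \<open>The fixed point of the transition: with negative ratio \<open>s\<close> it
      lies on the segment from \<open>z\<close> to \<open>w\<close>, at parameter
      \<open>1 / (1 - s)\<close>.\<close>
    define q where "q = z + of_real (1 / (1 - s)) * (w - z)"
    define t where "t = 1 / (1 - s)"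
    have "q = (1 - t) *\<^sub>R z + t *\<^sub>R w"
      unfolding q_def t_def[symmetric] by (simp add: scaleR_conv_of_real algebra_simps)
    moreover have "0 \<le> t" "t \<le> 1" using neg by (auto simp: t_def)
    ultimately have "q \<in> C" using convexD_alt[OF convex_C z(1,2), of t] by simp
    moreover have "A * q + B = q"
    proof -
      have "A * q + B = w + of_real s * of_real (1 / (1 - s)) * (w - z)"
        using AB(2) s(1) by (simp add: q_def algebra_simps)
      moreover have "w + of_real s * of_real (1 / (1 - s)) * (w - z) - q = (1 + of_real s * of_real (1 / (1 - s)) - of_real (1 / (1 - s))) * (w - z)"
        by (simp add: q_def algebra_simps)
      moreover have "1 + s * (1 / (1 - s)) - 1 / (1 - s) = 0" using neg by (simp add: field_simps)
      hence "1 + of_real s * of_real (1 / (1 - s)) - of_real (1 / (1 - s)) = (0::complex)"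
        by (metis of_real_0 of_real_1 of_real_add of_real_diff of_real_mult)
      ultimately show ?thesis by simp
    qed
    ultimately have "A = 1 \<and> B = 0" using affine_fixpoint[OF AB(1) z(1) _ ev] AB(2) z(2) by blast
    thus False using s(1) neg by simp
  qed
  hence "sym s B" using symI_local[OF _ z(1), of s B] ev AB(2) s(1) z(2) by auto
  thus ?thesis using that AB(2) s(1) by simp
qed

end

section \<open>Absence of translations and the common centre of the homotheties\<close>

context conic_immersion
begin

text \<open>The two products of a pair of homotheties have the same ratio, so one times the inverse
  of the other is a translation.\<close>

lemma sym_inv': "sym s b \<Longrightarrow> sym s' b' \<Longrightarrow> sym 1 (of_real s * b' + b - (of_real s' * b + b'))"
proof -
  assume *: "sym s b" "sym s' b'"
  hence s: "s > 0" "s' > 0" by (auto simp: sym_def)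
  have "sym ((s * s') * (1 / (s' * s)))
     (of_real (s * s') * (- (of_real s' * b + b') / of_real (s' * s)) + (of_real s * b' + b))"
    by (rule sym_comp[OF sym_comp[OF *] sym_inv[OF sym_comp[OF *(2,1)]]])
  moreover have e1: "(s * s') * (1 / (s' * s)) = 1" using s by simp
  moreover have e2: "of_real (s * s') * (- (of_real s' * b + b') / of_real (s' * s)) = - (of_real s' * b + b')"
    using s by (simp add: mult.commute)
  ultimately have "sym 1 (- (of_real s' * b + b') + (of_real s * b' + b))" by (simp only:)
  thus ?thesis by (simp only: diff_conv_add_uminus add.commute)
qed

lemma sym_translation_int:
  assumes "sym 1 v"
  shows "sym 1 (of_int m * v)"
proof -
  have nat: "sym 1 (of_nat n * w)" if "sym 1 w" for n w
  proof (induction n)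
    case (Suc n)
    from sym_comp[OF that Suc] show ?case by (simp add: algebra_simps)
  qed (simp add: sym_id)
  have neg: "sym 1 (- v)" using sym_inv[OF assms] by simp
  show ?thesis
  proof (cases "m \<ge> 0")
    case True
    thus ?thesis using nat[OF assms, of "nat m"] by simp
  next
    case False
    thus ?thesis using nat[OF neg, of "nat (- m)"] by simp
  qed
qed

text \<open>Two independent translations would make the image of \<open>f\<close> compact.\<close>

lemma no_lattice:
  assumes v: "sym 1 v" "sym 1 b" "v \<noteq> 0"
  shows "Im (b / v) = 0"
proof (rule ccontr)
  assume ind: "Im (b / v) \<noteq> 0"
  have "\<forall>\<^sub>F t in at_top. of_real 1 * (z0 + of_real t * u0) + 0 \<in> C \<and> of_real 1 * (z0 + of_real t * u0) + v \<in> C \<and>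
      of_real 1 * (z0 + of_real t * u0) + b \<in> C \<and> of_real 1 * (z0 + of_real t * u0) + (v + b) \<in> C"
    by (intro eventually_conj deep) auto
  then obtain t where "z0 + of_real t * u0 \<in> C" "z0 + of_real t * u0 + v \<in> C"
    "z0 + of_real t * u0 + b \<in> C" "z0 + of_real t * u0 + (v + b) \<in> C"
    by (auto simp: eventually_at_top_linorder)
  then obtain d where d: "d \<in> C" "d + v \<in> C" "d + b \<in> C" "d + (v + b) \<in> C" by blast
  \<comment> \<open>A parametrized fundamental parallelogram of the lattice. Its corners lie in
    \<open>C\<close>, so by convexity all of it does.\<close>
  define g where "g = (\<lambda>p. d + complex_of_real (fst p) * v + complex_of_real (snd p) * b)"
  define K where "K = g ` ({0..1} \<times> {0..1})"
  have KC: "K \<subseteq> C"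
  proof
    fix k assume "k \<in> K"
    then obtain x y where xy: "0 \<le> x" "x \<le> 1" "0 \<le> y" "y \<le> 1" "k = d + of_real x * v + of_real y * b"
      by (auto simp: K_def g_def)
    have "(1 - x) *\<^sub>R d + x *\<^sub>R (d + v) \<in> C" "(1 - x) *\<^sub>R (d + b) + x *\<^sub>R (d + (v + b)) \<in> C"
      using xy d by (auto intro!: convexD_alt[OF convex_C])
    hence "(1 - y) *\<^sub>R ((1 - x) *\<^sub>R d + x *\<^sub>R (d + v)) + y *\<^sub>R ((1 - x) *\<^sub>R (d + b) + x *\<^sub>R (d + (v + b))) \<in> C"
      using xy by (auto intro!: convexD_alt[OF convex_C])
    also have "(1 - y) *\<^sub>R ((1 - x) *\<^sub>R d + x *\<^sub>R (d + v)) + y *\<^sub>R ((1 - x) *\<^sub>R (d + b) + x *\<^sub>R (d + (v + b))) = k"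
      using xy(5) by (simp add: scaleR_conv_of_real algebra_simps)
    finally show "k \<in> C" .
  qed
  have "compact K" unfolding K_def g_def
    by (intro compact_continuous_image compact_Times compact_Icc continuous_intros)
  hence "compactin (top_of_set C) K" using KC by (simp add: compactin_subtopology)
  moreover have "continuous_map (top_of_set C) X f" by (rule afm_at_continuous_map[OF developing_simps(1) f_afm])
  ultimately have cK: "compactin X (f ` K)" by (rule image_compactin)
  have "f ` C \<subseteq> f ` K"
  proof
    fix x assume "x \<in> f ` C"
    then obtain \<zeta> where \<zeta>: "\<zeta> \<in> C" "x = f \<zeta>" by auto
    define Z where "Z = (\<zeta> - d) / v"
    define W where "W = b / v"
    define y where "y = Im Z / Im W"
    define x' where "x' = Re Z - y * Re W"
    have "Im W \<noteq> 0" using ind by (simp add: W_def)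
    hence Z: "Z = of_real x' + of_real y * W"
      by (intro complex_eqI) (simp_all add: x'_def y_def)
    have "\<zeta> - d = Z * v" "W * v = b" using v(3) by (simp_all add: Z_def W_def)
    hence "\<zeta> - d = of_real x' * v + of_real y * b" unfolding Z by (metis distrib_right mult.assoc)
    hence \<zeta>d: "\<zeta> = d + of_real x' * v + of_real y * b" by (simp add: algebra_simps)
    define k where "k = d + of_real (frac x') * v + of_real (frac y) * b"
    have kK: "k \<in> K" unfolding K_def
      by (intro image_eqI[of _ _ "(frac x', frac y)"]) (auto simp: g_def k_def less_imp_le[OF frac_lt_1])
    have "sym 1 (of_int \<lfloor>x'\<rfloor> * v + of_int \<lfloor>y\<rfloor> * b)"
      using sym_comp[OF sym_translation_int[OF v(1), of "\<lfloor>x'\<rfloor>"] sym_translation_int[OF v(2), of "\<lfloor>y\<rfloor>"]]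
      by (simp add: add.commute)
    moreover have "of_real 1 * k + (of_int \<lfloor>x'\<rfloor> * v + of_int \<lfloor>y\<rfloor> * b) = \<zeta>"
      by (simp add: k_def \<zeta>d frac_def algebra_simps)
    ultimately have "f \<zeta> = f k" using symD[of 1 _ k] kK KC \<zeta>(1) by fastforce
    thus "x \<in> f ` K" using \<zeta>(2) kK by auto
  qed
  hence "f ` C = f ` K" using KC by auto
  thus False using no_compact_image[OF developing_simps(1) open_C _ f_afm] cK z0 by auto
qed

text \<open>Choose an admissible ray not parallel to \<open>v\<close>. Its component transverse to
  \<open>v\<close> grows linearly, while the points of \<open>ray_returns\<close> with the same
  images stay bounded, so some collision displaces across \<open>v\<close>.\<close>

lemma collision_direction:
  assumes v: "v \<noteq> 0"
  obtains s b z where "sym s b" "z \<in> C" "of_real s * z + b \<in> C" "Im ((of_real s * z + b - z) / v) \<noteq> 0"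
proof -
  obtain u where u: "cmod (u - u0) < \<delta>" "Im (u / v) \<noteq> 0"
  proof (cases "Im (u0 / v) = 0")
    case True
    define u where "u = u0 + of_real (\<delta> / 2) * \<i> * (v / of_real (cmod v))"
    have "u / v = u0 / v + of_real (\<delta> / 2 / cmod v) * \<i>" using v by (simp add: u_def field_simps)
    hence "Im (u / v) = \<delta> / 2 / cmod v" using True by simp
    moreover have "cmod (u - u0) = \<delta> / 2" using v \<delta> by (simp add: u_def norm_mult norm_divide)
    ultimately show ?thesis using that[of u] \<delta> v by simp
  qed (use that[of u0] \<delta> in auto)
  hence u0': "u \<noteq> 0" by auto
  obtain B where B: "\<And>T. \<exists>t\<ge>T. \<exists>z\<in>C. cmod (z - z0) \<le> B \<and> f z = f (z0 + of_real t * u)"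
    using ray_returns[OF u(1) u0'] by blast
  define T where "T = \<bar>B\<bar> / (cmod v * \<bar>Im (u / v)\<bar>) + 1"
  obtain t z where tz: "t \<ge> T" "z \<in> C" "cmod (z - z0) \<le> B" "f z = f (z0 + of_real t * u)" using B by blast
  define w where "w = z0 + of_real t * u"
  have "0 \<le> \<bar>B\<bar> / (cmod v * \<bar>Im (u / v)\<bar>)" by simp
  hence "T \<ge> 1" unfolding T_def by linarith
  hence t0: "t > 0" using tz(1) by linarith
  have wC: "w \<in> C" unfolding w_def using t0 u by (intro recession z0) auto
  have "B < t * (cmod v * \<bar>Im (u / v)\<bar>)"
  proof -
    have "\<bar>B\<bar> / (cmod v * \<bar>Im (u / v)\<bar>) < t" using tz(1) by (simp add: T_def)
    thus ?thesis using u(2) v by (simp add: pos_divide_less_eq)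
  qed
  hence "B / cmod v < t * \<bar>Im (u / v)\<bar>" using v by (simp add: pos_divide_less_eq mult_ac)
  moreover have "\<bar>Im ((z0 - z) / v)\<bar> \<le> B / cmod v"
    using abs_Im_le_cmod[of "(z0 - z) / v"] tz(3) v
    by (simp add: norm_divide norm_minus_commute) (smt (verit) divide_right_mono norm_ge_zero)
  moreover have "Im ((w - z) / v) = t * Im (u / v) + Im ((z0 - z) / v)"
  proof -
    have "(w - z) / v = of_real t * (u / v) + (z0 - z) / v" using v by (simp add: w_def field_simps)
    thus ?thesis by (simp only: plus_complex.sel times_complex.sel Re_complex_of_real Im_complex_of_real mult_zero_left diff_zero)
  qed
  moreover have "\<bar>t * Im (u / v)\<bar> = t * \<bar>Im (u / v)\<bar>" using t0 by (simp add: abs_mult)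
  ultimately have Im_ne: "Im ((w - z) / v) \<noteq> 0" by linarith
  hence "z \<noteq> w" by auto
  then obtain s b where sb: "sym s b" "of_real s * z + b = w"
    using collision_sym[OF tz(2) wC] tz(4) unfolding w_def by blast
  show ?thesis using that[OF sb(1) tz(2)] sb(2) wC Im_ne by simp
qed

text \<open>A symmetry displacing across \<open>v\<close> is either a translation, giving a lattice,
  or has ratio different from 1. In the latter case conjugation by its powers produces translations
  by arbitrarily short nonzero vectors, against discreteness.\<close>

lemma no_translation:
  assumes v: "sym 1 v"
  shows "v = 0"
proof (rule ccontr)
  assume v0: "v \<noteq> 0"
  obtain s b z where sb: "sym s b" "z \<in> C" "of_real s * z + b \<in> C" "Im ((of_real s * z + b - z) / v) \<noteq> 0"
    by (rule collision_direction[OF v0])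
  have s: "s > 0" using sb by (simp add: sym_def)
  show False
  proof (cases "s = 1")
    case True
    thus False using no_lattice[OF v _ v0, of b] sb by simp
  next
    case False
    obtain s' b' where s': "sym s' b'" "0 < s'" "s' < 1"
    proof (cases "s < 1")
      case True
      thus ?thesis using that[OF sb(1)] s by simp
    next
      case False
      thus ?thesis using that[OF sym_inv[OF sb(1)]] s \<open>s \<noteq> 1\<close> by simp
    qed
    have conj: "sym 1 (of_real s' * w)" if "sym 1 w" for w
    proof -
      have "sym (s' * 1 * (1 / s')) (of_real (s' * 1) * (- b' / of_real s') + (of_real s' * w + b'))"
        by (rule sym_comp[OF sym_comp[OF s'(1) that] sym_inv[OF s'(1)]])
      thus ?thesis using s' by simp
    qed
    have pow: "sym 1 (of_real (s' ^ n) * v)" for n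
    proof (induction n)
      case (Suc n)
      from conj[OF Suc] show ?case by (simp add: mult_ac)
    qed (simp add: v)
    obtain r where r: "r > 0" "\<And>s b. sym s b \<Longrightarrow> cmod (of_real s * z0 + b - z0) < r \<Longrightarrow> s = 1 \<and> b = 0"
      using sym_discrete[OF z0] by blast
    obtain n where "s' ^ n < r / cmod v" using real_arch_pow_inv[of "r / cmod v" s'] r(1) v0 s' by auto
    hence "cmod (of_real (s' ^ n) * v) < r" using v0 s' by (simp add: norm_mult pos_less_divide_eq norm_power)
    hence "of_real (s' ^ n) * v = 0" using r(2)[OF pow[of n]] by simp
    thus False using s' v0 by simp
  qed
qed

text \<open>
  Commutators of homotheties are translations, so all symmetries share their centre; discreteness
  makes the group of ratios cyclic.
\<close>

lemma homothety_group:
  obtains l q where "l > 1" "q \<notin> C" "\<forall>s b. sym s b \<longleftrightarrow> (\<exists>k::int. s = l powi k \<and> b = (1 - of_real s) * q)"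
proof -
  \<comment> \<open>The direction 1 is immaterial: a nonzero displacement suffices, since ratio 1
    would make the symmetry a translation and hence the identity.\<close>
  obtain s1 b1 z1 where 1: "sym s1 b1" "z1 \<in> C" "of_real s1 * z1 + b1 \<in> C" "Im ((of_real s1 * z1 + b1 - z1) / 1) \<noteq> 0"
    using collision_direction[of 1] by auto
  have s1: "s1 > 0" using 1(1) by (simp add: sym_def)
  have s11: "s1 \<noteq> 1"
  proof
    assume "s1 = 1"
    hence "b1 = 0" using no_translation 1(1) by simp
    thus False using 1(4) \<open>s1 = 1\<close> by simp
  qed
  define q where "q = b1 / (1 - of_real s1)"
  have ne: "1 - complex_of_real s1 \<noteq> 0" using s11 by (metis of_real_1 of_real_eq_iff right_minus_eq)
  have b1: "b1 = (1 - of_real s1) * q" using ne by (simp add: q_def)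
  have centre: "b = (1 - of_real s) * q" if "sym s b" for s b
  proof -
    have "of_real s * b1 + b - (of_real s1 * b + b1) = 0" using no_translation[OF sym_inv'[OF that 1(1)]] .
    hence "(1 - of_real s1) * b = (1 - of_real s1) * ((1 - of_real s) * q)"
      by (simp add: b1 algebra_simps)
    thus ?thesis using ne by simp
  qed
  have qC: "q \<notin> C"
  proof
    assume "q \<in> C"
    moreover have "of_real s1 * q + b1 = q" by (simp add: b1 algebra_simps)
    ultimately show False using sym_fix[OF 1(1)] s11 by blast
  qed
  define R where "R = {s. sym s ((1 - of_real s) * q)}"
  have R: "sym s b \<longleftrightarrow> s \<in> R \<and> b = (1 - of_real s) * q" for s b
    using centre unfolding R_def by blast
  have R_pos: "s > 0" if "s \<in> R" for s using that by (simp add: R_def sym_def)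
  have R_mult: "s * s' \<in> R" if "s \<in> R" "s' \<in> R" for s s'
  proof -
    have h: "sym (s * s') (of_real s * ((1 - of_real s') * q) + (1 - of_real s) * q)"
      using that unfolding R_def by (intro sym_comp) auto
    show ?thesis unfolding R_def mem_Collect_eq centre[OF h, symmetric] by (rule h)
  qed
  have R_inv: "1 / s \<in> R" if "s \<in> R" for s
  proof -
    have h: "sym (1 / s) (- ((1 - of_real s) * q) / of_real s)"
      using that unfolding R_def by (intro sym_inv) auto
    show ?thesis unfolding R_def mem_Collect_eq centre[OF h, symmetric] by (rule h)
  qed
  have R1: "1 \<in> R" using sym_id by (simp add: R_def)
  have R_pow: "s powi k \<in> R" if "s \<in> R" for s and k :: int
  proof -
    have n: "s ^ n \<in> R" if "s \<in> R" for s n by (induction n) (use that R1 R_mult in auto)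
    show ?thesis
      using n[OF that] n[OF R_inv[OF that]] by (cases "k \<ge> 0") (auto simp: power_int_def divide_inverse)
  qed
  obtain r where r: "r > 0" "\<And>s b. sym s b \<Longrightarrow> cmod (of_real s * z0 + b - z0) < r \<Longrightarrow> s = 1 \<and> b = 0"
    using sym_discrete[OF z0] by blast
  define \<epsilon> where "\<epsilon> = r / (cmod (z0 - q) + 1)"
  have c1: "cmod (z0 - q) + 1 > 0" using norm_ge_zero[of "z0 - q"] by linarith
  have \<epsilon>: "\<epsilon> > 0" using r(1) c1 by (simp add: \<epsilon>_def)
  have disc: "s = 1" if "s \<in> R" "\<bar>s - 1\<bar> < \<epsilon>" for s
  proof -
    have "of_real s * z0 + (1 - of_real s) * q - z0 = of_real (s - 1) * (z0 - q)" by (simp add: algebra_simps)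
    hence "cmod (of_real s * z0 + (1 - of_real s) * q - z0) = \<bar>s - 1\<bar> * cmod (z0 - q)"
      by (simp add: norm_mult del: of_real_diff)
    also have "\<dots> \<le> \<bar>s - 1\<bar> * (cmod (z0 - q) + 1)" by (intro mult_left_mono) auto
    also have "\<dots> < \<epsilon> * (cmod (z0 - q) + 1)" using that(2) c1 by (intro mult_strict_right_mono)
    also have "\<dots> = r" using c1 by (simp add: \<epsilon>_def)
    finally show ?thesis using r(2) that(1) unfolding R_def by blast
  qed
  have "s1 \<in> R" using R 1(1) by blast
  moreover from this have "1 / s1 \<in> R" by (rule R_inv)
  moreover have "s1 > 1 \<or> 1 / s1 > 1" using s1 s11 by auto
  ultimately have "\<exists>s\<in>R. s > 1" by blast
  hence neR: "R \<inter> {1<..} \<noteq> {}" by auto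
  define m where "m = Inf (R \<inter> {1<..})"
  have bdd: "bdd_below (R \<inter> {1<..})" by (intro bdd_belowI[of _ 1]) auto
  have m1: "m \<ge> 1" unfolding m_def using neR by (intro cInf_greatest) auto
  \<comment> \<open>An element within the factor \<open>1 + \<epsilon>\<close> of the infimum is
    already the least one: a smaller element \<open>s > 1\<close> would give a ratio
    \<open>l / s\<close> strictly between 1 and \<open>1 + \<epsilon>\<close>, excluded by
    \<open>disc\<close>.\<close>
  have "m < m * (1 + \<epsilon>)" using m1 \<epsilon> by simp
  then obtain l where l: "l \<in> R" "l > 1" "l < m * (1 + \<epsilon>)"
    using cInf_lessD[OF neR, of "m * (1 + \<epsilon>)"] by (auto simp: m_def)
  have l_min: "l \<le> s" if "s \<in> R" "s > 1" for s
  proof (rule ccontr)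
    assume "\<not> l \<le> s"
    hence sl: "s < l" by simp
    have "m \<le> s" unfolding m_def using that bdd by (intro cInf_lower) auto
    hence "l < s * (1 + \<epsilon>)" using l(3) \<epsilon> m1 by (smt (verit) mult_right_mono)
    hence "l / s < 1 + \<epsilon>" using that by (simp add: pos_divide_less_eq mult.commute)
    moreover have "1 < l / s" using sl that by simp
    moreover have "l / s \<in> R" using R_mult[OF l(1) R_inv[OF that(1)]] by simp
    ultimately show False using disc[of "l / s"] by simp
  qed
  have all: "\<exists>k::int. s = l powi k" if s: "s \<in> R" for s
  proof -
    define k where "k = \<lfloor>log l s\<rfloor>"
    have sp: "s > 0" by (rule R_pos[OF s])
    have "l powr of_int k \<le> s" using l(2) sp by (simp add: k_def powr_le_iff)
    moreover have "s < l powr (of_int k + 1)" using l(2) sp by (subst less_powr_iff) (auto simp: k_def)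
    moreover have pk: "l powr of_int k = l powi k" using l(2) by (simp add: powr_real_of_int')
    ultimately have "l powi k \<le> s" "s < l powi k * l" using l(2) by (simp_all add: powr_add)
    moreover have pp: "l powi k > 0" using l(2) by (intro zero_less_power_int) auto
    ultimately have "1 \<le> s / l powi k" "s / l powi k < l" by (simp_all add: pos_divide_less_eq mult.commute)
    moreover have "s / l powi k \<in> R" using R_mult[OF s R_inv[OF R_pow[OF l(1), of k]]] by simp
    ultimately have "s / l powi k = 1" using l_min[of "s / l powi k"] by fastforce
    thus ?thesis using pp by (intro exI[of _ k]) simp
  qed
  have "sym s b \<longleftrightarrow> (\<exists>k::int. s = l powi k \<and> b = (1 - of_real s) * q)" for s b
    using R[of s b] all R_pow[OF l(1)] by blast
  thus ?thesis using that l(2) qC by blast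
qed

text \<open>A symmetry is determined by its germ at one point, and \<open>deep\<close> applied to
  the smaller cone supplies such a point. This carries the homothety group from a sector to an
  overlapping one.\<close>

lemma sym_subcone:
  assumes sub: "conic_immersion X \<Lambda> \<A> cP c\<kappa> c\<tau> cL C' f z0' u0' \<delta>'" "C' \<subseteq> C"
  shows "conic_immersion.sym C' f s b \<longleftrightarrow> sym s b"
proof -
  interpret sub: conic_immersion X \<Lambda> \<A> cP c\<kappa> c\<tau> cL C' f z0' u0' \<delta>' by (rule sub(1))
  show ?thesis
  proof
    assume sb: "sub.sym s b"
    hence s: "s > 0" by (simp add: sub.sym_def)
    have "\<forall>\<^sub>F t in at_top. of_real 1 * (z0' + of_real t * u0') + 0 \<in> C' \<and> of_real s * (z0' + of_real t * u0') + b \<in> C'"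
      using s by (intro eventually_conj sub.deep) auto
    then obtain t where t: "z0' + of_real t * u0' \<in> C'" "of_real s * (z0' + of_real t * u0') + b \<in> C'"
      by (auto simp: eventually_at_top_linorder)
    thus "sym s b"
      using symI_local[OF s, of "z0' + of_real t * u0'" b] sub.sym_local[OF sb t] sub(2) by auto
  next
    assume "sym s b"
    thus "sub.sym s b" using sub(2) unfolding sym_def sub.sym_def by blast
  qed
qed

end

section \<open>Sectors and strips\<close>

text \<open>An intersection of two half planes, hence convex at once. For \<open>s < s'\<close> and
  \<open>s' \<le> s + pi\<close> it is the open sector of arguments between \<open>s\<close> and
  \<open>s'\<close>.\<close>

definition sector :: "real \<Rightarrow> real \<Rightarrow> complex set" where
  "sector s s' = {z. 0 < Im (z * cis (- s)) \<and> Im (z * cis (- s')) < 0}"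

text \<open>The principal logarithm is rotated to the bisector, so that its cut lies opposite to the
  sector and the imaginary part takes values between \<open>s\<close> and \<open>s'\<close>.\<close>

definition sector_log :: "real \<Rightarrow> real \<Rightarrow> complex \<Rightarrow> complex" where
  "sector_log s s' z = Ln (z * cis (- ((s + s') / 2))) + \<i> * of_real ((s + s') / 2)"

lemma sectorD: "z \<in> sector s s' \<Longrightarrow> 0 < Im (z * cis (- s))" "z \<in> sector s s' \<Longrightarrow> Im (z * cis (- s')) < 0"
  by (auto simp only: sector_def mem_Collect_eq)

lemma sectorI: "0 < Im (z * cis (- s)) \<Longrightarrow> Im (z * cis (- s')) < 0 \<Longrightarrow> z \<in> sector s s'"
  by (unfold sector_def mem_Collect_eq, intro conjI)

lemma open_sector: "open (sector s s')"
  unfolding sector_def by (intro open_Collect_conj open_Collect_less continuous_intros)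

lemma sector_add_scale:
  assumes "z \<in> sector s s'" "u \<in> sector s s'" "0 \<le> t"
  shows "z + of_real t * u \<in> sector s s'"
proof -
  have e: "Im ((z + of_real t * u) * cis x) = Im (z * cis x) + t * Im (u * cis x)" for x
    by (simp add: algebra_simps)
  have "0 \<le> t * Im (u * cis (- s))" "t * Im (u * cis (- s')) \<le> 0"
    using sectorD[OF assms(2)] assms(3) by (auto simp only: mult_nonneg_nonneg less_imp_le mult_nonneg_nonpos)
  thus ?thesis using sectorD[OF assms(1)] by (intro sectorI; unfold e; linarith)
qed

lemma sector_scale: "z \<in> sector s s' \<Longrightarrow> t > 0 \<Longrightarrow> of_real t * z \<in> sector s s'"
proof -
  assume *: "z \<in> sector s s'" "t > 0"
  have e: "Im ((of_real t * z) * cis x) = t * Im (z * cis x)" for x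
    by (simp add: algebra_simps)
  show ?thesis using sectorD[OF *(1)] *(2)
    by (intro sectorI; unfold e; simp only: mult_pos_pos mult_pos_neg)
qed

lemma convex_sector: "convex (sector s s')"
proof (rule convexI)
  fix x y :: complex and u v :: real
  assume *: "x \<in> sector s s'" "y \<in> sector s s'" "0 \<le> u" "0 \<le> v" "u + v = 1"
  have "u > 0 \<or> v > 0" using * by linarith
  thus "u *\<^sub>R x + v *\<^sub>R y \<in> sector s s'"
  proof
    assume "u > 0"
    thus ?thesis using sector_add_scale[OF sector_scale[OF *(1), of u] *(2,4)] by (simp add: scaleR_conv_of_real)
  next
    assume "v > 0"
    thus ?thesis using sector_add_scale[OF sector_scale[OF *(2), of v] *(1,3)]
      by (simp add: scaleR_conv_of_real add.commute)
  qed
qed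

lemma Im_exp_cis: "Im (exp w * cis (- s)) = exp (Re w) * sin (Im w - s)"
proof -
  have "exp w * cis (- s) = exp (w - \<i> * of_real s)" by (simp add: cis_conv_exp exp_add[symmetric])
  thus ?thesis by (simp add: Im_exp)
qed

lemma exp_in_sector:
  assumes "s' \<le> s + pi" "s < Im w" "Im w < s'"
  shows "exp w \<in> sector s s'"
proof -
  have "sin (Im w - s) > 0" using assms by (intro sin_gt_zero) auto
  moreover have "sin (s' - Im w) > 0" using assms by (intro sin_gt_zero) auto
  hence "sin (Im w - s') < 0" by (metis minus_diff_eq neg_less_0_iff_less sin_minus)
  ultimately show ?thesis
    by (intro sectorI; unfold Im_exp_cis; simp only: mult_pos_pos mult_pos_neg exp_gt_zero)
qed

lemma sector_log_props:
  assumes s: "s < s'" "s' \<le> s + pi" and z: "z \<in> sector s s'"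
  shows "exp (sector_log s s' z) = z" "s < Im (sector_log s s' z)" "Im (sector_log s s' z) < s'"
    "z * cis (- ((s + s') / 2)) \<notin> \<real>\<^sub>\<le>\<^sub>0"
proof -
  let ?m = "(s + s') / 2"
  define h where "h = (s' - s) / 2"
  have h: "0 < h" "h \<le> pi / 2" using s by (simp_all add: h_def)
  have z0: "z \<noteq> 0" using z by (auto simp: sector_def)
  define x where "x = Ln (z * cis (- ?m))"
  have ex: "exp x = z * cis (- ?m)" using z0 by (simp add: x_def)
  have cc: "cis (- ?m) * exp (\<i> * of_real ?m) = 1" by (simp add: cis_conv_exp exp_add[symmetric])
  show e: "exp (sector_log s s' z) = z"
    unfolding sector_log_def exp_add x_def[symmetric] ex mult.assoc cc by simp
  define \<phi> where "\<phi> = Im x"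
  have \<phi>: "- pi < \<phi>" "\<phi> \<le> pi" using z0 mpi_less_Im_Ln[of "z * cis (- ?m)"] Im_Ln_le_pi[of "z * cis (- ?m)"]
    by (simp_all add: \<phi>_def x_def)
  have Im: "Im (sector_log s s' z) = \<phi> + ?m" by (simp add: sector_log_def \<phi>_def x_def)
  have "Im (z * cis (- s)) = exp (Re (sector_log s s' z)) * sin (\<phi> + h)"
    using Im_exp_cis[of "sector_log s s' z" s] unfolding e Im by (simp add: h_def field_simps)
  hence s1: "sin (\<phi> + h) > 0" using sectorD(1)[OF z] by (simp only: zero_less_mult_iff) auto
  have "Im (z * cis (- s')) = exp (Re (sector_log s s' z)) * sin (\<phi> - h)"
    using Im_exp_cis[of "sector_log s s' z" s'] unfolding e Im by (simp add: h_def field_simps)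
  hence s2: "sin (\<phi> - h) < 0" using sectorD(2)[OF z] by (simp only: mult_less_0_iff) auto
  have "\<phi> > - h"
  proof (rule ccontr)
    assume "\<not> \<phi> > - h"
    hence "sin (- (\<phi> + h)) \<ge> 0" using \<phi> h by (intro sin_ge_zero) auto
    thus False using s1 by (simp only: sin_minus)
  qed
  moreover have "\<phi> < h"
  proof (rule ccontr)
    assume "\<not> \<phi> < h"
    hence "sin (\<phi> - h) \<ge> 0" using \<phi> h by (intro sin_ge_zero) auto
    thus False using s2 by simp
  qed
  ultimately show "s < Im (sector_log s s' z)" "Im (sector_log s s' z) < s'" unfolding Im by (auto simp: h_def field_simps)
  have "\<bar>Im (Ln (z * cis (- ?m)))\<bar> < pi / 2" using \<open>\<phi> > - h\<close> \<open>\<phi> < h\<close> h by (simp add: \<phi>_def x_def)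
  hence "0 < Re (z * cis (- ?m))" using Re_Ln_pos_lt[of "z * cis (- ?m)"] z0 by simp
  thus "z * cis (- ?m) \<notin> \<real>\<^sub>\<le>\<^sub>0" by (auto simp: complex_nonpos_Reals_iff)
qed

lemma sector_log_exp:
  assumes s: "s' \<le> s + pi" and w: "s < Im w" "Im w < s'"
  shows "sector_log s s' (exp w) = w"
proof -
  have "exp w * cis (- ((s + s') / 2)) = exp (w - \<i> * of_real ((s + s') / 2))"
    by (simp add: cis_conv_exp exp_add[symmetric])
  moreover have "Ln (exp (w - \<i> * of_real ((s + s') / 2))) = w - \<i> * of_real ((s + s') / 2)"
    using s w by (intro Ln_exp) (auto simp: field_simps)
  ultimately show ?thesis unfolding sector_log_def by simp
qed

lemma isCont_sector_log:
  assumes "s < s'" "s' \<le> s + pi" "z \<in> sector s s'"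
  shows "isCont (sector_log s s') z"
  unfolding sector_log_def[abs_def] using sector_log_props(4)[OF assms] by (intro continuous_intros) auto

lemma sector_mono:
  assumes "s \<le> t" "t < t'" "t' \<le> s'" "s' \<le> s + pi"
  shows "sector t t' \<subseteq> sector s s'"
proof
  fix z assume z: "z \<in> sector t t'"
  have "exp (sector_log t t' z) \<in> sector s s'"
    using sector_log_props(2,3)[OF _ _ z] assms by (intro exp_in_sector) auto
  thus "z \<in> sector s s'" using sector_log_props(1)[OF _ _ z] assms by simp
qed

lemma sector_subset_open_cone:
  assumes "\<alpha> \<le> s" "s < s'" "s' \<le> \<alpha> + \<theta>" "s' \<le> s + pi" "z - c \<in> sector s s'"
  shows "z \<in> open_cone c \<alpha> \<theta>"
proof -
  let ?w = "sector_log s s' (z - c)"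
  have "z = c + rcis (exp (Re ?w)) (Im ?w)"
    using sector_log_props(1)[OF assms(2,4,5)] exp_eq_polar[of ?w] by (simp add: rcis_def)
  hence "z = c + rcis (exp (Re ?w)) (Im ?w) \<and> exp (Re ?w) > 0 \<and> \<alpha> < Im ?w \<and> Im ?w < \<alpha> + \<theta>"
    using sector_log_props(2,3)[OF assms(2,4,5)] assms by simp
  thus ?thesis unfolding open_cone_def by blast
qed

lemma open_open_cone: "open (open_cone c \<alpha> \<theta>)"
proof (subst open_subopen, intro ballI)
  fix z assume "z \<in> open_cone c \<alpha> \<theta>"
  then obtain r \<phi> where z: "z = c + rcis r \<phi>" "r > 0" "\<alpha> < \<phi>" "\<phi> < \<alpha> + \<theta>" by (auto simp: open_cone_def)
  define e where "e = min (pi / 2) (min (\<phi> - \<alpha>) (\<alpha> + \<theta> - \<phi>))"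
  have "e \<le> pi / 2" "e \<le> \<phi> - \<alpha>" "e \<le> \<alpha> + \<theta> - \<phi>" unfolding e_def by linarith+
  moreover have "e > 0" using z by (simp add: e_def)
  ultimately have e: "e > 0" "e \<le> pi / 2" "\<alpha> \<le> \<phi> - e" "\<phi> + e \<le> \<alpha> + \<theta>" by linarith+
  define T where "T = (\<lambda>z. z - c) -` sector (\<phi> - e) (\<phi> + e)"
  have "open T" unfolding T_def by (intro open_vimage open_sector continuous_intros)
  moreover have "rcis r \<phi> = exp (Complex (ln r) \<phi>)" using z(2) by (simp add: rcis_def exp_eq_polar)
  hence "z \<in> T" using e exp_in_sector[of "\<phi> + e" "\<phi> - e" "Complex (ln r) \<phi>"] by (simp add: T_def z(1))
  moreover have "T \<subseteq> open_cone c \<alpha> \<theta>"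
  proof
    fix x assume "x \<in> T"
    thus "x \<in> open_cone c \<alpha> \<theta>"
      using sector_subset_open_cone[of \<alpha> "\<phi> - e" "\<phi> + e" \<theta> x c] e by (simp add: T_def)
  qed
  ultimately show "\<exists>T. open T \<and> z \<in> T \<and> T \<subseteq> open_cone c \<alpha> \<theta>" by blast
qed

context affine_surface
begin

lemma affine_immersion_afm:
  assumes C: "open C" and f: "affine_immersion (top_of_set C) (plane_atlas C) (regular_part X \<Lambda>) \<A> f"
    and z: "z \<in> C"
  shows "afm_at (\<lambda>z. z) f z"
proof -
  have cont: "continuous_map (top_of_set C) (regular_part X \<Lambda>) f"
    and "\<forall>x\<in>topspace (top_of_set C). \<exists>\<psi>. affine_chart_at (regular_part X \<Lambda>) \<A> (f x) \<psi> \<and>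
      affine_chart_at (top_of_set C) (plane_atlas C) x (\<psi> \<circ> f)"
    using f unfolding affine_immersion_def by - ((elim conjE, assumption)+)
  then obtain \<psi> where \<psi>: "affine_chart_at (regular_part X \<Lambda>) \<A> (f z) \<psi>"
    "affine_chart_at (top_of_set C) (plane_atlas C) z (\<psi> \<circ> f)" using z by auto
  obtain U \<psi>0 a0 b0 W0 where 0: "(U, \<psi>0) \<in> \<A>" "a0 \<noteq> 0" "openin (regular_part X \<Lambda>) W0" "f z \<in> W0" "W0 \<subseteq> U"
    "\<And>y. y \<in> W0 \<Longrightarrow> \<psi> y = a0 * \<psi>0 y + b0"
    using \<psi>(1) unfolding affine_chart_at_def by auto
  obtain a b W where W: "a \<noteq> 0" "openin (top_of_set C) W" "z \<in> W" "\<And>y. y \<in> W \<Longrightarrow> \<psi> (f y) = a * y + b"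
    using \<psi>(2) unfolding affine_chart_at_def plane_atlas_def by auto
  have "openin (top_of_set C) {x \<in> topspace (top_of_set C). f x \<in> W0}"
    by (rule openin_continuous_map_preimage[OF cont 0(3)])
  hence "open {x \<in> C. f x \<in> W0}" using openin_open_trans C by auto
  hence "\<forall>\<^sub>F x in nhds z. x \<in> {x \<in> C. f x \<in> W0}" using z 0(4) by (intro eventually_nhds_in_open) auto
  moreover have "open W" using openin_open_trans W(2) C by blast
  hence "\<forall>\<^sub>F x in nhds z. x \<in> W" using W(3) by (intro eventually_nhds_in_open) auto
  ultimately have "\<forall>\<^sub>F x in nhds z. f x \<in> U \<and> \<psi>0 (f x) = (a / a0) * x + (b - b0) / a0"
  proof eventually_elim
    case (elim x)
    hence "a0 * \<psi>0 (f x) + b0 = a * x + b" "f x \<in> U" using 0(5,6) W(4) by (auto simp flip: W(4))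
    hence "a0 * \<psi>0 (f x) = a * x + b - b0" by (simp add: algebra_simps)
    hence "\<psi>0 (f x) = (a * x + b - b0) / a0" using 0(2) by (simp add: field_simps)
    thus ?case using \<open>f x \<in> U\<close> by (simp add: add_divide_distrib diff_divide_distrib)
  qed
  thus ?thesis by (rule afm_atI[OF 0(1), rotated]) (use W(1) 0(2) in simp)
qed

end

section \<open>From the cone to a periodic map of a strip, and its maximal extension\<close>

context straight_surface
begin

lemma conic_sector:
  assumes s: "s < s'" "s' \<le> s + pi" and f: "\<And>z. z - c \<in> sector s s' \<Longrightarrow> afm_at (\<lambda>z. z) f z"
  obtains z0 u0 \<delta> where "conic_immersion X \<Lambda> \<A> cP c\<kappa> c\<tau> cL {z. z - c \<in> sector s s'} f z0 u0 \<delta>"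
proof -
  define u where "u = exp (\<i> * of_real ((s + s') / 2))"
  have u: "u \<in> sector s s'" unfolding u_def using s by (intro exp_in_sector) auto
  obtain \<delta> where \<delta>: "\<delta> > 0" "ball u \<delta> \<subseteq> sector s s'" using open_sector u by (meson open_contains_ball)
  have C: "{z. z - c \<in> sector s s'} = (\<lambda>z. z - c) -` sector s s'" by auto
  have C': "{z. z - c \<in> sector s s'} = (\<lambda>x. c + x) ` sector s s'"
  proof -
    have "x \<in> (\<lambda>x. c + x) ` sector s s'" if "x - c \<in> sector s s'" for x
      using imageI[OF that, of "\<lambda>x. c + x"] by simp
    thus ?thesis by auto
  qed
  have "conic_immersion X \<Lambda> \<A> cP c\<kappa> c\<tau> cL {z. z - c \<in> sector s s'} f (c + u) u \<delta>"
  proof (unfold_locales)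
    show "open {z. z - c \<in> sector s s'}" unfolding C by (intro open_vimage open_sector continuous_intros)
    show "convex {z. z - c \<in> sector s s'}" unfolding C' by (intro convex_translation convex_sector)
    show "c + u \<in> {z. z - c \<in> sector s s'}" "0 < \<delta>" "u \<noteq> 0" using u \<delta> by (auto simp: u_def)
    show "z + of_real t * v \<in> {z. z - c \<in> sector s s'}"
      if "z \<in> {z. z - c \<in> sector s s'}" "0 \<le> t" "cmod (v - u) < \<delta>" for z t v
    proof -
      have "v \<in> sector s s'" using \<delta>(2) that(3) by (auto simp: dist_norm norm_minus_commute)
      thus ?thesis using sector_add_scale[of "z - c" s s' v t] that by (simp add: algebra_simps)
    qed
  qed (use f in auto)
  thus ?thesis using that by blast
qed

lemma conic_sym_power:
  assumes ci: "conic_immersion X \<Lambda> \<A> cP c\<kappa> c\<tau> cL C f z0 u0 \<delta>"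
    and s: "conic_immersion.sym C f \<rho> ((1 - of_real \<rho>) * q)"
  shows "conic_immersion.sym C f (\<rho> ^ n) ((1 - of_real (\<rho> ^ n)) * q)"
proof -
  interpret conic_immersion X \<Lambda> \<A> cP c\<kappa> c\<tau> cL C f z0 u0 \<delta> by (rule ci)
  show ?thesis
  proof (induction n)
    case (Suc n)
    from sym_comp[OF s Suc] show ?case by (simp add: algebra_simps)
  qed (simp add: sym_id)
qed

definition strip_map :: "real set \<Rightarrow> (complex \<Rightarrow> 'a) \<Rightarrow> bool" where
  "strip_map I F \<longleftrightarrow> open I \<and> is_interval I \<and> I \<noteq> {} \<and> (\<forall>w. Im w \<in> I \<longrightarrow> afm_at exp F w)"

lemma convex_strip:
  assumes "is_interval I"
  shows "convex {w. Im w \<in> I}"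
proof -
  have "convex (Im -` I)"
    using assms by (intro convex_linear_vimage bounded_linear.linear bounded_linear_Im) (simp add: is_interval_convex_1)
  thus ?thesis by (simp add: vimage_def)
qed

lemma open_strip: "open I \<Longrightarrow> open {w. Im w \<in> I}"
  using open_vimage[of I Im] by (simp add: vimage_def continuous_on_Im)

lemma strip_identity:
  assumes F: "strip_map I F" and G: "\<And>w. Im w \<in> I \<Longrightarrow> afm_at exp G w"
    and J: "J \<subseteq> I" "open J" "J \<noteq> {}" "\<And>w. Im w \<in> J \<Longrightarrow> F w = G w" and w: "Im w \<in> I"
  shows "F w = G w"
proof -
  obtain j where j: "j \<in> J" using J by blast
  have "\<forall>\<^sub>F v in nhds (\<i> * of_real j). v \<in> {w. Im w \<in> J}"
    using j by (intro eventually_nhds_in_open open_strip J) auto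
  hence ev: "\<forall>\<^sub>F v in nhds (\<i> * of_real j). F v = G v" by eventually_elim (use J in auto)
  show ?thesis
    by (rule identity_principle_eq[OF developing_simps(2), of "{w. Im w \<in> I}" F G "\<i> * of_real j"])
      (use F G w j J ev convex_connected[OF convex_strip] in \<open>auto simp: strip_map_def\<close>)
qed

lemma afm_exp_shift:
  assumes "afm_at exp F (w + c)"
  shows "afm_at exp (\<lambda>v. F (v + c)) w"
  by (rule afm_at_comp[where d=exp and g="\<lambda>v. v + c" and A="exp c" and B=0])
    (use assms in \<open>auto intro!: continuous_intros simp: exp_add mult.commute\<close>)

lemma afm_sector_log:
  assumes s: "s < s'" "s' \<le> s + pi" and F: "\<And>w. s < Im w \<Longrightarrow> Im w < s' \<Longrightarrow> afm_at exp F w" and z: "z \<in> sector s s'"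
  shows "afm_at (\<lambda>z. z) (\<lambda>z. F (sector_log s s' z)) z"
proof (rule afm_at_comp[where d=exp and A=1 and B=0])
  have "\<forall>\<^sub>F v in nhds z. v \<in> sector s s'" using open_sector z by (rule eventually_nhds_in_open)
  thus "\<forall>\<^sub>F v in nhds z. exp (sector_log s s' v) = 1 * v + 0"
    by eventually_elim (use sector_log_props(1)[OF s] in auto)
qed (use F sector_log_props[OF s z] isCont_sector_log[OF s z] in auto)

text \<open>A strip of height at most pi is a convex sector in the coordinate \<open>exp w\<close>.
  The given period is a homothety centred at 0, so by \<open>homothety_group\<close> every symmetry
  is centred at 0 and becomes a real translation of \<open>w\<close>.\<close>

lemma strip_group:
  assumes s: "s < s'" "s' \<le> s + pi" and F: "\<And>w. s < Im w \<Longrightarrow> Im w < s' \<Longrightarrow> afm_at exp F w"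
    and P: "P > 0" "\<And>w. s < Im w \<Longrightarrow> Im w < s' \<Longrightarrow> F (w + of_real P) = F w"
  obtains L where "L > 0" "\<And>w. s < Im w \<Longrightarrow> Im w < s' \<Longrightarrow> F (w + of_real L) = F w"
    "\<And>w w'. s < Im w \<Longrightarrow> Im w < s' \<Longrightarrow> s < Im w' \<Longrightarrow> Im w' < s' \<Longrightarrow> F w = F w' \<Longrightarrow> \<exists>k::int. w' = w + of_int k * of_real L"
proof -
  define G where "G = (\<lambda>z. F (sector_log s s' z))"
  obtain z0 u0 \<delta> where ci: "conic_immersion X \<Lambda> \<A> cP c\<kappa> c\<tau> cL {z. z - 0 \<in> sector s s'} G z0 u0 \<delta>"
    by (rule conic_sector[OF s, of 0 G]) (use afm_sector_log[OF s F] in \<open>auto simp: G_def\<close>)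
  interpret conic_immersion X \<Lambda> \<A> cP c\<kappa> c\<tau> cL "{z. z - 0 \<in> sector s s'}" G z0 u0 \<delta> by (rule ci)
  have G_exp: "G (exp w) = F w" "exp w \<in> sector s s'" if "s < Im w" "Im w < s'" for w
    using sector_log_exp[OF s(2) that] exp_in_sector[OF s(2) that] by (simp_all add: G_def)
  obtain l q where lq: "l > 1" "q \<notin> {z. z - 0 \<in> sector s s'}" "\<forall>r b. sym r b \<longleftrightarrow> (\<exists>k::int. r = l powi k \<and> b = (1 - of_real r) * q)"
    by (rule homothety_group)
  note l = lq(1) lq(3)[rule_format]
  have scale: "exp (w + of_real t) = of_real (exp t) * exp w" for w :: complex and t
    unfolding exp_add exp_of_real by (rule mult.commute)
  have "sym (exp P) 0"
    unfolding sym_def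
  proof (intro conjI ballI impI)
    fix v assume v: "v \<in> {z. z - 0 \<in> sector s s'}"
    define w where "w = sector_log s s' v"
    have w: "exp w = v" "s < Im w" "Im w < s'" using sector_log_props(1-3)[OF s, of v] v by (simp_all add: w_def)
    have "G (of_real (exp P) * v + 0) = F (w + of_real P)"
      using G_exp(1)[of "w + of_real P"] w scale[of w P] by simp
    thus "G (of_real (exp P) * v + 0) = G v" using P(2)[of w] G_exp(1)[of w] w by simp
  qed simp
  then obtain k :: int where k: "0 = (1 - complex_of_real (exp P)) * q" using l(2) by blast
  moreover have "1 - complex_of_real (exp P) \<noteq> 0"
    using P(1) by (metis exp_eq_one_iff less_irrefl of_real_1 of_real_eq_iff right_minus_eq)
  ultimately have q0: "q = 0" by simp
  define L where "L = ln l"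
  have L: "L > 0" "exp L = l" using l(1) by (simp_all add: L_def)
  have "sym l 0" using l(2)[of l 0] q0 by (auto intro!: exI[of _ 1])
  show ?thesis
  proof (rule that[OF L(1)])
    show "F (w + of_real L) = F w" if w: "s < Im w" "Im w < s'" for w
    proof -
      have "of_real l * exp w = exp (w + of_real L)" using scale[of w L] L(2) by simp
      hence "G (of_real l * exp w + 0) = F (w + of_real L)" "of_real l * exp w \<in> sector s s'"
        using G_exp[of "w + of_real L"] w by simp_all
      thus ?thesis using symD[OF \<open>sym l 0\<close>, of "exp w"] G_exp[OF w] by simp
    qed
    show "\<exists>k::int. w' = w + of_int k * of_real L"
      if w: "s < Im w" "Im w < s'" "s < Im w'" "Im w' < s'" "F w = F w'" for w w'
    proof (cases "exp w = exp w'")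
      case True
      hence "w = w'" using sector_log_exp[OF s(2) w(1,2)] sector_log_exp[OF s(2) w(3,4)] by metis
      thus ?thesis by (intro exI[of _ 0]) simp
    next
      case False
      obtain r b where rb: "sym r b" "of_real r * exp w + b = exp w'"
        using collision_sym[of "exp w" "exp w'"] G_exp w False by auto
      then obtain k :: int where k: "r = l powi k" "b = 0" using l(2)[of r b] q0 by auto
      have "exp (of_int k * L) = l powi k"
        using L by (metis exp_power_int)
      hence "exp w' = exp (w + of_int k * of_real L)"
        using rb(2) k scale[of w "of_int k * L"] by simp
      moreover have "sector_log s s' (exp (w + of_int k * of_real L)) = w + of_int k * of_real L"
        by (rule sector_log_exp[OF s(2)]) (use w in simp_all)
      ultimately have "w' = w + of_int k * of_real L"
        using sector_log_exp[OF s(2) w(3,4)] by metis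
      thus ?thesis by blast
    qed
  qed
qed

text \<open>Any two extensions agree on their overlap because they agree on \<open>I0\<close>. Hence
  the union of all of them is again an extension, and it is maximal.\<close>

lemma maximal_strip:
  assumes F0: "strip_map I0 F0"
  obtains I F where "I0 \<subseteq> I" "strip_map I F" "\<And>w. Im w \<in> I0 \<Longrightarrow> F w = F0 w"
    "\<And>I' F'. strip_map I' F' \<Longrightarrow> I \<subseteq> I' \<Longrightarrow> (\<And>w. Im w \<in> I \<Longrightarrow> F' w = F w) \<Longrightarrow> I' = I"
proof -
  define S where "S = {J. I0 \<subseteq> J \<and> (\<exists>G. strip_map J G \<and> (\<forall>w. Im w \<in> I0 \<longrightarrow> G w = F0 w))}"
  have I0: "open I0" "I0 \<noteq> {}" "is_interval I0" using F0 by (auto simp: strip_map_def)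
  have I0S: "I0 \<in> S" using F0 by (auto simp: S_def)
  have "\<forall>J\<in>S. \<exists>G. strip_map J G \<and> (\<forall>w. Im w \<in> I0 \<longrightarrow> G w = F0 w)" by (auto simp: S_def)
  then obtain g where g: "\<And>J. J \<in> S \<Longrightarrow> strip_map J (g J) \<and> (\<forall>w. Im w \<in> I0 \<longrightarrow> g J w = F0 w)" by metis
  define I where "I = \<Union>S"
  define F where "F w = g (SOME J. J \<in> S \<and> Im w \<in> J) w" for w
  have agree: "g J w = g J' w" if J: "J \<in> S" "J' \<in> S" "Im w \<in> J" "Im w \<in> J'" for J J' w
  proof (rule strip_identity[of "J \<inter> J'" _ _ I0])
    show "strip_map (J \<inter> J') (g J)" "I0 \<subseteq> J \<inter> J'"
      using g[OF J(1)] g[OF J(2)] J I0 unfolding strip_map_def S_def by (auto intro: is_interval_Int)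
  qed (use g J I0 in \<open>auto simp: strip_map_def\<close>)
  have FJ: "F w = g J w" if "J \<in> S" "Im w \<in> J" for J w
  proof -
    have "(SOME J. J \<in> S \<and> Im w \<in> J) \<in> S \<and> Im w \<in> (SOME J. J \<in> S \<and> Im w \<in> J)"
      by (rule someI[of "\<lambda>J. J \<in> S \<and> Im w \<in> J" J]) (use that in simp)
    thus ?thesis unfolding F_def using agree that by blast
  qed
  have opS: "open J" "is_interval J" "I0 \<subseteq> J" if "J \<in> S" for J using g[OF that] that by (auto simp: strip_map_def S_def)
  have conn: "connected I" unfolding I_def
  proof (rule connected_Union)
    show "\<Inter>S \<noteq> {}" using opS(3) I0(2) by blast
  qed (use opS(2) is_interval_connected in blast)
  have "strip_map I F"
    unfolding strip_map_def
  proof (intro conjI allI impI)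
    show "open I" unfolding I_def using opS by auto
    show "is_interval I" using conn by (simp add: is_interval_connected_1)
    show "I \<noteq> {}" using I0S I0 by (auto simp: I_def)
    fix w assume "Im w \<in> I"
    then obtain J where J: "J \<in> S" "Im w \<in> J" by (auto simp: I_def)
    have "\<forall>\<^sub>F v in nhds w. v \<in> {w. Im w \<in> J}" using J opS by (intro eventually_nhds_in_open open_strip) auto
    hence "\<forall>\<^sub>F v in nhds w. F v = g J v" by eventually_elim (use FJ J in auto)
    thus "afm_at exp F w" using afm_at_cong[of F "g J" w exp] g[OF J(1)] J(2) by (auto simp: strip_map_def)
  qed
  moreover have "I0 \<subseteq> I" using I0S by (auto simp: I_def)
  moreover have F_F0: "F w = F0 w" if "Im w \<in> I0" for w using FJ[OF I0S that] g[OF I0S] that by simp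
  moreover have "I' = I" if "strip_map I' F'" "I \<subseteq> I'" "\<And>w. Im w \<in> I \<Longrightarrow> F' w = F w" for I' F'
  proof -
    have "\<forall>w. Im w \<in> I0 \<longrightarrow> F' w = F0 w" using that(3) \<open>I0 \<subseteq> I\<close> F_F0 by auto
    hence "I' \<in> S" using that(1,2) \<open>I0 \<subseteq> I\<close> unfolding S_def by blast
    thus ?thesis using that(2) by (auto simp: I_def)
  qed
  ultimately show ?thesis using that by blast
qed

end

context straight_surface
begin

text \<open>The centre \<open>q\<close> of the homotheties need not be the apex \<open>c\<close>, so
  \<open>q + exp w\<close> may lie outside the cone. Multiplying \<open>exp w\<close> by a high
  power of the ratio moves the point into the right sector, and the symmetry makes the value
  independent of the power.\<close>

lemma initial_strip:
  assumes \<theta>: "0 < \<theta>" "\<theta> \<le> 2 * pi" and f: "\<And>z. z \<in> open_cone c \<alpha> \<theta> \<Longrightarrow> afm_at (\<lambda>z. z) f z"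
  obtains F P q where "P > 0" "\<And>w. \<alpha> < Im w \<Longrightarrow> Im w < \<alpha> + \<theta> \<Longrightarrow> afm_at exp F w"
    "\<And>w. \<alpha> < Im w \<Longrightarrow> Im w < \<alpha> + \<theta> \<Longrightarrow> F (w + of_real P) = F w"
    "\<And>w. \<alpha> < Im w \<Longrightarrow> Im w < \<alpha> + \<theta> \<Longrightarrow> F w \<in> f ` open_cone c \<alpha> \<theta>"
    "\<And>\<phi>. \<alpha> < \<phi> \<Longrightarrow> \<phi> < \<alpha> + \<theta> \<Longrightarrow> \<exists>s s'. \<alpha> \<le> s \<and> s < \<phi> \<and> \<phi> < s' \<and> s' \<le> \<alpha> + \<theta> \<and> s' \<le> s + pi \<and>
       (\<forall>v. s < Im v \<longrightarrow> Im v < s' \<longrightarrow> q + exp v - c \<in> sector s s' \<longrightarrow> F v = f (q + exp v))"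
proof -
  \<comment> \<open>Three sectors of angle \<open>\<theta> / 2 \<le> pi\<close> cover the cone, and
    consecutive ones overlap in angle \<open>\<theta> / 4\<close>. The overlaps identify their
    homothety groups.\<close>
  define A B where "A j = \<alpha> + real j * \<theta> / 4" and "B j = \<alpha> + (real j + 2) * \<theta> / 4" for j :: nat
  define D where "D j = {z. z - c \<in> sector (A j) (B j)}" for j
  have AB: "A j < B j" "B j \<le> A j + pi" "A (Suc j) < B j" "A j \<le> A (Suc j)" "B j \<le> B (Suc j)" for j
    using \<theta> by (auto simp: A_def B_def field_simps)
  have AB2: "\<alpha> \<le> A j" "B j \<le> \<alpha> + \<theta>" if "j \<le> 2" for j
  proof -
    have "real j * \<theta> \<le> 2 * \<theta>" using that \<theta> by (intro mult_right_mono) auto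
    thus "\<alpha> \<le> A j" "B j \<le> \<alpha> + \<theta>" using \<theta> by (auto simp: A_def B_def field_simps)
  qed
  have D_sub: "D j \<subseteq> open_cone c \<alpha> \<theta>" if "j \<le> 2" for j
    using sector_subset_open_cone[OF AB2(1)[OF that] AB(1) AB2(2)[OF that] AB(2)] by (auto simp: D_def)
  have fD: "afm_at (\<lambda>z. z) f z" if "j \<le> 2" "z - c \<in> sector (A j) (B j)" for j z
    using f D_sub[OF that(1)] that(2) by (auto simp: D_def)
  have ci: "\<exists>z0 u0 \<delta>. conic_immersion X \<Lambda> \<A> cP c\<kappa> c\<tau> cL (D j) f z0 u0 \<delta>" if "j \<le> 2" for j
    by (rule conic_sector[OF AB(1,2)[of j] fD[OF that]]) (auto simp: D_def)
  define E where "E j = {z. z - c \<in> sector (A (Suc j)) (B j)}" for j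
  have E_sub: "E j \<subseteq> D j" "E j \<subseteq> D (Suc j)" for j
    using sector_mono[of "A j" "A (Suc j)" "B j" "B j"] sector_mono[of "A (Suc j)" "A (Suc j)" "B j" "B (Suc j)"] AB
    by (auto simp: E_def D_def)
  have width: "B j \<le> A (Suc j) + pi" for j using AB(2,4)[of j] by linarith
  have ciE: "\<exists>z0 u0 \<delta>. conic_immersion X \<Lambda> \<A> cP c\<kappa> c\<tau> cL (E j) f z0 u0 \<delta>" if "j \<le> 2" for j
    by (rule conic_sector[OF AB(3)[of j] width, of c f])
      (use fD[OF that] E_sub(1)[of j] in \<open>auto simp: E_def D_def\<close>)
  have sym_Suc: "conic_immersion.sym (D (Suc j)) f s b \<longleftrightarrow> conic_immersion.sym (D j) f s b" if jj: "Suc j \<le> 2" for j s b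
  proof -
    obtain z0 u0 \<delta> where 1: "conic_immersion X \<Lambda> \<A> cP c\<kappa> c\<tau> cL (D j) f z0 u0 \<delta>" using ci[of j] jj by auto
    obtain z1 u1 \<delta>1 where 2: "conic_immersion X \<Lambda> \<A> cP c\<kappa> c\<tau> cL (D (Suc j)) f z1 u1 \<delta>1" using ci[OF jj] by auto
    obtain z2 u2 \<delta>2 where 3: "conic_immersion X \<Lambda> \<A> cP c\<kappa> c\<tau> cL (E j) f z2 u2 \<delta>2" using ciE[of j] jj by auto
    show ?thesis
      using conic_immersion.sym_subcone[OF 1 3 E_sub(1)] conic_immersion.sym_subcone[OF 2 3 E_sub(2)] by metis
  qed
  obtain z0 u0 \<delta> where ci0: "conic_immersion X \<Lambda> \<A> cP c\<kappa> c\<tau> cL (D 0) f z0 u0 \<delta>" using ci[of 0] by auto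
  obtain l q where l: "l > 1" "q \<notin> D 0"
    "\<forall>s b. conic_immersion.sym (D 0) f s b \<longleftrightarrow> (\<exists>k::int. s = l powi k \<and> b = (1 - of_real s) * q)"
    by (rule conic_immersion.homothety_group[OF ci0])
  have "conic_immersion.sym (D 0) f l ((1 - of_real l) * q)" using l(3) by (auto intro!: exI[of _ 1])
  hence sym0: "conic_immersion.sym (D j) f l ((1 - of_real l) * q)" if "j \<le> 2" for j
    using that
  proof (induction j)
    case (Suc j)
    thus ?case using sym_Suc[of j] by simp
  qed simp
  have sym: "conic_immersion.sym (D j) f (l ^ n) ((1 - of_real (l ^ n)) * q)" if j: "j \<le> 2" for j n
  proof -
    obtain z0 u0 \<delta> where 1: "conic_immersion X \<Lambda> \<A> cP c\<kappa> c\<tau> cL (D j) f z0 u0 \<delta>" using ci[OF j] by auto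
    show ?thesis by (rule conic_sym_power[OF 1 sym0[OF j]])
  qed
  define P where "P = ln l"
  have P: "P > 0" "exp P = l" using l(1) by (simp_all add: P_def)
  have eP: "exp (w + of_nat n * of_real P) = of_real (l ^ n) * exp w" for w :: complex and n
  proof -
    have "exp (of_nat n * complex_of_real P) = of_real (l ^ n)"
      by (metis P(2) exp_of_nat_mult exp_of_real of_real_power)
    thus ?thesis by (simp add: exp_add mult.commute)
  qed
  \<comment> \<open>The power \<open>n\<close> brings the point over \<open>w\<close> into the
    sector number \<open>j\<close>; by \<open>ev_valid\<close> all large \<open>n\<close> do so,
    because \<open>q - c\<close> becomes negligible at that scale.\<close>
  define valid where "valid j n w \<longleftrightarrow> j \<le> 2 \<and> A j < Im w \<and> Im w < B j \<and> q + exp (w + of_nat n * of_real P) \<in> D j"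
    for j n :: nat and w
  have ev_valid: "\<exists>N. \<forall>n\<ge>N. valid j n w" if j: "j \<le> 2" "A j < Im w" "Im w < B j" for j w
  proof -
    have ew: "exp w \<in> sector (A j) (B j)" using exp_in_sector[OF AB(2) j(2,3)] .
    obtain e where e: "e > 0" "ball (exp w) e \<subseteq> sector (A j) (B j)" using open_sector ew by (meson open_contains_ball)
    have c1: "0 < cmod (q - c) + 1" by (rule add_nonneg_pos) auto
    obtain N where N: "(1 / l) ^ N < e / (cmod (q - c) + 1)"
      using real_arch_pow_inv[OF divide_pos_pos[OF e(1) c1], of "1 / l"] l(1) by auto
    have "valid j n w" if n: "n \<ge> N" for n
    proof -
      have ln: "l ^ n > 0" using l(1) by simp
      have "(1 / l) ^ n \<le> (1 / l) ^ N" using n l(1) by (intro power_decreasing) auto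
      hence "(1 / l) ^ n < e / (cmod (q - c) + 1)" using N by linarith
      hence "(1 / l) ^ n * (cmod (q - c) + 1) < e"
        by (simp only: pos_less_divide_eq[OF c1])
      moreover have "(1 / l) ^ n * cmod (q - c) \<le> (1 / l) ^ n * (cmod (q - c) + 1)"
        using l(1) by (intro mult_left_mono) auto
      moreover have "cmod ((q - c) / of_real (l ^ n)) = (1 / l) ^ n * cmod (q - c)"
        by (simp only: norm_divide norm_of_real abs_of_pos[OF ln]) (simp add: power_one_over)
      ultimately have "cmod ((q - c) / of_real (l ^ n)) < e" by linarith
      hence "exp w + (q - c) / of_real (l ^ n) \<in> sector (A j) (B j)" using e(2) by (auto simp: dist_norm)
      hence "of_real (l ^ n) * (exp w + (q - c) / of_real (l ^ n)) \<in> sector (A j) (B j)"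
        using ln by (rule sector_scale)
      moreover have "of_real (l ^ n) * (exp w + (q - c) / of_real (l ^ n)) = q + of_real (l ^ n) * exp w - c"
      proof -
        have "complex_of_real (l ^ n) \<noteq> 0" using ln by (simp only: of_real_eq_0_iff)
        thus ?thesis by (simp add: distrib_left del: of_real_power)
      qed
      ultimately show ?thesis using j by (simp add: valid_def D_def eP)
    qed
    thus ?thesis by blast
  qed
  have same: "f (q + exp (w + of_nat n * of_real P)) = f (q + exp (w + of_nat N * of_real P))"
    if v: "valid j n w" "valid j N w" "n \<le> N" for j n N w
  proof -
    have "j \<le> 2" using v(1) by (simp add: valid_def)
    then obtain z0 u0 \<delta> where 1: "conic_immersion X \<Lambda> \<A> cP c\<kappa> c\<tau> cL (D j) f z0 u0 \<delta>" using ci by blast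
    have e: "of_real (l ^ (N - n)) * (q + exp (w + of_nat n * of_real P)) + (1 - of_real (l ^ (N - n))) * q =
      q + exp (w + of_nat N * of_real P)"
    proof -
      have "l ^ (N - n) * l ^ n = l ^ N" using v(3) by (simp flip: power_add)
      hence "complex_of_real (l ^ (N - n)) * of_real (l ^ n) = of_real (l ^ N)" by (metis of_real_mult)
      thus ?thesis unfolding eP by (simp add: algebra_simps flip: mult.assoc)
    qed
    have "j \<le> 2" using v(1) by (simp add: valid_def)
    from conic_immersion.symD[OF 1 sym[OF this, of "N - n"], of "q + exp (w + of_nat n * of_real P)"] v
    show ?thesis unfolding e by (simp add: valid_def)
  qed
  have consistent: "f (q + exp (w + of_nat n * of_real P)) = f (q + exp (w + of_nat n' * of_real P))"
    if v: "valid j n w" "valid j' n' w" for j n j' n' w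
  proof -
    obtain N where N: "\<forall>n\<ge>N. valid j n w" using ev_valid[of j w] v(1) by (auto simp: valid_def)
    obtain N' where N': "\<forall>n\<ge>N'. valid j' n w" using ev_valid[of j' w] v(2) by (auto simp: valid_def)
    define m where "m = max (max N N') (max n n')"
    have "f (q + exp (w + of_nat n * of_real P)) = f (q + exp (w + of_nat m * of_real P))"
      by (rule same[OF v(1)]) (use N in \<open>auto simp: m_def\<close>)
    moreover have "f (q + exp (w + of_nat n' * of_real P)) = f (q + exp (w + of_nat m * of_real P))"
      by (rule same[OF v(2)]) (use N' in \<open>auto simp: m_def\<close>)
    ultimately show ?thesis by simp
  qed
  define F where "F w = f (q + exp (w + of_nat (SOME n. \<exists>j. valid j n w) * of_real P))" for w
  have FV: "F w = f (q + exp (w + of_nat n * of_real P))" if "valid j n w" for j n w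
  proof -
    have "\<exists>j. valid j (SOME n. \<exists>j. valid j n w) w"
      by (rule someI[of "\<lambda>n. \<exists>j. valid j n w" n]) (use that in blast)
    thus ?thesis unfolding F_def using consistent that by blast
  qed
  have cover: "\<exists>j\<le>2. A j < x \<and> x < B j" if "\<alpha> < x" "x < \<alpha> + \<theta>" for x
  proof -
    consider "x < \<alpha> + \<theta> / 2" | "x = \<alpha> + \<theta> / 2" | "\<alpha> + \<theta> / 2 < x" by linarith
    thus ?thesis
    proof cases
      case 1
      thus ?thesis using that by (intro exI[of _ 0]) (simp add: A_def B_def)
    next
      case 2
      thus ?thesis using \<theta> by (intro exI[of _ 1]) (simp add: A_def B_def field_simps)
    next
      case 3
      thus ?thesis using that by (intro exI[of _ 2]) (simp add: A_def B_def field_simps)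
    qed
  qed
  have ex_valid: "\<exists>j n. valid j n w" if "\<alpha> < Im w" "Im w < \<alpha> + \<theta>" for w
    using cover[OF that] ev_valid by blast
  have cont: "isCont (\<lambda>v. q + exp (v + of_nat n * of_real P)) w" for n w by (intro continuous_intros)
  show ?thesis
  proof (rule that[OF P(1)])
    show "afm_at exp F w" if w: "\<alpha> < Im w" "Im w < \<alpha> + \<theta>" for w
    proof -
      obtain j n where v: "valid j n w" using ex_valid[OF w] by blast
      hence j: "j \<le> 2" by (simp add: valid_def)
      have "open (D j)"
      proof -
        have "D j = (\<lambda>z. z - c) -` sector (A j) (B j)" by (auto simp: D_def)
        thus ?thesis using open_vimage[OF open_sector, of "\<lambda>z. z - c"] by (simp add: continuous_intros)
      qed
      hence "\<forall>\<^sub>F x in nhds (q + exp (w + of_nat n * of_real P)). x \<in> D j"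
        using v by (intro eventually_nhds_in_open) (auto simp: valid_def)
      from nhds_transport[where g="\<lambda>v. q + exp (v + of_nat n * of_real P)" and w=w, OF this cont]
      have 1: "\<forall>\<^sub>F v in nhds w. q + exp (v + of_nat n * of_real P) \<in> D j" .
      have 2: "\<forall>\<^sub>F v in nhds w. A j < Im v" "\<forall>\<^sub>F v in nhds w. Im v < B j"
        using v tendsto_Im_nhds[of w] by (auto simp: valid_def intro: order_tendstoD)
      have "\<forall>\<^sub>F v in nhds w. F v = f (q + exp (v + of_nat n * of_real P))"
        using 1 2
      proof eventually_elim
        case (elim v)
        hence "valid j n v" using j by (simp add: valid_def)
        thus ?case by (rule FV)
      qed
      moreover have "afm_at exp (\<lambda>v. f (q + exp (v + of_nat n * of_real P))) w"
      proof (rule afm_at_comp[where d="\<lambda>z. z" and A="of_real (l ^ n)" and B=q])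
        show "afm_at (\<lambda>z. z) f (q + exp (w + of_nat n * of_real P))" using f D_sub[OF j] v by (auto simp: valid_def)
        show "\<forall>\<^sub>F v in nhds w. q + exp (v + of_nat n * of_real P) = of_real (l ^ n) * exp v + q"
          unfolding eP by simp
      qed (use cont l(1) in auto)
      ultimately show ?thesis using afm_at_cong[of F "\<lambda>v. f (q + exp (v + of_nat n * of_real P))" w exp] by blast
    qed
    show "F (w + of_real P) = F w" if w: "\<alpha> < Im w" "Im w < \<alpha> + \<theta>" for w
    proof -
      obtain j n where v: "valid j n (w + of_real P)" using ex_valid[of "w + of_real P"] w by auto
      have e: "w + of_real P + of_nat n * of_real P = w + of_nat (Suc n) * of_real P" by (simp add: algebra_simps)
      have "valid j (Suc n) w" using v unfolding valid_def e by simp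
      thus ?thesis using FV[OF v] FV[of j "Suc n" w] unfolding e by simp
    qed
    show "F w \<in> f ` open_cone c \<alpha> \<theta>" if w: "\<alpha> < Im w" "Im w < \<alpha> + \<theta>" for w
    proof -
      obtain j n where v: "valid j n w" using ex_valid[OF w] by blast
      thus ?thesis using FV[OF v] D_sub[of j] unfolding valid_def by auto
    qed
    show "\<exists>s s'. \<alpha> \<le> s \<and> s < \<phi> \<and> \<phi> < s' \<and> s' \<le> \<alpha> + \<theta> \<and> s' \<le> s + pi \<and>
       (\<forall>v. s < Im v \<longrightarrow> Im v < s' \<longrightarrow> q + exp v - c \<in> sector s s' \<longrightarrow> F v = f (q + exp v))"
      if "\<alpha> < \<phi>" "\<phi> < \<alpha> + \<theta>" for \<phi>
    proof -
      obtain j where j: "j \<le> 2" "A j < \<phi>" "\<phi> < B j" using cover[OF \<open>\<alpha> < \<phi>\<close> \<open>\<phi> < \<alpha> + \<theta>\<close>] by blast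
      have "F v = f (q + exp v)" if "A j < Im v" "Im v < B j" "q + exp v - c \<in> sector (A j) (B j)" for v
        using FV[of j 0 v] that j by (simp add: valid_def D_def)
      thus ?thesis using j AB2[OF j(1)] AB(2)[of j] by blast
    qed
  qed
qed

end

text \<open>Injectivity modulo \<open>L\<close> is put in only for substrips of height at most pi,
  where \<open>exp\<close> is injective with convex image. The lemma \<open>collision\<close>
  removes that bound.\<close>

locale max_strip = straight_surface X \<Lambda> \<A> cP c\<kappa> c\<tau> cL
  for X :: "'a topology" and \<Lambda> \<A> cP c\<kappa> c\<tau> cL +
  fixes I :: "real set" and F :: "complex \<Rightarrow> 'a" and L :: real
  assumes strip: "strip_map I F" and L_pos: "L > 0"
    and period: "Im w \<in> I \<Longrightarrow> F (w + of_real L) = F w"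
    and local_collision: "s < s' \<Longrightarrow> s' \<le> s + pi \<Longrightarrow> {s<..<s'} \<subseteq> I \<Longrightarrow> s < Im w \<Longrightarrow> Im w < s' \<Longrightarrow>
        s < Im w' \<Longrightarrow> Im w' < s' \<Longrightarrow> F w = F w' \<Longrightarrow> \<exists>k::int. w' = w + of_int k * of_real L"
    and maximal: "strip_map I' F' \<Longrightarrow> I \<subseteq> I' \<Longrightarrow> (\<And>w. Im w \<in> I \<Longrightarrow> F' w = F w) \<Longrightarrow> I' = I"
begin

lemma open_I: "open I" and interval_I: "is_interval I" and I_ne: "I \<noteq> {}"
  and F_afm: "Im w \<in> I \<Longrightarrow> afm_at exp F w"
  using strip by (auto simp: strip_map_def)

lemma I_between: "a \<in> I \<Longrightarrow> b \<in> I \<Longrightarrow> a \<le> x \<Longrightarrow> x \<le> b \<Longrightarrow> x \<in> I"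
  using interval_I unfolding is_interval_1 by blast

lemma period_int: "Im w \<in> I \<Longrightarrow> F (w + of_int k * of_real L) = F w"
proof -
  have nat: "F (w + of_nat n * of_real L) = F w" if "Im w \<in> I" for w n
  proof (induction n)
    case (Suc n)
    have "F (w + of_nat n * of_real L + of_real L) = F (w + of_nat n * of_real L)" using that by (intro period) simp
    thus ?case using Suc by (simp add: algebra_simps)
  qed simp
  assume w: "Im w \<in> I"
  show ?thesis
  proof (cases "k \<ge> 0")
    case True
    thus ?thesis using nat[OF w, of "nat k"] by simp
  next
    case False
    thus ?thesis using nat[of "w + of_int k * of_real L" "nat (- k)"] w by simp
  qed
qed

lemma I_margin:
  assumes "x \<in> I"
  obtains e where "e > 0" "x - e \<in> I" "x + e \<in> I"
proof -
  obtain e where e: "e > 0" "ball x e \<subseteq> I" using open_I assms by (meson open_contains_ball)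
  hence "x - e / 2 \<in> I" "x + e / 2 \<in> I" by (auto simp: dist_norm)
  thus ?thesis using that[of "e / 2"] e(1) by simp
qed

lemma collision_close:
  assumes w: "Im w \<in> I" "Im w' \<in> I" "\<bar>Im w - Im w'\<bar> < pi" "F w = F w'"
  shows "\<exists>k::int. w' = w + of_int k * of_real L"
proof -
  define a b where "a = min (Im w) (Im w')" and "b = max (Im w) (Im w')"
  have ab: "a \<in> I" "b \<in> I" "a \<le> b" "b - a < pi" using w by (auto simp: a_def b_def min_def max_def)
  obtain e1 where e1: "e1 > 0" "a - e1 \<in> I" using I_margin[OF ab(1)] by blast
  obtain e2 where e2: "e2 > 0" "b + e2 \<in> I" using I_margin[OF ab(2)] by blast
  define e where "e = min (min e1 e2) ((pi - (b - a)) / 2)"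
  have e: "e > 0" "e \<le> e1" "e \<le> e2" "e \<le> (pi - (b - a)) / 2"
    using e1 e2 ab(4) min.cobounded2[of "min e1 e2" "(pi - (b - a)) / 2"] by (simp_all only: e_def min_less_iff_conj) auto
  have "{a - e<..<b + e} \<subseteq> I" using I_between[OF e1(2) e2(2)] e by auto
  moreover have "b + e \<le> a - e + pi" using e(4) by (simp add: field_simps)
  moreover have "a - e < Im w" "Im w < b + e" "a - e < Im w'" "Im w' < b + e"
    using e(1) by (auto simp: a_def b_def)
  ultimately show ?thesis using local_collision[of "a - e" "b + e" w w'] ab(3) e(1) w(4) by auto
qed

lemma Re_mod_period:
  obtains k :: int where "0 \<le> Re w + of_int k * L" "Re w + of_int k * L \<le> L"
proof -
  define k where "k = - \<lfloor>Re w / L\<rfloor>"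
  have "of_int \<lfloor>Re w / L\<rfloor> \<le> Re w / L" "Re w / L < of_int \<lfloor>Re w / L\<rfloor> + 1" by linarith+
  hence "of_int \<lfloor>Re w / L\<rfloor> * L \<le> Re w" "Re w < (of_int \<lfloor>Re w / L\<rfloor> + 1) * L"
    by (simp_all only: pos_le_divide_eq[OF L_pos] pos_divide_less_eq[OF L_pos])
  thus ?thesis using that[of k] by (simp add: k_def algebra_simps)
qed

text \<open>A deck transformation that rotates would make the image of the strip compact.\<close>

lemma no_rotation:
  assumes d: "Im d > 0" and w: "Im w \<in> I" "Im w + Im d \<in> I" and ev: "\<forall>\<^sub>F v in nhds w. F (v + d) = F v"
  shows False
proof -
  have per: "F (v + d) = F v" if v: "Im v \<in> I" "Im v + Im d \<in> I" for v
  proof -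
    have I': "{v. Im v \<in> I \<and> Im v + Im d \<in> I} = {v. Im v \<in> I} \<inter> (\<lambda>x. - d + x) ` {v. Im v \<in> I}"
      by (auto simp: image_iff intro!: exI[of _ "_ + d"])
    have "connected {v. Im v \<in> I \<and> Im v + Im d \<in> I}"
      unfolding I' by (intro convex_connected convex_Int convex_translation convex_strip interval_I)
    thus ?thesis
      by (rule identity_principle_eq[OF developing_simps(2), where ?w0.0 = w])
        (use F_afm afm_exp_shift[of F _ d] w ev v in auto)
  qed
  define K where "K = {u. 0 \<le> Re u \<and> Re u \<le> L \<and> Im w \<le> Im u \<and> Im u \<le> Im w + Im d}"
  have KI: "K \<subseteq> {v. Im v \<in> I}" using I_between[OF w] by (auto simp: K_def)
  \<comment> \<open>Repeated steps of \<open>\<plusminus> d\<close> bring the height of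
    \<open>v\<close> into the band above \<open>w\<close>; all intermediate heights stay in the
    interval \<open>I\<close>, so \<open>per\<close> applies at each step.\<close>
  have red: "\<exists>u. F u = F v \<and> Im w \<le> Im u \<and> Im u \<le> Im w + Im d" if "Im v \<in> I" "\<bar>Im v - Im w\<bar> \<le> real n * Im d" for v n
    using that
  proof (induction n arbitrary: v)
    case 0
    thus ?case using d by (intro exI[of _ v]) auto
  next
    case (Suc n)
    have n: "real (Suc n) * Im d = real n * Im d + Im d" by (simp add: algebra_simps)
    consider "Im v > Im w + Im d" | "Im v + Im d < Im w" | "Im v < Im w" "Im w \<le> Im v + Im d" | "Im w \<le> Im v" "Im v \<le> Im w + Im d"
      by linarith
    thus ?case
    proof cases
      case 1
      have "Im (v - d) \<in> I" using I_between[OF w(1) Suc.prems(1)] 1 d by simp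
      moreover from this have "F (v - d) = F v" using per[of "v - d"] Suc.prems(1) by simp
      moreover have "\<bar>Im (v - d) - Im w\<bar> \<le> real n * Im d" using Suc.prems(2) 1 unfolding n by simp
      ultimately show ?thesis using Suc.IH[of "v - d"] by metis
    next
      case 2
      have "Im v + Im d \<in> I" using I_between[OF Suc.prems(1) w(1)] 2 d by simp
      moreover from this have "F (v + d) = F v" using per[of v] Suc.prems(1) by simp
      moreover have "\<bar>Im (v + d) - Im w\<bar> \<le> real n * Im d" using Suc.prems(2) 2 unfolding n by simp
      ultimately show ?thesis using Suc.IH[of "v + d"] by (metis plus_complex.sel(2))
    next
      case 3
      hence "Im v + Im d \<in> I" using I_between[OF Suc.prems(1) w(2)] d by simp
      hence "F (v + d) = F v" using per[of v] Suc.prems(1) by simp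
      thus ?thesis using 3 by (intro exI[of _ "v + d"]) auto
    qed (intro exI[of _ v], simp)
  qed
  have "F ` {v. Im v \<in> I} \<subseteq> F ` K"
  proof
    fix x assume "x \<in> F ` {v. Im v \<in> I}"
    then obtain v where v: "Im v \<in> I" "x = F v" by auto
    obtain n :: nat where "\<bar>Im v - Im w\<bar> / Im d \<le> real n" using real_arch_simple by blast
    hence "\<bar>Im v - Im w\<bar> \<le> real n * Im d" using d by (simp add: pos_divide_le_eq)
    from red[OF v(1) this] obtain u where u: "F u = F v" "Im w \<le> Im u" "Im u \<le> Im w + Im d" by blast
    obtain k :: int where k: "0 \<le> Re u + of_int k * L" "Re u + of_int k * L \<le> L" by (rule Re_mod_period)
    have "u + of_int k * of_real L \<in> K" using k u by (simp add: K_def)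
    moreover have "F (u + of_int k * of_real L) = F u" using u I_between[OF w] by (intro period_int) auto
    ultimately show "x \<in> F ` K" using u(1) v(2) by (metis imageI)
  qed
  hence eq: "F ` {v. Im v \<in> I} = F ` K" using KI by auto
  have "K = cbox (Complex 0 (Im w)) (Complex L (Im w + Im d))"
    by (auto simp: K_def in_cbox_complex_iff)
  hence "compactin (top_of_set {v. Im v \<in> I}) K" using KI by (simp add: compactin_subtopology)
  moreover have "continuous_map (top_of_set {v. Im v \<in> I}) X F"
    by (rule afm_at_continuous_map[OF developing_simps(2)]) (use F_afm in auto)
  ultimately have "compactin X (F ` K)" by (rule image_compactin)
  thus False
    using no_compact_image[OF developing_simps(2) open_strip[OF open_I], of F] F_afm w(1) eq by auto
qed

text \<open>The points \<open>1 + \<kappa> x\<close> and \<open>1 - \<kappa> y\<close> lie on a line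
  through 1 that misses the origin, on opposite sides of 1. Seen from the origin such a line sweeps
  an angle less than pi. The computation reads this off the sign of
  \<open>sin (p - q)\<close>.\<close>

lemma arg_bounds:
  assumes \<kappa>: "Im \<kappa> \<noteq> 0" and x: "0 < x" and y: "0 < y" "y < 1"
  defines "p \<equiv> Im (Ln (1 + \<kappa> * of_real x))" and "q \<equiv> Im (Ln (1 - \<kappa> * of_real y))"
  shows "p * q < 0" "\<bar>p - q\<bar> < pi"
proof -
  define P Q where "P = 1 + \<kappa> * of_real x" and "Q = 1 - \<kappa> * of_real y"
  have Im: "Im P = Im \<kappa> * x" "Im Q = - (Im \<kappa> * y)" by (simp_all add: P_def Q_def)
  have ne: "P \<noteq> 0" "Q \<noteq> 0" using Im \<kappa> x y by auto
  have sgn: "0 < Im (Ln z) \<and> Im (Ln z) < pi \<longleftrightarrow> 0 < Im z" if "z \<noteq> 0" for z using Im_Ln_pos_lt[OF that] by simp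
  have PQ: "exp (Ln P - Ln Q) = P / Q" using ne by (simp add: exp_diff)
  have ImPQ: "Im (P * cnj Q) = Im \<kappa> * (x + y)"
    by (simp add: P_def Q_def algebra_simps)
  have "P / Q = (P * cnj Q) / of_real ((cmod Q)\<^sup>2)" using complex_div_cnj[of P Q] by simp
  hence "Im (P / Q) = Im (P * cnj Q) / (cmod Q)\<^sup>2" by (simp only: Im_divide_of_real)
  hence "exp (Re (Ln P - Ln Q)) * sin (p - q) = Im \<kappa> * (x + y) / (cmod Q)\<^sup>2"
    using PQ ImPQ Im_exp[of "Ln P - Ln Q"] by (simp add: p_def q_def P_def[symmetric] Q_def[symmetric])
  hence "exp (Re (Ln P - Ln Q)) * sin (p - q) / exp (Re (Ln P - Ln Q)) =
      Im \<kappa> * (x + y) / (cmod Q)\<^sup>2 / exp (Re (Ln P - Ln Q))" by (simp only:)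
  hence "sin (p - q) = Im \<kappa> * (x + y) / (cmod Q)\<^sup>2 / exp (Re (Ln P - Ln Q))"
    by (simp only: nonzero_mult_div_cancel_left exp_not_eq_zero not_False_eq_True simp_thms)
  hence sin_sgn: "sin (p - q) = Im \<kappa> * ((x + y) / (cmod Q)\<^sup>2 / exp (Re (Ln P - Ln Q)))"
    by (simp only: times_divide_eq_right)
  have pos: "(x + y) / (cmod Q)\<^sup>2 / exp (Re (Ln P - Ln Q)) > 0" using x y ne by simp
  have rng: "- pi < p" "p \<le> pi" "- pi < q" "q \<le> pi"
    using mpi_less_Im_Ln Im_Ln_le_pi ne by (auto simp: p_def q_def P_def[symmetric] Q_def[symmetric])
  show "p * q < 0" "\<bar>p - q\<bar> < pi"
  proof -
    have "p * q < 0 \<and> \<bar>p - q\<bar> < pi"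
    proof (cases "Im \<kappa> > 0")
      case True
      have "0 < p" "p < pi" using sgn[OF ne(1)] Im True x by (auto simp: p_def P_def[symmetric])
      moreover have "q < 0"
      proof -
        have "Im Q < 0" using Im True y by simp
        thus ?thesis using sgn[OF ne(2)] Im_Ln_pos_le[OF ne(2)] rng unfolding q_def Q_def[symmetric] by linarith
      qed
      moreover have "p - q < pi"
      proof (rule ccontr)
        assume "\<not> p - q < pi"
        hence "sin (p - q) \<le> 0" using rng \<open>p < pi\<close> by (intro sin_le_zero) auto
        thus False using sin_sgn pos True by (metis linorder_not_less mult_pos_pos)
      qed
      ultimately show ?thesis by (simp add: mult_pos_neg)
    next
      case False
      hence neg: "Im \<kappa> < 0" using \<kappa> by simp
      have "0 < q" "q < pi" using sgn[OF ne(2)] Im neg y by (auto simp: q_def Q_def[symmetric] mult_neg_pos)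
      moreover have "p < 0"
      proof -
        have "Im P < 0" using Im neg x by (simp add: mult_neg_pos)
        thus ?thesis using sgn[OF ne(1)] Im_Ln_pos_le[OF ne(1)] rng unfolding p_def P_def[symmetric] by linarith
      qed
      moreover have "q - p < pi"
      proof (rule ccontr)
        assume "\<not> q - p < pi"
        hence "sin (q - p) \<le> 0" using rng \<open>q < pi\<close> by (intro sin_le_zero) auto
        moreover have "sin (q - p) = - sin (p - q)" by (metis minus_diff_eq sin_minus)
        ultimately show False using sin_sgn pos neg by (metis linorder_not_less mult_neg_pos neg_le_0_iff_le)
      qed
      ultimately show ?thesis by (simp add: mult_neg_pos)
    qed
    thus "p * q < 0" "\<bar>p - q\<bar> < pi" by auto
  qed
qed

text \<open>
  If the transition at a collision is not linear in the developing coordinate, it carries a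
  closed leaf to a straight line that turns by less than \<open>\<pi>\<close>; such a line meets a closed leaf
  at most once, so it has to leave the strip on both sides.
\<close>

lemma collision_linear:
  assumes w: "Im w1 \<in> I" "Im w2 \<in> I" and A: "A \<noteq> 0" "exp w2 = A * exp w1 + B"
    and ev: "\<forall>\<^sub>F x in nhds w1. F x = F (w2 + Ln ((A * exp x + B) / exp w2))"
    and \<kappa>: "Im (A * exp w1 / exp w2) \<noteq> 0" and wide: "a \<in> I" "b \<in> I" "b - a > pi"
  shows False
proof -
  define \<kappa> where "\<kappa> = A * exp w1 / exp w2"
  define \<Theta> where "\<Theta> x = w2 + Ln ((A * exp x + B) / exp w2)" for x
  \<comment> \<open>The lift through \<open>w2\<close> of the straight line into which the
    transition takes the horizontal leaf through \<open>w1\<close>; \<open>\<kappa>\<close> is its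
    direction seen from \<open>exp w2\<close>, and it is radial only when \<open>\<kappa>\<close> is
    real.\<close>
  define \<omega> where "\<omega> t = w2 + Ln (1 + \<kappa> * of_real (exp t - 1))" for t
  have arg: "(A * exp (w1 + of_real t) + B) / exp w2 = 1 + \<kappa> * of_real (exp t - 1)" for t
  proof -
    have "B = exp w2 - A * exp w1" using A(2) by simp
    thus ?thesis by (simp add: \<kappa>_def exp_add exp_of_real field_simps)
  qed
  have \<Theta>\<omega>: "\<Theta> (w1 + of_real t) = \<omega> t" for t by (simp add: \<Theta>_def \<omega>_def arg)
  have np: "1 + \<kappa> * of_real (exp t - 1) \<notin> \<real>\<^sub>\<le>\<^sub>0" for t
  proof
    assume n: "1 + \<kappa> * of_real (exp t - 1) \<in> \<real>\<^sub>\<le>\<^sub>0"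
    hence "Im \<kappa> * (exp t - 1) = 0" by (auto simp: complex_nonpos_Reals_iff)
    hence "exp t - 1 = 0" using \<kappa> by (simp add: \<kappa>_def)
    thus False using n by (simp add: complex_nonpos_Reals_iff)
  qed
  \<comment> \<open>If the lift stayed in the strip during one period, its end would have the same
    image as \<open>w2\<close> at a height differing by less than pi. By
    \<open>collision_close\<close> the heights would agree, which is impossible for nonreal
    \<open>\<kappa>\<close>.\<close>
  have exits: "\<exists>t\<in>closed_segment 0 t1. Im (\<omega> t) \<notin> I" if t1: "t1 = L \<or> t1 = - L" for t1
  proof (rule ccontr)
    assume "\<not> ?thesis"
    hence inI: "\<And>t. t \<in> closed_segment 0 t1 \<Longrightarrow> Im (\<omega> t) \<in> I" by blast
    let ?D = "(\<lambda>t. w1 + complex_of_real t) ` closed_segment 0 t1"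
    have "connected ?D" by (intro connected_continuous_image continuous_intros connected_segment)
    moreover have "afm_at exp (\<lambda>x. F (\<Theta> x)) x" if xD: "x \<in> ?D" for x
    proof -
      obtain t where t: "t \<in> closed_segment 0 t1" "x = w1 + of_real t" using xD by blast
      show ?thesis
      proof (rule afm_at_comp[where d=exp and A=A and B=B])
        show "afm_at exp F (\<Theta> x)" using inI[OF t(1)] by (simp add: t(2) \<Theta>\<omega> F_afm)
        show "isCont \<Theta> x" unfolding \<Theta>_def[abs_def] using np[of t] arg[of t] t(2) by (intro continuous_intros) auto
        have "A * exp x + B \<noteq> 0"
        proof
          assume "A * exp x + B = 0"
          hence "1 + \<kappa> * of_real (exp t - 1) = 0" using arg[of t] t(2) by simp
          thus False using np[of t] by simp
        qed
        moreover have "isCont (\<lambda>v. A * exp v + B) x" by (intro continuous_intros)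
        ultimately have "\<forall>\<^sub>F v in nhds x. A * exp v + B \<noteq> 0"
          using tendsto_imp_eventually_ne[OF isCont_nhds] by blast
        thus "\<forall>\<^sub>F v in nhds x. exp (\<Theta> v) = A * exp v + B"
          by eventually_elim (simp add: \<Theta>_def exp_add)
      qed (rule A(1))
    qed
    moreover have "afm_at exp F x" if "x \<in> ?D" for x using that w(1) by (auto intro: F_afm)
    moreover have "w1 \<in> ?D" by (intro image_eqI[of _ _ 0]) auto
    moreover have "w1 + of_real t1 \<in> ?D" by (intro imageI) auto
    ultimately have "F (w1 + of_real t1) = F (\<Theta> (w1 + of_real t1))"
      using identity_principle_eq[OF developing_simps(2), of ?D F "\<lambda>x. F (\<Theta> x)" w1 "w1 + of_real t1"] ev
      unfolding \<Theta>_def by blast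
    hence "F (w1 + of_real t1) = F (\<omega> t1)" by (simp add: \<Theta>\<omega>)
    moreover have "F (w1 + of_real t1) = F w1"
      using t1 period_int[OF w(1), of 1] period_int[OF w(1), of "-1"] by auto
    moreover have "F w1 = F w2"
      using eventually_nhds_x_imp_x[OF ev] by (simp add: A(2)[symmetric])
    ultimately have "F w2 = F (\<omega> t1)" by simp
    moreover have dIm: "Im (\<omega> t1) - Im w2 = Im (Ln (1 + \<kappa> * of_real (exp t1 - 1)))" by (simp add: \<omega>_def)
    moreover have ne1: "1 + \<kappa> * of_real (exp t1 - 1) \<noteq> 0" using np[of t1] by auto
    have "\<bar>Im (Ln (1 + \<kappa> * of_real (exp t1 - 1)))\<bar> < pi"
      using Im_Ln_less_pi[OF np[of t1]] mpi_less_Im_Ln[OF ne1] by linarith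
    hence "\<bar>Im w2 - Im (\<omega> t1)\<bar> < pi" using dIm by linarith
    ultimately obtain k :: int where "\<omega> t1 = w2 + of_int k * of_real L"
      using collision_close[OF w(2) inI[of t1]] by auto
    hence "Im (Ln (1 + \<kappa> * of_real (exp t1 - 1))) = 0" using dIm by simp
    hence "Im (1 + \<kappa> * of_real (exp t1 - 1)) = 0"
      using Im_exp[of "Ln (1 + \<kappa> * of_real (exp t1 - 1))"] exp_Ln[OF ne1] by simp
    hence "Im \<kappa> * (exp t1 - 1) = 0" by simp
    moreover have "exp t1 - 1 \<noteq> 0" using t1 L_pos by auto
    ultimately show False using \<kappa> by (simp add: \<kappa>_def)
  qed
  obtain t where t: "0 \<le> t" "Im (\<omega> t) \<notin> I"
    using exits[of L] L_pos by (auto simp: closed_segment_eq_real_ivl split: if_splits)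
  obtain t' where t': "t' \<le> 0" "Im (\<omega> t') \<notin> I"
    using exits[of "- L"] L_pos by (auto simp: closed_segment_eq_real_ivl split: if_splits)
  have w0: "Im (\<omega> 0) \<in> I" using w(2) by (simp add: \<omega>_def)
  hence "t \<noteq> 0" "t' \<noteq> 0" using t t' by auto
  hence xy: "0 < exp t - 1" "0 < 1 - exp t'" "1 - exp t' < 1" using t t' by auto
  define p q where "p = Im (Ln (1 + \<kappa> * of_real (exp t - 1)))" and "q = Im (Ln (1 - \<kappa> * of_real (1 - exp t')))"
  have pq: "p * q < 0" "\<bar>p - q\<bar> < pi" using arg_bounds[OF _ xy, of \<kappa>] \<kappa> by (simp_all add: p_def q_def \<kappa>_def)
  have e: "1 - \<kappa> * of_real (1 - exp t') = 1 + \<kappa> * of_real (exp t' - 1)" by (simp add: algebra_simps)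
  have "Im w2 + p \<notin> I" "Im w2 + q \<notin> I" using t(2) t'(2) unfolding p_def q_def e by (simp_all add: \<omega>_def)
  hence "p \<noteq> 0" "q \<noteq> 0" using w(2) by auto
  \<comment> \<open>The two exits are on opposite sides of the strip, one below \<open>a\<close> and
    one above \<open>b\<close>, although they are less than pi apart.\<close>
  consider "p < 0" "q > 0" | "p > 0" "q < 0" using pq(1) by (auto simp: mult_less_0_iff)
  thus False
  proof cases
    case 1
    have "Im w2 + p < a" using I_between[OF wide(1) w(2), of "Im w2 + p"] 1 \<open>Im w2 + p \<notin> I\<close> by linarith
    moreover have "b < Im w2 + q" using I_between[OF w(2) wide(2), of "Im w2 + q"] 1 \<open>Im w2 + q \<notin> I\<close> by linarith
    ultimately show False using pq(2) wide(3) by linarith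
  next
    case 2
    have "Im w2 + q < a" using I_between[OF wide(1) w(2), of "Im w2 + q"] 2 \<open>Im w2 + q \<notin> I\<close> by linarith
    moreover have "b < Im w2 + p" using I_between[OF w(2) wide(2), of "Im w2 + p"] 2 \<open>Im w2 + p \<notin> I\<close> by linarith
    ultimately show False using pq(2) wide(3) by linarith
  qed
qed

text \<open>A collision over a height of at least pi has an affine transition
  \<open>A z + B\<close>. With \<open>B = 0\<close> it is a deck transformation that rotates,
  excluded by \<open>no_rotation\<close>; otherwise a nearby collision has nonreal direction and
  \<open>collision_linear\<close> applies.\<close>

lemma collision:
  assumes w: "Im w \<in> I" "Im w' \<in> I" "F w = F w'"
  shows "\<exists>k::int. w' = w + of_int k * of_real L"
proof (cases "\<bar>Im w - Im w'\<bar> < pi")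
  case True
  thus ?thesis using collision_close[OF w(1,2) _ w(3)] by blast
next
  case far: False
  have False if v: "Im v \<in> I" "Im v' \<in> I" "F v = F v'" "Im v' - Im v \<ge> pi" for v v'
  proof -
    \<comment> \<open>The extra margin below \<open>Im v\<close> makes the available height strictly
      larger than pi.\<close>
    obtain e where e: "e > 0" "Im v - e \<in> I" using I_margin[OF v(1)] by blast
    have wide: "Im v' - (Im v - e) > pi" using v(4) e(1) by simp
    obtain A B where AB: "A \<noteq> 0" "exp v' = A * exp v + B"
      "\<forall>\<^sub>F p in nhds v \<times>\<^sub>F nhds v'. F (fst p) = F (snd p) \<longleftrightarrow> A * exp (fst p) + B = exp (snd p)"
      by (rule transition[OF developing_simps(2,2) F_afm[OF v(1)] F_afm[OF v(2)] v(3)])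
    define g where "g x = v' + Ln ((A * exp x + B) / exp v')" for x
    have g: "g v = v'" by (simp add: g_def AB(2)[symmetric])
    have gc: "isCont g v" unfolding g_def[abs_def] using AB(2) by (intro continuous_intros) (auto simp flip: AB(2))
    have "\<forall>\<^sub>F x in nhds v. F x = F (g x) \<longleftrightarrow> A * exp x + B = exp (g x)"
      by (rule eventually_nhds_prod_along[where P="\<lambda>x y. F x = F y \<longleftrightarrow> A * exp x + B = exp y"]) (use AB(3) g gc in auto)
    moreover have "isCont (\<lambda>x. A * exp x + B) v" by (intro continuous_intros)
    from tendsto_imp_eventually_ne[OF isCont_nhds[OF this], of 0]
    have ne: "\<forall>\<^sub>F x in nhds v. A * exp x + B \<noteq> 0" by (simp flip: AB(2))
    ultimately have Fg: "\<forall>\<^sub>F x in nhds v. F x = F (g x) \<and> exp (g x) = A * exp x + B"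
      by eventually_elim (auto simp: g_def exp_add)
    show False
    proof (cases "B = 0")
      case True
      have "A = exp (v' - v)" using AB(2) True by (simp add: exp_diff)
      have "\<forall>\<^sub>F x in nhds v. F x = F (x + (v' - v)) \<longleftrightarrow> A * exp x + B = exp (x + (v' - v))"
        by (rule eventually_nhds_prod_along[where P="\<lambda>x y. F x = F y \<longleftrightarrow> A * exp x + B = exp y"])
          (use AB(3) in \<open>auto intro!: continuous_intros\<close>)
      hence "\<forall>\<^sub>F x in nhds v. F (x + (v' - v)) = F x"
        by eventually_elim (use True \<open>A = exp (v' - v)\<close> in \<open>simp add: exp_add mult.commute\<close>)
      thus False using no_rotation[of "v' - v" v] v pi_gt_zero by (auto simp: less_le_trans)
    next
      case B: False
      have evnp: "\<forall>\<^sub>F x in nhds v. (A * exp x + B) / exp v' \<in> - \<real>\<^sub>\<le>\<^sub>0"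
      proof (rule nhds_transport[where g="\<lambda>x. (A * exp x + B) / exp v'"])
        have "(A * exp v + B) / exp v' = 1" by (simp add: AB(2)[symmetric])
        thus "\<forall>\<^sub>F x in nhds ((A * exp v + B) / exp v'). x \<in> - \<real>\<^sub>\<le>\<^sub>0"
          by (intro eventually_nhds_in_open open_Compl closed_nonpos_Reals_complex) (simp add: complex_nonpos_Reals_iff)
      qed (intro continuous_intros, simp)
      have evI: "\<forall>\<^sub>F x in nhds v. Im x \<in> I \<and> Im (g x) \<in> I"
      proof (rule eventually_conj)
        show 1: "\<forall>\<^sub>F x in nhds v. Im x \<in> I"
          using eventually_nhds_in_open[OF open_strip[OF open_I], of v] v(1) by simp
        have "\<forall>\<^sub>F x in nhds (g v). Im x \<in> I"
          using eventually_nhds_in_open[OF open_strip[OF open_I], of "g v"] v(2) g by simp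
        thus "\<forall>\<^sub>F x in nhds v. Im (g x) \<in> I" by (rule nhds_transport[OF _ gc])
      qed
      define Q1 where "Q1 x \<longleftrightarrow> (\<forall>\<^sub>F y in nhds x. F y = F (g y) \<and> exp (g y) = A * exp y + B)" for x
      have Fg': "\<forall>\<^sub>F x in nhds v. Q1 x"
        using Fg by (simp add: Q1_def eventually_eventually)
      obtain r where r1: "r > 0"
        "\<And>x. dist x v < r \<Longrightarrow> ((Im x \<in> I \<and> Im (g x) \<in> I) \<and> Q1 x) \<and> (A * exp x + B) / exp v' \<in> - \<real>\<^sub>\<le>\<^sub>0"
        using eventually_conj[OF eventually_conj[OF evI Fg'] evnp] unfolding eventually_nhds_metric by blast
      have r: "r > 0"
        "\<And>x. dist x v < r \<Longrightarrow> (Im x \<in> I \<and> Im (g x) \<in> I) \<and> (\<forall>\<^sub>F y in nhds x. F y = F (g y) \<and> exp (g y) = A * exp y + B)"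
        "\<And>x. dist x v < r \<Longrightarrow> (A * exp x + B) / exp v' \<notin> \<real>\<^sub>\<le>\<^sub>0"
        using r1 unfolding Q1_def by simp_all
      \<comment> \<open>If \<open>A * exp v / B\<close> is real, a vertical shift by less than pi
        rotates it off the real axis while staying in the ball where the collision persists.\<close>
      define \<eta> where "\<eta> = min (r / 2) 1"
      have \<eta>: "0 < \<eta>" "\<eta> < r" "\<eta> < pi" using r(1) pi_gt3 by (auto simp: \<eta>_def)
      have "\<exists>x. dist x v < r \<and> Im (A * exp x / B) \<noteq> 0"
      proof (cases "Im (A * exp v / B) = 0")
        case True
        let ?x = "v + \<i> * of_real \<eta>"
        define zz where "zz = A * exp v / B"
        have zz: "Im zz = 0" "zz \<noteq> 0" using True AB(1) B by (simp_all add: zz_def)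
        hence "Re zz \<noteq> 0" by (auto simp: complex_eq_iff)
        moreover have "A * exp ?x / B = zz * cis \<eta>" by (simp add: exp_add cis_conv_exp zz_def)
        hence "Im (A * exp ?x / B) = Re zz * sin \<eta>" using zz by simp
        moreover have "sin \<eta> > 0" using \<eta> by (intro sin_gt_zero)
        ultimately have "Im (A * exp ?x / B) \<noteq> 0" by simp
        moreover have "dist ?x v < r" using \<eta> by (simp add: dist_norm norm_mult)
        ultimately show ?thesis by blast
      qed (use r(1) in \<open>auto intro: exI[of _ v]\<close>)
      then obtain x where x: "dist x v < r" "Im (A * exp x / B) \<noteq> 0" by blast
      note rx = r(2)[OF x(1)]
      have ex: "exp (g x) = A * exp x + B" using eventually_nhds_x_imp_x[OF rx[THEN conjunct2]] by simp
      \<comment> \<open>Since \<open>exp (g x) = A * exp x + B\<close>, this quotient is real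
        exactly when \<open>A * exp x / B\<close> is.\<close>
      have "Im (A * exp x / exp (g x)) \<noteq> 0"
      proof
        assume 0: "Im (A * exp x / exp (g x)) = 0"
        define y where "y = A * exp x / exp (g x)"
        have "Im y = 0" "y \<noteq> 0" using 0 AB(1) by (simp_all add: y_def)
        then obtain ry where ry: "y = of_real ry" by (metis complex_is_Real_iff Reals_cases)
        have "B = exp (g x) - A * exp x" using ex by simp
        hence "B / (A * exp x) = 1 / y - 1" using AB(1) by (simp add: y_def field_simps)
        also have "\<dots> = of_real (1 / ry - 1)" by (simp add: ry)
        finally have BA: "B / (A * exp x) = of_real (1 / ry - 1)" .
        have "A * exp x / B = 1 / (B / (A * exp x))" by simp
        also have "\<dots> = of_real (1 / (1 / ry - 1))" unfolding BA by simp
        finally show False using x(2) by simp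
      qed
      moreover have "\<forall>\<^sub>F y in nhds x. F y = F (g x + Ln ((A * exp y + B) / exp (g x)))"
      proof -
        define h where "h y = g x + Ln ((A * exp y + B) / exp (g x))" for y
        have hx: "h x = g x" by (simp add: h_def ex[symmetric])
        have hc: "isCont h x" unfolding h_def[abs_def] using ex
          by (intro continuous_intros) (auto simp: ex[symmetric])
        have gcx: "isCont g x" unfolding g_def[abs_def] using r(3)[OF x(1)] by (intro continuous_intros) auto
        have "filterlim (\<lambda>y. (g y, h y)) (nhds (g x) \<times>\<^sub>F nhds (g x)) (nhds x)"
          using isCont_nhds[OF gcx] isCont_nhds[OF hc] hx by (intro filterlim_Pair) auto
        from eventually_compose_filterlim[OF locally_injective[OF developing_simps(2) F_afm[of "g x"]] this]
        have "\<forall>\<^sub>F y in nhds x. F (g y) = F (h y) \<longleftrightarrow> exp (g y) = exp (h y)" using rx by simp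
        moreover have "\<forall>\<^sub>F y in nhds x. F y = F (g y) \<and> exp (g y) = A * exp y + B" using rx by simp
        ultimately have "\<forall>\<^sub>F y in nhds x. F y = F (h y)"
        proof eventually_elim
          case (elim y)
          have "exp (h y) = A * exp y + B"
          proof -
            have "A * exp y + B \<noteq> 0" using elim by (metis exp_not_eq_zero)
            thus ?thesis by (simp add: h_def exp_add)
          qed
          thus ?case using elim by simp
        qed
        thus ?thesis by (simp add: h_def)
      qed
      ultimately show False
        using collision_linear[of x "g x" A B "Im v - e" "Im v'"] rx ex AB(1) e(2) v(2) wide by auto
    qed
  qed
  from this[of w w'] this[of w' w] far w show ?thesis by (cases "Im w \<le> Im w'") auto
qed

end

context straight_surface
begin

text \<open>Every substrip of height at most pi has its own minimal period, but by the identity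
  principle each of these is a period on all of \<open>I\<close>. They therefore divide one another
  and coincide.\<close>

lemma exists_max_strip:
  assumes \<theta>: "\<theta> > 0" and P: "P > 0" and F0: "\<And>w. \<alpha> < Im w \<Longrightarrow> Im w < \<alpha> + \<theta> \<Longrightarrow> afm_at exp F0 w"
    and per: "\<And>w. \<alpha> < Im w \<Longrightarrow> Im w < \<alpha> + \<theta> \<Longrightarrow> F0 (w + of_real P) = F0 w"
  obtains I F L where "max_strip X \<Lambda> \<A> cP c\<kappa> c\<tau> cL I F L" "{\<alpha><..<\<alpha> + \<theta>} \<subseteq> I"
    "\<And>w. \<alpha> < Im w \<Longrightarrow> Im w < \<alpha> + \<theta> \<Longrightarrow> F w = F0 w"
proof -
  have "strip_map {\<alpha><..<\<alpha> + \<theta>} F0" using \<theta> F0 by (auto simp: strip_map_def is_interval_oo)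
  then obtain I F where I: "{\<alpha><..<\<alpha> + \<theta>} \<subseteq> I" "strip_map I F" "\<And>w. Im w \<in> {\<alpha><..<\<alpha> + \<theta>} \<Longrightarrow> F w = F0 w"
    and max: "\<And>I' F'. strip_map I' F' \<Longrightarrow> I \<subseteq> I' \<Longrightarrow> (\<And>w. Im w \<in> I \<Longrightarrow> F' w = F w) \<Longrightarrow> I' = I"
    using maximal_strip by blast
  have afm: "afm_at exp F w" if "Im w \<in> I" for w using I(2) that by (simp add: strip_map_def)
  have extend: "F (w + of_real p) = F w"
    if p: "s < s'" "{s<..<s'} \<subseteq> I" "\<And>v. s < Im v \<Longrightarrow> Im v < s' \<Longrightarrow> F (v + of_real p) = F v" and w: "Im w \<in> I" for s s' p w
  proof -
    have "F w = F (w + of_real p)"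
      by (rule strip_identity[OF I(2), of "\<lambda>w. F (w + of_real p)" "{s<..<s'}"])
        (use p w in \<open>auto intro!: afm_exp_shift afm\<close>)
    thus ?thesis by simp
  qed
  have perI: "F (w + of_real P) = F w" if "Im w \<in> I" for w
    by (rule extend[of \<alpha> "\<alpha> + \<theta>" P w]) (use \<theta> I per that in auto)
  have group: "\<exists>l>0. (\<forall>w. Im w \<in> I \<longrightarrow> F (w + of_real l) = F w) \<and>
     (\<forall>w w'. s < Im w \<longrightarrow> Im w < s' \<longrightarrow> s < Im w' \<longrightarrow> Im w' < s' \<longrightarrow> F w = F w' \<longrightarrow> (\<exists>k::int. w' = w + of_int k * of_real l))"
    if s: "s < s'" "s' \<le> s + pi" "{s<..<s'} \<subseteq> I" for s s'
  proof -
    have sub: "Im w \<in> I" if "s < Im w" "Im w < s'" for w using s(3) that by auto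
    obtain l where l: "l > 0" "\<And>w. s < Im w \<Longrightarrow> Im w < s' \<Longrightarrow> F (w + of_real l) = F w"
      "\<And>w w'. s < Im w \<Longrightarrow> Im w < s' \<Longrightarrow> s < Im w' \<Longrightarrow> Im w' < s' \<Longrightarrow> F w = F w' \<Longrightarrow> \<exists>k::int. w' = w + of_int k * of_real l"
      using strip_group[OF s(1,2) afm[OF sub] P perI[OF sub]] by metis
    have "F (w + of_real l) = F w" if "Im w \<in> I" for w by (rule extend[OF s(1,3) l(2) that])
    thus ?thesis using l(1,3) by blast
  qed
  define s0' where "s0' = \<alpha> + min \<theta> pi"
  have s0: "\<alpha> < s0'" "s0' \<le> \<alpha> + pi" "{\<alpha><..<s0'} \<subseteq> I"
  proof -
    show "\<alpha> < s0'" "s0' \<le> \<alpha> + pi" using \<theta> by (auto simp: s0'_def)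
    have "s0' \<le> \<alpha> + \<theta>" by (simp add: s0'_def)
    thus "{\<alpha><..<s0'} \<subseteq> I" using I(1) by auto
  qed
  obtain L where L: "L > 0" "\<And>w. Im w \<in> I \<Longrightarrow> F (w + of_real L) = F w"
    "\<And>w w'. \<alpha> < Im w \<Longrightarrow> Im w < s0' \<Longrightarrow> \<alpha> < Im w' \<Longrightarrow> Im w' < s0' \<Longrightarrow> F w = F w' \<Longrightarrow> \<exists>k::int. w' = w + of_int k * of_real L"
    using group[OF s0] by blast
  have "max_strip X \<Lambda> \<A> cP c\<kappa> c\<tau> cL I F L"
  proof (unfold_locales)
    fix s s' w w'
    assume s: "s < s'" "s' \<le> s + pi" "{s<..<s'} \<subseteq> I"
      and w: "s < Im w" "Im w < s'" "s < Im w'" "Im w' < s'" "F w = F w'"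
    obtain l where l: "l > 0" "\<And>w. Im w \<in> I \<Longrightarrow> F (w + of_real l) = F w"
      "\<And>w w'. s < Im w \<Longrightarrow> Im w < s' \<Longrightarrow> s < Im w' \<Longrightarrow> Im w' < s' \<Longrightarrow> F w = F w' \<Longrightarrow> \<exists>k::int. w' = w + of_int k * of_real l"
      using group[OF s] by blast
    \<comment> \<open>A point of the reference substrip: there the period \<open>l\<close> is a
      multiple of \<open>L\<close>, while in the given substrip \<open>L\<close> is a multiple of
      \<open>l\<close>.\<close>
    define w0 where "w0 = \<i> * of_real ((\<alpha> + s0') / 2)"
    have "Im w0 = (\<alpha> + s0') / 2" by (simp add: w0_def)
    hence w0: "\<alpha> < Im w0" "Im w0 < s0'" "Im w0 \<in> I" using s0 by (auto intro!: subsetD[OF s0(3)])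
    obtain k :: int where k: "w0 + of_real l = w0 + of_int k * of_real L"
      using L(3)[of w0 "w0 + of_real l"] l(2)[OF w0(3)] w0 by auto
    have wI: "Im w \<in> I" using s(3) w(1,2) by auto
    obtain k' :: int where k': "w + of_real L = w + of_int k' * of_real l"
      using l(3)[of w "w + of_real L"] L(2)[OF wI] w(1,2) by auto
    have lk: "l = of_int k * L" and Lk: "L = of_int k' * l"
      using arg_cong[OF k, of Re] arg_cong[OF k', of Re] by simp_all
    have "0 < of_int k * L" using lk l(1) by linarith
    moreover have "0 < of_int k' * l" using Lk L(1) by linarith
    ultimately have "0 < real_of_int k" "0 < real_of_int k'"
      using zero_less_mult_pos2 l(1) L(1) by blast+
    hence "k > 0" "k' > 0" by simp_all
    hence "1 * L \<le> of_int k * L" "1 * l \<le> of_int k' * l"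
      using L(1) l(1) by (intro mult_right_mono; simp)+
    hence "l = L" using lk Lk by linarith
    thus "\<exists>k::int. w' = w + of_int k * of_real L" using l(3)[OF w] by simp
  qed (use I(2) L max in auto)
  thus ?thesis using that I by auto
qed

end

section \<open>Finite width of a maximal strip\<close>

context max_strip
begin

text \<open>Each window of height pi is a half plane in the coordinate \<open>exp w\<close>, with a
  point of its axis mapped into \<open>thick\<close>. Infinitely many of these images cluster in one
  embedded disc, and either size of that disc contradicts what is known about collisions.\<close>

lemma no_spread:
  assumes \<phi>: "\<And>k::nat. {\<phi> k - pi / 2<..<\<phi> k + pi / 2} \<subseteq> I" and sep: "\<And>k m. k \<noteq> m \<Longrightarrow> \<bar>\<phi> k - \<phi> m\<bar> \<ge> pi"
  shows False
proof -
  define s s' where "s k = \<phi> k - pi / 2" and "s' k = \<phi> k + pi / 2" for k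
  have s: "s k < s' k" "s' k \<le> s k + pi" for k by (simp_all add: s_def s'_def)
  have sI: "Im w \<in> I" if "s k < Im w" "Im w < s' k" for w k using \<phi>[of k] that by (auto simp: s_def s'_def)
  define G where "G k = (\<lambda>z. F (sector_log (s k) (s' k) z))" for k
  have G_afm: "afm_at (\<lambda>z. z) (G k) z" if "z \<in> sector (s k) (s' k)" for k z
    unfolding G_def by (rule afm_sector_log[OF s F_afm[OF sI] that])
  have G_exp: "G k (exp w) = F w" "exp w \<in> sector (s k) (s' k)" if "s k < Im w" "Im w < s' k" for k w
    using sector_log_exp[OF s(2) that] exp_in_sector[OF s(2) that] by (simp_all add: G_def)
  have ray: "of_real t * cis (\<phi> k) = exp (Complex (ln t) (\<phi> k))" if "t > 0" for t k
    using that by (simp add: exp_eq_polar exp_of_real[symmetric])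
  have "\<exists>t\<ge>1. G k (0 + of_real t * cis (\<phi> k)) \<in> thick" for k
  proof (rule ray_visits_thick)
    show "afm_at (\<lambda>z. z) (G k) (0 + of_real t * cis (\<phi> k))" if "t \<ge> 1" for t
      using that G_exp(2)[of k "Complex (ln t) (\<phi> k)"] by (auto intro!: G_afm simp: ray s_def s'_def)
  qed simp
  then obtain t where t: "\<And>k. t k \<ge> 1 \<and> G k (of_real (t k) * cis (\<phi> k)) \<in> thick" by (metis add_0)
  define w where "w k = Complex (ln (t k)) (\<phi> k)" for k
  have w: "exp (w k) = of_real (t k) * cis (\<phi> k)" "s k < Im (w k)" "Im (w k) < s' k" for k
    using t[of k] ray[of "t k" k] by (auto simp: w_def s_def s'_def)
  have wI: "Im (w k) \<in> I" for k using sI w by blast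
  have tpos: "t k > 0" for k using t[of k] by linarith
  have nw: "cmod (exp (w k)) = t k" for k using tpos[of k] by (simp add: w norm_mult)
  \<comment> \<open>The point \<open>exp (w k)\<close> lies on the axis of the half plane at
    distance \<open>t k\<close> from the boundary.\<close>
  have half: "v \<in> sector (s k) (s' k)" if "cmod (v - exp (w k)) < t k" for v k
  proof -
    define x where "x = v * cis (- \<phi> k)"
    have "x - of_real (t k) = (v - exp (w k)) * cis (- \<phi> k)"
      by (simp add: x_def w algebra_simps cis_mult)
    hence "cmod (x - of_real (t k)) < t k" using that by (simp add: norm_mult)
    hence pos: "0 < Re x" using abs_Re_le_cmod[of "x - of_real (t k)"] by simp
    have "cis (- s k) = cis (- \<phi> k) * \<i>" "cis (- s' k) = cis (- \<phi> k) * (- \<i>)"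
      by (simp_all add: s_def s'_def complex_eq_iff cos_add sin_add cos_diff sin_diff)
    hence "v * cis (- s k) = x * \<i>" "v * cis (- s' k) = x * (- \<i>)" by (simp_all add: x_def)
    thus ?thesis using pos by (intro sectorI) (simp_all only: times_complex.sel, simp_all)
  qed
  have "F (w k) \<in> thick" for k using t[of k] G_exp(1)[of k "w k"] w[of k] by simp
  then obtain E where E: "\<And>e. e \<in> ball 0 1 \<Longrightarrow> afm_at (\<lambda>z. z) E e" "inj_on E (ball 0 1)"
    "\<And>r. 0 < r \<Longrightarrow> r \<le> 1 \<Longrightarrow> infinite {k \<in> UNIV. F (w k) \<in> E ` ball 0 r}"
    using regular_cluster[of "UNIV :: nat set" "\<lambda>k. F (w k)"] by blast
  define N where "N = {k. F (w k) \<in> E ` ball 0 (1/8)}"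
  have infN: "infinite N" using E(3)[of "1/8"] by (simp add: N_def)
  obtain k where k: "k \<in> N" using infN by (metis finite.emptyI ex_in_conv)
  obtain m where m: "m \<in> N" "m > k" using infN infinite_nat_iff_unbounded by blast
  obtain e where e: "cmod e < 1/8" "F (w k) = E e" using k by (auto simp: N_def)
  obtain e' where e': "cmod e' < 1/8" "F (w m) = E e'" using m by (auto simp: N_def)
  have Gk: "G k (exp (w k)) = E e" using G_exp(1)[OF w(2,3)] e by simp
  have e1: "cmod e < 1" using e by simp
  obtain A where A: "A \<noteq> 0"
    "\<And>v. v \<in> sector (s k) (s' k) \<Longrightarrow> cmod (A * (v - exp (w k))) < 1 - cmod e \<Longrightarrow> G k v = E (A * (v - exp (w k)) + e)"
    by (rule disc_param[OF convex_sector G_exp(2)[OF w(2,3)] G_afm E(1) e1 Gk]; blast)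
  show False
  \<comment> \<open>A disc small compared with \<open>t k\<close> pulls back into window
    \<open>k\<close>, so the image of \<open>w m\<close> is also taken there; but collisions
    preserve the height and the windows are disjoint.\<close>
  proof (cases "1 / 2 \<le> cmod A * t k")
    case True
    define v where "v = exp (w k) + (e' - e) / A"
    have de: "cmod (e' - e) < 1/4" using norm_triangle_ineq4[of e' e] e e' by linarith
    have "cmod ((e' - e) / A) < t k"
    proof -
      have "cmod (e' - e) < cmod A * t k" using de True by linarith
      thus ?thesis using A(1) by (simp add: norm_divide pos_divide_less_eq mult.commute)
    qed
    hence v: "v \<in> sector (s k) (s' k)" by (intro half) (simp add: v_def)
    have Av: "A * (v - exp (w k)) = e' - e" using A(1) by (simp add: v_def)
    have "cmod (A * (v - exp (w k))) < 1 - cmod e" unfolding Av using de e by linarith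
    from A(2)[OF v this] have "G k v = E e'" by (simp add: Av)
    hence "F (sector_log (s k) (s' k) v) = F (w m)" using e' by (simp add: G_def)
    moreover have im: "s k < Im (sector_log (s k) (s' k) v)" "Im (sector_log (s k) (s' k) v) < s' k"
      using sector_log_props(2,3)[OF s v] by auto
    ultimately obtain j :: int where "w m = sector_log (s k) (s' k) v + of_int j * of_real L"
      using collision[OF sI[OF im] wI] by blast
    hence "Im (w m) = Im (sector_log (s k) (s' k) v)" by simp
    hence "\<bar>\<phi> k - \<phi> m\<bar> < pi" using im by (simp add: w_def s_def s'_def)
    thus False using sep[of k m] m by simp
  next
    case False
    \<comment> \<open>A large disc also covers the homothetic copy of \<open>exp (w k)\<close>,
      which has the same image; this contradicts injectivity of \<open>E\<close>.\<close>
    define v where "v = exp (w k - of_real L)"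
    have "G k v = F (w k - of_real L)" "v \<in> sector (s k) (s' k)"
      using G_exp[of k "w k - of_real L"] w[of k] by (simp_all add: v_def)
    moreover have "F (w k - of_real L) = F (w k)" using period_int[OF wI, of k "-1"] by simp
    moreover have vk: "v - exp (w k) = of_real (exp (- L) - 1) * exp (w k)"
    proof -
      have "v = exp (w k) * exp (of_real (- L))" by (simp add: v_def exp_diff exp_minus divide_inverse)
      hence "v = exp (w k) * of_real (exp (- L))" by (simp only: exp_of_real)
      thus ?thesis by (simp add: algebra_simps)
    qed
    hence "cmod (v - exp (w k)) = \<bar>exp (- L) - 1\<bar> * t k" by (simp only: norm_mult norm_of_real nw)
    hence "cmod (A * (v - exp (w k))) = \<bar>exp (- L) - 1\<bar> * (cmod A * t k)" by (simp add: norm_mult)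
    moreover have "\<bar>exp (- L) - 1\<bar> \<le> 1" using L_pos by (simp add: abs_le_iff)
    hence "\<bar>exp (- L) - 1\<bar> * (cmod A * t k) \<le> 1 * (cmod A * t k)" using tpos[of k] by (intro mult_right_mono) auto
    ultimately have small: "cmod (A * (v - exp (w k))) < 1 / 2" and eq: "E (A * (v - exp (w k)) + e) = E e" "v \<in> sector (s k) (s' k)"
      using False e A(2)[of v] by auto
    have "cmod (A * (v - exp (w k)) + e) < 1" using norm_triangle_ineq[of "A * (v - exp (w k))" e] small e by linarith
    hence "A * (v - exp (w k)) + e = e" using inj_onD[OF E(2) eq(1)] e by simp
    hence "of_real (exp (- L) - 1) * exp (w k) = 0" using A(1) vk by simp
    thus False using L_pos by (simp del: of_real_diff)
  qed
qed

lemma I_bounded: obtains a b where "a < b" "I = {a<..<b}"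
proof -
  obtain x0 where x0: "x0 \<in> I" using I_ne by blast
  have above: "bdd_above I"
  proof (rule ccontr)
    assume "\<not> bdd_above I"
    hence unb: "\<exists>y\<in>I. y > z" for z unfolding bdd_above_def by (metis linorder_not_le)
    have up: "x \<in> I" if "x0 \<le> x" for x using unb[of x] I_between[OF x0] that by (metis less_imp_le)
    show False
    proof (rule no_spread[of "\<lambda>k. x0 + pi * (real k + 1)"])
      show "{x0 + pi * (real k + 1) - pi / 2<..<x0 + pi * (real k + 1) + pi / 2} \<subseteq> I" for k
      proof
        fix x assume "x \<in> {x0 + pi * (real k + 1) - pi / 2<..<x0 + pi * (real k + 1) + pi / 2}"
        moreover have "pi * (real k + 1) = pi * real k + pi" "0 \<le> pi * real k" by (simp_all add: algebra_simps)
        ultimately show "x \<in> I" using pi_gt_zero by (intro up) (simp only: greaterThanLessThan_iff, linarith)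
      qed
      show "pi \<le> \<bar>x0 + pi * (real k + 1) - (x0 + pi * (real m + 1))\<bar>" if "k \<noteq> m" for k m :: nat
      proof -
        have "x0 + pi * (real k + 1) - (x0 + pi * (real m + 1)) = pi * (real k - real m)" by (simp add: algebra_simps)
        moreover have "1 \<le> \<bar>real k - real m\<bar>" using that by linarith
        hence "pi * 1 \<le> pi * \<bar>real k - real m\<bar>" by (intro mult_left_mono) auto
        ultimately show ?thesis by (simp add: abs_mult)
      qed
    qed
  qed
  have below: "bdd_below I"
  proof (rule ccontr)
    assume "\<not> bdd_below I"
    hence unb: "\<exists>y\<in>I. y < z" for z unfolding bdd_below_def by (metis linorder_not_le)
    have down: "x \<in> I" if "x \<le> x0" for x using unb[of x] I_between[OF _ x0] that by (metis less_imp_le)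
    show False
    proof (rule no_spread[of "\<lambda>k. x0 - pi * (real k + 1)"])
      show "{x0 - pi * (real k + 1) - pi / 2<..<x0 - pi * (real k + 1) + pi / 2} \<subseteq> I" for k
      proof
        fix x assume "x \<in> {x0 - pi * (real k + 1) - pi / 2<..<x0 - pi * (real k + 1) + pi / 2}"
        moreover have "pi * (real k + 1) = pi * real k + pi" "0 \<le> pi * real k" by (simp_all add: algebra_simps)
        ultimately show "x \<in> I" using pi_gt_zero by (intro down) (simp only: greaterThanLessThan_iff, linarith)
      qed
      show "pi \<le> \<bar>x0 - pi * (real k + 1) - (x0 - pi * (real m + 1))\<bar>" if "k \<noteq> m" for k m :: nat
      proof -
        have "x0 - pi * (real k + 1) - (x0 - pi * (real m + 1)) = pi * (real m - real k)" by (simp add: algebra_simps)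
        moreover have "1 \<le> \<bar>real m - real k\<bar>" using that by linarith
        hence "pi * 1 \<le> pi * \<bar>real m - real k\<bar>" by (intro mult_left_mono) auto
        ultimately show ?thesis by (simp add: abs_mult)
      qed
    qed
  qed
  have notin1: "Sup I \<notin> I"
  proof
    assume "Sup I \<in> I"
    then obtain e where "e > 0" "Sup I + e \<in> I" by (rule I_margin)
    thus False using cSup_upper[OF _ above, of "Sup I + e"] by simp
  qed
  have notin2: "Inf I \<notin> I"
  proof
    assume "Inf I \<in> I"
    then obtain e where "e > 0" "Inf I - e \<in> I" by (rule I_margin)
    thus False using cInf_lower[OF _ below, of "Inf I - e"] by simp
  qed
  have "I = {Inf I<..<Sup I}"
  proof (intro set_eqI iffI)
    fix x assume "x \<in> I"
    thus "x \<in> {Inf I<..<Sup I}" using cSup_upper[OF _ above, of x] cInf_lower[OF _ below, of x] notin1 notin2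
      by (metis greaterThanLessThan_iff order_le_less)
  next
    fix x assume x: "x \<in> {Inf I<..<Sup I}"
    obtain y where "y \<in> I" "y < x" using cInf_lessD[OF I_ne, of x] x by auto
    moreover obtain z where "z \<in> I" "x < z" using less_cSupD[OF I_ne, of x] x by auto
    ultimately show "x \<in> I" using I_between by (meson less_imp_le)
  qed
  thus ?thesis using that[of "Inf I" "Sup I"] x0 by (metis greaterThanLessThan_iff less_trans)
qed

end

section \<open>The boundary of a maximal strip\<close>

lemma sgn_Im_Ln:
  assumes "0 < Re x" "\<sigma> = 1 \<or> \<sigma> = - (1::real)"
  shows "0 < \<sigma> * Im (Ln x) \<longleftrightarrow> 0 < \<sigma> * Im x" "Im (Ln x) = 0 \<longleftrightarrow> Im x = 0"
proof -
  have x0: "x \<noteq> 0" using assms(1) by auto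
  have b: "\<bar>Im (Ln x)\<bar> < pi / 2" using assms(1) x0 by (subst Re_Ln_pos_lt) auto
  have e: "Im x = exp (Re (Ln x)) * sin (Im (Ln x))" using Im_exp[of "Ln x"] x0 by simp
  have "sin (Im (Ln x)) > 0" if "Im (Ln x) > 0" using that b by (intro sin_gt_zero) auto
  moreover have "sin (Im (Ln x)) < 0" if "Im (Ln x) < 0"
  proof -
    have "sin (- Im (Ln x)) > 0" using that b by (intro sin_gt_zero) auto
    thus ?thesis by simp
  qed
  ultimately have "(0 < Im (Ln x) \<longleftrightarrow> 0 < Im x) \<and> (Im (Ln x) < 0 \<longleftrightarrow> Im x < 0)"
    using e by (cases "Im (Ln x) = 0"; cases "Im (Ln x) > 0") (auto simp: zero_less_mult_iff mult_less_0_iff)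
  thus "0 < \<sigma> * Im (Ln x) \<longleftrightarrow> 0 < \<sigma> * Im x" "Im (Ln x) = 0 \<longleftrightarrow> Im x = 0" using assms(2) by (auto; linarith)+
qed

lemma nonneg_not_nonpos: "0 \<le> Re x \<Longrightarrow> x \<noteq> 0 \<Longrightarrow> x \<notin> \<real>\<^sub>\<le>\<^sub>0"
  by (auto simp: complex_nonpos_Reals_iff complex_eq_iff)

context max_strip
begin

text \<open>The sign \<open>\<sigma>\<close> points into the strip: 1 at the lower end of
  \<open>I\<close> and -1 at the upper end. It lets one argument treat both boundary lines.\<close>

definition edge :: "real \<Rightarrow> real \<Rightarrow> bool" where
  "edge \<sigma> e \<longleftrightarrow> (\<sigma> = 1 \<or> \<sigma> = - 1) \<and> e \<notin> I \<and> (\<exists>h>0. \<forall>x. \<bar>x - e\<bar> < h \<longrightarrow> (x \<in> I \<longleftrightarrow> 0 < \<sigma> * (x - e)))"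

text \<open>The developed boundary line through \<open>exp w0\<close> is a ray from the origin; this
  is its unit normal on the side of the strip.\<close>

definition inward :: "real \<Rightarrow> complex \<Rightarrow> complex" where
  "inward \<sigma> w0 = of_real \<sigma> * \<i> * cis (Im w0)"

definition reg_data :: "real \<Rightarrow> complex \<Rightarrow> real \<Rightarrow> (complex \<Rightarrow> 'a) \<Rightarrow> bool" where
  "reg_data \<sigma> w0 r H \<longleftrightarrow> r > 0 \<and> (\<forall>w\<in>ball w0 r. afm_at exp H w) \<and>
     (\<forall>w\<in>ball w0 r. 0 < \<sigma> * (Im w - Im w0) \<longrightarrow> Im w \<in> I \<and> F w = H w)"

text \<open>The conditions on cut and level include the boundary points beside \<open>w0\<close>, so
  that the formula can be continued across the boundary there.\<close>

definition sing_data :: "real \<Rightarrow> complex \<Rightarrow> real \<Rightarrow> 'a \<Rightarrow> complex \<Rightarrow> bool" where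
  "sing_data \<sigma> w0 r y c \<longleftrightarrow> y \<in> \<Lambda> \<and> r > 0 \<and>
     (\<forall>w\<in>ball w0 r. w \<noteq> w0 \<longrightarrow> 0 \<le> \<sigma> * (Im w - Im w0) \<longrightarrow>
        (exp w - exp w0) / inward \<sigma> w0 \<notin> \<real>\<^sub>\<le>\<^sub>0 \<and> lv y (c + Ln ((exp w - exp w0) / inward \<sigma> w0)) < cL y) \<and>
     (\<forall>w\<in>ball w0 r. 0 < \<sigma> * (Im w - Im w0) \<longrightarrow> Im w \<in> I \<and> F w = cP y (c + Ln ((exp w - exp w0) / inward \<sigma> w0)))"

lemma edges: "I = {a<..<b} \<Longrightarrow> a < b \<Longrightarrow> edge 1 a" "I = {a<..<b} \<Longrightarrow> a < b \<Longrightarrow> edge (- 1) b"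
  unfolding edge_def by (auto intro!: exI[of _ "b - a"])

lemma edge_side:
  assumes "edge \<sigma> e" "x \<in> I"
  shows "0 < \<sigma> * (x - e)"
proof -
  obtain h where h: "h > 0" "\<And>x. \<bar>x - e\<bar> < h \<Longrightarrow> (x \<in> I \<longleftrightarrow> 0 < \<sigma> * (x - e))" and s: "\<sigma> = 1 \<or> \<sigma> = - 1" "e \<notin> I"
    using assms(1) unfolding edge_def by auto
  have "e + \<sigma> * h / 2 \<in> I" using h(2)[of "e + \<sigma> * h / 2"] h(1) s by auto
  hence x0: "e + \<sigma> * h / 2 \<in> I" .
  show ?thesis
  proof (rule ccontr)
    assume n: "\<not> ?thesis"
    from s(1) show False
    proof
      assume "\<sigma> = 1"
      thus False using n I_between[OF assms(2) x0, of e] s(2) h(1) by simp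
    next
      assume "\<sigma> = - 1"
      thus False using n I_between[OF x0 assms(2), of e] s(2) h(1) by simp
    qed
  qed
qed

lemma inward_norm: "\<sigma> = 1 \<or> \<sigma> = - 1 \<Longrightarrow> cmod (inward \<sigma> w0) = 1"
  by (auto simp: inward_def norm_mult)

lemma Re_div_inward:
  assumes "\<sigma> = 1 \<or> \<sigma> = - 1"
  shows "Re ((z - exp w0) / inward \<sigma> w0) = \<sigma> * exp (Re w0) * Im (z / exp w0)"
proof -
  have e: "exp w0 / cis (Im w0) = of_real (exp (Re w0))" by (simp add: exp_eq_polar exp_of_real)
  have inv: "1 / inward \<sigma> w0 = of_real \<sigma> * (- \<i>) / cis (Im w0)"
    using assms by (auto simp: inward_def divide_simps)
  have "(z - exp w0) / inward \<sigma> w0 = (z - exp w0) * (1 / inward \<sigma> w0)" by simp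
  also have "\<dots> = of_real \<sigma> * (- \<i>) * ((z - exp w0) / cis (Im w0))" unfolding inv by simp
  also have "(z - exp w0) / cis (Im w0) = exp w0 / cis (Im w0) * (z / exp w0 - 1)"
    by (simp add: right_diff_distrib diff_divide_distrib)
  also have "of_real \<sigma> * (- \<i>) * (exp w0 / cis (Im w0) * (z / exp w0 - 1)) =
      of_real (\<sigma> * exp (Re w0)) * (- \<i>) * (z / exp w0 - 1)" unfolding e by simp
  finally have "(z - exp w0) / inward \<sigma> w0 = of_real (\<sigma> * exp (Re w0)) * (- \<i>) * (z / exp w0 - 1)" .
  thus ?thesis by (simp only: times_complex.sel Re_complex_of_real Im_complex_of_real) simp
qed

text \<open>In the coordinate \<open>z = exp w\<close> the strip near \<open>w0\<close> becomes a
  half disc on which \<open>F\<close> is injective, so \<open>half_disc_boundary\<close> applies;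
  the result is then pulled back by \<open>exp\<close>.\<close>

lemma edge_point:
  assumes "edge \<sigma> (Im w0)"
  shows "(\<exists>r H. reg_data \<sigma> w0 r H) \<or> (\<exists>r y c. sing_data \<sigma> w0 r y c)"
proof -
  define p n where "p = exp w0" and "n = inward \<sigma> w0"
  obtain h where h: "h > 0" "\<And>x. \<bar>x - Im w0\<bar> < h \<Longrightarrow> (x \<in> I \<longleftrightarrow> 0 < \<sigma> * (x - Im w0))" and s: "\<sigma> = 1 \<or> \<sigma> = - 1"
    using assms unfolding edge_def by auto
  have n: "cmod n = 1" "n \<noteq> 0" using inward_norm[OF s, of w0] by (auto simp: n_def)
  \<comment> \<open>Two bounds on \<open>Ln\<close> fix the radius \<open>R\<close>:
    \<open>h\<close> keeps the height where the edge decides membership in \<open>I\<close>, and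
    \<open>L / 2\<close> keeps two lifts less than one period apart, so that \<open>G\<close> is
    injective.\<close>
  have "isCont Ln 1" by (intro continuous_intros) auto
  hence "(Ln \<longlongrightarrow> Ln 1) (nhds 1)" by (rule isCont_nhds)
  hence "\<forall>\<^sub>F x in nhds 1. dist (Ln x) (Ln 1) < min h (L / 2)" using h(1) L_pos by (intro tendstoD) auto
  then obtain d0 where d0: "d0 > 0" "\<And>x. dist x 1 < d0 \<Longrightarrow> cmod (Ln x) < min h (L / 2)"
    unfolding eventually_nhds_metric by auto
  define d where "d = min d0 1"
  define R where "R = cmod p * d"
  have R: "R > 0" using d0(1) by (simp add: R_def d_def p_def)
  define \<omega> where "\<omega> z = w0 + Ln (z / p)" for z
  have near: "cmod (z / p - 1) < d" if "cmod (z - p) < R" for z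
  proof -
    have "z / p - 1 = (z - p) / p" by (simp add: p_def field_simps)
    thus ?thesis using that by (simp add: norm_divide R_def p_def pos_divide_less_eq mult.commute)
  qed
  have props: "0 < Re (z / p)" "cmod (Ln (z / p)) < h" "cmod (Ln (z / p)) < L / 2" "z \<noteq> 0" "exp (\<omega> z) = z"
    if "cmod (z - p) < R" for z
  proof -
    have n1: "cmod (z / p - 1) < d0" "cmod (z / p - 1) < 1" using near[OF that] by (auto simp: d_def)
    show re: "0 < Re (z / p)" using abs_Re_le_cmod[of "z / p - 1"] n1(2) by simp
    show "cmod (Ln (z / p)) < h" "cmod (Ln (z / p)) < L / 2" using d0(2)[of "z / p"] n1(1) by (auto simp: dist_norm)
    show z0: "z \<noteq> 0" using re by auto
    show "exp (\<omega> z) = z" using z0 by (simp add: \<omega>_def exp_add p_def)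
  qed
  have side: "0 < Re ((z - p) / n) \<longleftrightarrow> 0 < \<sigma> * (Im (\<omega> z) - Im w0)" "Re ((z - p) / n) = 0 \<longleftrightarrow> Im (\<omega> z) = Im w0"
    if "cmod (z - p) < R" for z
  proof -
    have e: "Re ((z - p) / n) = exp (Re w0) * (\<sigma> * Im (z / p))" using Re_div_inward[OF s, of z w0] by (simp add: p_def n_def)
    have i: "Im (\<omega> z) - Im w0 = Im (Ln (z / p))" by (simp add: \<omega>_def)
    show "0 < Re ((z - p) / n) \<longleftrightarrow> 0 < \<sigma> * (Im (\<omega> z) - Im w0)"
      unfolding e i sgn_Im_Ln(1)[OF props(1)[OF that] s] by (simp only: zero_less_mult_iff exp_gt_zero) auto
    have "Re ((z - p) / n) = 0 \<longleftrightarrow> Im (z / p) = 0" unfolding e using s by auto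
    also have "\<dots> \<longleftrightarrow> Im (Ln (z / p)) = 0" using sgn_Im_Ln(2)[OF props(1)[OF that] s] by simp
    finally show "Re ((z - p) / n) = 0 \<longleftrightarrow> Im (\<omega> z) = Im w0" using i by auto
  qed
  have inI: "Im (\<omega> z) \<in> I \<longleftrightarrow> 0 < \<sigma> * (Im (\<omega> z) - Im w0)" if "cmod (z - p) < R" for z
  proof -
    have "\<bar>Im (\<omega> z) - Im w0\<bar> < h" using abs_Im_le_cmod[of "Ln (z / p)"] props(2)[OF that] by (simp add: \<omega>_def)
    thus ?thesis by (rule h(2))
  qed
  define G where "G z = F (\<omega> z)" for z
  have G_afm: "afm_at (\<lambda>z. z) G z" if z: "cmod (z - p) < R" "0 < Re ((z - p) / n)" for z
    unfolding G_def
  proof (rule afm_at_comp[where d=exp and A=1 and B=0])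
    show "afm_at exp F (\<omega> z)" using side(1)[OF z(1)] inI[OF z(1)] z(2) by (intro F_afm) simp
    have "z / p \<notin> \<real>\<^sub>\<le>\<^sub>0" using props(1)[OF z(1)] by (auto simp: complex_nonpos_Reals_iff)
    thus "isCont \<omega> z" unfolding \<omega>_def[abs_def] by (intro continuous_intros) (auto simp: p_def)
    have "\<forall>\<^sub>F v in nhds z. v \<noteq> 0" using props(4)[OF z(1)] by (simp add: t1_space_nhds)
    thus "\<forall>\<^sub>F v in nhds z. exp (\<omega> v) = 1 * v + 0"
      by eventually_elim (simp add: \<omega>_def exp_add p_def)
  qed simp
  have G_inj: "inj_on G {z. cmod (z - p) < R \<and> 0 < Re ((z - p) / n)}"
  proof (rule inj_onI)
    fix z z' assume z: "z \<in> {z. cmod (z - p) < R \<and> 0 < Re ((z - p) / n)}" "z' \<in> {z. cmod (z - p) < R \<and> 0 < Re ((z - p) / n)}" "G z = G z'"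
    have "Im (\<omega> z) \<in> I" "Im (\<omega> z') \<in> I" using z side(1) inI by auto
    then obtain k :: int where k: "\<omega> z' = \<omega> z + of_int k * of_real L" using collision z(3) unfolding G_def by blast
    have "of_int k * complex_of_real L = Ln (z' / p) - Ln (z / p)" using k by (simp add: \<omega>_def)
    hence "cmod (of_int k * complex_of_real L) \<le> cmod (Ln (z' / p)) + cmod (Ln (z / p))" by (metis norm_triangle_ineq4)
    also have "\<dots> < L" using props(3)[of z] props(3)[of z'] z by simp
    finally have "\<bar>of_int k\<bar> * L < 1 * L" using L_pos by (simp add: norm_mult)
    hence "\<bar>real_of_int k\<bar> < 1" using L_pos by (simp only: mult_less_cancel_right_pos)
    hence "k = 0" by linarith
    hence "exp (\<omega> z) = exp (\<omega> z')" using k by simp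
    thus "z = z'" using props(5) z by simp
  qed
  have pull: "\<exists>r1>0. \<forall>w\<in>ball w0 r1. cmod (exp w - p) < r \<and> \<omega> (exp w) = w" if "r > 0" for r
  proof -
    have "(exp \<longlongrightarrow> exp w0) (nhds w0)" by (intro isCont_nhds continuous_intros)
    hence "\<forall>\<^sub>F w in nhds w0. dist (exp w) (exp w0) < r" using that by (rule tendstoD)
    then obtain r2 where r2: "r2 > 0" "\<And>w. dist w w0 < r2 \<Longrightarrow> dist (exp w) (exp w0) < r"
      unfolding eventually_nhds_metric by blast
    have "cmod (exp w - p) < r \<and> \<omega> (exp w) = w" if w: "w \<in> ball w0 (min r2 pi)" for w
    proof
      show "cmod (exp w - p) < r" using r2(2)[of w] w by (simp add: dist_norm p_def norm_minus_commute)
      have "\<bar>Im (w - w0)\<bar> < pi" using abs_Im_le_cmod[of "w - w0"] w by (simp add: dist_norm norm_minus_commute)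
      hence "Ln (exp (w - w0)) = w - w0" by (intro Ln_exp) (auto simp: abs_less_iff)
      thus "\<omega> (exp w) = w" by (simp add: \<omega>_def p_def exp_diff)
    qed
    thus ?thesis using r2(1) by (intro exI[of _ "min r2 pi"]) auto
  qed
  have "(\<exists>r G'. 0 < r \<and> r \<le> R \<and> (\<forall>z. cmod (z - p) < r \<longrightarrow> afm_at (\<lambda>z. z) G' z) \<and>
            (\<forall>z. cmod (z - p) < r \<longrightarrow> 0 < Re ((z - p) / n) \<longrightarrow> G' z = G z)) \<or>
         (\<exists>y\<in>\<Lambda>. \<exists>r c. 0 < r \<and> r \<le> R \<and>
            (\<forall>z. cmod (z - p) < r \<longrightarrow> z \<noteq> p \<longrightarrow> 0 \<le> Re ((z - p) / n) \<longrightarrow> lv y (c + Ln ((z - p) / n)) < cL y) \<and>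
            (\<forall>z. cmod (z - p) < r \<longrightarrow> 0 < Re ((z - p) / n) \<longrightarrow> G z = cP y (c + Ln ((z - p) / n))))"
    by (rule half_disc_boundary[OF n(1) R _ G_inj]) (rule G_afm)
  thus ?thesis
  proof (elim disjE exE bexE conjE)
    fix r G'
    assume r: "0 < r" "r \<le> R" and G': "\<forall>z. cmod (z - p) < r \<longrightarrow> afm_at (\<lambda>z. z) G' z"
      "\<forall>z. cmod (z - p) < r \<longrightarrow> 0 < Re ((z - p) / n) \<longrightarrow> G' z = G z"
    obtain r1 where r1: "r1 > 0" "\<And>w. w \<in> ball w0 r1 \<Longrightarrow> cmod (exp w - p) < r \<and> \<omega> (exp w) = w" using pull[OF r(1)] by blast
    have "reg_data \<sigma> w0 r1 (\<lambda>w. G' (exp w))"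
      unfolding reg_data_def
    proof (intro conjI ballI impI r1(1))
      fix w assume w: "w \<in> ball w0 r1"
      note rw = r1(2)[OF w]
      show "afm_at exp (\<lambda>w. G' (exp w)) w"
        by (rule afm_at_comp[where d="\<lambda>z. z" and A=1 and B=0]) (use G' rw in \<open>auto intro!: continuous_intros\<close>)
      assume "0 < \<sigma> * (Im w - Im w0)"
      hence "0 < Re ((exp w - p) / n)" "Im w \<in> I" using side(1)[of "exp w"] inI[of "exp w"] rw r(2) by auto
      thus "Im w \<in> I" "F w = G' (exp w)" using G'(2) rw by (auto simp: G_def)
    qed
    thus ?thesis by blast
  next
    fix y r c
    assume y: "y \<in> \<Lambda>" and r: "0 < r" "r \<le> R"
      and low: "\<forall>z. cmod (z - p) < r \<longrightarrow> z \<noteq> p \<longrightarrow> 0 \<le> Re ((z - p) / n) \<longrightarrow> lv y (c + Ln ((z - p) / n)) < cL y"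
      and G': "\<forall>z. cmod (z - p) < r \<longrightarrow> 0 < Re ((z - p) / n) \<longrightarrow> G z = cP y (c + Ln ((z - p) / n))"
    obtain r1 where r1: "r1 > 0" "\<And>w. w \<in> ball w0 r1 \<Longrightarrow> cmod (exp w - p) < r \<and> \<omega> (exp w) = w" using pull[OF r(1)] by blast
    have "sing_data \<sigma> w0 r1 y c"
      unfolding sing_data_def p_def[symmetric] n_def[symmetric]
    proof (intro conjI ballI impI r1(1) y)
      fix w assume w: "w \<in> ball w0 r1"
      note rw = r1(2)[OF w]
      have rR: "cmod (exp w - p) < R" using rw r by simp
      {
        assume ne: "w \<noteq> w0" and s0: "0 \<le> \<sigma> * (Im w - Im w0)"
        have "exp w \<noteq> p"
        proof
          assume "exp w = p"
          hence "w = w0" using rw r1(1) r1(2)[of w0] by (metis centre_in_ball p_def)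
          thus False using ne by simp
        qed
        moreover have "0 \<le> Re ((exp w - p) / n)"
        proof (cases "Im w = Im w0")
          case True
          thus ?thesis using side(2)[OF rR] rw by simp
        next
          case False
          hence "0 < \<sigma> * (Im w - Im w0)" using s0 s by (auto simp: less_le)
          thus ?thesis using side(1)[OF rR] rw by simp
        qed
        ultimately show "lv y (c + Ln ((exp w - p) / n)) < cL y" "(exp w - p) / n \<notin> \<real>\<^sub>\<le>\<^sub>0"
          using low rw n(2) nonneg_not_nonpos[of "(exp w - p) / n"] by auto
      }
      assume "0 < \<sigma> * (Im w - Im w0)"
      hence "0 < Re ((exp w - p) / n)" "Im w \<in> I" using side(1)[OF rR] inI[OF rR] rw by auto
      thus "Im w \<in> I" "F w = cP y (c + Ln ((exp w - p) / n))" using G' rw by (auto simp: G_def)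
    qed
    thus ?thesis by blast
  qed
qed

lemma reg_data_sub:
  assumes "reg_data \<sigma> w0 r H" "w1 \<in> ball w0 r" "Im w1 = Im w0"
  shows "reg_data \<sigma> w1 (r - dist w0 w1) H"
proof -
  have "ball w1 (r - dist w0 w1) \<subseteq> ball w0 r"
  proof
    fix w assume "w \<in> ball w1 (r - dist w0 w1)"
    thus "w \<in> ball w0 r" using dist_triangle[of w0 w w1] by (simp add: dist_commute)
  qed
  thus ?thesis using assms unfolding reg_data_def by auto
qed

lemma reg_data_shift:
  assumes "reg_data \<sigma> w0 r H"
  shows "reg_data \<sigma> (w0 + of_int k * of_real L) r (\<lambda>w. H (w + of_int (- k) * of_real L))"
  unfolding reg_data_def
proof (intro conjI ballI impI)
  show "r > 0" using assms by (simp add: reg_data_def)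
  fix w assume "w \<in> ball (w0 + of_int k * of_real L) r"
  hence w: "w + of_int (- k) * of_real L \<in> ball w0 r" by (simp add: dist_norm algebra_simps)
  show "afm_at exp (\<lambda>w. H (w + of_int (- k) * of_real L)) w"
    using assms w by (intro afm_exp_shift) (simp add: reg_data_def)
  assume "0 < \<sigma> * (Im w - Im (w0 + of_int k * of_real L))"
  hence "0 < \<sigma> * (Im (w + of_int (- k) * of_real L) - Im w0)" by simp
  hence "Im (w + of_int (- k) * of_real L) \<in> I \<and> F (w + of_int (- k) * of_real L) = H (w + of_int (- k) * of_real L)"
    using assms w unfolding reg_data_def by blast
  thus "Im w \<in> I" "F w = H (w + of_int (- k) * of_real L)" using period_int[of w "- k"] by auto
qed

text \<open>Both balls are centred on the boundary line, so with \<open>w\<close> they contain its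
  vertical projection to that line. Just inside the strip both extensions equal \<open>F\<close>,
  and the intersection of the balls is connected.\<close>

lemma reg_data_agree:
  assumes s: "\<sigma> = 1 \<or> \<sigma> = - 1" and w01: "Im w0 = Im w1" and H: "reg_data \<sigma> w0 r H" "reg_data \<sigma> w1 r' H'"
    and w: "w \<in> ball w0 r" "w \<in> ball w1 r'"
  shows "H w = H' w"
proof -
  let ?B = "ball w0 r \<inter> ball w1 r'"
  define e where "e = Im w0"
  define v where "v = Complex (Re w) e"
  have vd: "dist x v \<le> dist x w" if "Im x = e" for x
  proof -
    have "cmod (x - v) = \<bar>Re (x - w)\<bar>" using that by (simp add: v_def cmod_def)
    thus ?thesis using abs_Re_le_cmod[of "x - w"] by (simp add: dist_norm)
  qed
  hence "v \<in> ?B" using vd[of w0] vd[of w1] w w01 by (auto simp: e_def intro: le_less_trans)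
  moreover have "open ?B" by (intro open_Int open_ball)
  ultimately obtain \<eta> where \<eta>: "\<eta> > 0" "ball v \<eta> \<subseteq> ?B" by (meson open_contains_ball)
  define u where "u = v + of_real (\<sigma> * \<eta> / 2) * \<i>"
  have "dist v u < \<eta>" using \<eta>(1) s by (auto simp: u_def dist_norm norm_mult)
  hence uB: "u \<in> ?B" using \<eta>(2) by auto
  have us: "0 < \<sigma> * (Im u - e)" using s \<eta>(1) by (auto simp: u_def v_def)
  have "open {x. 0 < \<sigma> * (Im x - e)}" by (intro open_Collect_less continuous_intros)
  hence "\<forall>\<^sub>F x in nhds u. x \<in> {x. 0 < \<sigma> * (Im x - e)} \<inter> ?B"
    using us uB by (intro eventually_nhds_in_open open_Int open_ball) auto
  hence "\<forall>\<^sub>F x in nhds u. H x = H' x"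
    by eventually_elim (use H w01 in \<open>auto simp: reg_data_def e_def\<close>)
  moreover have "connected ?B" by (intro convex_connected convex_Int convex_ball)
  moreover have "afm_at exp H x" "afm_at exp H' x" if "x \<in> ?B" for x
    using that H by (auto simp: reg_data_def)
  ultimately show ?thesis
    using identity_principle_eq[OF developing_simps(2), of ?B H H' u w] uB w by blast
qed

lemma glue_exists:
  assumes "edge \<sigma> e"
  shows "\<exists>Fx. (\<forall>w. Im w \<in> I \<longrightarrow> Fx w = F w) \<and>
    (\<forall>w0 r H. Im w0 = e \<longrightarrow> reg_data \<sigma> w0 r H \<longrightarrow> (\<forall>w\<in>ball w0 r. Fx w = H w))"
proof -
  have s: "\<sigma> = 1 \<or> \<sigma> = - 1" using assms by (simp add: edge_def)
  define Q where "Q w x \<longleftrightarrow> (\<exists>w0 r H. Im w0 = e \<and> reg_data \<sigma> w0 r H \<and> w \<in> ball w0 r \<and> x = H w)" for w x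
  define Fx where "Fx w = (if Im w \<in> I then F w else SOME x. Q w x)" for w
  have "Fx w = H w" if h: "Im w0 = e" "reg_data \<sigma> w0 r H" "w \<in> ball w0 r" for w0 r H w
  proof (cases "Im w \<in> I")
    case True
    thus ?thesis using edge_side[OF assms True] h by (simp add: Fx_def reg_data_def)
  next
    case False
    have "Q w (SOME x. Q w x)" by (rule someI[of _ "H w"]) (use h in \<open>auto simp: Q_def\<close>)
    moreover have "x = H w" if Qx: "Q w x" for x
    proof -
      obtain w1 r1 H1 where 1: "Im w1 = e" "reg_data \<sigma> w1 r1 H1" "w \<in> ball w1 r1" "x = H1 w"
        using Qx unfolding Q_def by blast
      have "H1 w = H w" by (rule reg_data_agree[OF s _ 1(2) h(2) 1(3) h(3)]) (use 1(1) h(1) in simp)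
      thus ?thesis using 1(4) by simp
    qed
    ultimately show ?thesis using False by (simp add: Fx_def)
  qed
  thus ?thesis by (intro exI[of _ Fx]) (auto simp: Fx_def)
qed

text \<open>A single extension of \<open>F\<close> across all regular points of the edge. It permits
  continuation along the edge as well as an enlargement of the strip.\<close>

definition "edge_ext \<sigma> e = (SOME Fx. (\<forall>w. Im w \<in> I \<longrightarrow> Fx w = F w) \<and>
    (\<forall>w0 r H. Im w0 = e \<longrightarrow> reg_data \<sigma> w0 r H \<longrightarrow> (\<forall>w\<in>ball w0 r. Fx w = H w)))"

lemma edge_ext:
  assumes "edge \<sigma> e"
  shows "Im w \<in> I \<Longrightarrow> edge_ext \<sigma> e w = F w"
    "Im w0 = e \<Longrightarrow> reg_data \<sigma> w0 r H \<Longrightarrow> w \<in> ball w0 r \<Longrightarrow> edge_ext \<sigma> e w = H w"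
  using someI_ex[OF glue_exists[OF assms]] unfolding edge_ext_def[symmetric] by blast+

lemma edge_ext_afm:
  assumes "edge \<sigma> e" "Im w0 = e" "reg_data \<sigma> w0 r H" "w \<in> ball w0 r"
  shows "afm_at exp (edge_ext \<sigma> e) w"
proof -
  have "\<forall>\<^sub>F v in nhds w. v \<in> ball w0 r" using assms(4) by (intro eventually_nhds_in_open) auto
  hence "\<forall>\<^sub>F v in nhds w. edge_ext \<sigma> e v = H v" by eventually_elim (use edge_ext(2)[OF assms(1-3)] in auto)
  thus ?thesis using afm_at_cong assms unfolding reg_data_def by blast
qed

text \<open>If all points of the edge were regular, compactness of one period would give an
  extension of uniform width, and periodicity would extend it along the whole line, against
  maximality.\<close>

lemma some_singular:
  assumes e: "edge \<sigma> e"
  shows "\<exists>w0. Im w0 = e \<and> (\<nexists>r H. reg_data \<sigma> w0 r H)"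
proof (rule ccontr)
  assume "\<not> ?thesis"
  hence all: "\<exists>r H. reg_data \<sigma> w0 r H" if "Im w0 = e" for w0 using that by blast
  define S where "S = {w. \<exists>w0 r H. Im w0 = e \<and> reg_data \<sigma> w0 r H \<and> w \<in> ball w0 r}"
  have opS: "open S"
  proof (subst open_subopen, intro ballI)
    fix w assume "w \<in> S"
    then obtain w0 r H where *: "Im w0 = e" "reg_data \<sigma> w0 r H" "w \<in> ball w0 r" by (auto simp: S_def)
    hence "ball w0 r \<subseteq> S" unfolding S_def by blast
    with *(3) show "\<exists>T. open T \<and> w \<in> T \<and> T \<subseteq> S" by (intro exI[of _ "ball w0 r"] conjI open_ball)
  qed
  define J where "J = {w. 0 \<le> Re w \<and> Re w \<le> L \<and> Im w = e}"
  have "J = cbox (Complex 0 e) (Complex L e)" by (auto simp: J_def in_cbox_complex_iff)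
  hence "compact J" by simp
  moreover have "J \<subseteq> S"
  proof
    fix w assume "w \<in> J"
    hence "Im w = e" by (simp add: J_def)
    moreover obtain r H where "reg_data \<sigma> w r H" using all[OF \<open>Im w = e\<close>] by blast
    ultimately show "w \<in> S" by (auto simp: S_def reg_data_def intro!: exI[of _ w] exI[of _ r] exI[of _ H])
  qed
  ultimately obtain \<epsilon> where \<epsilon>: "\<epsilon> > 0" "(\<Union>x\<in>J. ball x \<epsilon>) \<subseteq> S"
    using compact_subset_open_imp_ball_epsilon_subset[of J S] opS by blast
  have shift: "w + of_int k * of_real L \<in> S" if wS: "w \<in> S" for w and k :: int
  proof -
    obtain w0 r H where *: "Im w0 = e" "reg_data \<sigma> w0 r H" "w \<in> ball w0 r" using wS by (auto simp: S_def)
    hence "Im (w0 + of_int k * of_real L) = e" "w + of_int k * of_real L \<in> ball (w0 + of_int k * of_real L) r"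
      by (auto simp: dist_norm)
    thus ?thesis using reg_data_shift[OF *(2), of k] unfolding S_def by blast
  qed
  have inS: "w \<in> S" if w: "\<bar>Im w - e\<bar> < \<epsilon>" for w
  proof -
    obtain k :: int where k: "0 \<le> Re w + of_int k * L" "Re w + of_int k * L \<le> L" by (rule Re_mod_period)
    have "Complex (Re w + of_int k * L) e \<in> J" using k by (simp add: J_def)
    moreover have "w + of_int k * of_real L \<in> ball (Complex (Re w + of_int k * L) e) \<epsilon>"
      using w by (simp add: dist_norm cmod_def abs_minus_commute)
    ultimately have "w + of_int k * of_real L \<in> S" using \<epsilon>(2) by blast
    hence "w + of_int k * of_real L + of_int (- k) * of_real L \<in> S" by (rule shift)
    thus ?thesis by (simp add: algebra_simps)
  qed
  obtain h where h: "h > 0" "\<And>x. \<bar>x - e\<bar> < h \<Longrightarrow> (x \<in> I \<longleftrightarrow> 0 < \<sigma> * (x - e))" and s: "\<sigma> = 1 \<or> \<sigma> = - 1" and eI: "e \<notin> I"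
    using e unfolding edge_def by auto
  let ?I' = "I \<union> {e - \<epsilon><..<e + \<epsilon>}"
  have "is_interval ?I'"
  proof -
    have "e + \<sigma> * (min \<epsilon> h / 2) \<in> I" using h(2)[of "e + \<sigma> * (min \<epsilon> h / 2)"] h(1) \<epsilon>(1) s by auto
    moreover have "e + \<sigma> * (min \<epsilon> h / 2) \<in> {e - \<epsilon><..<e + \<epsilon>}" using h(1) \<epsilon>(1) s by auto
    ultimately have "I \<inter> {e - \<epsilon><..<e + \<epsilon>} \<noteq> {}" by blast
    moreover have "connected I" using interval_I by (simp add: is_interval_connected)
    ultimately have "connected ?I'" by (intro connected_Un) auto
    thus ?thesis by (simp add: is_interval_connected_1)
  qed
  moreover have "afm_at exp (edge_ext \<sigma> e) w" if w: "Im w \<in> ?I'" for w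
  proof (cases "Im w \<in> I")
    case True
    have "\<forall>\<^sub>F v in nhds w. v \<in> {w. Im w \<in> I}" using True open_I by (intro eventually_nhds_in_open open_strip) auto
    hence "\<forall>\<^sub>F v in nhds w. edge_ext \<sigma> e v = F v" by eventually_elim (use edge_ext(1)[OF e] in auto)
    thus ?thesis using afm_at_cong F_afm[OF True] by blast
  next
    case False
    hence "w \<in> S" using w by (intro inS) auto
    thus ?thesis using edge_ext_afm[OF e] unfolding S_def by blast
  qed
  ultimately have "strip_map ?I' (edge_ext \<sigma> e)" using open_I I_ne by (auto simp: strip_map_def)
  hence "?I' = I" by (rule maximal) (use edge_ext(1)[OF e] in auto)
  moreover have "e \<in> ?I'" using \<epsilon>(1) by simp
  ultimately show False using eI by simp
qed

definition lim_val :: "complex \<Rightarrow> 'a \<Rightarrow> bool" where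
  "lim_val w0 x \<longleftrightarrow> x \<in> topspace X \<and> (\<forall>W. openin X W \<longrightarrow> x \<in> W \<longrightarrow> (\<exists>r>0. \<forall>w\<in>ball w0 r. Im w \<in> I \<longrightarrow> F w \<in> W))"

text \<open>The boundary value is the limit from inside the strip, so that regular and singular edge
  points are treated alike. Uniqueness of limits makes the choice definite.\<close>

definition Fb :: "complex \<Rightarrow> 'a" where
  "Fb w = (if Im w \<in> I then F w else SOME x. lim_val w x)"

lemma edge_approach:
  assumes "edge \<sigma> (Im w0)" "r > 0"
  shows "\<exists>w\<in>ball w0 r. Im w \<in> I"
proof -
  obtain h where h: "h > 0" "\<And>x. \<bar>x - Im w0\<bar> < h \<Longrightarrow> (x \<in> I \<longleftrightarrow> 0 < \<sigma> * (x - Im w0))" and s: "\<sigma> = 1 \<or> \<sigma> = - 1"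
    using assms unfolding edge_def by auto
  define t where "t = min r h / 2"
  have t: "0 < t" "t < r" "t < h" using h(1) assms(2) by (auto simp: t_def)
  have "Im w0 + \<sigma> * t \<in> I" using h(2)[of "Im w0 + \<sigma> * t"] t s by auto
  thus ?thesis using t s by (intro bexI[of _ "w0 + of_real (\<sigma> * t) * \<i>"]) (auto simp: dist_norm norm_mult)
qed

lemma lim_val_unique:
  assumes e: "edge \<sigma> (Im w0)" and x: "lim_val w0 x" "lim_val w0 y"
  shows "x = y"
proof (rule ccontr)
  assume "x \<noteq> y"
  then obtain V W where VW: "openin X V" "openin X W" "x \<in> V" "y \<in> W" "disjnt V W"
    using Hausdorff_X x unfolding Hausdorff_space_def lim_val_def by metis
  obtain r where r: "r > 0" "\<forall>w\<in>ball w0 r. Im w \<in> I \<longrightarrow> F w \<in> V" using x(1) VW unfolding lim_val_def by blast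
  obtain r' where r': "r' > 0" "\<forall>w\<in>ball w0 r'. Im w \<in> I \<longrightarrow> F w \<in> W" using x(2) VW unfolding lim_val_def by blast
  obtain w where "w \<in> ball w0 (min r r')" "Im w \<in> I" using edge_approach[OF e, of "min r r'"] r r' by auto
  hence "F w \<in> V" "F w \<in> W" using r r' by auto
  thus False using VW(5) by (auto simp: disjnt_iff)
qed

lemma Fb_eqI:
  assumes "edge \<sigma> (Im w0)" "lim_val w0 x"
  shows "Fb w0 = x"
proof -
  have "Im w0 \<notin> I" using assms(1) by (simp add: edge_def)
  moreover have "lim_val w0 (SOME x. lim_val w0 x)" using assms(2) by (rule someI)
  ultimately show ?thesis using lim_val_unique[OF assms(1) _ assms(2)] by (simp add: Fb_def)
qed

lemma Fb_F: "Im w \<in> I \<Longrightarrow> Fb w = F w"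
  by (simp add: Fb_def)

lemma lim_val_reg:
  assumes e: "edge \<sigma> (Im w0)" and H: "reg_data \<sigma> w0 r H"
  shows "lim_val w0 (H w0)"
proof -
  have af: "afm_at exp H w0" using H by (simp add: reg_data_def)
  have "\<exists>r'>0. \<forall>w\<in>ball w0 r'. Im w \<in> I \<longrightarrow> F w \<in> W" if W: "openin X W" "H w0 \<in> W" for W
  proof -
    obtain d where d: "d > 0" "\<And>w. dist w w0 < d \<Longrightarrow> H w \<in> W"
      using afm_at_open_preimage[OF developing_simps(2) af W] unfolding eventually_nhds_metric by blast
    have "F w \<in> W" if "w \<in> ball w0 (min r d)" "Im w \<in> I" for w
      using edge_side[OF e that(2)] that d(2)[of w] H unfolding reg_data_def by (auto simp: dist_commute)
    thus ?thesis using d(1) H by (intro exI[of _ "min r d"]) (auto simp: reg_data_def)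
  qed
  thus ?thesis using afm_at_in_M[OF af] by (simp add: lim_val_def)
qed

lemma Fb_reg:
  assumes e: "edge \<sigma> e" "Im w0 = e" and H: "reg_data \<sigma> w0 r H" and w: "w \<in> ball w0 r" "Im w \<in> I \<or> Im w = e"
  shows "Fb w = H w"
proof (cases "Im w \<in> I")
  case True
  thus ?thesis using edge_side[OF e(1) True] H w e(2) by (simp add: Fb_F reg_data_def)
next
  case False
  hence "reg_data \<sigma> w (r - dist w0 w) H" using reg_data_sub[OF H w(1)] w e by simp
  thus ?thesis using Fb_eqI lim_val_reg False w(2) e by metis
qed

text \<open>Beside its centre the logarithmic formula is regular on the edge itself, so it extends
  \<open>F\<close> across. Hence singular edge points are isolated.\<close>

lemma sing_reg:
  assumes s: "\<sigma> = 1 \<or> \<sigma> = - 1" and S: "sing_data \<sigma> w0 r y c" and w: "w \<in> ball w0 r" "w \<noteq> w0" "Im w = Im w0"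
  shows "\<exists>r'. reg_data \<sigma> w r' (\<lambda>v. cP y (c + Ln ((exp v - exp w0) / inward \<sigma> w0)))"
proof -
  let ?H = "\<lambda>v. cP y (c + Ln ((exp v - exp w0) / inward \<sigma> w0))"
  have n0: "inward \<sigma> w0 \<noteq> 0" using inward_norm[OF s, of w0] by auto
  have *: "(exp w - exp w0) / inward \<sigma> w0 \<notin> \<real>\<^sub>\<le>\<^sub>0" "lv y (c + Ln ((exp w - exp w0) / inward \<sigma> w0)) < cL y" "y \<in> \<Lambda>"
    using S w unfolding sing_data_def by auto
  have "afm_at exp ?H w"
    by (rule afm_at_comp[where d="\<lambda>z. z" and g=exp and A=1 and B=0 and
        F="\<lambda>z. cP y (c + Ln ((z - exp w0) / inward \<sigma> w0))"])
      (use cP_Ln_afm[OF *(3) n0 *(1,2)] in \<open>auto intro!: continuous_intros\<close>)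
  hence "\<forall>\<^sub>F v in nhds w. afm_at exp ?H v" by (rule afm_at_eventually)
  then obtain d where d: "d > 0" "\<And>v. dist v w < d \<Longrightarrow> afm_at exp ?H v" unfolding eventually_nhds_metric by blast
  define r' where "r' = min d (r - dist w0 w)"
  have sub: "v \<in> ball w0 r" if "v \<in> ball w r'" for v
    using that dist_triangle[of w0 v w] by (simp add: r'_def)
  have "reg_data \<sigma> w r' ?H"
    unfolding reg_data_def
  proof (intro conjI ballI impI)
    show "r' > 0" using d(1) w by (simp add: r'_def)
    fix v assume v: "v \<in> ball w r'"
    show "afm_at exp ?H v" using d(2)[of v] v by (simp add: r'_def dist_commute)
    assume "0 < \<sigma> * (Im v - Im w)"
    thus "Im v \<in> I" "F v = ?H v" using S sub[OF v] w(3) unfolding sing_data_def by auto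
  qed
  thus ?thesis by blast
qed

lemma sing_small:
  assumes s: "\<sigma> = 1 \<or> \<sigma> = - 1" and S: "sing_data \<sigma> w0 r y c"
  shows "\<exists>d>0. d \<le> r \<and> (\<forall>w\<in>ball w0 d. w \<noteq> w0 \<longrightarrow> 0 \<le> \<sigma> * (Im w - Im w0) \<longrightarrow> lv y (c + Ln ((exp w - exp w0) / inward \<sigma> w0)) < l)"
proof -
  have n: "cmod (inward \<sigma> w0) = 1" by (rule inward_norm[OF s])
  define m where "m = exp (l - lv y c - \<bar>c\<kappa> y\<bar> * pi)"
  have "(exp \<longlongrightarrow> exp w0) (nhds w0)" by (intro isCont_nhds continuous_intros)
  hence "\<forall>\<^sub>F w in nhds w0. dist (exp w) (exp w0) < m" by (rule tendstoD) (simp add: m_def)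
  then obtain d where d: "d > 0" "\<And>w. dist w w0 < d \<Longrightarrow> dist (exp w) (exp w0) < m"
    unfolding eventually_nhds_metric by blast
  have "lv y (c + Ln ((exp w - exp w0) / inward \<sigma> w0)) < l"
    if w: "w \<in> ball w0 (min d r)" "w \<noteq> w0" "0 \<le> \<sigma> * (Im w - Im w0)" for w
  proof -
    define x where "x = (exp w - exp w0) / inward \<sigma> w0"
    have x0: "x \<noteq> 0" using S w unfolding sing_data_def x_def by auto
    have "cmod x < m" using d(2)[of w] w(1) n by (simp add: x_def norm_divide dist_norm norm_minus_commute)
    hence "ln (cmod x) < l - lv y c - \<bar>c\<kappa> y\<bar> * pi" using x0 unfolding m_def by (metis exp_less_cancel_iff exp_ln zero_less_norm_iff)
    thus ?thesis using lv_Ln(2)[where z=x and y=y and c=c, OF x0] unfolding x_def[symmetric] by linarith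
  qed
  thus ?thesis using d(1) S by (intro exI[of _ "min d r"]) (auto simp: sing_data_def)
qed

lemma Fb_sing_near:
  assumes e: "edge \<sigma> (Im w0)" and S: "sing_data \<sigma> w0 r y c" and w: "w \<in> ball w0 r" "w \<noteq> w0" "Im w \<in> I \<or> Im w = Im w0"
  shows "Fb w = cP y (c + Ln ((exp w - exp w0) / inward \<sigma> w0))"
proof (cases "Im w \<in> I")
  case True
  thus ?thesis using edge_side[OF e True] S w by (simp add: Fb_F sing_data_def)
next
  case False
  have s: "\<sigma> = 1 \<or> \<sigma> = - 1" using e by (simp add: edge_def)
  have im: "Im w = Im w0" using False w by simp
  obtain r' where r': "reg_data \<sigma> w r' (\<lambda>v. cP y (c + Ln ((exp v - exp w0) / inward \<sigma> w0)))"
    using sing_reg[OF s S w(1,2) im] by blast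
  thus ?thesis using Fb_reg[OF e im r', of w] False w by (simp add: reg_data_def)
qed

lemma Fb_sing:
  assumes e: "edge \<sigma> (Im w0)" and S: "sing_data \<sigma> w0 r y c"
  shows "Fb w0 = y"
proof (rule Fb_eqI[OF e])
  have s: "\<sigma> = 1 \<or> \<sigma> = - 1" using e by (simp add: edge_def)
  have y: "y \<in> \<Lambda>" using S by (simp add: sing_data_def)
  have "\<exists>r'>0. \<forall>w\<in>ball w0 r'. Im w \<in> I \<longrightarrow> F w \<in> W" if W: "openin X W" "y \<in> W" for W
  proof -
    obtain l where l: "cP y ` {w. lv y w < l} \<subseteq> W" using nb_basis[OF y W] by blast
    obtain d where d: "d > 0" "d \<le> r" "\<forall>w\<in>ball w0 d. w \<noteq> w0 \<longrightarrow> 0 \<le> \<sigma> * (Im w - Im w0) \<longrightarrow> lv y (c + Ln ((exp w - exp w0) / inward \<sigma> w0)) < l"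
      using sing_small[OF s S] by blast
    have "F w \<in> W" if w: "w \<in> ball w0 d" "Im w \<in> I" for w
    proof -
      have sd: "0 < \<sigma> * (Im w - Im w0)" by (rule edge_side[OF e w(2)])
      hence "w \<noteq> w0" by auto
      hence "lv y (c + Ln ((exp w - exp w0) / inward \<sigma> w0)) < l" using d(3) w(1) sd by simp
      moreover have "F w = cP y (c + Ln ((exp w - exp w0) / inward \<sigma> w0))"
        using S sd w(1) d(2) unfolding sing_data_def by auto
      ultimately show ?thesis using l by auto
    qed
    thus ?thesis using d(1) by blast
  qed
  thus "lim_val w0 y" using y sing_subset by (auto simp: lim_val_def)
qed

text \<open>At a regular edge point \<open>Fb\<close> is the local extension. At a singular one the
  level of the lift tends to minus infinity, and the sublevels form a neighbourhood basis of the
  singularity.\<close>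

lemma Fb_continuous:
  assumes e: "edge \<sigma> e"
  shows "continuous_map (top_of_set {w. Im w \<in> I \<or> Im w = e}) X Fb"
proof -
  let ?D = "{w. Im w \<in> I \<or> Im w = e}"
  have s: "\<sigma> = 1 \<or> \<sigma> = - 1" using e by (simp add: edge_def)
  have top: "Fb w \<in> topspace X" if w: "w \<in> ?D" for w
  proof (cases "Im w \<in> I")
    case True
    thus ?thesis using afm_at_in_M[OF F_afm[OF True]] by (simp add: Fb_F)
  next
    case False
    hence ew: "edge \<sigma> (Im w)" using w e by simp
    from edge_point[OF this] show ?thesis
    proof (elim disjE exE)
      fix r H assume "reg_data \<sigma> w r H"
      thus ?thesis using Fb_eqI[OF ew lim_val_reg[OF ew]] lim_val_reg[OF ew] unfolding lim_val_def by metis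
    next
      fix r y c assume "sing_data \<sigma> w r y c"
      thus ?thesis using Fb_sing[OF ew] sing_subset by (auto simp: sing_data_def)
    qed
  qed
  have loc: "\<exists>r>0. \<forall>w\<in>ball w0 r. w \<in> ?D \<longrightarrow> Fb w \<in> W" if w0: "w0 \<in> ?D" and W: "openin X W" "Fb w0 \<in> W" for w0 W
  proof (cases "Im w0 \<in> I")
    case True
    have "\<forall>\<^sub>F v in nhds w0. v \<in> {w. Im w \<in> I}" using True open_I by (intro eventually_nhds_in_open open_strip) auto
    moreover have "\<forall>\<^sub>F v in nhds w0. F v \<in> W"
      using afm_at_open_preimage[OF developing_simps(2) F_afm[OF True] W(1)] W(2) True by (simp add: Fb_F)
    ultimately have "\<forall>\<^sub>F v in nhds w0. Fb v \<in> W" by eventually_elim (auto simp: Fb_F)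
    thus ?thesis unfolding eventually_nhds_metric by (auto simp: dist_commute)
  next
    case False
    hence im: "Im w0 = e" and ew: "edge \<sigma> (Im w0)" using w0 e by auto
    from edge_point[OF ew] show ?thesis
    proof (elim disjE exE)
      fix r H assume H: "reg_data \<sigma> w0 r H"
      hence r0: "r > 0" and af: "afm_at exp H w0" by (auto simp: reg_data_def)
      have "Fb w0 = H w0" using Fb_reg[OF e im H, of w0] im r0 by simp
      then obtain d where d: "d > 0" "\<And>w. dist w w0 < d \<Longrightarrow> H w \<in> W"
        using afm_at_open_preimage[OF developing_simps(2) af W(1)] W(2) unfolding eventually_nhds_metric by auto
      have "Fb w \<in> W" if "w \<in> ball w0 (min r d)" "w \<in> ?D" for w
        using Fb_reg[OF e im H, of w] d(2)[of w] that by (auto simp: dist_commute)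
      thus ?thesis using d(1) r0 by (intro exI[of _ "min r d"]) auto
    next
      fix r y c assume S: "sing_data \<sigma> w0 r y c"
      have y: "y \<in> \<Lambda>" using S by (simp add: sing_data_def)
      have Fy: "Fb w0 = y" by (rule Fb_sing[OF ew S])
      obtain l where l: "cP y ` {w. lv y w < l} \<subseteq> W" using nb_basis[OF y W(1)] W(2) Fy by blast
      obtain d where d: "d > 0" "d \<le> r" "\<forall>w\<in>ball w0 d. w \<noteq> w0 \<longrightarrow> 0 \<le> \<sigma> * (Im w - Im w0) \<longrightarrow> lv y (c + Ln ((exp w - exp w0) / inward \<sigma> w0)) < l"
        using sing_small[OF s S] by blast
      have "Fb w \<in> W" if w: "w \<in> ball w0 d" "w \<in> ?D" for w
      proof (cases "w = w0")
        case ne: False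
        have sd: "0 \<le> \<sigma> * (Im w - Im w0)" using edge_side[OF ew] w im by fastforce
        hence "lv y (c + Ln ((exp w - exp w0) / inward \<sigma> w0)) < l" using d(3) w ne by blast
        moreover have "Fb w = cP y (c + Ln ((exp w - exp w0) / inward \<sigma> w0))"
          using Fb_sing_near[OF ew S _ ne] w d(2) im by auto
        ultimately show ?thesis using l by auto
      qed (use W in simp)
      thus ?thesis using d(1) by blast
    qed
  qed
  show ?thesis
    unfolding continuous_map_def
  proof (intro conjI allI impI)
    show "Fb \<in> topspace (top_of_set ?D) \<rightarrow> topspace X" using top by auto
    fix W assume W: "openin X W"
    show "openin (top_of_set ?D) {x \<in> topspace (top_of_set ?D). Fb x \<in> W}"
      unfolding openin_contains_ball
    proof (intro conjI ballI)
      fix x assume "x \<in> {x \<in> topspace (top_of_set ?D). Fb x \<in> W}"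
      then obtain r where "r > 0" "\<forall>w\<in>ball x r. w \<in> ?D \<longrightarrow> Fb w \<in> W" using loc[of x W] W by auto
      thus "\<exists>e>0. ball x e \<inter> ?D \<subseteq> {x \<in> topspace (top_of_set ?D). Fb x \<in> W}" by (intro exI[of _ r]) auto
    qed auto
  qed
qed

end

section \<open>Saddle connections on the frontier\<close>

context charted_surface
begin

lemma straight_at_exp_line:
  assumes H: "afm_at exp H (Complex s0 e)" and d: "d > 0"
    and \<gamma>: "\<forall>\<^sub>F s in nhds t. \<gamma> s = H (Complex (s0 + (s - t) * d) e)"
  shows "\<exists>\<phi> u. straight_at (regular_part X \<Lambda>) \<A> \<gamma> t \<phi> u"
proof -
  obtain U \<psi> a b where ch: "(U, \<psi>) \<in> \<A>" and a: "a \<noteq> 0"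
    and ev: "\<forall>\<^sub>F v in nhds (Complex s0 e). H v \<in> U \<and> \<psi> (H v) = a * exp v + b"
    by (rule afm_atE[OF H])
  define g where "g s = Complex (s0 + (s - t) * d) e" for s
  have "isCont g t" unfolding g_def[abs_def] Complex_eq by (intro continuous_intros)
  hence "(g \<longlongrightarrow> Complex s0 e) (nhds t)"
    unfolding isCont_def tendsto_at_iff_tendsto_nhds by (simp add: g_def)
  hence "\<forall>\<^sub>F s in nhds t. H (g s) \<in> U \<and> \<psi> (H (g s)) = a * exp (g s) + b"
    using ev unfolding filterlim_iff by blast
  with \<gamma> have "\<forall>\<^sub>F s in nhds t. \<gamma> s \<in> U \<and> \<psi> (\<gamma> s) = a * (0 + of_real (exp (s0 + (s - t) * d)) * cis e) + b"
    by eventually_elim (simp add: g_def exp_eq_polar)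
  hence "straight_at (regular_part X \<Lambda>) \<A> \<gamma> t \<psi> (a * cis e)"
    by (rule straight_atI[OF ch a cis_neq_zero, rotated]) (use d in \<open>simp add: strict_mono_def\<close>)
  thus ?thesis by blast
qed

text \<open>An affine transition in logarithmic coordinates, normalised at the two base points;
  \<open>\<kappa>\<close> is the derivative of the lift at \<open>w\<close>.\<close>

lemma transition_lift:
  assumes F: "afm_at exp F w" and G: "afm_at exp G v" and eq: "F w = G v"
  obtains \<kappa> where "\<forall>\<^sub>F x in nhds w. F x = G (v + Ln (1 + \<kappa> * (exp (x - w) - 1)))"
proof -
  obtain A B where A: "A \<noteq> 0" "exp v = A * exp w + B"
    and ev: "\<forall>\<^sub>F p in nhds w \<times>\<^sub>F nhds v. F (fst p) = G (snd p) \<longleftrightarrow> A * exp (fst p) + B = exp (snd p)"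
    by (rule transition[OF developing_simps(2) developing_simps(2) F G eq])
  define \<kappa> where "\<kappa> = A * exp w / exp v"
  define u where "u x = 1 + \<kappa> * (exp (x - w) - 1)" for x
  define g where "g x = v + Ln (u x)" for x
  have u: "exp v * u x = A * exp x + B" for x
  proof -
    have "exp v * u x = exp v + A * exp w * (exp (x - w) - 1)" by (simp add: u_def \<kappa>_def distrib_left)
    also have "A * exp w * (exp (x - w) - 1) = A * exp x - A * exp w" by (simp add: exp_diff right_diff_distrib)
    finally show ?thesis using A(2) by simp
  qed
  have gw: "g w = v" by (simp add: g_def u_def)
  have uc: "isCont u w" unfolding u_def[abs_def] by (intro continuous_intros)
  have g1: "isCont g w" unfolding g_def[abs_def] u_def[abs_def] by (intro continuous_intros) auto
  have "\<forall>\<^sub>F x in nhds w. F x = G (g x) \<longleftrightarrow> A * exp x + B = exp (g x)"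
    by (rule eventually_nhds_prod_along[where P="\<lambda>x y. F x = G y \<longleftrightarrow> A * exp x + B = exp y" and g=g]) (use ev gw g1 in simp_all)
  moreover have "\<forall>\<^sub>F x in nhds w. u x \<noteq> 0"
    by (rule tendsto_imp_eventually_ne[OF isCont_nhds[OF uc]]) (simp add: u_def)
  ultimately have "\<forall>\<^sub>F x in nhds w. F x = G (g x)"
    by eventually_elim (simp add: g_def exp_add u)
  thus ?thesis using that unfolding g_def u_def by blast
qed

end

context max_strip
begin

definition singular :: "real \<Rightarrow> real \<Rightarrow> real \<Rightarrow> bool" where
  "singular \<sigma> e s \<longleftrightarrow> (\<nexists>r H. reg_data \<sigma> (Complex s e) r H)"

lemma edge_segment:
  assumes e: "edge \<sigma> e" and s: "\<not> singular \<sigma> e s"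
  shows "afm_at exp (edge_ext \<sigma> e) (Complex s e)" "Fb (Complex s e) = edge_ext \<sigma> e (Complex s e)"
    "\<forall>\<^sub>F x in nhds s. Fb (Complex x e) = edge_ext \<sigma> e (Complex x e)"
proof -
  obtain r H where H: "reg_data \<sigma> (Complex s e) r H" using s by (auto simp: singular_def)
  have r: "r > 0" using H by (simp add: reg_data_def)
  show "afm_at exp (edge_ext \<sigma> e) (Complex s e)" using edge_ext_afm[OF e _ H] r by simp
  have eq: "Fb w = edge_ext \<sigma> e w" if "w \<in> ball (Complex s e) r" "Im w = e" for w
    using Fb_reg[OF e _ H that(1)] edge_ext(2)[OF e _ H that(1)] that(2) by simp
  show "Fb (Complex s e) = edge_ext \<sigma> e (Complex s e)" using eq r by simp
  have "Fb (Complex x e) = edge_ext \<sigma> e (Complex x e)" if "dist x s < r" for x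
  proof (rule eq)
    have "Complex s e - Complex x e = of_real (s - x)" by (simp add: complex_eq_iff)
    thus "Complex x e \<in> ball (Complex s e) r" using that
      by (simp only: mem_ball dist_norm norm_of_real) (simp add: abs_minus_commute)
  qed simp
  thus "\<forall>\<^sub>F x in nhds s. Fb (Complex x e) = edge_ext \<sigma> e (Complex x e)"
    unfolding eventually_nhds_metric using r by blast
qed

text \<open>
  Two edge points with the same image are identified by a transition map \<open>A z + B\<close> of the developed
  edge. Unless \<open>A\<close> is negative, nearby points inside the strip collide too; if \<open>A\<close> is negative, the
  edge is folded onto itself and the fold has a fixed point.
\<close>

lemma edge_inj:
  assumes e: "edge \<sigma> e" and L: "s2 \<le> s1 + L" and reg: "\<And>x. s1 < x \<Longrightarrow> x < s2 \<Longrightarrow> \<not> singular \<sigma> e x"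
    and s: "s1 < s" "s < s'" "s' < s2"
  shows "Fb (Complex s e) \<noteq> Fb (Complex s' e)"
proof
  assume eq: "Fb (Complex s e) = Fb (Complex s' e)"
  define w w' where "w = Complex s e" and "w' = Complex s' e"
  define Fx where "Fx = edge_ext \<sigma> e"
  have fx: "afm_at exp Fx (Complex x e)" "Fb (Complex x e) = Fx (Complex x e)" if "s1 < x" "x < s2" for x
    using edge_segment[OF e reg[OF that]] by (simp_all add: Fx_def)
  have fxw: "afm_at exp Fx w" "afm_at exp Fx w'" "Fx w = Fx w'" using fx[of s] fx[of s'] s eq by (auto simp: w_def w'_def)
  obtain A B where A: "A \<noteq> 0" "exp w' = A * exp w + B"
    and ev: "\<forall>\<^sub>F p in nhds w \<times>\<^sub>F nhds w'. Fx (fst p) = Fx (snd p) \<longleftrightarrow> A * exp (fst p) + B = exp (snd p)"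
    by (rule transition[OF developing_simps(2) developing_simps(2) fxw])
  have ew: "exp (Complex x e) = of_real (exp x) * cis e" for x by (simp add: exp_eq_polar)
  show False
  proof (cases "A \<in> \<real>\<^sub>\<le>\<^sub>0")
    case False
    obtain h where h: "h > 0" "\<And>x. \<bar>x - e\<bar> < h \<Longrightarrow> (x \<in> I \<longleftrightarrow> 0 < \<sigma> * (x - e))" and \<sigma>: "\<sigma> = 1 \<or> \<sigma> = - 1"
      using e unfolding edge_def by auto
    have Apos: "0 < Re A + cmod A"
    proof (rule ccontr)
      assume n: "\<not> ?thesis"
      hence "Re A = - cmod A" using abs_Re_le_cmod[of A] by linarith
      hence "Im A = 0" using cmod_power2[of A] by simp
      thus False using False n norm_ge_zero[of A] by (auto simp: complex_nonpos_Reals_iff)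
    qed
    \<comment> \<open>Since \<open>A * \<zeta> = |A| * (A + |A|)\<close>, both
      \<open>\<zeta>\<close> and \<open>A * \<zeta>\<close> have positive real part unless
      \<open>A\<close> is a nonpositive real number. So the inner normal turned by
      \<open>\<zeta>\<close> and its image under \<open>A\<close> both point into the strip.\<close>
    define \<zeta> where "\<zeta> = cnj A + of_real (cmod A)"
    have \<zeta>: "Re \<zeta> > 0" using Apos by (simp add: \<zeta>_def)
    have "A * \<zeta> = of_real (cmod A) * (A + of_real (cmod A))"
      using complex_norm_square[of A] by (simp add: \<zeta>_def algebra_simps power2_eq_square)
    hence A\<zeta>: "Re (A * \<zeta>) > 0" using Apos A(1) by simp
    \<comment> \<open>The factors \<open>exp (- s)\<close> and \<open>exp (- s')\<close> cancel the
      moduli of \<open>exp w\<close> and \<open>exp w'\<close>. In the developed plane the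
      displacements then correspond exactly under the transition, so \<open>p\<close> and
      \<open>q\<close> collide.\<close>
    define p where "p \<epsilon> = w + Ln (1 + of_real (\<epsilon> * \<sigma> * exp (- s)) * \<i> * \<zeta>)" for \<epsilon>
    define q where "q \<epsilon> = w' + Ln (1 + of_real (\<epsilon> * \<sigma> * exp (- s')) * \<i> * (A * \<zeta>))" for \<epsilon>
    have lim: "((\<lambda>\<epsilon>. v + Ln (1 + of_real (\<epsilon> * \<sigma> * k) * \<i> * z)) \<longlongrightarrow> v) (at_right 0)"
        "((\<lambda>\<epsilon>. 1 + of_real (\<epsilon> * \<sigma> * k) * \<i> * z) \<longlongrightarrow> 1) (at_right 0)" for v z k
    proof -
      have "isCont (\<lambda>\<epsilon>. v + Ln (1 + of_real (\<epsilon> * \<sigma> * k) * \<i> * z)) 0"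
           "isCont (\<lambda>\<epsilon>. 1 + of_real (\<epsilon> * \<sigma> * k) * \<i> * z) 0" by (intro continuous_intros; simp)+
      thus "((\<lambda>\<epsilon>. v + Ln (1 + of_real (\<epsilon> * \<sigma> * k) * \<i> * z)) \<longlongrightarrow> v) (at_right 0)"
        "((\<lambda>\<epsilon>. 1 + of_real (\<epsilon> * \<sigma> * k) * \<i> * z) \<longlongrightarrow> 1) (at_right 0)"
        by (auto simp: isCont_def intro: tendsto_within_subset)
    qed
    have inside: "\<forall>\<^sub>F \<epsilon> in at_right 0. Im (v + Ln (1 + of_real (\<epsilon> * \<sigma> * exp k) * \<i> * z)) \<in> I \<and>
        exp (v + Ln (1 + of_real (\<epsilon> * \<sigma> * exp k) * \<i> * z)) = exp v + of_real (\<epsilon> * \<sigma> * exp k) * \<i> * z * exp v"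
      if v: "Im v = e" "Re z > 0" for v z k
    proof -
      have "((\<lambda>\<epsilon>. Im (v + Ln (1 + of_real (\<epsilon> * \<sigma> * exp k) * \<i> * z))) \<longlongrightarrow> Im v) (at_right 0)"
        by (intro tendsto_Im lim)
      hence 1: "\<forall>\<^sub>F \<epsilon> in at_right 0. dist (Im (v + Ln (1 + of_real (\<epsilon> * \<sigma> * exp k) * \<i> * z))) (Im v) < h"
        using h(1) by (rule tendstoD)
      have "((\<lambda>\<epsilon>. Re (1 + of_real (\<epsilon> * \<sigma> * exp k) * \<i> * z)) \<longlongrightarrow> Re 1) (at_right 0)"
        by (intro tendsto_Re lim)
      hence 2: "\<forall>\<^sub>F \<epsilon> in at_right 0. 0 < Re (1 + of_real (\<epsilon> * \<sigma> * exp k) * \<i> * z)"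
        by (rule order_tendstoD(1)) simp
      have 3: "\<forall>\<^sub>F \<epsilon> in at_right 0. \<epsilon> > (0::real)" by (rule eventually_at_right_less)
      from 1 2 3 show ?thesis
      proof eventually_elim
        case (elim \<epsilon>)
        let ?x = "1 + complex_of_real (\<epsilon> * \<sigma> * exp k) * \<i> * z"
        have im: "Im ?x = \<epsilon> * \<sigma> * exp k * Re z" by simp
        have "\<sigma> * Im ?x = (\<sigma> * \<sigma>) * (\<epsilon> * exp k * Re z)" unfolding im by simp
        also have "\<dots> = \<epsilon> * exp k * Re z" using \<sigma> by auto
        finally have "\<sigma> * Im ?x = \<epsilon> * exp k * Re z" .
        hence "0 < \<sigma> * Im ?x" using mult_pos_pos[OF mult_pos_pos[OF elim(3) exp_gt_zero] v(2)] by (simp only:)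
        hence "0 < \<sigma> * Im (Ln ?x)" using sgn_Im_Ln(1)[OF elim(2) \<sigma>] by simp
        moreover have "Im (v + Ln ?x) - e = Im (Ln ?x)" using v(1) by simp
        ultimately have "0 < \<sigma> * (Im (v + Ln ?x) - e)" by metis
        moreover have "\<bar>Im (v + Ln ?x) - e\<bar> < h" using elim(1) v(1) by (simp only: dist_real_def)
        moreover have "exp (v + Ln ?x) = exp v * ?x"
        proof -
          have "?x \<noteq> 0" using elim(2) by (metis order_less_irrefl zero_complex.sel(1))
          thus ?thesis by (subst exp_add, subst exp_Ln) simp_all
        qed
        ultimately show ?case using h(2) by (simp add: algebra_simps)
      qed
    qed
    have im: "Im w = e" "Im w' = e" by (simp_all add: w_def w'_def)
    note in1 = inside[OF im(1) \<zeta>, of "- s", folded p_def] and in2 = inside[OF im(2) A\<zeta>, of "- s'", folded q_def]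
    have pq: "(p \<longlongrightarrow> w) (at_right 0)" "(q \<longlongrightarrow> w') (at_right 0)" unfolding p_def[abs_def] q_def[abs_def] by (rule lim)+
    hence "filterlim (\<lambda>\<epsilon>. (p \<epsilon>, q \<epsilon>)) (nhds w \<times>\<^sub>F nhds w') (at_right 0)" by (rule filterlim_Pair)
    hence 4: "\<forall>\<^sub>F \<epsilon> in at_right 0. Fx (p \<epsilon>) = Fx (q \<epsilon>) \<longleftrightarrow> A * exp (p \<epsilon>) + B = exp (q \<epsilon>)"
      using ev unfolding filterlim_iff by fastforce
    have "((\<lambda>\<epsilon>. Re (q \<epsilon> - p \<epsilon>)) \<longlongrightarrow> Re (w' - w)) (at_right 0)" by (intro tendsto_intros pq)
    moreover have "Re (w' - w) = s' - s" by (simp add: w_def w'_def)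
    ultimately have lim: "((\<lambda>\<epsilon>. Re (q \<epsilon> - p \<epsilon>)) \<longlongrightarrow> s' - s) (at_right 0)" by simp
    have 5: "\<forall>\<^sub>F \<epsilon> in at_right 0. 0 < Re (q \<epsilon> - p \<epsilon>)" by (rule order_tendstoD(1)[OF lim]) (use s in simp)
    have 6: "\<forall>\<^sub>F \<epsilon> in at_right 0. Re (q \<epsilon> - p \<epsilon>) < L" by (rule order_tendstoD(2)[OF lim]) (use s L in simp)
    have "\<forall>\<^sub>F \<epsilon> in at_right (0::real). False"
      using in1 in2 4 5 6
    proof eventually_elim
      case (elim \<epsilon>)
      have "A * exp (p \<epsilon>) + B = exp w' + of_real (\<epsilon> * \<sigma> * exp (- s)) * \<i> * (A * \<zeta>) * exp w"
        using elim(1) A(2) by (simp add: algebra_simps)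
      also have "of_real (\<epsilon> * \<sigma> * exp (- s)) * \<i> * (A * \<zeta>) * exp w = of_real (\<epsilon> * \<sigma>) * \<i> * (A * \<zeta>) * cis e"
        unfolding w_def ew by (simp add: exp_minus field_simps flip: exp_of_real)
      also have "\<dots> = of_real (\<epsilon> * \<sigma> * exp (- s')) * \<i> * (A * \<zeta>) * exp w'"
        unfolding w'_def ew by (simp add: exp_minus field_simps flip: exp_of_real)
      finally have "A * exp (p \<epsilon>) + B = exp (q \<epsilon>)" using elim(2) by simp
      hence "Fx (p \<epsilon>) = Fx (q \<epsilon>)" using elim(3) by simp
      hence "F (p \<epsilon>) = F (q \<epsilon>)" using elim(1,2) edge_ext(1)[OF e] by (simp add: Fx_def)
      then obtain k :: int where "q \<epsilon> = p \<epsilon> + of_int k * of_real L" using collision elim(1,2) by blast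
      hence "Re (q \<epsilon> - p \<epsilon>) = of_int k * L" by simp
      hence k: "0 < of_int k * L" "of_int k * L < 1 * L" using elim(4,5) by simp_all
      have "0 < real_of_int k" by (rule zero_less_mult_pos2[OF k(1) L_pos])
      moreover have "real_of_int k < 1" using k(2) by (simp only: mult_less_cancel_right_pos[OF L_pos])
      ultimately show False by (simp only: of_int_0_less_iff of_int_less_1_iff)
    qed
    thus False by simp
  next
    case True
    then obtain c where c: "A = - of_real c" "c > 0" using A(1)
      by (metis add.inverse_inverse neg_0_less_iff_less nonpos_Reals_cases of_real_0 of_real_minus order_le_less)
    \<comment> \<open>On the developed edge the transition is the reflection-like map
      \<open>x \<mapsto> \<kappa> - c * x\<close> of moduli, exchanging the order; its fixed modulus
      \<open>\<kappa> / (1 + c)\<close> lies between \<open>exp s\<close> and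
      \<open>exp s'\<close>.\<close>
    define \<kappa> where "\<kappa> = exp s' + c * exp s"
    have B: "B = of_real \<kappa> * cis e"
      using A(2) unfolding c(1) w_def w'_def ew \<kappa>_def by (simp add: algebra_simps)
    define xs where "xs = ln (\<kappa> / (1 + c))"
    have \<kappa>: "\<kappa> > 0" using c(2) by (simp add: \<kappa>_def add_pos_pos)
    have exs: "exp xs = \<kappa> / (1 + c)" using \<kappa> c(2) by (simp add: xs_def)
    have es: "exp s < exp s'" using s by simp
    have "exp s < exp xs" unfolding exs using es c(2) by (simp add: \<kappa>_def pos_less_divide_eq algebra_simps)
    moreover have "exp xs < exp s'" unfolding exs using es c(2) by (simp add: \<kappa>_def pos_divide_less_eq algebra_simps)
    ultimately have xs: "s < xs" "xs < s'" by simp_all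
    have fixp: "\<kappa> - c * exp xs = exp xs" unfolding exs using c(2) by (simp add: field_simps)
    define g where "g v = w' + Ln ((A * exp v + B) / exp w')" for v
    have dev: "A * exp (Complex x e) + B = of_real (\<kappa> - c * exp x) * cis e" for x
      unfolding B c(1) ew by (simp add: algebra_simps)
    have gx: "(A * exp (Complex x e) + B) / exp w' = of_real ((\<kappa> - c * exp x) / exp s')" for x
      unfolding dev unfolding w'_def ew by simp
    have pos: "exp xs \<le> \<kappa> - c * exp x" "\<kappa> - c * exp x \<le> exp s'" if "s \<le> x" "x \<le> xs" for x
    proof -
      have "c * exp x \<le> c * exp xs" "c * exp s \<le> c * exp x" using that c(2) by (auto intro!: mult_left_mono)
      thus "exp xs \<le> \<kappa> - c * exp x" "\<kappa> - c * exp x \<le> exp s'" using fixp by (auto simp: \<kappa>_def)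
    qed
    have gval: "g (Complex x e) = Complex (ln (\<kappa> - c * exp x)) e" and gin: "s1 < ln (\<kappa> - c * exp x)" "ln (\<kappa> - c * exp x) < s2"
      and gnp: "(A * exp (Complex x e) + B) / exp w' \<notin> \<real>\<^sub>\<le>\<^sub>0"
      if "s \<le> x" "x \<le> xs" for x
    proof -
      note ps = pos[OF that]
      have p0: "0 < \<kappa> - c * exp x" using ps(1) exp_gt_zero[of xs] by linarith
      have "ln (exp xs) \<le> ln (\<kappa> - c * exp x)" using ps p0 by (subst ln_le_cancel_iff) auto
      moreover have "ln (\<kappa> - c * exp x) \<le> ln (exp s')" using ps p0 by (subst ln_le_cancel_iff) auto
      ultimately show "s1 < ln (\<kappa> - c * exp x)" "ln (\<kappa> - c * exp x) < s2" using s xs by simp_all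
      have q0: "0 < (\<kappa> - c * exp x) / exp s'" using p0 by simp
      show "(A * exp (Complex x e) + B) / exp w' \<notin> \<real>\<^sub>\<le>\<^sub>0" unfolding gx nonpos_Reals_of_real_iff using q0 by linarith
      have "g (Complex x e) = w' + of_real (ln ((\<kappa> - c * exp x) / exp s'))" unfolding g_def gx by (simp only: Ln_of_real[OF q0])
      also have "ln ((\<kappa> - c * exp x) / exp s') = ln (\<kappa> - c * exp x) - s'" using p0 by (subst ln_div) auto
      finally show "g (Complex x e) = Complex (ln (\<kappa> - c * exp x)) e" by (simp add: w'_def complex_eq_iff)
    qed
    have gcont: "isCont g (Complex x e)" if "s \<le> x" "x \<le> xs" for x
      unfolding g_def[abs_def] using gnp[OF that] by (intro continuous_intros) auto
    have gexp: "\<forall>\<^sub>F v in nhds (Complex x e). exp (g v) = A * exp v + B" if "s \<le> x" "x \<le> xs" for x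
    proof -
      have "isCont (\<lambda>v. A * exp v + B) (Complex x e)" by (intro continuous_intros)
      hence "((\<lambda>v. A * exp v + B) \<longlongrightarrow> A * exp (Complex x e) + B) (nhds (Complex x e))"
        by (rule isCont_nhds[where g="\<lambda>v. A * exp v + B"])
      moreover have "A * exp (Complex x e) + B \<noteq> 0" using gnp[OF that] by auto
      ultimately have "\<forall>\<^sub>F v in nhds (Complex x e). A * exp v + B \<noteq> 0" by (rule tendsto_imp_eventually_ne)
      thus ?thesis by eventually_elim (simp add: g_def exp_add)
    qed
    let ?S = "(\<lambda>x. Complex x e) ` {s..xs}"
    have "connected ?S" unfolding Complex_eq by (intro connected_continuous_image continuous_intros) auto
    hence id: "\<forall>\<^sub>F v in nhds (Complex xs e). Fx v = Fx (g v)"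
    proof (rule identity_principle[OF developing_simps(2), where ?w0.0="Complex s e"])
      fix v assume "v \<in> ?S"
      then obtain x where x: "v = Complex x e" "s \<le> x" "x \<le> xs" by auto
      show "afm_at exp Fx v" unfolding x(1) by (rule fx(1)) (use x s xs in auto)
      show "afm_at exp (\<lambda>v. Fx (g v)) v" unfolding x(1)
      proof (rule afm_at_comp[where d=exp and A=A and B=B, OF _ gcont[OF x(2,3)] A(1) gexp[OF x(2,3)]])
        show "afm_at exp Fx (g (Complex x e))" unfolding gval[OF x(2,3)] by (rule fx(1)[OF gin[OF x(2,3)]])
      qed
    next
      have sx: "s \<le> s" "s \<le> xs" using xs by auto
      have "g w = w'" using gval[OF sx] by (simp add: w_def w'_def \<kappa>_def)
      hence "\<forall>\<^sub>F p in nhds w \<times>\<^sub>F nhds (g w). Fx (fst p) = Fx (snd p) \<longleftrightarrow> A * exp (fst p) + B = exp (snd p)" using ev by simp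
      hence "\<forall>\<^sub>F v in nhds w. Fx v = Fx (g v) \<longleftrightarrow> A * exp v + B = exp (g v)"
        by (rule eventually_nhds_prod_along[where P="\<lambda>x y. Fx x = Fx y \<longleftrightarrow> A * exp x + B = exp y"]) (use gcont[OF sx] in \<open>simp add: w_def\<close>)
      with gexp[OF sx] show "\<forall>\<^sub>F v in nhds (Complex s e). Fx v = Fx (g v)"
        unfolding w_def by eventually_elim simp
    qed (use xs in auto)
    have sx: "s \<le> xs" "xs \<le> xs" using xs by auto
    have "g (Complex xs e) = Complex xs e" using gval[OF sx] by (simp add: fixp)
    hence "\<forall>\<^sub>F p in nhds (Complex xs e) \<times>\<^sub>F nhds (g (Complex xs e)). Fx (fst p) = Fx (snd p) \<longleftrightarrow> exp (fst p) = exp (snd p)"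
      using locally_injective[OF developing_simps(2) fx(1)[of xs]] xs s by simp
    hence "\<forall>\<^sub>F v in nhds (Complex xs e). Fx v = Fx (g v) \<longleftrightarrow> exp v = exp (g v)"
      by (rule eventually_nhds_prod_along[where P="\<lambda>x y. Fx x = Fx y \<longleftrightarrow> exp x = exp y"]) (rule gcont[OF sx])
    with id gexp[OF sx] have "\<forall>\<^sub>F v in nhds (Complex xs e). A * exp v + B = exp v" by eventually_elim simp
    hence "A = 1" using developing_affine_unique[OF developing_simps(2)] by blast
    hence "Re A = 1" by simp
    thus False using c by simp
  qed
qed

lemma singular_period:
  assumes "singular \<sigma> e s"
  shows "singular \<sigma> e (s + of_int k * L)"
  unfolding singular_def
proof
  assume "\<exists>r H. reg_data \<sigma> (Complex (s + of_int k * L) e) r H"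
  then obtain r H where H: "reg_data \<sigma> (Complex (s + of_int k * L) e) r H" by blast
  have "Complex (s + of_int k * L) e + of_int (- k) * of_real L = Complex s e" by (simp add: complex_eq_iff)
  thus False using reg_data_shift[OF H, of "- k"] assms unfolding singular_def by metis
qed

lemma Complex_ball: "Complex x e \<in> ball (Complex s e) r \<longleftrightarrow> \<bar>x - s\<bar> < r"
proof -
  have "Complex s e - Complex x e = of_real (s - x)" by (simp add: complex_eq_iff)
  thus ?thesis by (simp only: mem_ball dist_norm norm_of_real) (simp add: abs_minus_commute)
qed

lemma closed_singular: "closed {s. singular \<sigma> e s}"
  unfolding closed_def open_dist
proof
  fix s assume "s \<in> - {s. singular \<sigma> e s}"
  then obtain r H where H: "reg_data \<sigma> (Complex s e) r H" by (auto simp: singular_def)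
  have "\<not> singular \<sigma> e x" if "\<bar>x - s\<bar> < r" for x
    using reg_data_sub[OF H, of "Complex x e", unfolded Complex_ball] that unfolding singular_def by auto
  thus "\<exists>\<epsilon>>0. \<forall>y. dist y s < \<epsilon> \<longrightarrow> y \<in> - {s. singular \<sigma> e s}"
    using H by (intro exI[of _ r]) (auto simp: reg_data_def dist_real_def)
qed

lemma singular_isolated:
  assumes "edge \<sigma> e"
  shows "\<exists>r>0. \<forall>x. \<bar>x - s\<bar> < r \<longrightarrow> x \<noteq> s \<longrightarrow> \<not> singular \<sigma> e x"
proof -
  have ew: "edge \<sigma> (Im (Complex s e))" and \<sigma>: "\<sigma> = 1 \<or> \<sigma> = - 1" using assms by (simp_all add: edge_def)
  from edge_point[OF ew] show ?thesis
  proof (elim disjE exE)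
    fix r H assume H: "reg_data \<sigma> (Complex s e) r H"
    have "\<not> singular \<sigma> e x" if "\<bar>x - s\<bar> < r" for x
      using reg_data_sub[OF H, of "Complex x e", unfolded Complex_ball] that unfolding singular_def by auto
    thus ?thesis using H by (intro exI[of _ r]) (auto simp: reg_data_def)
  next
    fix r y c assume S: "sing_data \<sigma> (Complex s e) r y c"
    have "\<not> singular \<sigma> e x" if "\<bar>x - s\<bar> < r" "x \<noteq> s" for x
      using sing_reg[OF \<sigma> S, of "Complex x e", unfolded Complex_ball] that unfolding singular_def by auto
    thus ?thesis using S by (intro exI[of _ r]) (auto simp: sing_data_def)
  qed
qed

text \<open>Singular points form a closed set, periodic and nonempty by
  \<open>some_singular\<close>, so there is a nearest one on each side, at most one period
  apart.\<close>

lemma singular_between: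
  assumes e: "edge \<sigma> e"
  obtains s1 s2 where "s1 \<le> s" "s \<le> s2" "s1 < s2" "s2 \<le> s1 + L" "singular \<sigma> e s1" "singular \<sigma> e s2"
    "\<And>x. s1 < x \<Longrightarrow> x < s2 \<Longrightarrow> \<not> singular \<sigma> e x"
proof -
  obtain r where r: "r > 0" "\<And>x. \<bar>x - s\<bar> < r \<Longrightarrow> x \<noteq> s \<Longrightarrow> \<not> singular \<sigma> e x" using singular_isolated[OF e, of s] by blast
  \<comment> \<open>The search starts at a nonsingular point slightly to the right, so that a
    singular \<open>s\<close> becomes the left end of its interval.\<close>
  define x0 where "x0 = s + r / 2"
  have x0: "\<not> singular \<sigma> e x0" "s < x0" using r by (auto simp: x0_def)
  obtain w0 where w0: "Im w0 = e" "\<nexists>r H. reg_data \<sigma> w0 r H" using some_singular[OF e] by blast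
  have "Complex (Re w0) e = w0" using w0(1) by (simp add: complex_eq_iff)
  hence sg: "singular \<sigma> e (Re w0)" using w0(2) unfolding singular_def by metis
  define k where "k = \<lfloor>(x0 - Re w0) / L\<rfloor>"
  define s0 where "s0 = Re w0 + of_int k * L"
  have sg0: "singular \<sigma> e s0" unfolding s0_def by (rule singular_period[OF sg])
  have "of_int k \<le> (x0 - Re w0) / L" "(x0 - Re w0) / L < of_int k + 1" unfolding k_def by linarith+
  hence s0: "s0 \<le> x0" "x0 \<le> s0 + L"
    using L_pos by (auto simp: s0_def pos_le_divide_eq pos_divide_less_eq algebra_simps)
  let ?S = "{s. singular \<sigma> e s} \<inter> {s0..x0}"
  have "compact ?S" by (intro closed_Int_compact closed_singular) simp
  moreover have "?S \<noteq> {}" using sg0 s0 by auto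
  ultimately obtain s1 where s1: "s1 \<in> ?S" "\<And>x. x \<in> ?S \<Longrightarrow> x \<le> s1" by (meson compact_attains_sup)
  have sg1: "singular \<sigma> e (s1 + L)" using singular_period[of \<sigma> e s1 1] s1(1) by simp
  let ?T = "{s. singular \<sigma> e s} \<inter> {x0..s1 + L}"
  have "compact ?T" by (intro closed_Int_compact closed_singular) simp
  moreover have "?T \<noteq> {}" using sg1 s1(1) s0 by auto
  ultimately obtain s2 where s2: "s2 \<in> ?T" "\<And>x. x \<in> ?T \<Longrightarrow> s2 \<le> x" by (meson compact_attains_inf)
  have lt: "s1 < x0" "x0 < s2" using s1(1) s2(1) x0(1) by (auto simp: order_le_less)
  show ?thesis
  proof
    show "s1 \<le> s"
    proof (rule ccontr)
      assume "\<not> s1 \<le> s"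
      thus False using r(2)[of s1] lt(1) s1(1) r(1) by (auto simp: x0_def)
    qed
    show "\<not> singular \<sigma> e x" if "s1 < x" "x < s2" for x
      using s1(1) s1(2)[of x] s2(1) s2(2)[of x] that by fastforce
  qed (use lt s1(1) s2(1) x0(2) in auto)
qed

lemma saddle:
  assumes e: "edge \<sigma> e" and s12: "s1 < s2" "s2 \<le> s1 + L" and sg: "singular \<sigma> e s1" "singular \<sigma> e s2"
    and reg: "\<And>x. s1 < x \<Longrightarrow> x < s2 \<Longrightarrow> \<not> singular \<sigma> e x"
  shows "saddle_connection X \<Lambda> \<A> (\<lambda>t. Fb (Complex (s1 + t * (s2 - s1)) e))"
proof -
  define d where "d = s2 - s1"
  have d: "d > 0" using s12 by (simp add: d_def)
  define g where "g t = Complex (s1 + t * d) e" for t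
  have inside: "s1 < s1 + t * d" "s1 + t * d < s2" if "0 < t" "t < 1" for t
  proof -
    have "t * d < 1 * d" using that d by (intro mult_strict_right_mono) auto
    moreover have "0 < t * d" using that d by simp
    moreover have "s2 = s1 + d" by (simp add: d_def)
    ultimately show "s1 < s1 + t * d" "s1 + t * d < s2" by linarith+
  qed
  have in\<Lambda>: "Fb (Complex s e) \<in> \<Lambda>" if sg: "singular \<sigma> e s" for s
  proof -
    have ew: "edge \<sigma> (Im (Complex s e))" using e by simp
    obtain r y c where S: "sing_data \<sigma> (Complex s e) r y c" using edge_point[OF ew] sg unfolding singular_def by blast
    thus ?thesis using Fb_sing[OF ew S] by (simp add: sing_data_def)
  qed
  have cont: "continuous_map (top_of_set {0..1}) X (\<lambda>t. Fb (g t))"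
  proof -
    have "continuous_map (top_of_set {0..1}) (top_of_set {w. Im w \<in> I \<or> Im w = e}) g"
      unfolding g_def[abs_def] Complex_eq by (auto simp: continuous_map_in_subtopology intro!: continuous_intros)
    from continuous_map_compose[OF this Fb_continuous[OF e]] show ?thesis by (simp add: o_def)
  qed
  have straight: "\<exists>\<phi> u. straight_at (regular_part X \<Lambda>) \<A> (\<lambda>t. Fb (g t)) t \<phi> u" if t: "0 < t" "t < 1" for t
  proof (rule straight_at_exp_line[where H="edge_ext \<sigma> e" and ?s0.0="s1 + t * d" and e=e and d=d])
    note seg = edge_segment[OF e reg[OF inside[OF t]]]
    show "afm_at exp (edge_ext \<sigma> e) (Complex (s1 + t * d) e)" by (rule seg(1))
    have "((\<lambda>x. s1 + x * d) \<longlongrightarrow> s1 + t * d) (nhds t)" by (intro tendsto_intros) (simp add: filterlim_def)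
    with seg(3) have "\<forall>\<^sub>F x in nhds t. Fb (Complex (s1 + x * d) e) = edge_ext \<sigma> e (Complex (s1 + x * d) e)"
      unfolding filterlim_iff by blast
    thus "\<forall>\<^sub>F x in nhds t. Fb (g x) = edge_ext \<sigma> e (Complex (s1 + t * d + (x - t) * d) e)"
      by eventually_elim (simp add: g_def algebra_simps)
  qed (rule d)
  have "inj_on (\<lambda>t. Fb (g t)) {0<..<1}"
  proof (rule linorder_inj_onI')
    fix t t' :: real assume t: "t \<in> {0<..<1}" "t' \<in> {0<..<1}" "t < t'"
    have "t * d < t' * d" using t d by simp
    thus "Fb (g t) \<noteq> Fb (g t')" unfolding g_def
      using edge_inj[OF e s12(2) reg, of "s1 + t * d" "s1 + t' * d"] inside[of t] inside[of t'] t by auto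
  qed
  moreover have "Fb (g 0) \<in> \<Lambda>" "Fb (g 1) \<in> \<Lambda>" using in\<Lambda>[OF sg(1)] in\<Lambda>[OF sg(2)] by (simp_all add: g_def d_def)
  moreover have "trajectory X \<Lambda> \<A> {0..1} (\<lambda>t. Fb (g t))"
    unfolding trajectory_def using cont straight by (auto simp: is_interval_cc)
  ultimately show ?thesis unfolding saddle_connection_def g_def d_def by blast
qed

lemma strip_image_open: "openin X (F ` {w. Im w \<in> I})" and strip_image_M: "F ` {w. Im w \<in> I} \<subseteq> M"
  using afm_open_image[OF developing_simps(2), of "{w. Im w \<in> I}" F] F_afm open_strip[OF open_I] afm_at_in_M[OF F_afm] by auto

text \<open>A regular boundary value taken inside the strip would, after moving slightly inward,
  give two interior points with the same image and different heights. A singular one is not a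
  regular value at all.\<close>

lemma edge_value_outside:
  assumes e: "edge \<sigma> (Im w)"
  shows "Fb w \<notin> F ` {w. Im w \<in> I}"
proof
  assume "Fb w \<in> F ` {w. Im w \<in> I}"
  then obtain w' where w': "Im w' \<in> I" "Fb w = F w'" by auto
  from edge_point[OF e] show False
  proof (elim disjE exE)
    fix r y c assume S: "sing_data \<sigma> w r y c"
    hence "Fb w \<in> \<Lambda>" using Fb_sing[OF e S] by (simp add: sing_data_def)
    thus False using w' strip_image_M by auto
  next
    fix r H assume H: "reg_data \<sigma> w r H"
    have r: "r > 0" "afm_at exp H w" using H by (auto simp: reg_data_def)
    have "Fb w = H w" using Fb_reg[OF e _ H, of w] r by simp
    hence eq: "H w = F w'" using w' by simp
    obtain \<kappa> where \<kappa>: "\<forall>\<^sub>F x in nhds w. H x = F (w' + Ln (1 + \<kappa> * (exp (x - w) - 1)))"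
      by (rule transition_lift[OF r(2) F_afm[OF w'(1)] eq])
    define g where "g x = w' + Ln (1 + \<kappa> * (exp (x - w) - 1))" for x
    have gw: "g w = w'" by (simp add: g_def)
    have g1: "isCont g w" unfolding g_def[abs_def] by (intro continuous_intros) auto
    have "\<forall>\<^sub>F v in nhds w. H v = F (g v)" using \<kappa> by (simp add: g_def)
    moreover define \<delta> where "\<delta> = \<bar>Im w' - Im w\<bar> / 2"
    have \<delta>: "\<delta> > 0" using e w'(1) by (auto simp: \<delta>_def edge_def)
    have "(g \<longlongrightarrow> w') (nhds w)" using isCont_nhds[OF g1] gw by simp
    hence "((\<lambda>v. Im (g v)) \<longlongrightarrow> Im w') (nhds w)" by (rule tendsto_Im)
    hence "\<forall>\<^sub>F v in nhds w. dist (Im (g v)) (Im w') < \<delta>" using \<delta> by (rule tendstoD)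
    moreover have "\<forall>\<^sub>F v in nhds w. Im (g v) \<in> I"
      by (rule nhds_transport[of "\<lambda>v. Im v \<in> I" g, OF _ g1]) (use eventually_nhds_in_open[OF open_strip[OF open_I]] gw w'(1) in auto)
    ultimately have "\<forall>\<^sub>F v in nhds w. H v = F (g v) \<and> dist (Im (g v)) (Im w') < \<delta> \<and> Im (g v) \<in> I"
      by eventually_elim simp
    then obtain d where d: "d > 0" "\<And>v. dist v w < d \<Longrightarrow> H v = F (g v) \<and> dist (Im (g v)) (Im w') < \<delta> \<and> Im (g v) \<in> I"
      unfolding eventually_nhds_metric by blast
    have "min d (min r \<delta>) > 0" using d(1) r(1) \<delta> by simp
    then obtain v where v: "v \<in> ball w (min d (min r \<delta>))" "Im v \<in> I" using edge_approach[OF e] by blast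
    have dv: "H v = F (g v)" "dist (Im (g v)) (Im w') < \<delta>" "Im (g v) \<in> I" using d(2)[of v] v(1) by (auto simp: dist_commute)
    have "F v = H v" using H v edge_side[OF e v(2)] unfolding reg_data_def by auto
    hence "F v = F (g v)" using dv(1) by simp
    then obtain k :: int where "g v = v + of_int k * of_real L" using collision[OF v(2) dv(3)] by blast
    hence "Im (g v) = Im v" by simp
    moreover have "\<bar>Im v - Im w\<bar> < \<delta>" using abs_Im_le_cmod[of "v - w"] v(1) by (simp add: dist_norm norm_minus_commute)
    ultimately show False using dv(2) by (auto simp: \<delta>_def dist_real_def abs_if split: if_splits)
  qed
qed

lemma edge_value_closure:
  assumes e: "edge \<sigma> (Im w)"
  shows "Fb w \<in> X closure_of F ` {w. Im w \<in> I}"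
proof -
  let ?D = "{v. Im v \<in> I \<or> Im v = Im w}"
  note c = Fb_continuous[OF e]
  have "Fb w \<in> topspace X" using c by (auto simp: continuous_map_def)
  moreover have "\<exists>y\<in>F ` {w. Im w \<in> I}. y \<in> T" if T: "Fb w \<in> T" "openin X T" for T
  proof -
    have "openin (top_of_set ?D) {v \<in> ?D. Fb v \<in> T}" using openin_continuous_map_preimage[OF c T(2)] by simp
    then obtain r where r: "r > 0" "ball w r \<inter> ?D \<subseteq> {v \<in> ?D. Fb v \<in> T}"
      unfolding openin_contains_ball using T(1) by blast
    obtain v where v: "v \<in> ball w r" "Im v \<in> I" using edge_approach[OF e r(1)] by blast
    hence "Fb v \<in> T" using r(2) by auto
    thus ?thesis using v(2) Fb_F[OF v(2)] by (intro bexI[of _ "F v"]) auto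
  qed
  ultimately show ?thesis by (auto simp: in_closure_of)
qed

text \<open>Modulo the period the closure is covered by the images of two closed rectangles, one for
  each edge because \<open>Fb\<close> is continuous with one edge added. Boundary values are limits
  of the open image but do not belong to it.\<close>

lemma frontier_strip:
  assumes ab: "a < b" "I = {a<..<b}"
  shows "X frontier_of (F ` {w. Im w \<in> I}) = Fb ` {w. Im w = a \<or> Im w = b}"
proof -
  let ?K = "F ` {w. Im w \<in> I}"
  note ed = edges[OF ab(2,1)]
  have fr: "X frontier_of ?K = X closure_of ?K - ?K" by (simp add: frontier_of_def interior_of_openin strip_image_open)
  define m where "m = (a + b) / 2"
  have m: "a < m" "m < b" using ab(1) by (auto simp: m_def)
  have comp: "compactin X (Fb ` cbox (Complex 0 x) (Complex L y))" if "edge \<sigma> e" "cbox (Complex 0 x) (Complex L y) \<subseteq> {w. Im w \<in> I \<or> Im w = e}" for \<sigma> e x y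
    by (rule image_compactin[OF _ Fb_continuous[OF that(1)]]) (use that(2) in \<open>simp add: compactin_subtopology\<close>)
  let ?C = "Fb ` cbox (Complex 0 a) (Complex L m) \<union> Fb ` cbox (Complex 0 m) (Complex L b)"
  have "compactin X ?C"
    by (rule compactin_Un[OF comp[OF ed(1)] comp[OF ed(2)]]) (use m ab(2) in \<open>auto simp: in_cbox_complex_iff\<close>)
  hence "closedin X ?C" by (rule compactin_imp_closedin[OF Hausdorff_X])
  moreover have "?K \<subseteq> ?C"
  proof
    fix x assume "x \<in> ?K"
    then obtain w where w: "Im w \<in> I" "x = F w" by auto
    obtain k :: int where k: "0 \<le> Re w + of_int k * L" "Re w + of_int k * L \<le> L" by (rule Re_mod_period)
    let ?v = "w + of_int k * of_real L"
    have "Fb ?v = F w" using period_int[OF w(1)] w(1) by (simp add: Fb_F)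
    moreover have "?v \<in> cbox (Complex 0 a) (Complex L m) \<union> cbox (Complex 0 m) (Complex L b)"
      using k w(1) ab(2) by (auto simp: in_cbox_complex_iff)
    ultimately show "x \<in> ?C" using w(2) by (metis UnE UnI1 UnI2 imageI)
  qed
  ultimately have cl: "X closure_of ?K \<subseteq> ?C" by (rule closure_of_minimal[rotated])
  show ?thesis
  proof
    show "X frontier_of ?K \<subseteq> Fb ` {w. Im w = a \<or> Im w = b}"
    proof
      fix x assume "x \<in> X frontier_of ?K"
      hence x: "x \<in> ?C" "x \<notin> ?K" using cl fr by auto
      then obtain w where w: "x = Fb w" "a \<le> Im w" "Im w \<le> b" using m by (auto simp: in_cbox_complex_iff)
      have "Im w \<notin> I" using x(2) w(1) Fb_F by auto
      thus "x \<in> Fb ` {w. Im w = a \<or> Im w = b}" using w ab(2) by auto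
    qed
    show "Fb ` {w. Im w = a \<or> Im w = b} \<subseteq> X frontier_of ?K"
    proof
      fix x assume "x \<in> Fb ` {w. Im w = a \<or> Im w = b}"
      then obtain w where w: "x = Fb w" "Im w = a \<or> Im w = b" by auto
      from w(2) have "\<exists>\<sigma>. edge \<sigma> (Im w)" using ed by (elim disjE) (metis)+
      then obtain \<sigma> where "edge \<sigma> (Im w)" ..
      thus "x \<in> X frontier_of ?K" unfolding fr w(1) using edge_value_outside edge_value_closure by blast
    qed
  qed
qed

lemma frontier_saddles:
  assumes ab: "a < b" "I = {a<..<b}"
  shows "\<exists>\<S>. (\<forall>\<sigma>\<in>\<S>. saddle_connection X \<Lambda> \<A> \<sigma>) \<and> X frontier_of (F ` {w. Im w \<in> I}) = (\<Union>\<sigma>\<in>\<S>. \<sigma> ` {0..1})"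
proof (intro exI conjI ballI)
  let ?fr = "X frontier_of (F ` {w. Im w \<in> I})"
  let ?S = "{\<sigma>. saddle_connection X \<Lambda> \<A> \<sigma> \<and> \<sigma> ` {0..1} \<subseteq> ?fr}"
  note ed = edges[OF ab(2,1)]
  show "saddle_connection X \<Lambda> \<A> \<sigma>" if "\<sigma> \<in> ?S" for \<sigma> using that by simp
  have "x \<in> (\<Union>\<sigma>\<in>?S. \<sigma> ` {0..1})" if x: "x \<in> ?fr" for x
  proof -
    obtain w where w: "x = Fb w" "Im w = a \<or> Im w = b" using x unfolding frontier_strip[OF ab] by blast
    from w(2) have "\<exists>\<sigma>. edge \<sigma> (Im w)" using ed by (elim disjE) (metis)+
    then obtain \<sigma> where e: "edge \<sigma> (Im w)" ..
    obtain s1 s2 where s: "s1 \<le> Re w" "Re w \<le> s2" "s1 < s2" "s2 \<le> s1 + L" "singular \<sigma> (Im w) s1" "singular \<sigma> (Im w) s2"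
      "\<And>x. s1 < x \<Longrightarrow> x < s2 \<Longrightarrow> \<not> singular \<sigma> (Im w) x"
      by (rule singular_between[OF e, of "Re w"]; blast)
    let ?\<gamma> = "\<lambda>t. Fb (Complex (s1 + t * (s2 - s1)) (Im w))"
    have "?\<gamma> \<in> ?S" using saddle[OF e s(3-7)] frontier_strip[OF ab] w(2) by auto
    moreover have "x \<in> ?\<gamma> ` {0..1}"
    proof (rule image_eqI[where x="(Re w - s1) / (s2 - s1)"])
      show "x = ?\<gamma> ((Re w - s1) / (s2 - s1))" using s(3) w(1) by simp
    qed (use s(1-3) in \<open>auto simp: divide_simps\<close>)
    ultimately show ?thesis by blast
  qed
  thus "?fr = (\<Union>\<sigma>\<in>?S. \<sigma> ` {0..1})" by auto
qed

end

section \<open>Hyperbolic annuli\<close>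

lemma topspace_quotient: "topspace (quotient_topology Y r) = topspace Y // r"
proof -
  have "{x \<in> topspace Y. r `` {x} \<in> topspace Y // r} = topspace Y" by (auto intro: quotientI)
  hence "openin (quotient_topology Y r) (topspace Y // r)" by (simp add: openin_quotient_topology)
  hence "topspace Y // r \<subseteq> topspace (quotient_topology Y r)" by (rule openin_subset)
  moreover have "topspace (quotient_topology Y r) \<subseteq> topspace Y // r"
    using openin_topspace[of "quotient_topology Y r"] unfolding openin_quotient_topology by blast
  ultimately show ?thesis by blast
qed

text \<open>The covering of the cylinder in logarithmic coordinates, where the homothety of ratio
  \<open>\<rho>\<close> is the translation by \<open>ln \<rho>\<close>.\<close>

definition cyl_par :: "real \<Rightarrow> real \<Rightarrow> complex \<Rightarrow> (real \<times> real) set" where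
  "cyl_par \<beta> \<rho> w = cylinder_rel \<beta> \<rho> `` {(exp (Re w), Im w)}"

definition log_strip :: "real \<Rightarrow> complex set" where
  "log_strip \<beta> = {w. 0 < Im w \<and> Im w < \<beta>}"

lemma log_strip_eq: "log_strip \<beta> = {w. Im w \<in> {0<..<\<beta>}}"
  by (auto simp: log_strip_def)

lemma open_log_strip: "open (log_strip \<beta>)"
  unfolding log_strip_def by (intro open_Collect_conj open_Collect_less continuous_intros)

lemma polar_log:
  "w \<in> log_strip \<beta> \<Longrightarrow> (exp (Re w), Im w) \<in> cylinder_strip \<beta>"
  "p \<in> cylinder_strip \<beta> \<Longrightarrow> Complex (ln (fst p)) (snd p) \<in> log_strip \<beta>"
  "p \<in> cylinder_strip \<beta> \<Longrightarrow> (exp (Re (Complex (ln (fst p)) (snd p))), Im (Complex (ln (fst p)) (snd p))) = p"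
  by (auto simp: log_strip_def cylinder_strip_def)

lemma cyl_par_polar:
  "p \<in> cylinder_strip \<beta> \<Longrightarrow> cyl_par \<beta> \<rho> (Complex (ln (fst p)) (snd p)) = cylinder_rel \<beta> \<rho> `` {p}"
  by (auto simp: cyl_par_def cylinder_strip_def)

lemma open_cylinder_strip: "open (cylinder_strip \<beta>)"
  unfolding cylinder_strip_def by (intro open_Times) auto

lemma open_polar_iff:
  fixes P :: "real \<times> real \<Rightarrow> bool"
  shows "open {p \<in> cylinder_strip \<beta>. P p} \<longleftrightarrow> open {w \<in> log_strip \<beta>. P (exp (Re w), Im w)}"
proof
  assume o: "open {p \<in> cylinder_strip \<beta>. P p}"
  have "open ((\<lambda>w. (exp (Re w), Im w)) -` {p \<in> cylinder_strip \<beta>. P p})"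
    by (intro open_vimage o continuous_intros)
  moreover have "(\<lambda>w. (exp (Re w), Im w)) -` {p \<in> cylinder_strip \<beta>. P p} = {w \<in> log_strip \<beta>. P (exp (Re w), Im w)}"
    by (auto simp: log_strip_def cylinder_strip_def)
  ultimately show "open {w \<in> log_strip \<beta>. P (exp (Re w), Im w)}" by simp
next
  let ?E = "\<lambda>p::real \<times> real. Complex (ln (fst p)) (snd p)"
  assume o: "open {w \<in> log_strip \<beta>. P (exp (Re w), Im w)}"
  have "continuous_on (cylinder_strip \<beta>) ?E"
    unfolding Complex_eq by (intro continuous_intros) (auto simp: cylinder_strip_def)
  hence "\<forall>B. open B \<longrightarrow> open (?E -` B \<inter> cylinder_strip \<beta>)"
    by (simp only: continuous_on_open_vimage[OF open_cylinder_strip])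
  hence "open (?E -` {w \<in> log_strip \<beta>. P (exp (Re w), Im w)} \<inter> cylinder_strip \<beta>)" using o by blast
  moreover have "?E -` {w \<in> log_strip \<beta>. P (exp (Re w), Im w)} \<inter> cylinder_strip \<beta> = {p \<in> cylinder_strip \<beta>. P p}"
    by (auto simp: log_strip_def cylinder_strip_def)
  ultimately show "open {p \<in> cylinder_strip \<beta>. P p}" by simp
qed

locale cylinder_model =
  fixes \<beta> \<rho> :: real
  assumes \<rho>: "\<rho> > 1"
begin

lemma topspace_cyl: "topspace (cylinder_space \<beta> \<rho>) = cyl_par \<beta> \<rho> ` log_strip \<beta>"
proof -
  have "topspace (cylinder_space \<beta> \<rho>) = cylinder_strip \<beta> // cylinder_rel \<beta> \<rho>"
    by (simp add: cylinder_space_def topspace_quotient)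
  also have "\<dots> = cyl_par \<beta> \<rho> ` log_strip \<beta>"
  proof
    show "cylinder_strip \<beta> // cylinder_rel \<beta> \<rho> \<subseteq> cyl_par \<beta> \<rho> ` log_strip \<beta>"
    proof
      fix C assume "C \<in> cylinder_strip \<beta> // cylinder_rel \<beta> \<rho>"
      then obtain p where p: "p \<in> cylinder_strip \<beta>" "C = cylinder_rel \<beta> \<rho> `` {p}" by (rule quotientE)
      thus "C \<in> cyl_par \<beta> \<rho> ` log_strip \<beta>" using polar_log(2)[OF p(1)] cyl_par_polar[OF p(1)] by blast
    qed
    show "cyl_par \<beta> \<rho> ` log_strip \<beta> \<subseteq> cylinder_strip \<beta> // cylinder_rel \<beta> \<rho>"
      unfolding cyl_par_def using polar_log(1) by (auto intro!: quotientI)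
  qed
  finally show ?thesis .
qed

lemma openin_cyl:
  "openin (cylinder_space \<beta> \<rho>) V \<longleftrightarrow>
     V \<subseteq> cyl_par \<beta> \<rho> ` log_strip \<beta> \<and> open {w \<in> log_strip \<beta>. cyl_par \<beta> \<rho> w \<in> V}"
proof -
  have "topspace (cylinder_space \<beta> \<rho>) = cylinder_strip \<beta> // cylinder_rel \<beta> \<rho>"
    by (simp add: cylinder_space_def topspace_quotient)
  hence "V \<subseteq> cylinder_strip \<beta> // cylinder_rel \<beta> \<rho> \<longleftrightarrow> V \<subseteq> cyl_par \<beta> \<rho> ` log_strip \<beta>"
    using topspace_cyl by simp
  moreover have "openin (top_of_set (cylinder_strip \<beta>)) {p \<in> cylinder_strip \<beta>. cylinder_rel \<beta> \<rho> `` {p} \<in> V} \<longleftrightarrow>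
      open {p \<in> cylinder_strip \<beta>. cylinder_rel \<beta> \<rho> `` {p} \<in> V}"
    using open_cylinder_strip by (subst openin_open_eq) auto
  ultimately show ?thesis
    unfolding cylinder_space_def openin_quotient_topology topspace_euclidean_subtopology
    by (simp add: open_polar_iff cyl_par_def)
qed

lemma cyl_par_eq:
  assumes w: "w \<in> log_strip \<beta>" "w' \<in> log_strip \<beta>"
  shows "cyl_par \<beta> \<rho> w = cyl_par \<beta> \<rho> w' \<longleftrightarrow> (\<exists>k::int. w' = w + of_int k * of_real (ln \<rho>))"
proof -
  have pow: "\<rho> powi k = exp (of_int k * ln \<rho>)" for k :: int
    using powr_real_of_int'[of \<rho> k] \<rho> by (simp add: powr_def)
  have "cyl_par \<beta> \<rho> w = cyl_par \<beta> \<rho> w' \<longleftrightarrow> ((exp (Re w), Im w), (exp (Re w'), Im w')) \<in> cylinder_rel \<beta> \<rho>"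
    unfolding cyl_par_def by (rule eq_equiv_class_iff[OF equiv_cylinder_rel[OF \<rho>]]) (use polar_log(1) w in auto)
  also have "\<dots> \<longleftrightarrow> (\<exists>k::int. exp (Re w') = exp (of_int k * ln \<rho> + Re w) \<and> Im w' = Im w)"
    using polar_log(1) w by (simp add: cylinder_rel_def pow exp_add)
  also have "\<dots> \<longleftrightarrow> (\<exists>k::int. w' = w + of_int k * of_real (ln \<rho>))"
    by (simp only: exp_inj_iff) (simp add: complex_eq_iff add.commute)
  finally show ?thesis .
qed

lemma cyl_atlasI:
  assumes V: "openin (cylinder_space \<beta> \<rho>) V" "open (\<xi> ` V)" "homeomorphic_map (subtopology (cylinder_space \<beta> \<rho>) V) (top_of_set (\<xi> ` V)) \<xi>"
    and aff: "\<And>w. w \<in> log_strip \<beta> \<Longrightarrow> cyl_par \<beta> \<rho> w \<in> V \<Longrightarrow> \<exists>a b. a \<noteq> 0 \<and> (\<forall>\<^sub>F v in nhds w. \<xi> (cyl_par \<beta> \<rho> v) = a * exp v + b)"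
  shows "(V, \<xi>) \<in> cylinder_atlas \<beta> \<rho>"
proof -
  have "fst p > 0 \<and> (\<exists>a b W. a \<noteq> 0 \<and> openin (top_of_set (cylinder_strip \<beta>)) W \<and> p \<in> W \<and>
      (\<forall>q\<in>W. \<xi> (cylinder_rel \<beta> \<rho> `` {q}) = a * rcis (fst q) (snd q) + b))"
    if p: "p \<in> cylinder_strip \<beta>" "cylinder_rel \<beta> \<rho> `` {p} \<in> V" for p
  proof
    show "fst p > 0" using p(1) by (auto simp: cylinder_strip_def)
    let ?w = "Complex (ln (fst p)) (snd p)"
    have "cyl_par \<beta> \<rho> ?w \<in> V" using p by (simp add: cyl_par_polar)
    then obtain a b where ab: "a \<noteq> 0" "\<forall>\<^sub>F v in nhds ?w. \<xi> (cyl_par \<beta> \<rho> v) = a * exp v + b"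
      using aff polar_log(2)[OF p(1)] by blast
    then obtain N where N: "open N" "?w \<in> N" "\<And>v. v \<in> N \<Longrightarrow> \<xi> (cyl_par \<beta> \<rho> v) = a * exp v + b"
      unfolding eventually_nhds by blast
    let ?W = "{q \<in> cylinder_strip \<beta>. Complex (ln (fst q)) (snd q) \<in> N}"
    have "{w \<in> log_strip \<beta>. Complex (ln (fst (exp (Re w), Im w))) (snd (exp (Re w), Im w)) \<in> N} = log_strip \<beta> \<inter> N" by auto
    hence "open ?W" unfolding open_polar_iff using open_log_strip N(1) by auto
    hence "openin (top_of_set (cylinder_strip \<beta>)) ?W" using open_cylinder_strip by (subst openin_open_eq) auto
    moreover have "\<xi> (cylinder_rel \<beta> \<rho> `` {q}) = a * rcis (fst q) (snd q) + b" if q: "q \<in> ?W" for q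
    proof -
      have "\<xi> (cyl_par \<beta> \<rho> (Complex (ln (fst q)) (snd q))) = a * exp (Complex (ln (fst q)) (snd q)) + b" using N(3) q by simp
      moreover have "exp (Complex (ln (fst q)) (snd q)) = rcis (fst q) (snd q)"
        using q by (auto simp: exp_eq_polar rcis_def cylinder_strip_def)
      ultimately show ?thesis using q by (simp add: cyl_par_polar)
    qed
    ultimately show "\<exists>a b W. a \<noteq> 0 \<and> openin (top_of_set (cylinder_strip \<beta>)) W \<and> p \<in> W \<and>
        (\<forall>q\<in>W. \<xi> (cylinder_rel \<beta> \<rho> `` {q}) = a * rcis (fst q) (snd q) + b)"
      using ab(1) p(1) N(2) by (rule_tac x=a in exI, rule_tac x=b in exI, rule_tac x="?W" in exI) simp
  qed
  thus ?thesis using V unfolding cylinder_atlas_def polar_quotient_atlas_def cylinder_space_def by simp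
qed

lemma cyl_atlasD:
  assumes ch: "(V, \<xi>) \<in> cylinder_atlas \<beta> \<rho>" and w: "w \<in> log_strip \<beta>" "cyl_par \<beta> \<rho> w \<in> V"
  obtains a b where "a \<noteq> 0" "\<forall>\<^sub>F v in nhds w. \<xi> (cyl_par \<beta> \<rho> v) = a * exp v + b"
proof -
  have "\<forall>p\<in>cylinder_strip \<beta>. cylinder_rel \<beta> \<rho> `` {p} \<in> V \<longrightarrow> fst p > 0 \<and>
        (\<exists>a b W. a \<noteq> 0 \<and> openin (top_of_set (cylinder_strip \<beta>)) W \<and> p \<in> W \<and>
           (\<forall>q\<in>W. \<xi> (cylinder_rel \<beta> \<rho> `` {q}) = a * rcis (fst q) (snd q) + b))"
    using ch unfolding cylinder_atlas_def polar_quotient_atlas_def by simp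
  note this[THEN bspec, OF polar_log(1)[OF w(1)], THEN mp, OF w(2)[unfolded cyl_par_def], THEN conjunct2]
  then obtain a b W where W: "a \<noteq> 0" "openin (top_of_set (cylinder_strip \<beta>)) W" "(exp (Re w), Im w) \<in> W"
     "\<And>q. q \<in> W \<Longrightarrow> \<xi> (cylinder_rel \<beta> \<rho> `` {q}) = a * rcis (fst q) (snd q) + b"
    by blast
  have "open W" using openin_open_trans[OF W(2) open_cylinder_strip] .
  hence "open ((\<lambda>w. (exp (Re w), Im w)) -` W)" by (intro open_vimage continuous_intros)
  hence "\<forall>\<^sub>F v in nhds w. v \<in> (\<lambda>w. (exp (Re w), Im w)) -` W" using W(3) by (intro eventually_nhds_in_open) auto
  hence "\<forall>\<^sub>F v in nhds w. \<xi> (cyl_par \<beta> \<rho> v) = a * exp v + b"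
    by eventually_elim (use W(4) in \<open>simp add: cyl_par_def exp_eq_polar rcis_def\<close>)
  with W(1) show ?thesis by (rule that)
qed

end

context affine_surface
begin

text \<open>\<open>F\<close> and the cylinder covering have the same fibres, so \<open>F\<close>
  descends to a bijection. Surface charts composed with it belong to the cylinder atlas because both
  coverings are affine in \<open>exp\<close>.\<close>

lemma annulusI:
  assumes \<beta>: "\<beta> > 0" and L: "L > 0" and F: "\<And>w. w \<in> log_strip \<beta> \<Longrightarrow> afm_at exp F w"
    and eq: "\<And>w w'. w \<in> log_strip \<beta> \<Longrightarrow> w' \<in> log_strip \<beta> \<Longrightarrow> F w = F w' \<longleftrightarrow> (\<exists>k::int. w' = w + of_int k * of_real L)"
  shows "hyperbolic_annulus X \<Lambda> \<A> (F ` log_strip \<beta>) \<beta>"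
proof -
  define \<rho> where "\<rho> = exp L"
  have ln\<rho>: "ln \<rho> = L" and \<rho>1: "\<rho> > 1" using L by (simp_all add: \<rho>_def)
  interpret cylinder_model \<beta> \<rho> by standard (rule \<rho>1)
  let ?Q = "cylinder_space \<beta> \<rho>" and ?K = "F ` log_strip \<beta>" and ?p = "cyl_par \<beta> \<rho>"
  define h where "h C = F (SOME w. w \<in> log_strip \<beta> \<and> ?p w = C)" for C
  have peq: "?p w = ?p w' \<longleftrightarrow> F w = F w'" if "w \<in> log_strip \<beta>" "w' \<in> log_strip \<beta>" for w w'
    using cyl_par_eq[OF that] eq[OF that] by (simp add: ln\<rho>)
  have hp: "h (?p w) = F w" if w: "w \<in> log_strip \<beta>" for w
  proof -
    have "(SOME v. v \<in> log_strip \<beta> \<and> ?p v = ?p w) \<in> log_strip \<beta> \<and> ?p (SOME v. v \<in> log_strip \<beta> \<and> ?p v = ?p w) = ?p w"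
      by (rule someI[of "\<lambda>v. v \<in> log_strip \<beta> \<and> ?p v = ?p w" w]) (use w in simp)
    thus ?thesis unfolding h_def using peq w by blast
  qed
  have openK: "openin X ?K" by (rule afm_open_image[OF developing_simps(2) _ open_log_strip]) (rule F)
  have KM: "?K \<subseteq> M" using afm_at_in_M[OF F] by auto
  hence topK: "topspace (subtopology X ?K) = ?K" by auto
  have open_im: "openin X (F ` N)" if "open N" "N \<subseteq> log_strip \<beta>" for N
    by (rule afm_open_image[OF developing_simps(2) _ that(1)]) (use F that in auto)
  have open_pre: "open {w \<in> log_strip \<beta>. F w \<in> W}" if W: "openin X W" for W
  proof (subst open_subopen, intro ballI)
    fix w assume w: "w \<in> {w \<in> log_strip \<beta>. F w \<in> W}"
    have "\<forall>\<^sub>F v in nhds w. F v \<in> W" by (rule afm_at_open_preimage[OF developing_simps(2) F W]) (use w in auto)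
    moreover have "\<forall>\<^sub>F v in nhds w. v \<in> log_strip \<beta>" using w open_log_strip by (intro eventually_nhds_in_open) auto
    ultimately have "\<forall>\<^sub>F v in nhds w. v \<in> {w \<in> log_strip \<beta>. F w \<in> W}" by eventually_elim simp
    thus "\<exists>T. open T \<and> w \<in> T \<and> T \<subseteq> {w \<in> log_strip \<beta>. F w \<in> W}" unfolding eventually_nhds by blast
  qed
  have hV: "h ` V = F ` {w \<in> log_strip \<beta>. ?p w \<in> V}" if "V \<subseteq> ?p ` log_strip \<beta>" for V
    using that hp by (auto simp: image_iff) (metis imageE subsetD)+
  have hom: "homeomorphic_map ?Q (subtopology X ?K) h"
  proof (rule bijective_open_imp_homeomorphic_map)
    show "continuous_map ?Q (subtopology X ?K) h"
      unfolding continuous_map_def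
    proof (intro conjI allI impI)
      show "h \<in> topspace ?Q \<rightarrow> topspace (subtopology X ?K)" unfolding topspace_cyl topK using hp by auto
      fix W assume "openin (subtopology X ?K) W"
      hence W: "openin X W" using openK openin_trans_full by blast
      have "{w \<in> log_strip \<beta>. ?p w \<in> {x \<in> topspace ?Q. h x \<in> W}} = {w \<in> log_strip \<beta>. F w \<in> W}"
        unfolding topspace_cyl using hp by auto
      thus "openin ?Q {x \<in> topspace ?Q. h x \<in> W}"
        unfolding openin_cyl using open_pre[OF W] by (auto simp: topspace_cyl)
    qed
    show "open_map ?Q (subtopology X ?K) h"
      unfolding open_map_def
    proof (intro allI impI)
      fix V assume "openin ?Q V"
      hence V: "V \<subseteq> ?p ` log_strip \<beta>" "open {w \<in> log_strip \<beta>. ?p w \<in> V}" by (simp_all add: openin_cyl)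
      have "openin X (h ` V)" unfolding hV[OF V(1)] by (rule open_im[OF V(2)]) auto
      moreover have "h ` V \<subseteq> ?K" unfolding hV[OF V(1)] by auto
      ultimately show "openin (subtopology X ?K) (h ` V)" using openin_subset_topspace_eq openin_subtopology_Int2 by (metis inf.absorb_iff2)
    qed
    show "h ` topspace ?Q = topspace (subtopology X ?K)" unfolding topspace_cyl topK using hp by (auto simp: image_image)
    show "inj_on h (topspace ?Q)" unfolding topspace_cyl using hp peq by (auto simp: inj_on_def)
  qed
  have imm: "affine_immersion ?Q (cylinder_atlas \<beta> \<rho>) (subtopology X ?K) \<A> h"
    unfolding affine_immersion_def
  proof (intro conjI ballI)
    show "continuous_map ?Q (subtopology X ?K) h" using hom by (rule homeomorphic_imp_continuous_map)
    fix x assume "x \<in> topspace ?Q"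
    then obtain w where w: "w \<in> log_strip \<beta>" "x = ?p w" by (auto simp: topspace_cyl)
    have hx: "h x = F w" using hp w by simp
    obtain U \<psi> a b where ch: "(U, \<psi>) \<in> \<A>" and ab: "a \<noteq> 0" "\<forall>\<^sub>F v in nhds w. F v \<in> U \<and> \<psi> (F v) = a * exp v + b"
      by (rule afm_atE[OF F[OF w(1)]])
    have "\<forall>\<^sub>F v in nhds w. v \<in> log_strip \<beta>" using w open_log_strip by (intro eventually_nhds_in_open) auto
    with ab(2) have "\<forall>\<^sub>F v in nhds w. v \<in> log_strip \<beta> \<and> F v \<in> U" by eventually_elim simp
    then obtain N where N: "open N" "w \<in> N" "N \<subseteq> log_strip \<beta>" "F ` N \<subseteq> U" unfolding eventually_nhds by blast
    define V where "V = ?p ` N"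
    have pV: "?p v \<in> V \<longleftrightarrow> F v \<in> F ` N" if "v \<in> log_strip \<beta>" for v
      using that N(3) peq[OF that] unfolding V_def image_iff by blast
    have V: "openin ?Q V"
    proof -
      have "{v \<in> log_strip \<beta>. ?p v \<in> V} = {v \<in> log_strip \<beta>. F v \<in> F ` N}" using pV by auto
      thus ?thesis unfolding openin_cyl using open_pre[OF open_im[OF N(1,3)]] N(3) by (auto simp: V_def)
    qed
    have hVN: "h ` V = F ` N" unfolding V_def image_image using hp N(3) by (intro image_cong) auto
    have \<psi>V: "(\<psi> \<circ> h) ` V = \<psi> ` F ` N" unfolding image_comp[symmetric] hVN ..
    have chart: "(V, \<psi> \<circ> h) \<in> cylinder_atlas \<beta> \<rho>"
    proof (rule cyl_atlasI[OF V])
      show "open ((\<psi> \<circ> h) ` V)" unfolding \<psi>V by (rule chart_image[OF ch open_im[OF N(1,3)] N(4)])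
      have "topspace ?Q \<inter> V = V" "?K \<inter> F ` N = F ` N" using openin_subset[OF V] N(3) by auto
      hence "h ` (topspace ?Q \<inter> V) = topspace (subtopology X ?K) \<inter> F ` N" unfolding topK using hVN by simp
      hence "homeomorphic_map (subtopology ?Q V) (subtopology (subtopology X ?K) (F ` N)) h"
        by (rule homeomorphic_map_subtopologies[OF hom])
      moreover have "subtopology (subtopology X ?K) (F ` N) = subtopology X (F ` N)"
        using N(3) by (simp add: subtopology_subtopology Int_absorb1 image_mono)
      ultimately have 1: "homeomorphic_map (subtopology ?Q V) (subtopology X (F ` N)) h" by simp
      have "homeomorphic_map (subtopology (subtopology X U) (F ` N)) (subtopology (top_of_set (\<psi> ` U)) (\<psi> ` F ` N)) \<psi>"
        by (rule homeomorphic_map_subtopologies[OF chart_homeomorphic(1)[OF ch]]) (use N(4) chart_open[OF ch] in auto)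
      moreover have "subtopology (subtopology X U) (F ` N) = subtopology X (F ` N)"
        using N(4) by (simp add: subtopology_subtopology Int_absorb1)
      moreover have "subtopology (top_of_set (\<psi> ` U)) (\<psi> ` F ` N) = top_of_set (\<psi> ` F ` N)"
        using N(4) by (simp add: subtopology_subtopology Int_absorb1 image_mono)
      ultimately have "homeomorphic_map (subtopology X (F ` N)) (top_of_set (\<psi> ` F ` N)) \<psi>" by simp
      from homeomorphic_map_compose[OF 1 this]
      show "homeomorphic_map (subtopology ?Q V) (top_of_set ((\<psi> \<circ> h) ` V)) (\<psi> \<circ> h)" unfolding \<psi>V .
    next
      fix v assume v: "v \<in> log_strip \<beta>" "?p v \<in> V"
      hence "F v \<in> U" using pV N(4) by auto
      then obtain a b where ab: "a \<noteq> 0" "\<forall>\<^sub>F u in nhds v. F u \<in> U \<and> \<psi> (F u) = a * exp u + b"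
        using afm_at_chart[OF developing_simps(2) F[OF v(1)] ch] by blast
      have "\<forall>\<^sub>F u in nhds v. u \<in> log_strip \<beta>" using v open_log_strip by (intro eventually_nhds_in_open) auto
      with ab(2) have "\<forall>\<^sub>F u in nhds v. (\<psi> \<circ> h) (?p u) = a * exp u + b" by eventually_elim (simp add: hp)
      thus "\<exists>a b. a \<noteq> 0 \<and> (\<forall>\<^sub>F u in nhds v. (\<psi> \<circ> h) (?p u) = a * exp u + b)" using ab(1) by blast
    qed
    show "\<exists>\<psi>. affine_chart_at (subtopology X ?K) \<A> (h x) \<psi> \<and> affine_chart_at ?Q (cylinder_atlas \<beta> \<rho>) x (\<psi> \<circ> h)"
    proof (intro exI[of _ \<psi>] conjI)
      have o: "openin (subtopology X ?K) (F ` N)"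
        using open_im[OF N(1,3)] N(3) openin_subtopology_Int2[of X "F ` N" ?K] by (simp add: Int_absorb1 image_mono)
      show "affine_chart_at (subtopology X ?K) \<A> (h x) \<psi>"
        unfolding affine_chart_at_def hx
        by (rule bexI[OF _ ch], unfold case_prod_conv, rule exI[of _ 1], rule exI[of _ 0], rule exI[of _ "F ` N"]) (use o N in auto)
      show "affine_chart_at ?Q (cylinder_atlas \<beta> \<rho>) x (\<psi> \<circ> h)"
        unfolding affine_chart_at_def
        by (rule bexI[OF _ chart], unfold case_prod_conv, rule exI[of _ 1], rule exI[of _ 0], rule exI[of _ V]) (use V N(2) w in \<open>auto simp: V_def\<close>)
    qed
  qed
  show ?thesis
    unfolding hyperbolic_annulus_def affine_isomorphism_def using openK KM \<beta> \<rho>1 hom imm by blast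
qed

text \<open>Conversely, composing the isomorphism with the covering turns a competing annulus into a
  periodic map of a strip, to which the local theory applies.\<close>

lemma annulusD:
  assumes ann: "hyperbolic_annulus X \<Lambda> \<A> K \<beta>"
  obtains G L where "L > 0" "\<And>w. w \<in> log_strip \<beta> \<Longrightarrow> afm_at exp G w" "K = G ` log_strip \<beta>"
    "\<And>w w'. w \<in> log_strip \<beta> \<Longrightarrow> w' \<in> log_strip \<beta> \<Longrightarrow> G w = G w' \<Longrightarrow> \<exists>k::int. w' = w + of_int k * of_real L"
    "\<And>w k. w \<in> log_strip \<beta> \<Longrightarrow> G (w + of_int k * of_real L) = G w"
proof -
  obtain \<rho> h where \<rho>1: "\<rho> > 1" and K: "openin X K" "K \<inter> \<Lambda> = {}"
    and hom: "homeomorphic_map (cylinder_space \<beta> \<rho>) (subtopology X K) h"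
    and imm: "affine_immersion (cylinder_space \<beta> \<rho>) (cylinder_atlas \<beta> \<rho>) (subtopology X K) \<A> h"
    using ann unfolding hyperbolic_annulus_def affine_isomorphism_def by blast
  interpret cylinder_model \<beta> \<rho> by standard (rule \<rho>1)
  let ?Q = "cylinder_space \<beta> \<rho>" and ?p = "cyl_par \<beta> \<rho>"
  define G where "G w = h (?p w)" for w
  have topK: "topspace (subtopology X K) = K" using openin_subset[OF K(1)] by auto
  have inj: "inj_on h (?p ` log_strip \<beta>)" and surj: "h ` ?p ` log_strip \<beta> = K"
    using hom topK unfolding topspace_cyl[symmetric] by (auto simp: homeomorphic_imp_injective_map homeomorphic_imp_surjective_map)
  have eq: "G w = G w' \<longleftrightarrow> (\<exists>k::int. w' = w + of_int k * of_real (ln \<rho>))" if w: "w \<in> log_strip \<beta>" "w' \<in> log_strip \<beta>" for w w'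
    using inj_on_eq_iff[OF inj, of "?p w" "?p w'"] w cyl_par_eq[OF w] by (simp add: G_def)
  show ?thesis
  proof (rule that[of "ln \<rho>" G])
    show "K = G ` log_strip \<beta>" using surj by (auto simp: G_def)
    show "ln \<rho> > 0" using \<rho>1 by simp
    show "\<exists>k::int. w' = w + of_int k * of_real (ln \<rho>)" if "w \<in> log_strip \<beta>" "w' \<in> log_strip \<beta>" "G w = G w'" for w w'
      using eq that by blast
    show "G (w + of_int k * of_real (ln \<rho>)) = G w" if w: "w \<in> log_strip \<beta>" for w k
    proof -
      have "w + of_int k * of_real (ln \<rho>) \<in> log_strip \<beta>" using w by (simp add: log_strip_def)
      thus ?thesis using eq[OF w] by metis
    qed
    show "afm_at exp G w" if w: "w \<in> log_strip \<beta>" for w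
    proof -
      have "?p w \<in> topspace ?Q" using w by (auto simp: topspace_cyl)
      then obtain \<psi> where \<psi>: "affine_chart_at (subtopology X K) \<A> (G w) \<psi>" "affine_chart_at ?Q (cylinder_atlas \<beta> \<rho>) (?p w) (\<psi> \<circ> h)"
        using imm unfolding affine_immersion_def G_def by blast
      obtain U \<psi>0 a0 b0 W0 where 0: "(U, \<psi>0) \<in> \<A>" "a0 \<noteq> 0" "openin (subtopology X K) W0" "G w \<in> W0" "W0 \<subseteq> U"
        "\<And>y. y \<in> W0 \<Longrightarrow> \<psi> y = a0 * \<psi>0 y + b0"
        using \<psi>(1) unfolding affine_chart_at_def by auto
      obtain V \<xi> a1 b1 W1 where 1: "(V, \<xi>) \<in> cylinder_atlas \<beta> \<rho>" "a1 \<noteq> 0" "openin ?Q W1" "?p w \<in> W1" "W1 \<subseteq> V"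
        "\<And>y. y \<in> W1 \<Longrightarrow> \<psi> (h y) = a1 * \<xi> y + b1"
        using \<psi>(2) unfolding affine_chart_at_def by auto
      have pV: "?p w \<in> V" using 1 by auto
      obtain a b where ab: "a \<noteq> 0" "\<forall>\<^sub>F v in nhds w. \<xi> (?p v) = a * exp v + b" by (rule cyl_atlasD[OF 1(1) w pV])
      have "openin ?Q {x \<in> topspace ?Q. h x \<in> W0}"
        by (rule openin_continuous_map_preimage[OF homeomorphic_imp_continuous_map[OF hom] 0(3)])
      hence "open {v \<in> log_strip \<beta>. ?p v \<in> {x \<in> topspace ?Q. h x \<in> W0}}" by (simp add: openin_cyl)
      hence ev0: "\<forall>\<^sub>F v in nhds w. v \<in> {v \<in> log_strip \<beta>. ?p v \<in> {x \<in> topspace ?Q. h x \<in> W0}}"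
        using w 0(4) by (intro eventually_nhds_in_open) (auto simp: topspace_cyl G_def)
      have "open {v \<in> log_strip \<beta>. ?p v \<in> W1}" using 1(3) by (simp add: openin_cyl)
      hence ev1: "\<forall>\<^sub>F v in nhds w. v \<in> {v \<in> log_strip \<beta>. ?p v \<in> W1}"
        using w 1(4) by (intro eventually_nhds_in_open) auto
      from ev0 ev1 ab(2) have "\<forall>\<^sub>F v in nhds w. G v \<in> U \<and> \<psi>0 (G v) = (a1 * a / a0) * exp v + (a1 * b + b1 - b0) / a0"
      proof eventually_elim
        case (elim v)
        have G0: "G v \<in> W0" using elim(1) by (simp add: G_def)
        have "a0 * \<psi>0 (G v) + b0 = a1 * (a * exp v + b) + b1" using 0(6)[OF G0] 1(6)[of "?p v"] elim(2,3) by (simp add: G_def)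
        hence "a0 * \<psi>0 (G v) = a1 * a * exp v + (a1 * b + b1 - b0)" by (simp add: algebra_simps)
        hence "\<psi>0 (G v) = (a1 * a * exp v + (a1 * b + b1 - b0)) / a0" using 0(2) by (simp add: nonzero_eq_divide_eq mult.commute)
        thus ?case using G0 0(5) by (auto simp: add_divide_distrib)
      qed
      thus ?thesis by (rule afm_atI[OF 0(1), rotated]) (use 0(2) 1(2) ab(1) in simp)
    qed
  qed
qed

end

section \<open>The cylinder of a maximal strip\<close>

lemma mod_period:
  fixes L :: real
  assumes "L > 0"
  obtains k :: int where "0 \<le> x + of_int k * L" "x + of_int k * L \<le> L"
proof
  show "0 \<le> x + of_int (- \<lfloor>x / L\<rfloor>) * L" using floor_divide_lower[OF assms, of x] by simp
  show "x + of_int (- \<lfloor>x / L\<rfloor>) * L \<le> L" using floor_divide_upper[OF assms, of x] by (simp add: algebra_simps)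
qed

lemma Complex_isCont: "isCont (\<lambda>t. Complex t e) s"
  unfolding Complex_eq by (intro continuous_intros)

lemma Complex_tendsto: "((\<lambda>t. Complex t e) \<longlongrightarrow> Complex s e) (nhds s)"
  by (rule isCont_nhds[where g="\<lambda>t. Complex t e", OF Complex_isCont])

context max_strip
begin

lemma F_continuous: "continuous_map (top_of_set {w. Im w \<in> I}) X F"
  by (rule afm_at_continuous_map[OF developing_simps(2)]) (use F_afm in auto)

lemma F_line_continuous:
  assumes "\<phi> \<in> I"
  shows "continuous_map euclidean X (\<lambda>t. F (Complex t \<phi>))"
proof -
  have "continuous_map euclidean (top_of_set {w. Im w \<in> I}) (\<lambda>t. Complex t \<phi>)"
    unfolding Complex_eq using assms by (auto simp: continuous_map_in_subtopology intro!: continuous_intros)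
  from continuous_map_compose[OF this F_continuous] show ?thesis by (simp add: o_def)
qed

text \<open>
  The closed geodesics of the strip are level curves of the angle of any annulus that contains them:
  at a maximum of the angle, a straight line is radial.
\<close>

lemma angle_constant:
  assumes G: "\<And>w. w \<in> log_strip \<beta> \<Longrightarrow> afm_at exp G w" and sub: "F ` {w. Im w \<in> I} \<subseteq> G ` log_strip \<beta>"
    and \<Theta>G: "\<And>v. v \<in> log_strip \<beta> \<Longrightarrow> \<Theta> (G v) = Im v"
    and \<Theta>: "continuous_map (subtopology X (G ` log_strip \<beta>)) euclideanreal \<Theta>" and \<phi>: "\<phi> \<in> I"
  shows "\<exists>\<tau>. \<forall>t. \<Theta> (F (Complex t \<phi>)) = \<tau>"
proof -
  define \<theta> where "\<theta> t = \<Theta> (F (Complex t \<phi>))" for t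
  have "continuous_map euclidean (subtopology X (G ` log_strip \<beta>)) (\<lambda>t. F (Complex t \<phi>))"
    using F_line_continuous[OF \<phi>] sub \<phi> by (auto simp: continuous_map_in_subtopology)
  from continuous_map_compose[OF this \<Theta>] have cont: "continuous_on UNIV \<theta>"
    by (simp add: o_def \<theta>_def[abs_def])
  have per: "\<theta> (t + of_int k * L) = \<theta> t" for t k
  proof -
    have "Complex (t + of_int k * L) \<phi> = Complex t \<phi> + of_int k * of_real L" by (simp add: complex_eq_iff)
    thus ?thesis using period_int[of "Complex t \<phi>" k] \<phi> by (simp add: \<theta>_def)
  qed
  \<comment> \<open>By periodicity a maximum over one period is a maximum over the whole
    line.\<close>
  have "\<exists>t0\<in>{0..L}. \<forall>t\<in>{0..L}. \<theta> t \<le> \<theta> t0"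
    by (rule continuous_attains_sup) (use continuous_on_subset[OF cont] L_pos in auto)
  then obtain t0 where t0: "\<And>t. t \<in> {0..L} \<Longrightarrow> \<theta> t \<le> \<theta> t0" by blast
  have max: "\<theta> t \<le> \<theta> t0" for t
  proof -
    obtain k :: int where "0 \<le> t + of_int k * L" "t + of_int k * L \<le> L" by (rule mod_period[OF L_pos])
    thus ?thesis using t0[of "t + of_int k * L"] per[of t k] by simp
  qed
  have loc: "\<exists>d>0. \<forall>x. dist x t < d \<longrightarrow> \<theta> x = \<theta> t0" if t: "\<theta> t = \<theta> t0" for t
  proof -
    define w where "w = Complex t \<phi>"
    have "F w \<in> G ` log_strip \<beta>" using sub \<phi> by (auto simp: w_def)
    then obtain v where v: "v \<in> log_strip \<beta>" "F w = G v" by auto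
    have Fw: "afm_at exp F w" using \<phi> by (intro F_afm) (simp add: w_def)
    obtain \<kappa> where \<kappa>: "\<forall>\<^sub>F x in nhds w. F x = G (v + Ln (1 + \<kappa> * (exp (x - w) - 1)))"
      by (rule transition_lift[OF Fw G[OF v(1)] v(2)])
    define g where "g x = v + Ln (1 + \<kappa> * (exp (x - w) - 1))" for x
    have g1: "isCont g w" unfolding g_def[abs_def] by (intro continuous_intros) auto
    have "\<forall>\<^sub>F x in nhds w. g x \<in> log_strip \<beta>"
      by (rule nhds_transport[of "\<lambda>v. v \<in> log_strip \<beta>" g, OF _ g1])
        (use eventually_nhds_in_open[OF open_log_strip] v(1) in \<open>auto simp: g_def\<close>)
    moreover have "\<forall>\<^sub>F x in nhds w. 0 < Re (1 + \<kappa> * (exp (x - w) - 1))"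
    proof (rule order_tendstoD(1))
      have "isCont (\<lambda>x. 1 + \<kappa> * (exp (x - w) - 1)) w" by (intro continuous_intros)
      hence "((\<lambda>x. 1 + \<kappa> * (exp (x - w) - 1)) \<longlongrightarrow> 1 + \<kappa> * (exp (w - w) - 1)) (nhds w)"
        by (rule isCont_nhds[where g="\<lambda>x. 1 + \<kappa> * (exp (x - w) - 1)"])
      thus "((\<lambda>x. Re (1 + \<kappa> * (exp (x - w) - 1))) \<longlongrightarrow> Re (1 + \<kappa> * (exp (w - w) - 1))) (nhds w)"
        by (rule tendsto_Re)
    qed simp
    ultimately have "\<forall>\<^sub>F x in nhds w. \<Theta> (F x) = Im (g x) \<and> 0 < Re (1 + \<kappa> * (exp (x - w) - 1))"
      using \<kappa> by eventually_elim (simp add: \<Theta>G g_def)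
    hence "\<forall>\<^sub>F x in nhds t. \<Theta> (F (Complex x \<phi>)) = Im (g (Complex x \<phi>)) \<and> 0 < Re (1 + \<kappa> * (exp (Complex x \<phi> - w) - 1))"
      using Complex_tendsto[where e=\<phi> and s=t] unfolding w_def filterlim_iff by blast
    then obtain d where d: "d > 0" "\<And>x. dist x t < d \<Longrightarrow> \<theta> x = Im (g (Complex x \<phi>)) \<and> 0 < Re (1 + \<kappa> * (exp (Complex x \<phi> - w) - 1))"
      unfolding eventually_nhds_metric \<theta>_def by blast
    have ex: "exp (Complex x \<phi> - w) = of_real (exp (x - t))" for x
    proof -
      have "Complex x \<phi> - w = of_real (x - t)" by (simp add: w_def complex_eq_iff)
      thus ?thesis by (simp only: exp_of_real)
    qed
    have m: "\<theta> t0 = Im v" using t \<Theta>G[OF v(1)] v(2) by (simp add: \<theta>_def w_def)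
    have val: "\<theta> x = Im v + Im (Ln (1 + \<kappa> * of_real (exp (x - t) - 1)))" "0 < Re (1 + \<kappa> * of_real (exp (x - t) - 1))"
      if "dist x t < d" for x
      using d(2)[OF that] unfolding g_def ex by simp_all
    show ?thesis
    proof (cases "Im \<kappa> = 0")
      case True
      have "\<theta> x = \<theta> t0" if x: "dist x t < d" for x
      proof -
        have "Im (1 + \<kappa> * of_real (exp (x - t) - 1)) = 0" using True by simp
        hence "Im (Ln (1 + \<kappa> * of_real (exp (x - t) - 1))) = 0" using sgn_Im_Ln(2)[OF val(2)[OF x], of 1] by simp
        thus ?thesis using val(1)[OF x] m by simp
      qed
      thus ?thesis using d(1) by blast
    next
      case False
      \<comment> \<open>A line crossing the radius at a nonzero angle increases the angle on one
        side; the sign of \<open>Im \<kappa>\<close> selects that side and contradicts the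
        maximum.\<close>
      define x where "x = t + sgn (Im \<kappa>) * (d / 2)"
      have x: "dist x t < d" using d(1) by (auto simp: x_def dist_real_def abs_mult sgn_if)
      have "Im (1 + \<kappa> * of_real (exp (x - t) - 1)) = Im \<kappa> * (exp (x - t) - 1)" by simp
      moreover have "0 < Im \<kappa> * (exp (x - t) - 1)"
        using False d(1) by (cases "Im \<kappa> > 0") (auto simp: x_def sgn_if zero_less_mult_iff)
      ultimately have "0 < 1 * Im (1 + \<kappa> * of_real (exp (x - t) - 1))" by simp
      hence "0 < Im (Ln (1 + \<kappa> * of_real (exp (x - t) - 1)))" using sgn_Im_Ln(1)[OF val(2)[OF x], of 1] by simp
      thus ?thesis using val(1)[OF x] m max[of x] by simp
    qed
  qed
  have "closed {t. \<theta> t = \<theta> t0}" by (intro closed_Collect_eq cont continuous_on_const)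
  moreover have "open {t. \<theta> t = \<theta> t0}" unfolding open_dist using loc by blast
  ultimately have "{t. \<theta> t = \<theta> t0} = UNIV" using clopen[of "{t. \<theta> t = \<theta> t0}"] by auto
  thus ?thesis unfolding \<theta>_def by blast
qed

text \<open>A larger connected annulus contains a point of the frontier. Along that boundary line
  its angle is constant, as a limit of the constants of \<open>angle_constant\<close>, so the part
  of the line inside the annulus is both open and closed. The whole line would then be regular,
  against \<open>some_singular\<close>.\<close>

lemma annulus_maximal:
  assumes ab: "a < b" "I = {a<..<b}" and ann: "hyperbolic_annulus X \<Lambda> \<A> K' \<beta>" and sub: "F ` {w. Im w \<in> I} \<subseteq> K'"
  shows "K' = F ` {w. Im w \<in> I}"
proof (rule ccontr)
  let ?K = "F ` {w. Im w \<in> I}"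
  assume ne: "K' \<noteq> ?K"
  obtain G L' where L': "L' > 0" and G: "\<And>w. w \<in> log_strip \<beta> \<Longrightarrow> afm_at exp G w" and K': "K' = G ` log_strip \<beta>"
    and inj: "\<And>w w'. w \<in> log_strip \<beta> \<Longrightarrow> w' \<in> log_strip \<beta> \<Longrightarrow> G w = G w' \<Longrightarrow> \<exists>k::int. w' = w + of_int k * of_real L'"
    and per: "\<And>w k. w \<in> log_strip \<beta> \<Longrightarrow> G (w + of_int k * of_real L') = G w"
    by (rule annulusD[OF ann]; blast)
  define \<Theta> where "\<Theta> x = Im (SOME v. v \<in> log_strip \<beta> \<and> G v = x)" for x
  have \<Theta>G: "\<Theta> (G v) = Im v" if v: "v \<in> log_strip \<beta>" for v
  proof -
    have "(SOME u. u \<in> log_strip \<beta> \<and> G u = G v) \<in> log_strip \<beta> \<and> G (SOME u. u \<in> log_strip \<beta> \<and> G u = G v) = G v"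
      by (rule someI[of "\<lambda>u. u \<in> log_strip \<beta> \<and> G u = G v" v]) (use v in simp)
    then obtain k :: int where "v = (SOME u. u \<in> log_strip \<beta> \<and> G u = G v) + of_int k * of_real L'" using inj v by blast
    hence "Im v = Im ((SOME u. u \<in> log_strip \<beta> \<and> G u = G v) + of_int k * of_real L')" by metis
    thus ?thesis by (simp add: \<Theta>_def)
  qed
  have openG: "openin X (G ` N)" if "open N" "N \<subseteq> log_strip \<beta>" for N
    by (rule afm_open_image[OF developing_simps(2) _ that(1)]) (use G that in auto)
  have oK: "openin X K'" unfolding K' by (rule openG[OF open_log_strip]) simp
  have \<Theta>: "continuous_map (subtopology X (G ` log_strip \<beta>)) euclideanreal \<Theta>"
    unfolding continuous_map_def
  proof (intro conjI allI impI)
    fix U :: "real set" assume "openin euclideanreal U"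
    hence U: "open U" by simp
    have "{x \<in> topspace (subtopology X (G ` log_strip \<beta>)). \<Theta> x \<in> U} = G ` {v \<in> log_strip \<beta>. Im v \<in> U}"
      using \<Theta>G openin_subset[OF oK] by (auto simp: K')
    moreover have "openin X (G ` {v \<in> log_strip \<beta>. Im v \<in> U})"
    proof (rule openG)
      have "{v \<in> log_strip \<beta>. Im v \<in> U} = log_strip \<beta> \<inter> {v. Im v \<in> U}" by auto
      thus "open {v \<in> log_strip \<beta>. Im v \<in> U}" using open_log_strip open_strip[OF U] by auto
    qed auto
    moreover have "G ` {v \<in> log_strip \<beta>. Im v \<in> U} \<subseteq> G ` log_strip \<beta>" by auto
    ultimately show "openin (subtopology X (G ` log_strip \<beta>)) {x \<in> topspace (subtopology X (G ` log_strip \<beta>)). \<Theta> x \<in> U}"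
      using openin_subtopology_Int2[of X "G ` {v \<in> log_strip \<beta>. Im v \<in> U}" "G ` log_strip \<beta>"] by (simp add: Int_absorb1)
  qed auto
  have const: "\<exists>\<tau>. \<forall>t. \<Theta> (F (Complex t \<phi>)) = \<tau>" if "\<phi> \<in> I" for \<phi>
    by (rule angle_constant[OF G _ \<Theta>G \<Theta> that]) (use sub K' in auto)
  have "connectedin X K'"
  proof -
    have "connected (log_strip \<beta>)" unfolding log_strip_eq by (intro convex_connected convex_strip is_interval_oo)
    hence "connectedin (top_of_set (log_strip \<beta>)) (log_strip \<beta>)" by (simp add: connectedin_subtopology)
    moreover have "continuous_map (top_of_set (log_strip \<beta>)) X G" by (rule afm_at_continuous_map[OF developing_simps(2) G])
    ultimately show ?thesis unfolding K' by (intro connectedin_continuous_map_image)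
  qed
  moreover have "K' \<inter> ?K \<noteq> {}"
  proof -
    obtain \<phi> where "\<phi> \<in> I" using I_ne by blast
    hence "F (Complex 0 \<phi>) \<in> ?K" by (intro imageI) simp
    thus ?thesis using sub by blast
  qed
  moreover have "K' - ?K \<noteq> {}" using ne sub by blast
  ultimately have "K' \<inter> X frontier_of ?K \<noteq> {}" by (rule connectedin_Int_frontier_of)
  then obtain w1 where w1: "Fb w1 \<in> K'" "Im w1 = a \<or> Im w1 = b" unfolding frontier_strip[OF ab] by blast
  define e where "e = Im w1"
  have "\<exists>\<sigma>. edge \<sigma> e" using w1(2) edges[OF ab(2,1)] unfolding e_def by metis
  then obtain \<sigma> where e: "edge \<sigma> e" ..
  define s0 where "s0 = Re w1"
  have s0: "Fb (Complex s0 e) \<in> K'" using w1(1) by (simp add: s0_def e_def)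
  let ?T = "{s. Fb (Complex s e) \<in> K'}"
  let ?D = "{w. Im w \<in> I \<or> Im w = e}"
  have lineD: "continuous_map euclidean (top_of_set ?D) (\<lambda>s. Complex s e)"
    unfolding Complex_eq by (auto simp: continuous_map_in_subtopology intro!: continuous_intros)
  from continuous_map_compose[OF this Fb_continuous[OF e]] have line: "continuous_map euclidean X (\<lambda>s. Fb (Complex s e))" by (simp add: o_def)
  have openT: "open ?T" using openin_continuous_map_preimage[OF line oK] by simp
  have near: "\<exists>h>0. \<forall>\<phi>\<in>I. \<bar>\<phi> - e\<bar> < h \<longrightarrow> \<bar>\<Theta> (F (Complex s \<phi>)) - \<Theta> (Fb (Complex s e))\<bar> < \<epsilon>" if s: "s \<in> ?T" and \<epsilon>: "\<epsilon> > 0" for s \<epsilon>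
  proof -
    let ?W = "{x \<in> topspace (subtopology X K'). \<Theta> x \<in> ball (\<Theta> (Fb (Complex s e))) \<epsilon>}"
    have "openin (subtopology X K') ?W" by (rule openin_continuous_map_preimage[OF \<Theta>[folded K']]) simp
    hence W: "openin X ?W" using oK openin_trans_full by blast
    have sW: "Fb (Complex s e) \<in> ?W" using s \<epsilon> openin_subset[OF oK] by auto
    have "openin (top_of_set ?D) {v \<in> ?D. Fb v \<in> ?W}" using openin_continuous_map_preimage[OF Fb_continuous[OF e] W] by simp
    moreover have "Complex s e \<in> {v \<in> ?D. Fb v \<in> ?W}" using sW by simp
    ultimately obtain r where r: "r > 0" "ball (Complex s e) r \<inter> ?D \<subseteq> {v \<in> ?D. Fb v \<in> ?W}"
      unfolding openin_contains_ball by blast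
    have "\<bar>\<Theta> (F (Complex s \<phi>)) - \<Theta> (Fb (Complex s e))\<bar> < \<epsilon>" if \<phi>: "\<phi> \<in> I" "\<bar>\<phi> - e\<bar> < r" for \<phi>
    proof -
      have "Complex s e - Complex s \<phi> = \<i> * of_real (e - \<phi>)" by (simp add: complex_eq_iff)
      hence "cmod (Complex s e - Complex s \<phi>) = \<bar>e - \<phi>\<bar>" by (simp only: norm_mult norm_of_real) simp
      hence "Complex s \<phi> \<in> ball (Complex s e) r \<inter> ?D" using \<phi> by (simp add: dist_norm abs_minus_commute)
      hence "Fb (Complex s \<phi>) \<in> ?W" using r(2) by blast
      thus ?thesis using \<phi>(1) by (simp add: Fb_F dist_real_def abs_minus_commute)
    qed
    thus ?thesis using r(1) by blast
  qed
  define \<tau> where "\<tau> = \<Theta> (Fb (Complex s0 e))"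
  have level: "\<Theta> (Fb (Complex s e)) = \<tau>" if s: "s \<in> ?T" for s
  proof (rule ccontr)
    assume "\<Theta> (Fb (Complex s e)) \<noteq> \<tau>"
    hence \<epsilon>: "\<bar>\<Theta> (Fb (Complex s e)) - \<tau>\<bar> / 2 > 0" (is "?\<epsilon> > 0") by simp
    obtain h where h: "h > 0" "\<forall>\<phi>\<in>I. \<bar>\<phi> - e\<bar> < h \<longrightarrow> \<bar>\<Theta> (F (Complex s \<phi>)) - \<Theta> (Fb (Complex s e))\<bar> < ?\<epsilon>" using near[OF s \<epsilon>] by blast
    have "s0 \<in> ?T" using s0 by simp
    then obtain h0 where h0: "h0 > 0" "\<forall>\<phi>\<in>I. \<bar>\<phi> - e\<bar> < h0 \<longrightarrow> \<bar>\<Theta> (F (Complex s0 \<phi>)) - \<tau>\<bar> < ?\<epsilon>" unfolding \<tau>_def using near[OF _ \<epsilon>[unfolded \<tau>_def]] by blast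
    have "edge \<sigma> (Im (Complex 0 e))" "min h h0 > 0" using e h(1) h0(1) by simp_all
    then obtain w where w: "w \<in> ball (Complex 0 e) (min h h0)" "Im w \<in> I" using edge_approach by blast
    have "\<bar>Im w - e\<bar> < min h h0" using abs_Im_le_cmod[of "w - Complex 0 e"] w(1) by (simp add: dist_norm norm_minus_commute)
    hence "\<bar>\<Theta> (F (Complex s (Im w))) - \<Theta> (Fb (Complex s e))\<bar> < ?\<epsilon>" "\<bar>\<Theta> (F (Complex s0 (Im w))) - \<tau>\<bar> < ?\<epsilon>" using h(2) h0(2) w(2) by simp_all
    moreover have "\<Theta> (F (Complex s (Im w))) = \<Theta> (F (Complex s0 (Im w)))" using const[OF w(2)] by metis
    ultimately show False by (simp add: abs_if split: if_splits)
  qed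
  obtain v0 where v0: "v0 \<in> log_strip \<beta>" "Fb (Complex s0 e) = G v0" using s0 K' by auto
  have \<tau>: "Complex t \<tau> \<in> log_strip \<beta>" for t using v0 \<Theta>G[OF v0(1)] by (simp add: \<tau>_def log_strip_def)
  \<comment> \<open>The compact closed geodesic of angle \<open>\<tau>\<close> in the competing
    annulus: all points of the edge that lie in the annulus lie on it.\<close>
  let ?\<Gamma> = "G ` (\<lambda>t. Complex t \<tau>) ` {0..L'}"
  have "closedin X ?\<Gamma>"
  proof (rule compactin_imp_closedin[OF Hausdorff_X], rule image_compactin)
    have "compact ((\<lambda>t. Complex t \<tau>) ` {0..L'})" unfolding Complex_eq by (intro compact_continuous_image continuous_intros) simp
    thus "compactin (top_of_set (log_strip \<beta>)) ((\<lambda>t. Complex t \<tau>) ` {0..L'})" using \<tau> by (auto simp: compactin_subtopology)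
    show "continuous_map (top_of_set (log_strip \<beta>)) X G" by (rule afm_at_continuous_map[OF developing_simps(2) G])
  qed
  hence "closed {s. Fb (Complex s e) \<in> ?\<Gamma>}" using closedin_continuous_map_preimage[OF line] by simp
  moreover have "{s. Fb (Complex s e) \<in> ?\<Gamma>} = ?T"
  proof (intro equalityI subsetI)
    fix s assume "s \<in> {s. Fb (Complex s e) \<in> ?\<Gamma>}"
    thus "s \<in> ?T" using \<tau> K' by auto
  next
    fix s assume s: "s \<in> ?T"
    then obtain v where v: "v \<in> log_strip \<beta>" "Fb (Complex s e) = G v" using K' by auto
    have "Im v = \<tau>" using level[OF s] \<Theta>G[OF v(1)] v(2) by simp
    obtain k :: int where k: "0 \<le> Re v + of_int k * L'" "Re v + of_int k * L' \<le> L'" by (rule mod_period[OF L'])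
    have "v + of_int k * of_real L' = Complex (Re v + of_int k * L') \<tau>" using \<open>Im v = \<tau>\<close> by (simp add: complex_eq_iff)
    hence "G v = G (Complex (Re v + of_int k * L') \<tau>)" using per[OF v(1), of k] by simp
    thus "s \<in> {s. Fb (Complex s e) \<in> ?\<Gamma>}" using v(2) k by auto
  qed
  ultimately have "closed ?T" by simp
  hence T: "?T = UNIV" using openT s0 clopen[of ?T] by auto
  obtain w0 where w0: "Im w0 = e" "\<nexists>r H. reg_data \<sigma> w0 r H" using some_singular[OF e] by blast
  have ew: "edge \<sigma> (Im w0)" using e w0(1) by simp
  obtain r y c where S: "sing_data \<sigma> w0 r y c" using edge_point[OF ew] w0(2) by blast
  have "Fb w0 \<in> \<Lambda>" using Fb_sing[OF ew S] S by (simp add: sing_data_def)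
  moreover have "Complex (Re w0) e = w0" using w0(1) by (simp add: complex_eq_iff)
  hence "Fb w0 \<in> K'" using T by (metis UNIV_I mem_Collect_eq)
  ultimately show False using ann unfolding hyperbolic_annulus_def by blast
qed

lemma strip_cylinder:
  assumes ab: "a < b" "I = {a<..<b}"
  shows "hyperbolic_cylinder X \<Lambda> \<A> (F ` {w. Im w \<in> I}) (b - a)"
proof -
  let ?F = "\<lambda>w. F (w + \<i> * of_real a)"
  have sh: "w \<in> log_strip (b - a) \<longleftrightarrow> Im (w + \<i> * of_real a) \<in> I" for w using ab(2) by (auto simp: log_strip_def)
  have im: "?F ` log_strip (b - a) = F ` {w. Im w \<in> I}"
  proof (intro equalityI subsetI)
    fix x assume "x \<in> F ` {w. Im w \<in> I}"
    then obtain w where w: "x = F w" "Im w \<in> I" by auto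
    have "w - \<i> * of_real a \<in> log_strip (b - a)" unfolding sh using w(2) by simp
    thus "x \<in> ?F ` log_strip (b - a)" using w(1) by (intro image_eqI[where x="w - \<i> * of_real a"]) auto
  qed (use sh in auto)
  have "hyperbolic_annulus X \<Lambda> \<A> (?F ` log_strip (b - a)) (b - a)"
  proof (rule annulusI[OF _ L_pos])
    show "afm_at exp ?F w" if "w \<in> log_strip (b - a)" for w
      by (rule afm_exp_shift, rule F_afm) (use that sh in auto)
    show "?F w = ?F w' \<longleftrightarrow> (\<exists>k::int. w' = w + of_int k * of_real L)" if w: "w \<in> log_strip (b - a)" "w' \<in> log_strip (b - a)" for w w'
    proof
      assume "?F w = ?F w'"
      then obtain k :: int where "w' + \<i> * of_real a = w + \<i> * of_real a + of_int k * of_real L" using collision w sh by blast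
      hence "w' = w + of_int k * of_real L" by (simp add: algebra_simps)
      thus "\<exists>k::int. w' = w + of_int k * of_real L" ..
    next
      assume "\<exists>k::int. w' = w + of_int k * of_real L"
      then obtain k :: int where "w' = w + of_int k * of_real L" ..
      hence "w' + \<i> * of_real a = w + \<i> * of_real a + of_int k * of_real L" by simp
      thus "?F w = ?F w'" using period_int[of "w + \<i> * of_real a" k] w(1) sh by metis
    qed
  qed (use ab in simp)
  hence ann: "hyperbolic_annulus X \<Lambda> \<A> (F ` {w. Im w \<in> I}) (b - a)" unfolding im .
  show ?thesis
    unfolding hyperbolic_cylinder_def
  proof (intro conjI allI impI)
    show "K' = F ` {w. Im w \<in> I}" if "hyperbolic_annulus X \<Lambda> \<A> K' \<beta>' \<and> F ` {w. Im w \<in> I} \<subseteq> K'" for K' \<beta>'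
      using that by (elim conjE) (rule annulus_maximal[OF ab])
  qed (rule ann frontier_saddles[OF ab])+
qed

section \<open>The closed geodesics of the strip: holonomy and accumulation\<close>

definition core :: "real \<Rightarrow> real \<Rightarrow> 'a" where
  "core \<phi> t = F (Complex (t * L) \<phi>)"

lemma core_closed_geodesic:
  assumes \<phi>: "\<phi> \<in> I"
  shows "closed_geodesic X \<Lambda> \<A> (core \<phi>)"
  unfolding closed_geodesic_def
proof (intro conjI allI)
  have "continuous_map euclidean euclideanreal (\<lambda>t. t * L)" by (simp add: continuous_intros)
  from continuous_map_compose[OF this F_line_continuous[OF \<phi>]]
  have c: "continuous_map (top_of_set UNIV) X (core \<phi>)" by (simp add: o_def core_def[abs_def])
  have "\<exists>\<xi> u. straight_at (regular_part X \<Lambda>) \<A> (core \<phi>) t \<xi> u" for t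
  proof (rule straight_at_exp_line[where H=F and ?s0.0="t * L" and e=\<phi> and d=L])
    show "afm_at exp F (Complex (t * L) \<phi>)" using \<phi> by (intro F_afm) simp
    show "\<forall>\<^sub>F s in nhds t. core \<phi> s = F (Complex (t * L + (s - t) * L) \<phi>)"
      by (rule always_eventually) (simp add: core_def algebra_simps)
  qed (rule L_pos)
  thus "trajectory X \<Lambda> \<A> UNIV (core \<phi>)" unfolding trajectory_def using c by (simp add: is_interval_univ)
  show "core \<phi> (t + 1) = core \<phi> t" for t
  proof -
    have "Complex ((t + 1) * L) \<phi> = Complex (t * L) \<phi> + of_real L" by (simp add: complex_eq_iff algebra_simps)
    thus ?thesis using period[of "Complex (t * L) \<phi>"] \<phi> by (simp add: core_def)
  qed
  show "inj_on (core \<phi>) {0..<1}"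
  proof (rule inj_onI)
    fix t t' assume t: "t \<in> {0..<1}" "t' \<in> {0..<1}" "core \<phi> t = core \<phi> t'"
    obtain k :: int where "Complex (t' * L) \<phi> = Complex (t * L) \<phi> + of_int k * of_real L"
      using collision[of "Complex (t * L) \<phi>" "Complex (t' * L) \<phi>"] t(3) \<phi> by (auto simp: core_def)
    hence "Re (Complex (t' * L) \<phi>) = Re (Complex (t * L) \<phi> + of_int k * of_real L)" by metis
    hence "t' * L = (t + of_int k) * L" by (simp add: algebra_simps)
    hence "t' = t + of_int k" using L_pos by simp
    hence "real_of_int k < 1" "real_of_int k > - 1" using t by auto
    hence "k = 0" by linarith
    thus "t = t'" using \<open>t' = t + of_int k\<close> by simp
  qed
qed

text \<open>The developing coordinate \<open>exp\<close> itself continues along the leaf. After one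
  period its lift is shifted by \<open>L\<close>, so the chart is multiplied by
  \<open>exp L\<close>.\<close>

lemma core_hyperbolic:
  assumes \<phi>: "\<phi> \<in> I"
  shows "hyperbolic_closed_geodesic X \<Lambda> \<A> (core \<phi>)"
proof -
  \<comment> \<open>The lift is fixed by asking its real part to be within \<open>L / 2\<close> of
    \<open>t * L\<close>. Windows of width \<open>L / 4\<close> later leave room for nearby times to
    select the same lift.\<close>
  define \<Phi> where "\<Phi> t x = exp (SOME v. F v = x \<and> Im v \<in> I \<and> \<bar>Re v - t * L\<bar> < L / 2)" for t x
  have \<Phi>: "\<Phi> t (F v) = exp v" if v: "Im v \<in> I" "\<bar>Re v - t * L\<bar> < L / 2" for t v
  proof -
    define u where "u = (SOME u. F u = F v \<and> Im u \<in> I \<and> \<bar>Re u - t * L\<bar> < L / 2)"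
    have u: "F u = F v \<and> Im u \<in> I \<and> \<bar>Re u - t * L\<bar> < L / 2" unfolding u_def
      by (rule someI[of "\<lambda>u. F u = F v \<and> Im u \<in> I \<and> \<bar>Re u - t * L\<bar> < L / 2" v]) (use v in simp)
    obtain k :: int where k: "u = v + of_int k * of_real L" using collision[OF v(1), of u] u by auto
    hence "of_int k * L = (Re u - t * L) - (Re v - t * L)" by simp
    hence "\<bar>of_int k * L\<bar> < 1 * L" using u v(2) by linarith
    hence "\<bar>of_int k\<bar> * L < 1 * L" using L_pos by (simp add: abs_mult)
    hence "\<bar>real_of_int k\<bar> < 1" by (simp only: mult_less_cancel_right_pos[OF L_pos])
    hence "k = 0" by linarith
    thus ?thesis using k by (simp add: \<Phi>_def u_def)
  qed
  define N where "N t = {v. Im v \<in> I \<and> \<bar>Re v - t * L\<bar> < L / 4}" for t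
  have oN: "open (N t)" for t
  proof -
    have "open {v::complex. \<bar>Re v - t * L\<bar> < L / 4}" by (intro open_Collect_less continuous_intros)
    moreover have "N t = {v. Im v \<in> I} \<inter> {v. \<bar>Re v - t * L\<bar> < L / 4}" by (auto simp: N_def)
    ultimately show ?thesis using open_strip[OF open_I] by auto
  qed
  have oF: "openin (regular_part X \<Lambda>) (F ` V)" if "open V" "V \<subseteq> {w. Im w \<in> I}" for V
    unfolding openin_regular using afm_open_image[OF developing_simps(2), of V F] F_afm afm_at_in_M[OF F_afm] that by blast
  have oFN: "openin (regular_part X \<Lambda>) (F ` N t)" for t by (rule oF[OF oN]) (auto simp: N_def)
  have wN: "Complex (t * L) \<phi> \<in> N t" for t using \<phi> L_pos by (simp add: N_def)
  have chart: "affine_chart_at (regular_part X \<Lambda>) \<A> (core \<phi> t) (\<Phi> t)" for t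
  proof -
    let ?w = "Complex (t * L) \<phi>"
    have "afm_at exp F ?w" using \<phi> by (intro F_afm) simp
    then obtain U \<psi> a b where ch: "(U, \<psi>) \<in> \<A>" "a \<noteq> 0" "\<forall>\<^sub>F v in nhds ?w. F v \<in> U \<and> \<psi> (F v) = a * exp v + b" by (rule afm_atE)
    have "\<forall>\<^sub>F v in nhds ?w. v \<in> N t" using oN wN by (intro eventually_nhds_in_open)
    with ch(3) have "\<forall>\<^sub>F v in nhds ?w. (F v \<in> U \<and> \<psi> (F v) = a * exp v + b) \<and> v \<in> N t" by eventually_elim simp
    then obtain V where V: "open V" "?w \<in> V" "\<And>v. v \<in> V \<Longrightarrow> (F v \<in> U \<and> \<psi> (F v) = a * exp v + b) \<and> v \<in> N t"
      unfolding eventually_nhds by blast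
    have "\<Phi> t (F v) = (1 / a) * \<psi> (F v) + (- b / a)" if v: "v \<in> V" for v
    proof -
      have "\<Phi> t (F v) = exp v" by (rule \<Phi>) (use V(3)[OF v] L_pos in \<open>auto simp: N_def\<close>)
      thus ?thesis using V(3)[OF v] ch(2) by (simp add: field_simps)
    qed
    moreover have "openin (regular_part X \<Lambda>) (F ` V)" using V by (intro oF) (auto simp: N_def)
    ultimately show ?thesis
      unfolding affine_chart_at_def core_def using V ch(2)
      by (intro bexI[OF _ ch(1)], unfold case_prod_conv, rule_tac x="1 / a" in exI, rule_tac x="- b / a" in exI, rule_tac x="F ` V" in exI) auto
  qed
  have "linear_holonomy (regular_part X \<Lambda>) \<A> (core \<phi>) (of_real (exp L))"
    unfolding linear_holonomy_def
  proof (intro conjI exI[of _ \<Phi>] ballI)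
    show "core \<phi> 0 = core \<phi> 1" using core_closed_geodesic[OF \<phi>] unfolding closed_geodesic_def by (metis add_0)
    fix t :: real
    show "affine_chart_at (regular_part X \<Lambda>) \<A> (core \<phi> t) (\<Phi> t)" by (rule chart)
    show "\<exists>\<delta>>0. \<exists>W. openin (regular_part X \<Lambda>) W \<and> core \<phi> t \<in> W \<and>
        (\<forall>s\<in>{0..1}. \<bar>s - t\<bar> < \<delta> \<longrightarrow> core \<phi> s \<in> W \<and> (\<forall>y\<in>W. \<Phi> s y = \<Phi> t y))"
    proof (rule exI[of _ "1 / 4"], intro conjI exI[of _ "F ` N t"] ballI impI)
      fix s :: real assume s: "\<bar>s - t\<bar> < 1 / 4"
      have sL: "\<bar>s * L - t * L\<bar> < L / 4"
      proof -
        have "\<bar>s * L - t * L\<bar> = \<bar>s - t\<bar> * L" using L_pos by (simp add: abs_mult flip: left_diff_distrib)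
        also have "\<dots> < 1 / 4 * L" using s L_pos by (intro mult_strict_right_mono) auto
        finally show ?thesis by simp
      qed
      thus "core \<phi> s \<in> F ` N t" unfolding core_def using \<phi> by (intro imageI) (simp add: N_def)
      fix y assume "y \<in> F ` N t"
      then obtain v where v: "y = F v" "v \<in> N t" by auto
      have "\<bar>Re v - t * L\<bar> < L / 4" "Im v \<in> I" using v(2) by (auto simp: N_def)
      hence "\<bar>Re v - s * L\<bar> < L / 2" "\<bar>Re v - t * L\<bar> < L / 2" "Im v \<in> I" using sL L_pos by linarith+
      thus "\<Phi> s y = \<Phi> t y" unfolding v(1) by (simp add: \<Phi>)
    qed (use wN oFN in \<open>auto simp: core_def\<close>)
  next
    show "\<exists>b W. openin (regular_part X \<Lambda>) W \<and> core \<phi> 0 \<in> W \<and> (\<forall>y\<in>W. \<Phi> 1 y = of_real (exp L) * \<Phi> 0 y + b)"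
    proof (rule exI[of _ 0], rule exI[of _ "F ` N 0"], intro conjI ballI)
      fix y assume "y \<in> F ` N 0"
      then obtain v where v: "y = F v" "v \<in> N 0" by auto
      hence v': "Im v \<in> I" "\<bar>Re v - 0 * L\<bar> < L / 2" "\<bar>Re (v + of_real L) - 1 * L\<bar> < L / 2" using L_pos by (auto simp: N_def)
      have "\<Phi> 1 y = exp (v + of_real L)" using \<Phi>[of "v + of_real L" 1] v' v(1) period[OF v'(1)] by simp
      moreover have "\<Phi> 0 y = exp v" using \<Phi>[of v 0] v' v(1) by simp
      ultimately show "\<Phi> 1 y = of_real (exp L) * \<Phi> 0 y + 0" by (simp add: exp_add exp_of_real)
    qed (use wN[of 0] oFN in \<open>auto simp: core_def\<close>)
  qed
  moreover have "cmod (of_real (exp L)) \<noteq> 1" using L_pos by simp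
  ultimately show ?thesis unfolding hyperbolic_closed_geodesic_def using core_closed_geodesic[OF \<phi>] by blast
qed

text \<open>The point of the ray at time \<open>t\<close> equals
  \<open>q + exp (ln t + i \<phi> + \<epsilon> t)\<close> with \<open>\<epsilon> t\<close> tending
  to 0. Modulo \<open>L\<close> the exponents approach the compact leaf of height
  \<open>\<phi>\<close>, and \<open>ln t\<close> runs through every residue infinitely often, so
  exactly the leaf is the limit set.\<close>

lemma core_accumulates:
  assumes \<phi>: "\<phi> \<in> I" and s: "s < \<phi>" "\<phi> < s'"
    and g: "\<And>v. s < Im v \<Longrightarrow> Im v < s' \<Longrightarrow> q + exp v - c \<in> sector s s' \<Longrightarrow> F v = f (q + exp v)" and s': "s' \<le> s + pi"
  shows "accumulates_on X (\<lambda>t. f (c + rcis t \<phi>)) (core \<phi>)"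
proof -
  define \<epsilon> where "\<epsilon> t = Ln (1 + (c - q) / rcis t \<phi>)" for t
  have z: "((\<lambda>t. (c - q) / rcis t \<phi>) \<longlongrightarrow> 0) at_top"
  proof (rule tendsto_norm_zero_cancel)
    have "((\<lambda>t. cmod (c - q) / \<bar>t\<bar>) \<longlongrightarrow> 0) at_top" by real_asymp
    thus "((\<lambda>t. cmod ((c - q) / rcis t \<phi>)) \<longlongrightarrow> 0) at_top" by (simp add: norm_divide)
  qed
  have "((\<lambda>t. Ln (1 + (c - q) / rcis t \<phi>)) \<longlongrightarrow> Ln (1 + 0)) at_top" by (intro tendsto_intros z) auto
  hence \<epsilon>0: "(\<epsilon> \<longlongrightarrow> 0) at_top" by (simp add: \<epsilon>_def[abs_def])
  have im\<epsilon>: "((\<lambda>t. \<phi> + Im (\<epsilon> t)) \<longlongrightarrow> \<phi>) at_top" using tendsto_add[OF tendsto_const tendsto_Im[OF \<epsilon>0], of \<phi>] by simp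
  have "\<forall>\<^sub>F t in at_top. (c - q) / rcis t \<phi> \<noteq> - 1" by (rule tendsto_imp_eventually_ne[OF z]) simp
  moreover have "\<forall>\<^sub>F t in at_top. s < \<phi> + Im (\<epsilon> t)" by (rule order_tendstoD(1)[OF im\<epsilon> s(1)])
  moreover have "\<forall>\<^sub>F t in at_top. \<phi> + Im (\<epsilon> t) < s'" by (rule order_tendstoD(2)[OF im\<epsilon> s(2)])
  moreover have "\<forall>\<^sub>F t in at_top. t > (0::real)" by (rule eventually_gt_at_top)
  ultimately have ray: "\<forall>\<^sub>F t in at_top. f (c + rcis t \<phi>) = F (Complex (ln t) \<phi> + \<epsilon> t)"
  proof eventually_elim
    case (elim t)
    have e1: "exp (Complex (ln t) \<phi>) = rcis t \<phi>" using elim(4) by (simp add: exp_eq_polar rcis_def)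
    have r0: "rcis t \<phi> \<noteq> 0" using elim(4) by simp
    have "1 + (c - q) / rcis t \<phi> \<noteq> 0" using elim(1) by (metis add.commute add_eq_0_iff)
    hence "exp (\<epsilon> t) = 1 + (c - q) / rcis t \<phi>" by (simp add: \<epsilon>_def)
    hence ex: "exp (Complex (ln t) \<phi> + \<epsilon> t) = rcis t \<phi> + (c - q)" using r0 by (simp only: exp_add e1) (simp add: distrib_left)
    have "rcis t \<phi> \<in> sector s s'"
      using exp_in_sector[OF s', of "Complex (ln t) \<phi>"] s by (simp add: e1)
    hence "F (Complex (ln t) \<phi> + \<epsilon> t) = f (q + exp (Complex (ln t) \<phi> + \<epsilon> t))"
      by (intro g) (use elim in \<open>simp_all add: ex\<close>)
    moreover have "q + exp (Complex (ln t) \<phi> + \<epsilon> t) = c + rcis t \<phi>" unfolding ex by simp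
    ultimately show ?case by metis
  qed
  let ?g = "\<lambda>t. f (c + rcis t \<phi>)"
  have compact: "compactin X (range (core \<phi>))" and Sub: "range (core \<phi>) = F ` (\<lambda>x. Complex x \<phi>) ` {0..L}"
  proof -
    show Sub: "range (core \<phi>) = F ` (\<lambda>x. Complex x \<phi>) ` {0..L}"
    proof (intro equalityI subsetI)
      fix x assume "x \<in> range (core \<phi>)"
      then obtain t where t: "x = F (Complex (t * L) \<phi>)" by (auto simp: core_def)
      obtain k :: int where k: "0 \<le> t * L + of_int k * L" "t * L + of_int k * L \<le> L" by (rule mod_period[OF L_pos])
      have "Complex (t * L) \<phi> + of_int k * of_real L = Complex (t * L + of_int k * L) \<phi>" by (simp add: complex_eq_iff)
      hence "x = F (Complex (t * L + of_int k * L) \<phi>)" using t period_int[of "Complex (t * L) \<phi>" k] \<phi> by simp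
      thus "x \<in> F ` (\<lambda>x. Complex x \<phi>) ` {0..L}" using k by auto
    next
      fix x assume "x \<in> F ` (\<lambda>x. Complex x \<phi>) ` {0..L}"
      then obtain t where "x = F (Complex t \<phi>)" by auto
      hence "x = core \<phi> (t / L)" using L_pos by (simp add: core_def)
      thus "x \<in> range (core \<phi>)" by simp
    qed
    have "compactin X ((\<lambda>x. F (Complex x \<phi>)) ` {0..L})"
      by (rule image_compactin[OF _ F_line_continuous[OF \<phi>]]) simp
    thus "compactin X (range (core \<phi>))" unfolding Sub by (simp add: image_image)
  qed
  have "omega_limit X ?g = range (core \<phi>)"
  proof (intro equalityI subsetI)
    fix y assume y: "y \<in> omega_limit X ?g"
    hence ycl: "y \<in> X closure_of (?g ` {T..})" if "T > 0" for T using that by (auto simp: omega_limit_def)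
    show "y \<in> range (core \<phi>)"
    proof (rule ccontr)
      assume n: "y \<notin> range (core \<phi>)"
      have yX: "y \<in> topspace X" using ycl[of 1] closure_of_subset_topspace by (metis subsetD zero_less_one)
      have "compactin X {y}" using yX by simp
      moreover have "disjnt {y} (range (core \<phi>))" using n by simp
      ultimately obtain V W where VW: "openin X V" "openin X W" "{y} \<subseteq> V" "range (core \<phi>) \<subseteq> W" "disjnt V W"
        using Hausdorff_space_compact_separation[OF Hausdorff_X _ compact, of "{y}"] by blast
      have "openin (top_of_set {w. Im w \<in> I}) {w \<in> topspace (top_of_set {w. Im w \<in> I}). F w \<in> W}"
        by (rule openin_continuous_map_preimage[OF F_continuous VW(2)])
      hence oB: "open {w. Im w \<in> I \<and> F w \<in> W}" using openin_open_trans open_strip[OF open_I] by auto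
      have cA: "compact ((\<lambda>x. Complex x \<phi>) ` {0..L})" unfolding Complex_eq by (intro compact_continuous_image continuous_intros) simp
      have "(\<lambda>x. Complex x \<phi>) ` {0..L} \<subseteq> {w. Im w \<in> I \<and> F w \<in> W}" using VW(4) \<phi> unfolding Sub by auto
      then obtain r where r: "r > 0" "(\<Union>w\<in>(\<lambda>x. Complex x \<phi>) ` {0..L}. ball w r) \<subseteq> {w. Im w \<in> I \<and> F w \<in> W}"
        by (rule compact_subset_open_imp_ball_epsilon_subset[OF cA oB])
      have "\<forall>\<^sub>F t in at_top. dist (\<epsilon> t) 0 < r" by (rule tendstoD[OF \<epsilon>0 r(1)])
      with ray have "\<forall>\<^sub>F t in at_top. ?g t \<in> W"
      proof eventually_elim
        case (elim t)
        obtain k :: int where k: "0 \<le> ln t + of_int k * L" "ln t + of_int k * L \<le> L" by (rule mod_period[OF L_pos])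
        let ?v = "Complex (ln t + of_int k * L) \<phi> + \<epsilon> t"
        have "?v \<in> ball (Complex (ln t + of_int k * L) \<phi>) r" using elim(2) by (simp add: dist_norm)
        moreover have "Complex (ln t + of_int k * L) \<phi> \<in> (\<lambda>x. Complex x \<phi>) ` {0..L}" using k by auto
        ultimately have "?v \<in> {w. Im w \<in> I \<and> F w \<in> W}" using r(2) by blast
        hence v: "Im ?v \<in> I" "F ?v \<in> W" by blast+
        have v': "?v + of_int (- k) * of_real L = Complex (ln t) \<phi> + \<epsilon> t" by (simp add: complex_eq_iff)
        have "F (Complex (ln t) \<phi> + \<epsilon> t) = F ?v" by (rule period_int[OF v(1), of "- k", unfolded v'])
        thus ?case using elim(1) v(2) by simp
      qed
      then obtain T0 where T0: "\<And>t. t \<ge> T0 \<Longrightarrow> ?g t \<in> W" unfolding eventually_at_top_linorder by blast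
      have "y \<in> X closure_of (?g ` {max T0 1..})" by (rule ycl) simp
      then obtain t where "t \<ge> max T0 1" "?g t \<in> V" using VW(1,3) unfolding in_closure_of by blast
      thus False using T0[of t] VW(5) by (auto simp: disjnt_def)
    qed
  next
    fix y assume "y \<in> range (core \<phi>)"
    then obtain x where x: "y = F (Complex (x * L) \<phi>)" by (auto simp: core_def)
    have yX: "y \<in> topspace X" using x afm_at_in_M[OF F_afm, of "Complex (x * L) \<phi>"] \<phi> by simp
    have "\<exists>u\<in>?g ` {T..}. u \<in> W" if W: "y \<in> W" "openin X W" for T W
    proof -
      have Fa: "afm_at exp F (Complex (x * L) \<phi>)" using \<phi> by (intro F_afm) simp
      have "\<forall>\<^sub>F v in nhds (Complex (x * L) \<phi>). F v \<in> W"
        using afm_at_open_preimage[OF developing_simps(2) Fa W(2)] W(1) x by simp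
      moreover have "\<forall>\<^sub>F v in nhds (Complex (x * L) \<phi>). v \<in> {v. Im v \<in> I}" using \<phi> open_strip[OF open_I] by (intro eventually_nhds_in_open) auto
      ultimately have "\<forall>\<^sub>F v in nhds (Complex (x * L) \<phi>). F v \<in> W \<and> Im v \<in> I" by eventually_elim simp
      then obtain r where r: "r > 0" "\<And>v. dist v (Complex (x * L) \<phi>) < r \<Longrightarrow> F v \<in> W \<and> Im v \<in> I"
        unfolding eventually_nhds_metric by blast
      have "\<forall>\<^sub>F t in at_top. dist (\<epsilon> t) 0 < r" by (rule tendstoD[OF \<epsilon>0 r(1)])
      moreover have "\<forall>\<^sub>F t in at_top. t \<ge> T" by (rule eventually_ge_at_top)
      ultimately have ev: "\<forall>\<^sub>F t in at_top. ?g t = F (Complex (ln t) \<phi> + \<epsilon> t) \<and> dist (\<epsilon> t) 0 < r \<and> t \<ge> T"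
        using ray by eventually_elim simp
      \<comment> \<open>At these times \<open>ln t\<close> is congruent to \<open>x * L\<close>
        modulo \<open>L\<close>, so the ray passes ever closer to the chosen point of the
        geodesic.\<close>
      have "filterlim (\<lambda>n::nat. exp ((x + real n) * L)) at_top sequentially" using L_pos by real_asymp
      with ev have "\<forall>\<^sub>F n in sequentially. ?g (exp ((x + real n) * L)) = F (Complex (ln (exp ((x + real n) * L))) \<phi> + \<epsilon> (exp ((x + real n) * L))) \<and>
          dist (\<epsilon> (exp ((x + real n) * L))) 0 < r \<and> exp ((x + real n) * L) \<ge> T"
        unfolding filterlim_iff by blast
      then obtain n where n: "?g (exp ((x + real n) * L)) = F (Complex (ln (exp ((x + real n) * L))) \<phi> + \<epsilon> (exp ((x + real n) * L)))"
          "dist (\<epsilon> (exp ((x + real n) * L))) 0 < r" "exp ((x + real n) * L) \<ge> T"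
        unfolding eventually_sequentially by blast
      let ?t = "exp ((x + real n) * L)"
      have v: "F (Complex (x * L) \<phi> + \<epsilon> ?t) \<in> W" "Im (Complex (x * L) \<phi> + \<epsilon> ?t) \<in> I" using r(2)[of "Complex (x * L) \<phi> + \<epsilon> ?t"] n(2) by (simp_all add: dist_norm)
      have v': "Complex (x * L) \<phi> + \<epsilon> ?t + of_int (int n) * of_real L = Complex (ln ?t) \<phi> + \<epsilon> ?t"
        by (simp add: complex_eq_iff algebra_simps)
      have "F (Complex (ln ?t) \<phi> + \<epsilon> ?t) = F (Complex (x * L) \<phi> + \<epsilon> ?t)" by (rule period_int[OF v(2), of "int n", unfolded v'])
      hence "?g ?t \<in> W" using n(1) v(1) by simp
      thus ?thesis using n(3) by (intro bexI[of _ "?g ?t"]) auto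
    qed
    thus "y \<in> omega_limit X ?g" using yX by (auto simp: omega_limit_def in_closure_of)
  qed
  thus ?thesis by (simp add: accumulates_on_def)
qed

end

theorem lemma2p4:
  fixes X :: "'a topology" and \<Lambda> :: "'a set" and \<A> :: "'a atlas"
    and c :: complex and \<alpha> \<theta> :: real and f :: "complex \<Rightarrow> 'a"
  assumes "branched_affine_surface X \<Lambda> \<A>"
    and "\<And>I \<gamma>. trajectory X \<Lambda> \<A> I \<gamma> \<Longrightarrow> \<not> self_intersecting X \<Lambda> \<A> I \<gamma>"
    and "0 < \<theta>" and "\<theta> \<le> 2 * pi"
    and "affine_immersion (top_of_set (open_cone c \<alpha> \<theta>)) (plane_atlas (open_cone c \<alpha> \<theta>))
           (regular_part X \<Lambda>) \<A> f"
  shows "\<exists>K \<beta>. hyperbolic_cylinder X \<Lambda> \<A> K \<beta> \<and> \<theta> \<le> \<beta> \<and>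
           (\<exists>\<gamma>. hyperbolic_closed_geodesic X \<Lambda> \<A> \<gamma> \<and>
                range \<gamma> \<subseteq> f ` open_cone c \<alpha> \<theta> \<and> range \<gamma> \<subseteq> K) \<and>
           (\<forall>\<phi>. \<alpha> < \<phi> \<and> \<phi> < \<alpha> + \<theta> \<longrightarrow>
              (\<exists>\<gamma>. closed_geodesic X \<Lambda> \<A> \<gamma> \<and> range \<gamma> \<subseteq> K \<and>
                   accumulates_on X (\<lambda>t. f (c + rcis t \<phi>)) \<gamma>))"
proof -
  interpret affine_surface X \<Lambda> \<A> by standard (rule assms(1))
  obtain cP c\<kappa> c\<tau> cL where charts: "\<And>y. y \<in> \<Lambda> \<Longrightarrow> cone_chart y (cP y) (c\<kappa> y) (c\<tau> y) (cL y)"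
    "\<And>y y'. y \<in> \<Lambda> \<Longrightarrow> y' \<in> \<Lambda> \<Longrightarrow> y \<noteq> y' \<Longrightarrow>
       insert y (cP y ` {w. Re w + c\<kappa> y * Im w < cL y}) \<inter> insert y' (cP y' ` {w. Re w + c\<kappa> y' * Im w < cL y'}) = {}"
    by (rule cone_charts_disjoint; blast)
  interpret straight_surface X \<Lambda> \<A> cP c\<kappa> c\<tau> cL by standard (use charts assms(2) in blast)+
  have f: "afm_at (\<lambda>z. z) f z" if "z \<in> open_cone c \<alpha> \<theta>" for z
    by (rule affine_immersion_afm[OF open_open_cone assms(5) that])
  obtain F0 P q where P: "P > 0" and F0: "\<And>w. \<alpha> < Im w \<Longrightarrow> Im w < \<alpha> + \<theta> \<Longrightarrow> afm_at exp F0 w"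
    "\<And>w. \<alpha> < Im w \<Longrightarrow> Im w < \<alpha> + \<theta> \<Longrightarrow> F0 (w + of_real P) = F0 w"
    "\<And>w. \<alpha> < Im w \<Longrightarrow> Im w < \<alpha> + \<theta> \<Longrightarrow> F0 w \<in> f ` open_cone c \<alpha> \<theta>"
    and near: "\<And>\<phi>. \<alpha> < \<phi> \<Longrightarrow> \<phi> < \<alpha> + \<theta> \<Longrightarrow> \<exists>s s'. \<alpha> \<le> s \<and> s < \<phi> \<and> \<phi> < s' \<and> s' \<le> \<alpha> + \<theta> \<and> s' \<le> s + pi \<and>
       (\<forall>v. s < Im v \<longrightarrow> Im v < s' \<longrightarrow> q + exp v - c \<in> sector s s' \<longrightarrow> F0 v = f (q + exp v))"
    by (rule initial_strip[OF assms(3,4) f]; blast)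
  obtain I F L where ms: "max_strip X \<Lambda> \<A> cP c\<kappa> c\<tau> cL I F L" and sub: "{\<alpha><..<\<alpha> + \<theta>} \<subseteq> I"
    and FF0: "\<And>w. \<alpha> < Im w \<Longrightarrow> Im w < \<alpha> + \<theta> \<Longrightarrow> F w = F0 w"
    by (rule exists_max_strip[OF assms(3) P F0(1,2)]; blast)
  interpret max_strip X \<Lambda> \<A> cP c\<kappa> c\<tau> cL I F L by (rule ms)
  obtain a b where ab: "a < b" "I = {a<..<b}" by (rule I_bounded)
  have "{\<alpha><..<\<alpha> + \<theta>} \<subseteq> {a<..<b}" using sub ab(2) by simp
  hence \<theta>: "\<theta> \<le> b - a" using assms(3) by (simp add: greaterThanLessThan_subseteq_greaterThanLessThan)
  have inI: "\<phi> \<in> I" if "\<alpha> < \<phi>" "\<phi> < \<alpha> + \<theta>" for \<phi> using sub that by auto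
  let ?K = "F ` {w. Im w \<in> I}"
  have coreK: "range (core \<phi>) \<subseteq> ?K" if "\<phi> \<in> I" for \<phi> using that by (auto simp: core_def)
  \<comment> \<open>A height of the original cone is needed here: only there are the values of
    \<open>F\<close> known to lie in the image of \<open>f\<close>.\<close>
  have mid: "\<alpha> < \<alpha> + \<theta> / 2" "\<alpha> + \<theta> / 2 < \<alpha> + \<theta>" using assms(3) by auto
  have "core (\<alpha> + \<theta> / 2) t \<in> f ` open_cone c \<alpha> \<theta>" for t
    using F0(3)[of "Complex (t * L) (\<alpha> + \<theta> / 2)"] FF0[of "Complex (t * L) (\<alpha> + \<theta> / 2)"] mid by (simp add: core_def)
  hence "range (core (\<alpha> + \<theta> / 2)) \<subseteq> f ` open_cone c \<alpha> \<theta>" by blast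
  hence geo: "\<exists>\<gamma>. hyperbolic_closed_geodesic X \<Lambda> \<A> \<gamma> \<and> range \<gamma> \<subseteq> f ` open_cone c \<alpha> \<theta> \<and> range \<gamma> \<subseteq> ?K"
    using core_hyperbolic[OF inI[OF mid]] coreK[OF inI[OF mid]] by blast
  have acc: "\<exists>\<gamma>. closed_geodesic X \<Lambda> \<A> \<gamma> \<and> range \<gamma> \<subseteq> ?K \<and> accumulates_on X (\<lambda>t. f (c + rcis t \<phi>)) \<gamma>"
    if \<phi>: "\<alpha> < \<phi>" "\<phi> < \<alpha> + \<theta>" for \<phi>
  proof -
    obtain s s' where s: "\<alpha> \<le> s" "s < \<phi>" "\<phi> < s'" "s' \<le> \<alpha> + \<theta>" "s' \<le> s + pi"
      "\<forall>v. s < Im v \<longrightarrow> Im v < s' \<longrightarrow> q + exp v - c \<in> sector s s' \<longrightarrow> F0 v = f (q + exp v)"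
      using near[OF \<phi>] by blast
    have "F v = f (q + exp v)" if "s < Im v" "Im v < s'" "q + exp v - c \<in> sector s s'" for v
      using s(6) that FF0[of v] s(1,4) by simp
    hence "accumulates_on X (\<lambda>t. f (c + rcis t \<phi>)) (core \<phi>)"
      by (rule core_accumulates[OF inI[OF \<phi>] s(2,3) _ s(5)])
    thus ?thesis using core_closed_geodesic[OF inI[OF \<phi>]] coreK[OF inI[OF \<phi>]] by blast
  qed
  show ?thesis
    by (rule exI[of _ ?K], rule exI[of _ "b - a"]) (use strip_cylinder[OF ab] \<theta> geo acc in blast)
qed

end
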